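(* Let $E^\omega$ be the nonautonomous affine set with random translations in $\mathbb R^d$, where $\Xi_k=\Xi=\{T_1,\dots,T_{n_0}\}$ for all $k>0$, with $n_0\ge2$ and the $T_i$ nonsingular $d\times d$ matrices with $\|T_i\|<1$. Let $\mu^\omega$ be the nonautonomous affine measure with $\mathbf p_k=\mathbf p=(p_1,\dots,p_{n_0})$ for all $k>0$. Then for all $q>0$, $d_q^-=d_q^+$, where $d_q^\pm$ are the critical values defined in the context; denote the common value by $d_q$. For $q>1$, $d_q$ is the unique solution to $$\lim_{k\to\infty}\Big(\sum_{\mathbf u\in\Sigma^k}\psi^{d_q}(T_{\mathbf u})^{1-q}p_{\mathbf u}^q\Big)^{1/k}=1,$$ and for $q=1$, $d_1$ is the unique solution to $$\lim_{k\to\infty}\frac1k\int\log\big(\psi^{d_1}(T_{\mathbf u|k})^{-1}p_{\mathbf u|k}\big)\,d\mu(\mathbf u)=0.$$ For $q\ge1$, the generalized $q$-dimension $D_q(\mu^\omega)$ exists and $$D_q(\mu^\omega)=\min\{d_q,d\}$$ for almost all $\omega$ (with respect to $\mathbf P$).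
   Context: **Words.** Here $n_k=n_0$ for all $k$: $\Sigma^k=\{1,\dots,n_0\}^k$, $\Sigma^0=\{\emptyset\}$, $\Sigma^*=\bigcup_{k\ge0}\Sigma^k$, $\Sigma^\infty=\{1,\dots,n_0\}^{\mathbb N}$. For $\mathbf u=u_1\cdots u_k$ write $\mathbf u^-=u_1\cdots u_{k-1}$; for an infinite word $\mathbf u$, $\mathbf u|k=u_1\cdots u_k$. $\mathcal C_{\mathbf u}\subset\Sigma^\infty$ is the cylinder of infinite words with prefix $\mathbf u$. **Nonautonomous affine set with random translations.** Let $J\subset\mathbb R^d$ be compact with non-empty interior. Let $\mathcal D\subset\mathbb R^d$ be a bounded region. For each $\mathbf u\in\Sigma^*$ let $\omega_{\mathbf u}\in\mathcal D$ be a random vector distributed according to a Borel probability measure $P_{\mathbf u}=P$ that is absolutely continuous with respect to $d$-dimensional Lebesgue measure; the $\omega_{\mathbf u}$ are independent and identically distributed, and $\mathbf P=\prod_{\mathbf u\in\Sigma^*}P_{\mathbf u}$ is the product probability measure on the family $\omega=\{\omega_{\mathbf u}:\mathbf u\in\Sigma^*\}$. For $\mathbf u=u_1\cdots u_k$ put $\Psi_{u_j}(x)=T_{u_j}x+\omega_{u_1\cdots u_j}$ and $J_{\mathbf u}=\Psi_{u_1}\circ\cdots\circ\Psi_{u_k}(J)$, $J_\emptyset=J$. It is assumed that these sets fulfil the nonautonomous structure: $J_{\mathbf u i}\subset J_{\mathbf u}\subset J$ for all $\mathbf u\in\Sigma^*$, $1\le i\le n_0$, and $\max_{\mathbf u\in\Sigma^k}|J_{\mathbf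 u}|\to0$ as $k\to\infty$ ($|\cdot|$ is diameter). Then $E^\omega=\bigcap_{k\ge1}\bigcup_{\mathbf u\in\Sigma^k}J_{\mathbf u}$. The projection $\Pi^\omega:\Sigma^\infty\to E^\omega$ sends $\mathbf u=u_1u_2\cdots$ to the unique point of $\bigcap_kJ_{u_1\cdots u_k}$. **Nonautonomous affine measure.** $\mathbf p=(p_1,\dots,p_{n_0})$ is a probability vector, $\mu$ is the Bernoulli measure on $\Sigma^\infty$ with $\mu(\mathcal C_{\mathbf u})=p_{\mathbf u}=p_{u_1}\cdots p_{u_k}$, and $\mu^\omega(A)=\mu\{\mathbf u:\Pi^\omega(\mathbf u)\in A\}$. **Generalized $q$-dimensions.** Let $\mathcal M_r$ be the family of $r$-mesh cubes $[j_1r,(j_1+1)r)\times\cdots\times[j_dr,(j_d+1)r)$, $j_i\in\mathbb Z$. For a finite Borel measure $\nu$ on $\mathbb R^d$ and $q\ne1$, $\underline D_q(\nu)$ and $\overline D_q(\nu)$ are the $\liminf$ and $\limsup$ as $r\to0$ of $\frac{\log\sum_{Q\in\mathcal M_r}\nu(Q)^q}{(q-1)\log r}$; $\underline D_1(\nu)$ and $\overline D_1(\nu)$ are the $\liminf$ and $\limsup$ as $r\to0$ of $\frac{\sum_{Q\in\mathcal M_r}\nu(Q)\log\nu(Q)}{\log r}$. If $\underline D_q(\nu)=\overline D_q(\nu)$, $D_q(\nu)$ exists and is the common value. **Singular value function.** For a contracting nonsingular linear $T$ with singular values $1>\alpha_1(T)\ge\cdots\ge\alpha_d(T)>0$: $\psi^s(T)=\alpha_1(T)\cdots\alpha_{m-1}(T)\alpha_m(T)^{s-m+1}$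 for $0<s\le d$, where $m$ is the integer with $m-1<s\le m$; $\psi^0(T)=1$; and $\psi^s(T)=(\alpha_1(T)\cdots\alpha_d(T))^{s/d}$ for $s>d$. For $\mathbf u=u_1\cdots u_k$, $T_{\mathbf u}=T_{u_1}\cdots T_{u_k}$, with $T_\emptyset=I$. **Critical values.** For $s>0$, $0<r<1$, with $m$ the integer such that $m-1<s\le m$ (and $m=d$ if $s>d$), let $\Sigma^*(s,r)=\{\mathbf u\in\Sigma^*:\alpha_m(T_{\mathbf u})\le r<\alpha_m(T_{\mathbf u^-})\}$. Let $F_q(s,r)=\sum_{\mathbf u\in\Sigma^*(s,r)}\psi^s(T_{\mathbf u})^{1-q}\mu(\mathcal C_{\mathbf u})^q$ for $q\ne1$ and $F_1(s,r)=\sum_{\mathbf u\in\Sigma^*(s,r)}\mu(\mathcal C_{\mathbf u})\log\big(\psi^s(T_{\mathbf u})^{-1}\mu(\mathcal C_{\mathbf u})\big)$. Then - for $q\ge1$: $d_q^-=\sup\{s:\limsup_{r\to0}F_q(s,r)<\infty\}$, $d_q^+=\sup\{s:\liminf_{r\to0}F_q(s,r)<\infty\}$; - for $0<q<1$: $d_q^-=\inf\{s:\liminf_{r\to0}F_q(s,r)<\infty\}$, $d_q^+=\inf\{s:\limsup_{r\to0}F_q(s,r)<\infty\}$. Here $s$ ranges over $s>0$, with $\sup\emptyset=0$, $\inf\emptyset=+\infty$, $0\log0=0$. *)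

theory Defs
  imports "HOL-Probability.Probability" "HOL-Library.Multiset"
begin

section \<open>Finite and infinite words\<close>

text \<open>
  Finite words over \<open>{1..n0}\<close> are lists whose head is the first letter. Infinite words are
  functions \<open>nat \<Rightarrow> nat\<close> indexed from \<open>0\<close>, so the letter \<open>u_j\<close> of an infinite word is \<open>u (j - 1)\<close>.
\<close>

definition words_of_length :: "nat \<Rightarrow> nat \<Rightarrow> nat list set" where
  "words_of_length n0 k = {u. length u = k \<and> set u \<subseteq> {1..n0}}"

definition words :: "nat \<Rightarrow> nat list set" where
  "words n0 = (\<Union>k. words_of_length n0 k)"

definition inf_words :: "nat \<Rightarrow> (nat \<Rightarrow> nat) set" where
  "inf_words n0 = {u. range u \<subseteq> {1..n0}}"

definition restr :: "(nat \<Rightarrow> nat) \<Rightarrow> nat \<Rightarrow> nat list" where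
  "restr u k = map u [0..<k]"

definition cylinder :: "nat \<Rightarrow> nat list \<Rightarrow> (nat \<Rightarrow> nat) set" where
  "cylinder n0 v = {u \<in> inf_words n0. restr u (length v) = v}"

definition bernoulli_measure :: "nat \<Rightarrow> (nat \<Rightarrow> real) \<Rightarrow> (nat \<Rightarrow> nat) measure" where
  "bernoulli_measure n0 p = (\<Pi>\<^sub>M k\<in>(UNIV :: nat set). point_measure {1..n0} (\<lambda>i. ennreal (p i)))"

definition word_prob :: "(nat \<Rightarrow> real) \<Rightarrow> nat list \<Rightarrow> real" where
  "word_prob p u = prod_list (map p u)"


section \<open>Singular values\<close>

text \<open>
  The singular values of \<open>A\<close> are the nonnegative square roots of the eigenvalues of
  \<open>A\<^sup>t A\<close>, counted with multiplicity and listed in decreasing order. As \<open>A\<^sup>t A\<close> is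
  symmetric, multiplicity is the dimension of the eigenspace, and the list has length \<open>CARD('d)\<close>.
\<close>

definition eigenspace_of :: "real^'d^'d \<Rightarrow> real \<Rightarrow> (real^'d) set" where
  "eigenspace_of B l = {v. B *v v = l *\<^sub>R v}"

definition singular_values :: "real^'d^'d \<Rightarrow> real list" where
  "singular_values A = rev (sorted_list_of_multiset
     (\<Sum>a\<in>{a. 0 \<le> a \<and> eigenspace_of (transpose A ** A) (a\<^sup>2) \<noteq> {0}}.
        replicate_mset (dim (eigenspace_of (transpose A ** A) (a\<^sup>2))) a))"

text \<open>Indexed from \<open>1\<close>: \<open>singular_value A 1\<close> is the largest one.\<close>

definition singular_value :: "real^'d^'d \<Rightarrow> nat \<Rightarrow> real" where
  "singular_value A m = singular_values A ! (m - 1)"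

text \<open>For \<open>0 < s \<le> d\<close> the integer \<open>m\<close> with \<open>m - 1 < s \<le> m\<close> is \<open>\<lceil>s\<rceil>\<close>.\<close>

definition svf :: "real \<Rightarrow> real^'d^'d \<Rightarrow> real" where
  "svf s A =
    (if s = 0 then 1
     else if s \<le> real CARD('d) then
       (let m = nat \<lceil>s\<rceil> in
         (\<Prod>i=1..m - 1. singular_value A i) * singular_value A m powr (s - real m + 1))
     else (\<Prod>i=1..CARD('d). singular_value A i) powr (s / real CARD('d)))"

definition word_mat :: "(nat \<Rightarrow> real^'d^'d) \<Rightarrow> nat list \<Rightarrow> real^'d^'d" where
  "word_mat T u = foldr (**) (map T u) (mat 1)"


section \<open>Nonautonomous affine sets with random translations\<close>

text \<open>
  The translation is attached to the whole prefix, not only to the letter: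
  \<open>prefix_map T \<omega> (u\<^sub>1\<dots>u\<^sub>j)\<close> is the map \<open>x \<mapsto> T\<^bsub>u\<^sub>j\<^esub> x + \<omega>\<^bsub>u\<^sub>1\<dots>u\<^sub>j\<^esub>\<close>.
\<close>

definition prefix_map :: "(nat \<Rightarrow> real^'d^'d) \<Rightarrow> (nat list \<Rightarrow> real^'d) \<Rightarrow> nat list \<Rightarrow> real^'d \<Rightarrow> real^'d"
  where "prefix_map T \<omega> v x = T (last v) *v x + \<omega> v"

definition word_set ::
  "(nat \<Rightarrow> real^'d^'d) \<Rightarrow> (real^'d) set \<Rightarrow> (nat list \<Rightarrow> real^'d) \<Rightarrow> nat list \<Rightarrow> (real^'d) set" where
  "word_set T J \<omega> u =
     foldr (\<circ>) (map (\<lambda>j. prefix_map T \<omega> (take j u)) [1..<Suc (length u)]) id ` J"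

definition nonautonomous_structure ::
  "nat \<Rightarrow> (nat \<Rightarrow> real^'d^'d) \<Rightarrow> (real^'d) set \<Rightarrow> (nat list \<Rightarrow> real^'d) \<Rightarrow> bool" where
  "nonautonomous_structure n0 T J \<omega> \<longleftrightarrow>
     (\<forall>u\<in>words n0. word_set T J \<omega> u \<subseteq> J \<and>
        (\<forall>i\<in>{1..n0}. word_set T J \<omega> (u @ [i]) \<subseteq> word_set T J \<omega> u)) \<and>
     (\<lambda>k. Max ((\<lambda>u. diameter (word_set T J \<omega> u)) ` words_of_length n0 k)) \<longlonglongrightarrow> 0"

definition nonautonomous_set ::
  "nat \<Rightarrow> (nat \<Rightarrow> real^'d^'d) \<Rightarrow> (real^'d) set \<Rightarrow> (nat list \<Rightarrow> real^'d) \<Rightarrow> (real^'d) set" where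
  "nonautonomous_set n0 T J \<omega> = (\<Inter>k\<in>{1..}. \<Union>u\<in>words_of_length n0 k. word_set T J \<omega> u)"

definition coding_map ::
  "(nat \<Rightarrow> real^'d^'d) \<Rightarrow> (real^'d) set \<Rightarrow> (nat list \<Rightarrow> real^'d) \<Rightarrow> (nat \<Rightarrow> nat) \<Rightarrow> real^'d" where
  "coding_map T J \<omega> u = (THE x. x \<in> (\<Inter>k\<in>{1..}. word_set T J \<omega> (restr u k)))"

definition nonautonomous_measure ::
  "nat \<Rightarrow> (nat \<Rightarrow> real^'d^'d) \<Rightarrow> (nat \<Rightarrow> real) \<Rightarrow> (real^'d) set \<Rightarrow> (nat list \<Rightarrow> real^'d) \<Rightarrow> (real^'d) measure"
  where "nonautonomous_measure n0 T p J \<omega> = distr (bernoulli_measure n0 p) borel (coding_map T J \<omega>)"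

definition translation_measure :: "nat \<Rightarrow> (real^'d) measure \<Rightarrow> (nat list \<Rightarrow> real^'d) measure" where
  "translation_measure n0 P = (\<Pi>\<^sub>M u\<in>words n0. P)"


section \<open>Generalized dimensions\<close>

definition mesh_cube :: "real \<Rightarrow> int^'d \<Rightarrow> (real^'d) set" where
  "mesh_cube r j = {x. \<forall>i. of_int (j $ i) * r \<le> x $ i \<and> x $ i < (of_int (j $ i) + 1) * r}"

definition mesh :: "real \<Rightarrow> (real^'d) set set" where
  "mesh r = range (mesh_cube r)"

text \<open>
  For a measure of bounded support, such as \<open>nonautonomous_measure\<close>, only finitely many
  terms of the sums over \<open>mesh r\<close> are nonzero.
\<close>

definition q_quotient :: "real \<Rightarrow> (real^'d) measure \<Rightarrow> real \<Rightarrow> real" where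
  "q_quotient q \<nu> r =
    (if q = 1 then (\<Sum>\<^sub>\<infinity>Q\<in>mesh r. measure \<nu> Q * ln (measure \<nu> Q)) / ln r
     else ln (\<Sum>\<^sub>\<infinity>Q\<in>mesh r. measure \<nu> Q powr q) / ((q - 1) * ln r))"

definition lower_q_dim :: "real \<Rightarrow> (real^'d) measure \<Rightarrow> ereal" where
  "lower_q_dim q \<nu> = Liminf (at_right 0) (\<lambda>r. ereal (q_quotient q \<nu> r))"

definition upper_q_dim :: "real \<Rightarrow> (real^'d) measure \<Rightarrow> ereal" where
  "upper_q_dim q \<nu> = Limsup (at_right 0) (\<lambda>r. ereal (q_quotient q \<nu> r))"

definition has_q_dim :: "real \<Rightarrow> (real^'d) measure \<Rightarrow> ereal \<Rightarrow> bool" where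
  "has_q_dim q \<nu> D \<longleftrightarrow> lower_q_dim q \<nu> = D \<and> upper_q_dim q \<nu> = D"


section \<open>Critical values\<close>

text \<open>The index \<open>m\<close> is \<open>\<lceil>s\<rceil>\<close> for \<open>0 < s \<le> d\<close> and \<open>d\<close> for \<open>s > d\<close>.\<close>

definition cut_set :: "nat \<Rightarrow> (nat \<Rightarrow> real^'d^'d) \<Rightarrow> real \<Rightarrow> real \<Rightarrow> nat list set" where
  "cut_set n0 T s r =
    (let m = min (nat \<lceil>s\<rceil>) CARD('d) in
      {u \<in> words n0. u \<noteq> [] \<and>
         singular_value (word_mat T u) m \<le> r \<and> r < singular_value (word_mat T (butlast u)) m})"

definition crit_sum :: "nat \<Rightarrow> (nat \<Rightarrow> real^'d^'d) \<Rightarrow> (nat \<Rightarrow> real) \<Rightarrow> real \<Rightarrow> real \<Rightarrow> real \<Rightarrow> real" where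
  "crit_sum n0 T p q s r =
    (if q = 1 then
       (\<Sum>u\<in>cut_set n0 T s r. measure (bernoulli_measure n0 p) (cylinder n0 u) *
          ln (inverse (svf s (word_mat T u)) * measure (bernoulli_measure n0 p) (cylinder n0 u)))
     else
       (\<Sum>u\<in>cut_set n0 T s r. svf s (word_mat T u) powr (1 - q) *
          measure (bernoulli_measure n0 p) (cylinder n0 u) powr q))"

text \<open>
  The supremum of the empty set is to be \<open>0\<close>, hence the \<open>insert 0\<close>;
  in \<^typ>\<open>ereal\<close> the infimum of the empty set is already \<open>\<infinity>\<close>.
\<close>

definition crit_minus :: "nat \<Rightarrow> (nat \<Rightarrow> real^'d^'d) \<Rightarrow> (nat \<Rightarrow> real) \<Rightarrow> real \<Rightarrow> ereal" where
  "crit_minus n0 T p q =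
    (if 1 \<le> q then
       Sup (insert 0 {ereal s | s. 0 < s \<and> Limsup (at_right 0) (\<lambda>r. ereal (crit_sum n0 T p q s r)) < \<infinity>})
     else
       Inf {ereal s | s. 0 < s \<and> Liminf (at_right 0) (\<lambda>r. ereal (crit_sum n0 T p q s r)) < \<infinity>})"

definition crit_plus :: "nat \<Rightarrow> (nat \<Rightarrow> real^'d^'d) \<Rightarrow> (nat \<Rightarrow> real) \<Rightarrow> real \<Rightarrow> ereal" where
  "crit_plus n0 T p q =
    (if 1 \<le> q then
       Sup (insert 0 {ereal s | s. 0 < s \<and> Liminf (at_right 0) (\<lambda>r. ereal (crit_sum n0 T p q s r)) < \<infinity>})
     else
       Inf {ereal s | s. 0 < s \<and> Limsup (at_right 0) (\<lambda>r. ereal (crit_sum n0 T p q s r)) < \<infinity>})"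


section \<open>Consistency of the definitions\<close>

lemma measure_cylinder:
  assumes p: "\<And>i. i \<in> {1..n0} \<Longrightarrow> 0 \<le> p i" "(\<Sum>i=1..n0. p i) = 1" and u: "u \<in> words n0"
  shows "measure (bernoulli_measure n0 p) (cylinder n0 u) = word_prob p u"
proof -
  let ?M = "point_measure {1..n0} (\<lambda>i. ennreal (p i))"
  have pr: "prob_space ?M"
  proof
    show "emeasure ?M (space ?M) = 1"
      using p by (simp add: space_point_measure emeasure_point_measure_finite del: One_nat_def)
        (subst sum_ennreal, auto)
  qed
  interpret product_prob_space "\<lambda>_. ?M" "UNIV :: nat set"
    using pr by (simp add: product_prob_space_def product_prob_space_axioms_def product_sigma_finite_def prob_space_imp_sigma_finite)
  have us: "set u \<subseteq> {1..n0}" using u by (auto simp: words_def words_of_length_def)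
  have nth: "u ! j \<in> {1..n0}" if "j < length u" for j using us that nth_mem by blast
  have single: "emeasure ?M {u ! j} = ennreal (p (u ! j))" if "j < length u" for j
    using nth[OF that] by (subst emeasure_point_measure_finite) auto
  have "cylinder n0 u = {x \<in> space (Pi\<^sub>M UNIV (\<lambda>_::nat. ?M)). \<forall>j\<in>{..<length u}. x j \<in> {u ! j}}"
  proof -
    have "restr x (length u) = u \<longleftrightarrow> (\<forall>j<length u. x j = u ! j)" for x
      unfolding restr_def by (subst list_eq_iff_nth_eq) auto
    moreover have "space (Pi\<^sub>M UNIV (\<lambda>_::nat. ?M)) = inf_words n0"
      by (simp add: space_PiM space_point_measure inf_words_def PiE_UNIV_domain image_subset_iff Pi_def)
    ultimately show ?thesis by (simp add: cylinder_def Ball_def)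
  qed
  moreover have "emeasure (Pi\<^sub>M UNIV (\<lambda>_::nat. ?M))
      {x \<in> space (Pi\<^sub>M UNIV (\<lambda>_::nat. ?M)). \<forall>j\<in>{..<length u}. x j \<in> {u ! j}}
      = (\<Prod>j\<in>{..<length u}. emeasure ?M {u ! j})"
    using nth by (intro emeasure_PiM_Collect) (auto simp: sets_point_measure)
  ultimately have "emeasure (bernoulli_measure n0 p) (cylinder n0 u) = (\<Prod>j<length u. ennreal (p (u ! j)))"
    using single by (simp add: bernoulli_measure_def)
  also have "\<dots> = ennreal (\<Prod>j<length u. p (u ! j))"
    using nth p by (intro prod_ennreal) auto
  also have "(\<Prod>j<length u. p (u ! j)) = word_prob p u"
    by (simp add: word_prob_def prod.list_conv_set_nth atLeast0LessThan)
  finally have *: "emeasure (bernoulli_measure n0 p) (cylinder n0 u) = ennreal (word_prob p u)" .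
  have "0 \<le> word_prob p u" unfolding word_prob_def using us p by (induction u) auto
  with * show ?thesis by (simp add: measure_def)
qed

lemma coding_map_unique:
  assumes J: "compact J" "J \<noteq> {}" and str: "nonautonomous_structure n0 T J \<omega>" and u: "u \<in> inf_words n0"
  shows "(\<Inter>k\<in>{1..}. word_set T J \<omega> (restr u k)) = {coding_map T J \<omega> u}"
    and "coding_map T J \<omega> u \<in> nonautonomous_set n0 T J \<omega>"
proof -
  have w: "restr u k \<in> words_of_length n0 k" for k
    using u by (auto simp: restr_def words_of_length_def inf_words_def)
  then have wS: "restr u k \<in> words n0" for k by (auto simp: words_def)
  let ?S = "\<lambda>k. word_set T J \<omega> (restr u k)"
  have cont: "continuous_on UNIV (foldr (\<circ>) (map (\<lambda>j. prefix_map T \<omega> (f j)) js) id)" for f :: "nat \<Rightarrow> nat list" and js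
  proof (induction js)
    case (Cons a js)
    have "continuous_on UNIV (prefix_map T \<omega> (f a))"
      unfolding prefix_map_def by (intro continuous_intros)
    then show ?case
      using continuous_on_compose[OF Cons continuous_on_subset[OF _ subset_UNIV]] by simp
  qed (simp add: continuous_on_id)
  have comp: "compact (?S k)" for k
    unfolding word_set_def using J by (intro compact_continuous_image continuous_on_subset[OF cont]) auto
  have ne: "?S k \<noteq> {}" for k using J by (auto simp: word_set_def)
  have step: "?S (Suc k) \<subseteq> ?S k" for k
  proof -
    have "restr u (Suc k) = restr u k @ [u k]" by (simp add: restr_def)
    moreover have "u k \<in> {1..n0}" using u unfolding inf_words_def by blast
    ultimately show ?thesis using str wS[of k] by (auto simp: nonautonomous_structure_def)
  qed
  have mono: "?S n \<subseteq> ?S m" if "m \<le> n" for m n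
    using lift_Suc_antimono_le[of ?S, OF step that] .
  have lim: "(\<lambda>k. Max ((\<lambda>u. diameter (word_set T J \<omega> u)) ` words_of_length n0 k)) \<longlonglongrightarrow> 0"
    using str by (simp add: nonautonomous_structure_def)
  have fin: "finite (words_of_length n0 k)" for k
    unfolding words_of_length_def using finite_lists_length_eq[of "{1..n0}" k] by (simp add: conj_commute)
  have small: "\<exists>n. \<forall>x\<in>?S n. \<forall>y\<in>?S n. dist x y < e" if e: "e > 0" for e
  proof -
    obtain n where n: "Max ((\<lambda>u. diameter (word_set T J \<omega> u)) ` words_of_length n0 n) < e"
      using order_tendstoD(2)[OF lim e] by (auto simp: eventually_sequentially)
    have "diameter (?S n) \<le> Max ((\<lambda>u. diameter (word_set T J \<omega> u)) ` words_of_length n0 n)"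
      using w fin by (intro Max_ge) auto
    with n have "diameter (?S n) < e" by simp
    then have "\<forall>x\<in>?S n. \<forall>y\<in>?S n. dist x y < e"
      using diameter_bounded_bound[OF compact_imp_bounded[OF comp[of n]]] by fastforce
    then show ?thesis by blast
  qed
  obtain a where a: "\<Inter>(range ?S) = {a}"
    using decreasing_closed_nest_sing[of ?S, OF compact_imp_closed[OF comp] ne mono small] by auto
  have "(\<Inter>k\<in>{1..}. ?S k) = \<Inter>(range ?S)"
  proof
    have "(\<Inter>k\<in>{1..}. ?S k) \<subseteq> ?S j" for j
      using mono[of j "Suc j"] by fastforce
    then show "(\<Inter>k\<in>{1..}. ?S k) \<subseteq> \<Inter>(range ?S)" by blast
  qed blast
  with a have I: "(\<Inter>k\<in>{1..}. ?S k) = {a}" by simp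
  then have ca: "coding_map T J \<omega> u = a" unfolding coding_map_def I by simp
  with I show eq: "(\<Inter>k\<in>{1..}. ?S k) = {coding_map T J \<omega> u}" by simp
  show "coding_map T J \<omega> u \<in> nonautonomous_set n0 T J \<omega>"
    using eq w unfolding nonautonomous_set_def by blast
qed

end

theory Submission
  imports Defs
begin

text \<open>
  Covering \<open>T\<^sub>u\<close>-images of balls shows that \<open>\<psi>\<^sup>s\<close> is submultiplicative up to a constant. Hence, for
  \<open>q \<ge> 1\<close>, the logarithms of the moment sums over words of length \<open>k\<close> (for \<open>q = 1\<close> the mean of
  \<open>ln (p\<^sub>u / \<psi>\<^sup>s(T\<^sub>u))\<close>) are almost superadditive in \<open>k\<close>, and their growth rate, the pressure, is
  strictly increasing in \<open>s\<close> with a unique zero \<open>d\<^sub>q\<close>. The cut set sums stay bounded above below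
  this zero and tend to infinity beyond it.

  The upper bound for the dimension holds for every admissible translation family: the cylinder
  sets indexed by a cut set are covered by about \<open>\<psi>\<^sup>s(T\<^sub>u) r\<^sup>-\<^sup>s\<close> mesh cubes. The lower
  bound rests on a small ball estimate: the probability that two coded points whose words separate
  after \<open>u\<close> are \<open>r\<close>-close is at most a constant times \<open>\<Prod>\<^sub>i min 1 (r / \<alpha>\<^sub>i(T\<^sub>u))\<close>. For \<open>q > 1\<close> it
  gives a recursion for the expected \<open>q\<close>-th moments of the cylinder masses, through a
  Rosenthal-type inequality. For \<open>q = 1\<close> it bounds the energy of the part of the measure
  carried by words along which \<open>ln (p\<^sub>u / \<psi>\<^sup>s(T\<^sub>u))\<close> has the expected behaviour; these words
  have almost full measure.
\<close>

section \<open>Singular values\<close>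

text \<open>The law \<open>P\<close> is only absolutely continuous. Its density may be unbounded, so
  one random translation need not give the small ball estimate; along a path one waits for a
  translation at which the density is bounded, and this works because the waiting probability can be
  made smaller than the loss per letter. Independence enters by redrawing one coordinate of the
  product while all other quantities are shown pointwise not to change with it
  (\<open>path_indep\<close>). The ranges of \<open>q\<close> need different tools because
  \<open>\<psi>\<close> is only submultiplicative. For \<open>q > 1\<close> the moment sums are
  supermultiplicative, and lower bounds multiply along blocks. For \<open>q < 1\<close> they are
  submultiplicative, and a renewal argument suffices. At \<open>q = 1\<close> the tails of
  \<open>info\<close> are controlled through its mean together with moments for exponents slightly
  below 1. There the energy of the full measure can be dominated by rare words; entropy, unlike
  energy, tolerates the loss of a small part of the mass.\<close>

lemma symmetric_eigenvector:
  fixes f :: "'a::euclidean_space \<Rightarrow> 'a"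
  assumes lin: "linear f" and sym: "\<And>x y. f x \<bullet> y = x \<bullet> f y"
    and V: "subspace V" "V \<noteq> {0}" and inv: "\<And>x. x \<in> V \<Longrightarrow> f x \<in> V"
  obtains x l where "x \<in> V" "norm x = 1" "f x = l *\<^sub>R x"
proof -
  let ?S = "sphere 0 1 \<inter> V"
  obtain v where v: "v \<in> V" "v \<noteq> 0" using V subspace_0 by blast
  have "v /\<^sub>R norm v \<in> ?S" using v V by (simp add: subspace_scale)
  then have ne: "?S \<noteq> {}" by blast
  have comp: "compact ?S" using V by (intro compact_Int_closed closed_subspace) auto
  have cont: "continuous_on ?S (\<lambda>x. x \<bullet> f x)"
    by (intro continuous_intros linear_continuous_on linear_conv_bounded_linear[THEN iffD1] lin)
  obtain x where x: "x \<in> ?S" and max: "\<And>y. y \<in> ?S \<Longrightarrow> y \<bullet> f y \<le> x \<bullet> f x"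
    using continuous_attains_sup[OF comp ne cont] by blast
  define l where "l = x \<bullet> f x"
  have xx: "x \<bullet> x = 1" using x by (simp add: dot_square_norm)
  have q: "y \<bullet> f y \<le> l * (y \<bullet> y)" if "y \<in> V" for y
  proof (cases "y = 0")
    case False
    have "y /\<^sub>R norm y \<in> ?S" using that V False by (simp add: subspace_scale)
    from max[OF this] have "(y \<bullet> f y) / (norm y)\<^sup>2 \<le> l"
      by (simp add: linear_scale[OF lin] l_def divide_inverse power2_eq_square mult_ac)
    then show ?thesis using False by (simp add: dot_square_norm divide_le_eq)
  qed (simp add: linear_0[OF lin])
  \<comment> \<open>The residual of the eigenvalue equation. Moving from the maximiser
    \<open>x\<close> in this direction raises the Rayleigh quotient to first order unless the
    residual vanishes.\<close>
  define w where "w = f x - l *\<^sub>R x"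
  have wV: "w \<in> V" using x inv V by (simp add: w_def subspace_diff subspace_scale)
  have key: "2 * t * (w \<bullet> w) \<le> t\<^sup>2 * (l * (w \<bullet> w) - w \<bullet> f w)" for t
  proof -
    have "x + t *\<^sub>R w \<in> V" using x wV V by (simp add: subspace_add subspace_scale)
    from q[OF this] have "(x + t *\<^sub>R w) \<bullet> (f x + t *\<^sub>R f w) \<le> l * ((x + t *\<^sub>R w) \<bullet> (x + t *\<^sub>R w))"
      by (simp add: linear_add[OF lin] linear_scale[OF lin])
    then have "l + t * (x \<bullet> f w) + t * (w \<bullet> f x) + t\<^sup>2 * (w \<bullet> f w) \<le> l * (1 + 2 * t * (x \<bullet> w) + t\<^sup>2 * (w \<bullet> w))"
      using xx by (simp add: l_def inner_simps power2_eq_square algebra_simps inner_commute)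
    moreover have "x \<bullet> f w = w \<bullet> f x" using sym[of x w] by (simp add: inner_commute)
    moreover have "w \<bullet> f x = w \<bullet> w + l * (x \<bullet> w)"
      using xx by (simp add: w_def inner_simps inner_commute algebra_simps)
    ultimately show ?thesis by (simp add: algebra_simps)
  qed
  have "w \<bullet> w \<le> 0"
  proof (rule ccontr)
    assume "\<not> w \<bullet> w \<le> 0"
    then have pos: "w \<bullet> w > 0" by (simp only: not_le)
    \<comment> \<open>With the step \<open>t = (w \<bullet> w) / c\<close> the quadratic term of
      \<open>key\<close> is at most half of the linear one.\<close>
    define c where "c = \<bar>l * (w \<bullet> w) - w \<bullet> f w\<bar> + 1"
    have c: "c > 0" by (simp add: c_def)
    have "2 * (w \<bullet> w / c) * (w \<bullet> w) \<le> (w \<bullet> w / c)\<^sup>2 * (l * (w \<bullet> w) - w \<bullet> f w)" by (rule key)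
    also have "\<dots> \<le> (w \<bullet> w / c)\<^sup>2 * c" by (intro mult_left_mono) (auto simp: c_def)
    also have "\<dots> = (w \<bullet> w / c) * (w \<bullet> w)" using c by (simp add: power2_eq_square)
    finally show False using mult_pos_pos[OF pos pos] c by (simp add: field_simps del: inner_eq_zero_iff)
  qed
  then have "w = 0" using inner_ge_zero[of w] by (metis antisym inner_eq_zero_iff)
  then show thesis using that[of x l] x by (simp add: w_def)
qed

text \<open>Symmetry makes the orthogonal complement of an eigenvector invariant, so eigenvectors
  split off one at a time. The form with invariant subspaces lets the induction on the dimension
  run.\<close>

lemma symmetric_orthonormal_eigenbasis:
  fixes f :: "'a::euclidean_space \<Rightarrow> 'a"
  assumes lin: "linear f" and sym: "\<And>x y. f x \<bullet> y = x \<bullet> f y"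
    and "subspace V" and "\<And>x. x \<in> V \<Longrightarrow> f x \<in> V"
  shows "\<exists>S. finite S \<and> S \<subseteq> V \<and> pairwise orthogonal S \<and> (\<forall>x\<in>S. norm x = 1) \<and>
           (\<forall>x\<in>S. \<exists>l. f x = l *\<^sub>R x) \<and> span S = V"
  using assms(3,4)
proof (induction "dim V" arbitrary: V rule: less_induct)
  case less
  note V = less.prems(1) and inv = less.prems(2)
  show ?case
  proof (cases "V = {0}")
    case True
    then show ?thesis by (intro exI[of _ "{}"]) auto
  next
    case False
    obtain x l where x: "x \<in> V" "norm x = 1" "f x = l *\<^sub>R x"
      using symmetric_eigenvector[OF lin sym V False inv] by metis
    define V' where "V' = {y \<in> V. x \<bullet> y = 0}"
    have sV': "subspace V'" using V by (auto simp: V'_def subspace_def inner_simps)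
    have invV': "f y \<in> V'" if "y \<in> V'" for y
    proof -
      have "x \<bullet> f y = f x \<bullet> y" by (simp add: sym)
      then show ?thesis using that inv x by (simp add: V'_def)
    qed
    have xV': "x \<notin> V'" using x by (auto simp: V'_def dot_square_norm)
    have "dim V' < dim V"
    proof (rule dim_psubset)
      have "span V' = V'" "span V = V" using sV' V by (auto simp: span_eq_iff)
      moreover have "V' \<subset> V" using xV' x(1) by (metis (no_types, lifting) V'_def mem_Collect_eq psubsetI subsetI)
      ultimately show "span V' \<subset> span V" by (simp only:)
    qed
    then obtain S where S: "finite S" "S \<subseteq> V'" "pairwise orthogonal S" "\<forall>x\<in>S. norm x = 1"
      "\<forall>x\<in>S. \<exists>l. f x = l *\<^sub>R x" "span S = V'"
      using less.hyps[OF _ sV' invV'] by blast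
    have "span (insert x S) = V"
    proof
      show "span (insert x S) \<subseteq> V" using x S V by (intro span_minimal) (auto simp: V'_def)
      show "V \<subseteq> span (insert x S)"
      proof
        fix y assume y: "y \<in> V"
        have "y - (x \<bullet> y) *\<^sub>R x \<in> V'"
          using x y V by (simp add: V'_def subspace_diff subspace_scale inner_diff_right dot_square_norm)
        then have "y - (x \<bullet> y) *\<^sub>R x \<in> span S" using S by simp
        then show "y \<in> span (insert x S)" unfolding span_insert by blast
      qed
    qed
    moreover have "pairwise orthogonal (insert x S)"
      using S by (auto simp: pairwise_insert orthogonal_def V'_def inner_commute)
    ultimately show ?thesis using x S
      by (intro exI[of _ "insert x S"]) (auto simp: V'_def)
  qed
qed

lemma sum_orthonormal_inner:
  fixes S :: "'a::euclidean_space set"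
  assumes "finite S" "pairwise orthogonal S" "\<And>x. x \<in> S \<Longrightarrow> norm x = 1" "y \<in> S"
  shows "(\<Sum>x\<in>S. c x *\<^sub>R x) \<bullet> y = c y"
proof -
  have "(\<Sum>x\<in>S. c x *\<^sub>R x) \<bullet> y = (\<Sum>x\<in>S. if x = y then c y else 0)"
    unfolding inner_sum_left
  proof (intro sum.cong refl)
    fix x assume "x \<in> S"
    then show "(c x *\<^sub>R x) \<bullet> y = (if x = y then c y else 0)"
      using assms(2)[unfolded pairwise_def orthogonal_def] assms(3)[of y] assms(4) by (auto simp: dot_square_norm)
  qed
  then show ?thesis using assms by simp
qed

lemma orthonormal_expansion:
  fixes S :: "'a::euclidean_space set"
  assumes S: "finite S" "pairwise orthogonal S" "\<And>x. x \<in> S \<Longrightarrow> norm x = 1" and "span S = UNIV"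
  shows "(\<Sum>x\<in>S. (y \<bullet> x) *\<^sub>R x) = y"
proof -
  let ?z = "(\<Sum>x\<in>S. (y \<bullet> x) *\<^sub>R x) - y"
  have "?z \<bullet> x = 0" if "x \<in> S" for x
    using sum_orthonormal_inner[OF S that] by (simp add: inner_diff_left)
  then have "\<forall>x\<in>S. orthogonal ?z x" by (simp add: orthogonal_def)
  then have "orthogonal ?z ?z"
    using orthogonal_to_span[of ?z S ?z] assms(4) by auto
  then show ?thesis by (simp add: orthogonal_self)
qed

lemma orthonormal_independent:
  fixes S :: "'a::euclidean_space set"
  assumes "pairwise orthogonal S" "\<And>x. x \<in> S \<Longrightarrow> norm x = 1"
  shows "independent S"
  using assms(1) assms(2)[of 0] by (intro pairwise_orthogonal_independent) auto

section \<open>The singular basis and the min-max description of singular values\<close>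

lemma sort_map_key: "sort (map f xs) = map f (sort_key f xs)"
  by (intro properties_for_sort) auto

text \<open>In an orthonormal eigenbasis of \<open>transpose A ** A\<close> each eigenspace is
  spanned by the basis vectors lying in it. Hence the multiplicities in the definition of
  \<open>singular_values\<close> count basis vectors, and the multiset is that of the norms
  \<open>norm (A *v x)\<close>. Sorting the basis by these norms gives \<open>v\<close>. The
  geometry of \<open>A\<close> is read off from this basis from here on.\<close>

lemma singular_basis:
  fixes A :: "real^'d^'d"
  obtains v :: "nat \<Rightarrow> real^'d"
  where "\<And>i j. i \<in> {1..CARD('d)} \<Longrightarrow> j \<in> {1..CARD('d)} \<Longrightarrow> v i \<bullet> v j = (if i = j then 1 else 0)"
    and "\<And>i j. i \<in> {1..CARD('d)} \<Longrightarrow> j \<in> {1..CARD('d)} \<Longrightarrow>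
           (A *v v i) \<bullet> (A *v v j) = (if i = j then (singular_value A i)\<^sup>2 else 0)"
    and "\<And>i j. 1 \<le> i \<Longrightarrow> i \<le> j \<Longrightarrow> j \<le> CARD('d) \<Longrightarrow> singular_value A j \<le> singular_value A i"
    and "\<And>i. i \<in> {1..CARD('d)} \<Longrightarrow> 0 \<le> singular_value A i"
    and "\<And>x. (\<Sum>i=1..CARD('d). (x \<bullet> v i) *\<^sub>R v i) = x"
    and "span (v ` {1..CARD('d)}) = UNIV"
proof -
  define B where "B = transpose A ** A"
  have Bv: "(B *v x) \<bullet> y = (A *v x) \<bullet> (A *v y)" for x y
    by (simp add: B_def matrix_vector_mul_assoc[symmetric] dot_lmul_matrix[symmetric] flip: transpose_matrix_vector)
  have sym: "(B *v x) \<bullet> y = x \<bullet> (B *v y)" for x y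
    using Bv[of x y] Bv[of y x] by (simp add: inner_commute)
  obtain S where S: "finite S" "pairwise orthogonal S" "\<And>x. x \<in> S \<Longrightarrow> norm x = 1"
      "\<And>x. x \<in> S \<Longrightarrow> \<exists>l. B *v x = l *\<^sub>R x" "span S = UNIV"
    using symmetric_orthonormal_eigenbasis[of "(*v) B" UNIV] sym by auto
  have ind: "independent S" using orthonormal_independent[OF S(2,3)] .
  have cS: "card S = CARD('d)"
    using dim_span_eq_card_independent[OF ind] S(5) by (simp add: dim_UNIV)
  define a where "a x = norm (A *v x)" for x
  have Ba: "B *v x = (a x)\<^sup>2 *\<^sub>R x" if xS: "x \<in> S" for x
  proof -
    obtain l where l: "B *v x = l *\<^sub>R x" using S(4)[OF xS] by blast
    have "(a x)\<^sup>2 = l" using Bv[of x x] l S(3)[OF xS]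
      by (simp add: a_def dot_square_norm)
    then show ?thesis using l by simp
  qed
  have eig: "eigenspace_of B l = span {x\<in>S. (a x)\<^sup>2 = l}" for l
  proof
    have "B *v x = l *\<^sub>R x" if "x \<in> span {x\<in>S. (a x)\<^sup>2 = l}" for x
      using that
    proof (induction rule: span_induct_alt)
      case (step c x y)
      then show ?case using Ba[of x]
        by (simp add: matrix_vector_right_distrib matrix_vector_mult_scaleR scaleR_add_right)
    qed simp
    then show "span {x\<in>S. (a x)\<^sup>2 = l} \<subseteq> eigenspace_of B l" by (auto simp: eigenspace_of_def)
    show "eigenspace_of B l \<subseteq> span {x\<in>S. (a x)\<^sup>2 = l}"
    proof
      fix y assume "y \<in> eigenspace_of B l"
      then have y: "B *v y = l *\<^sub>R y" by (simp add: eigenspace_of_def)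
      have z: "(y \<bullet> x) *\<^sub>R x \<in> span {x\<in>S. (a x)\<^sup>2 = l}" if x: "x \<in> S" for x
      proof (cases "(a x)\<^sup>2 = l")
        case True then show ?thesis using x by (intro span_scale span_base) auto
      next
        case False
        have "l * (y \<bullet> x) = (a x)\<^sup>2 * (y \<bullet> x)"
          using sym[of y x] y Ba[OF x] by simp
        then have "y \<bullet> x = 0" using False by simp
        then show ?thesis by (simp add: span_zero)
      qed
      have "(\<Sum>x\<in>S. (y \<bullet> x) *\<^sub>R x) \<in> span {x\<in>S. (a x)\<^sup>2 = l}" using z by (intro span_sum) auto
      then show "y \<in> span {x\<in>S. (a x)\<^sup>2 = l}" using orthonormal_expansion[OF S(1-3,5)] by metis
    qed
  qed
  have ind': "independent {x\<in>S. (a x)\<^sup>2 = l}" for l using ind by (rule independent_mono) auto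
  have dimE: "dim (eigenspace_of B l) = card {x\<in>S. (a x)\<^sup>2 = l}" for l
    unfolding eig using dim_span_eq_card_independent[OF ind'] by simp
  have a0: "a x \<ge> 0" for x by (simp add: a_def)
  have idx: "{t. 0 \<le> t \<and> eigenspace_of B (t\<^sup>2) \<noteq> {0}} = a ` S"
  proof (intro set_eqI iffI)
    fix t assume t: "t \<in> {t. 0 \<le> t \<and> eigenspace_of B (t\<^sup>2) \<noteq> {0}}"
    then have "{x\<in>S. (a x)\<^sup>2 = t\<^sup>2} \<noteq> {}" unfolding eig by (metis (mono_tags, lifting) mem_Collect_eq span_empty)
    then obtain x where "x \<in> S" "(a x)\<^sup>2 = t\<^sup>2" by blast
    then show "t \<in> a ` S" using a0[of x] t by (auto simp: power2_eq_iff_nonneg)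
  next
    fix t assume "t \<in> a ` S"
    then obtain x where x: "x \<in> S" "t = a x" by blast
    then have "x \<in> eigenspace_of B (t\<^sup>2)" unfolding eig by (auto intro!: span_base)
    moreover have "x \<noteq> 0" using S(3)[OF x(1)] by auto
    ultimately show "t \<in> {t. 0 \<le> t \<and> eigenspace_of B (t\<^sup>2) \<noteq> {0}}" using x a0 by auto
  qed
  have "(\<Sum>t\<in>a ` S. replicate_mset (dim (eigenspace_of B (t\<^sup>2))) t) = image_mset a (mset_set S)"
  proof (rule multiset_eqI)
    fix z
    have c1: "count (\<Sum>t\<in>a ` S. replicate_mset (dim (eigenspace_of B (t\<^sup>2))) t) z =
        (\<Sum>t\<in>a ` S. if t = z then dim (eigenspace_of B (z\<^sup>2)) else 0)"
      by (auto simp: count_sum intro!: sum.cong)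
    \<comment> \<open>Squaring is injective on nonnegative numbers, so distinct norms belong to
      distinct eigenvalues.\<close>
    have eqS: "{x\<in>S. (a x)\<^sup>2 = z\<^sup>2} = {x\<in>S. a x = z}" if "z \<ge> 0"
      using a0 that by (auto simp: power2_eq_iff_nonneg)
    have c2: "count (image_mset a (mset_set S)) z = card {x\<in>S. a x = z}"
      using S(1) by (simp add: count_image_mset count_mset_set' sum.If_cases vimage_def Int_def conj_commute)
    show "count (\<Sum>t\<in>a ` S. replicate_mset (dim (eigenspace_of B (t\<^sup>2))) t) z = count (image_mset a (mset_set S)) z"
    proof (cases "z \<in> a ` S")
      case True
      then have "z \<ge> 0" using a0 by auto
      then show ?thesis using True S(1) unfolding c1 c2 by (simp add: dimE eqS)
    next
      case False
      then have "{x\<in>S. a x = z} = {}" by auto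
      then show ?thesis using False S(1) unfolding c1 c2 by (simp add: sum.delta' )
    qed
  qed
  then have sv: "singular_values A = rev (sorted_list_of_multiset (image_mset a (mset_set S)))"
    unfolding singular_values_def B_def[symmetric] idx by simp
  obtain xs where xs: "set xs = S" "distinct xs" using finite_distinct_list[OF S(1)] by blast
  define ys where "ys = rev (sort_key a xs)"
  have "mset_set S = mset xs" using xs by (metis mset_set_set)
  then have "sorted_list_of_multiset (image_mset a (mset_set S)) = map a (sort_key a xs)"
    by (simp add: sort_map_key flip: mset_map)
  then have sv2: "singular_values A = map a ys" by (simp add: sv ys_def rev_map)
  have ys: "set ys = S" "distinct ys" "length ys = CARD('d)"
    using xs cS by (auto simp: ys_def distinct_card[symmetric])
  have srt: "sorted (rev (map a ys))" by (simp add: ys_def rev_map[symmetric])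
  define v where "v i = ys ! (i - 1)" for i
  have sva: "singular_value A i = a (v i)" if "i \<in> {1..CARD('d)}" for i
  proof -
    have "i - 1 < length ys" using that ys by auto
    then show ?thesis by (simp add: singular_value_def sv2 v_def)
  qed
  have vS: "v i \<in> S" if "i \<in> {1..CARD('d)}" for i
    using that ys nth_mem[of "i - 1" ys] by (auto simp: v_def)
  have vinj: "inj_on v {1..CARD('d)}"
    using ys by (auto simp: inj_on_def v_def nth_eq_iff_index_eq)
  have vim: "v ` {1..CARD('d)} = S"
    using vS vinj cS S(1) by (intro card_subset_eq) (auto simp: card_image)
  have orth: "v i \<bullet> v j = (if i = j then 1 else 0)" if "i \<in> {1..CARD('d)}" "j \<in> {1..CARD('d)}" for i j
    using S(2)[unfolded pairwise_def orthogonal_def] S(3) vS[OF that(1)] vS[OF that(2)] inj_onD[OF vinj _ that]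
    by (auto simp: dot_square_norm)
  show thesis
  proof (rule that[of v])
    show "(A *v v i) \<bullet> (A *v v j) = (if i = j then (singular_value A i)\<^sup>2 else 0)"
      if "i \<in> {1..CARD('d)}" "j \<in> {1..CARD('d)}" for i j
      using Bv[of "v i" "v j"] Ba[OF vS[OF that(1)]] orth[OF that] sva[OF that(1)] by auto
    show "singular_value A j \<le> singular_value A i" if "1 \<le> i" "i \<le> j" "j \<le> CARD('d)" for i j
      using sorted_rev_nth_mono[OF srt, of "i - 1" "j - 1"] that ys
      by (simp add: singular_value_def sv2)
    show "(\<Sum>i=1..CARD('d). (x \<bullet> v i) *\<^sub>R v i) = x" for x
      using orthonormal_expansion[OF S(1-3,5), of x] unfolding vim[symmetric] sum.reindex[OF vinj] by simp
  qed (use orth sva a0 vim S in auto)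
qed

lemma singular_basis_norm:
  fixes A :: "real^'d^'d"
  assumes "\<And>i j. i \<in> {1..CARD('d)} \<Longrightarrow> j \<in> {1..CARD('d)} \<Longrightarrow>
           (A *v v i) \<bullet> (A *v v j) = (if i = j then (singular_value A i)\<^sup>2 else 0)"
    and "I \<subseteq> {1..CARD('d)}"
  shows "(norm (A *v (\<Sum>i\<in>I. c i *\<^sub>R v i)))\<^sup>2 = (\<Sum>i\<in>I. (singular_value A i)\<^sup>2 * (c i)\<^sup>2)"
proof -
  have fin: "finite I" using assms(2) finite_subset by blast
  have "A *v (\<Sum>i\<in>I. c i *\<^sub>R v i) = (\<Sum>i\<in>I. c i *\<^sub>R (A *v v i))"
    by (simp add: linear_sum[OF matrix_vector_mul_linear] matrix_vector_mult_scaleR)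
  then have "(norm (A *v (\<Sum>i\<in>I. c i *\<^sub>R v i)))\<^sup>2 = (\<Sum>i\<in>I. \<Sum>j\<in>I. c i * c j * ((A *v v i) \<bullet> (A *v v j)))"
    by (simp add: inner_sum_left inner_sum_right sum_distrib_left mult.assoc mult.left_commute inner_commute flip: dot_square_norm)
  also have "\<dots> = (\<Sum>i\<in>I. \<Sum>j\<in>I. if i = j then c i * c i * (singular_value A i)\<^sup>2 else 0)"
    using assms by (intro sum.cong refl) (auto simp: subset_iff)
  also have "\<dots> = (\<Sum>i\<in>I. (singular_value A i)\<^sup>2 * (c i)\<^sup>2)"
    using fin by (intro sum.cong refl) (simp add: power2_eq_square)
  finally show ?thesis .
qed

text \<open>One half of the Courant-Fischer principle, attained by the span of the first
  \<open>m\<close> singular vectors; \<open>singular_value_ge\<close> is the other half. Subspaces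
  can be moved by invertible maps, which is how products of matrices are treated below.\<close>

lemma singular_value_subspace:
  fixes A :: "real^'d^'d"
  assumes m: "m \<in> {1..CARD('d)}"
  obtains V where "subspace V" "dim V = m" "\<And>x. x \<in> V \<Longrightarrow> singular_value A m * norm x \<le> norm (A *v x)"
proof -
  obtain v where v: "\<And>i j. i \<in> {1..CARD('d)} \<Longrightarrow> j \<in> {1..CARD('d)} \<Longrightarrow> v i \<bullet> v j = (if i = j then 1 else 0)"
    and Av: "\<And>i j. i \<in> {1..CARD('d)} \<Longrightarrow> j \<in> {1..CARD('d)} \<Longrightarrow>
           (A *v v i) \<bullet> (A *v v j) = (if i = j then (singular_value A i)\<^sup>2 else 0)"
    and mono: "\<And>i j. 1 \<le> i \<Longrightarrow> i \<le> j \<Longrightarrow> j \<le> CARD('d) \<Longrightarrow> singular_value A j \<le> singular_value A i"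
    and nn: "\<And>i. i \<in> {1..CARD('d)} \<Longrightarrow> 0 \<le> singular_value A i"
    by (rule singular_basis[of A]) blast
  let ?S = "v ` {1..m}"
  have inj: "inj_on v {1..m}"
    using v m by (auto simp: inj_on_def) (metis atLeastAtMost_iff le_trans zero_neq_one)
  have on: "pairwise orthogonal ?S" "\<And>x. x \<in> ?S \<Longrightarrow> norm x = 1"
    using v m by (auto simp: pairwise_def orthogonal_def norm_eq_1)
  have ind: "independent ?S" using orthonormal_independent[OF on] .
  have d: "dim (span ?S) = m"
    using dim_span_eq_card_independent[OF ind] inj by (simp add: card_image)
  have "singular_value A m * norm x \<le> norm (A *v x)" if xS: "x \<in> span ?S" for x
  proof -
    obtain c0 where c0: "x = (\<Sum>y\<in>?S. c0 y *\<^sub>R y)"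
      using xS span_finite[of ?S] by (auto simp del: One_nat_def)
    define c where "c i = c0 (v i)" for i
    have x: "x = (\<Sum>i=1..m. c i *\<^sub>R v i)" unfolding c0 c_def by (subst sum.reindex[OF inj]) simp
    have "x \<bullet> x = (\<Sum>i=1..m. \<Sum>j=1..m. c i * c j * (v i \<bullet> v j))"
      unfolding x by (simp add: inner_sum_left inner_sum_right sum_distrib_left mult.assoc mult.left_commute inner_commute)
    also have "\<dots> = (\<Sum>i=1..m. \<Sum>j=1..m. if i = j then c i * c i else 0)"
      using v m by (intro sum.cong refl) auto
    also have "\<dots> = (\<Sum>i=1..m. (c i)\<^sup>2)" by (intro sum.cong refl) (simp add: power2_eq_square)
    finally have nx: "(norm x)\<^sup>2 = (\<Sum>i=1..m. (c i)\<^sup>2)" by (simp add: dot_square_norm)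
    have "(norm (A *v x))\<^sup>2 = (\<Sum>i=1..m. (singular_value A i)\<^sup>2 * (c i)\<^sup>2)"
      unfolding x by (rule singular_basis_norm[OF Av]) (use m in auto)
    also have "\<dots> \<ge> (\<Sum>i=1..m. (singular_value A m)\<^sup>2 * (c i)\<^sup>2)"
      using mono nn m by (intro sum_mono mult_right_mono power_mono) auto
    also have "(\<Sum>i=1..m. (singular_value A m)\<^sup>2 * (c i)\<^sup>2) = (singular_value A m * norm x)\<^sup>2"
      by (simp add: nx power_mult_distrib sum_distrib_left)
    finally show ?thesis using power2_le_imp_le norm_ge_zero by blast
  qed
  then show thesis using that[of "span ?S"] d by simp
qed

text \<open>A dimension count: \<open>V\<close> meets the span of the last
  \<open>CARD('d) - m + 1\<close> singular vectors in a nonzero vector, and on that span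
  \<open>A\<close> stretches by at most its \<open>m\<close>-th singular value.\<close>

lemma singular_value_ge:
  fixes A :: "real^'d^'d"
  assumes m: "m \<in> {1..CARD('d)}" and V: "subspace V" "dim V \<ge> m"
    and le: "\<And>x. x \<in> V \<Longrightarrow> c * norm x \<le> norm (A *v x)"
  shows "c \<le> singular_value A m"
proof -
  obtain v where v: "\<And>i j. i \<in> {1..CARD('d)} \<Longrightarrow> j \<in> {1..CARD('d)} \<Longrightarrow> v i \<bullet> v j = (if i = j then 1 else 0)"
    and Av: "\<And>i j. i \<in> {1..CARD('d)} \<Longrightarrow> j \<in> {1..CARD('d)} \<Longrightarrow>
           (A *v v i) \<bullet> (A *v v j) = (if i = j then (singular_value A i)\<^sup>2 else 0)"
    and mono: "\<And>i j. 1 \<le> i \<Longrightarrow> i \<le> j \<Longrightarrow> j \<le> CARD('d) \<Longrightarrow> singular_value A j \<le> singular_value A i"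
    and nn: "\<And>i. i \<in> {1..CARD('d)} \<Longrightarrow> 0 \<le> singular_value A i"
    by (rule singular_basis[of A]) blast
  let ?I = "{m..CARD('d)}" let ?S = "v ` ?I"
  have inj: "inj_on v ?I"
    using v m by (auto simp: inj_on_def) (metis atLeastAtMost_iff le_trans zero_neq_one)
  have on: "pairwise orthogonal ?S" "\<And>x. x \<in> ?S \<Longrightarrow> norm x = 1"
    using v m by (auto simp: pairwise_def orthogonal_def norm_eq_1)
  have ind: "independent ?S" using orthonormal_independent[OF on] .
  have d: "dim (span ?S) = Suc (CARD('d)) - m"
    using dim_span_eq_card_independent[OF ind] inj by (simp add: card_image)
  have "dim {x + y |x y. x \<in> V \<and> y \<in> span ?S} + dim (V \<inter> span ?S) = dim V + dim (span ?S)"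
    using dim_sums_Int[OF V(1) subspace_span] .
  moreover have "dim {x + y |x y. x \<in> V \<and> y \<in> span ?S} \<le> CARD('d)"
    using dim_subset_UNIV_cart by blast
  ultimately have "dim (V \<inter> span ?S) > 0" using d V m by simp
  then obtain x where xV: "x \<in> V" and xS: "x \<in> span ?S" and x0: "x \<noteq> 0"
    by (metis (no_types, lifting) IntE dim_eq_0 insertI1 less_irrefl subsetI)
  obtain c0 where c0: "x = (\<Sum>y\<in>?S. c0 y *\<^sub>R y)"
    using xS span_finite[of ?S] by (auto simp del: One_nat_def)
  define b where "b i = c0 (v i)" for i
  have x: "x = (\<Sum>i\<in>?I. b i *\<^sub>R v i)" unfolding c0 b_def by (simp add: sum.reindex[OF inj])
  have "x \<bullet> x = (\<Sum>i\<in>?I. \<Sum>j\<in>?I. b i * b j * (v i \<bullet> v j))"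
    unfolding x by (simp add: inner_sum_left inner_sum_right sum_distrib_left mult.assoc mult.left_commute inner_commute)
  also have "\<dots> = (\<Sum>i\<in>?I. \<Sum>j\<in>?I. if i = j then b i * b i else 0)"
    using v m by (intro sum.cong refl) auto
  also have "\<dots> = (\<Sum>i\<in>?I. (b i)\<^sup>2)" by (intro sum.cong refl) (simp add: power2_eq_square)
  finally have nx: "(norm x)\<^sup>2 = (\<Sum>i\<in>?I. (b i)\<^sup>2)" by (simp add: dot_square_norm)
  have "(norm (A *v x))\<^sup>2 = (\<Sum>i\<in>?I. (singular_value A i)\<^sup>2 * (b i)\<^sup>2)"
    unfolding x by (rule singular_basis_norm[OF Av]) (use m in auto)
  also have "\<dots> \<le> (\<Sum>i\<in>?I. (singular_value A m)\<^sup>2 * (b i)\<^sup>2)"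
    using mono nn m by (intro sum_mono mult_right_mono power_mono) auto
  also have "\<dots> = (singular_value A m * norm x)\<^sup>2"
    by (simp add: nx power_mult_distrib sum_distrib_left)
  finally have "norm (A *v x) \<le> singular_value A m * norm x"
    using power2_le_imp_le nn[OF m] by (metis mult_nonneg_nonneg norm_ge_zero)
  with le[OF xV] have "c * norm x \<le> singular_value A m * norm x" by simp
  then show ?thesis using x0 by simp
qed

lemma singular_value_lower:
  fixes A :: "real^'d^'d"
  assumes "m \<in> {1..CARD('d)}" and "\<And>x. c * norm x \<le> norm (A *v x)"
  shows "c \<le> singular_value A m"
  using assms by (intro singular_value_ge[of m UNIV]) (auto simp: dim_UNIV)

lemma singular_value_nonneg: "m \<in> {1..CARD('d)} \<Longrightarrow> 0 \<le> singular_value (A::real^'d^'d) m"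
  by (rule singular_value_lower) auto

lemma singular_value_upper:
  fixes A :: "real^'d^'d"
  assumes m: "m \<in> {1..CARD('d)}" and le: "\<And>x. norm (A *v x) \<le> c * norm x"
  shows "singular_value A m \<le> c"
proof -
  obtain V where V: "subspace V" "dim V = m" "\<And>x. x \<in> V \<Longrightarrow> singular_value A m * norm x \<le> norm (A *v x)"
    using singular_value_subspace[OF m] by blast
  have "dim V \<noteq> 0" using V m by auto
  then obtain x where "x \<in> V" "x \<noteq> 0" by (metis dim_eq_0 insertI1 subsetI)
  then show ?thesis using V(3)[of x] le[of x] by (meson mult_right_le_imp_le order_trans zero_less_norm_iff)
qed

lemma singular_value_antimono:
  fixes A :: "real^'d^'d"
  assumes "1 \<le> i" "i \<le> j" "j \<le> CARD('d)"
  shows "singular_value A j \<le> singular_value A i"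
  by (rule singular_basis[of A]) (use assms in blast)

text \<open>An optimal subspace for \<open>A ** B\<close> is carried by the invertible
  \<open>B\<close> to one of the same dimension, on which \<open>A\<close> stretches at least by the
  quotient. For \<open>singular_value_mult_lower\<close> an optimal subspace of \<open>A\<close> is
  pulled back by the inverse of \<open>B\<close>.\<close>

lemma singular_value_mult_upper:
  fixes A B :: "real^'d^'d"
  assumes m: "m \<in> {1..CARD('d)}" and b: "0 < b" "\<And>x. norm (B *v x) \<le> b * norm x"
    and inv: "invertible B"
  shows "singular_value (A ** B) m \<le> singular_value A m * b"
proof -
  obtain V where V: "subspace V" "dim V = m"
      "\<And>x. x \<in> V \<Longrightarrow> singular_value (A ** B) m * norm x \<le> norm ((A ** B) *v x)"
    using singular_value_subspace[OF m] by blast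
  let ?W = "(*v) B ` V"
  have inj: "inj ((*v) B)" using inv by (simp add: invertible_left_inverse matrix_left_invertible_injective)
  have "dim ?W = m" using V(2) dim_image_eq[OF matrix_vector_mul_linear, of B V] inj by (simp add: inj_on_subset)
  moreover have "subspace ?W" using V(1) by (intro linear_subspace_image) auto
  moreover have "singular_value (A ** B) m / b * norm y \<le> norm (A *v y)" if y: "y \<in> ?W" for y
  proof -
    obtain x where x: "x \<in> V" "y = B *v x" using y by blast
    have "singular_value (A ** B) m * norm y \<le> singular_value (A ** B) m * (b * norm x)"
      using b singular_value_nonneg[OF m] x by (intro mult_left_mono) auto
    also have "\<dots> \<le> b * norm (A *v y)" using V(3)[OF x(1)] b x
      by (simp add: matrix_vector_mul_assoc mult.left_commute)
    finally show ?thesis using b by (simp add: field_simps)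
  qed
  ultimately have "singular_value (A ** B) m / b \<le> singular_value A m"
    by (intro singular_value_ge[OF m]) auto
  then show ?thesis using b by (simp add: field_simps)
qed

lemma singular_value_mult_lower:
  fixes A B :: "real^'d^'d"
  assumes m: "m \<in> {1..CARD('d)}" and c: "\<And>x. c * norm x \<le> norm (B *v x)" "c > 0"
    and inv: "invertible B"
  shows "singular_value A m * c \<le> singular_value (A ** B) m"
proof -
  obtain V where V: "subspace V" "dim V = m" "\<And>x. x \<in> V \<Longrightarrow> singular_value A m * norm x \<le> norm (A *v x)"
    using singular_value_subspace[OF m] by blast
  obtain B' where B': "B ** B' = mat 1" "B' ** B = mat 1" using inv by (auto simp: invertible_def)
  let ?W = "(*v) B' ` V"
  have "invertible B'" using B' by (auto simp: invertible_def)
  then have inj: "inj ((*v) B')" by (simp add: invertible_left_inverse matrix_left_invertible_injective)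
  have "dim ?W = m" using V(2) dim_image_eq[OF matrix_vector_mul_linear, of B' V] inj by (simp add: inj_on_subset)
  moreover have "subspace ?W" using V(1) by (intro linear_subspace_image) auto
  moreover have "singular_value A m * c * norm y \<le> norm ((A ** B) *v y)" if y: "y \<in> ?W" for y
  proof -
    obtain x where x: "x \<in> V" "y = B' *v x" using y by blast
    have By: "B *v y = x" using B' x by (simp add: matrix_vector_mul_assoc)
    have "singular_value A m * (c * norm y) \<le> singular_value A m * norm x"
      using c(1)[of y] singular_value_nonneg[OF m] By by (intro mult_left_mono) auto
    also have "\<dots> \<le> norm (A *v (B *v y))" using V(3)[OF x(1)] By by simp
    finally show ?thesis by (simp add: matrix_vector_mul_assoc mult.assoc)
  qed
  ultimately show ?thesis by (intro singular_value_ge[OF m]) auto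
qed

lemma singular_value_pos:
  fixes A :: "real^'d^'d"
  assumes "invertible A" "m \<in> {1..CARD('d)}"
  shows "0 < singular_value A m"
proof -
  have "inj ((*v) A)" using assms(1) by (simp add: invertible_left_inverse matrix_left_invertible_injective)
  then obtain B where "B > 0" "\<And>x. B * norm x \<le> norm (A *v x)"
    using linear_inj_bounded_below_pos[OF matrix_vector_mul_linear, of A] by blast
  then show ?thesis using singular_value_lower[OF assms(2), of B A] by simp
qed

subsection \<open>Covering numbers and volumes\<close>

text \<open>Every coordinate is rounded down to a grid of step \<open>e i\<close>. The directions
  \<open>u i\<close> are arbitrary: \<open>ellipsoid_cover\<close> takes the images of the singular
  basis, \<open>ellipsoid_volume\<close> the basis itself.\<close>

lemma parallelepiped_cover:
  fixes u :: "'i \<Rightarrow> 'a::real_normed_vector"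
  assumes I: "finite I" and e: "\<And>i. i \<in> I \<Longrightarrow> 0 < e i" and l: "\<And>i. i \<in> I \<Longrightarrow> 0 \<le> l i"
  shows "\<exists>Z. finite Z \<and> real (card Z) \<le> (\<Prod>i\<in>I. l i / e i + 1) \<and>
    (\<forall>t. (\<forall>i\<in>I. c i \<le> t i \<and> t i \<le> c i + l i) \<longrightarrow>
        (\<exists>z\<in>Z. norm ((\<Sum>i\<in>I. t i *\<^sub>R u i) - z) \<le> (\<Sum>i\<in>I. e i * norm (u i))))"
proof -
  define F where "F = (\<Pi>\<^sub>E i\<in>I. {0..nat \<lfloor>l i / e i\<rfloor>})"
  define Z where "Z = (\<lambda>k. \<Sum>i\<in>I. (c i + real (k i) * e i) *\<^sub>R u i) ` F"
  have finF: "finite F" unfolding F_def using I by (intro finite_PiE) auto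
  have "real (card Z) \<le> real (card F)" unfolding Z_def using finF by (simp add: card_image_le)
  also have "\<dots> = (\<Prod>i\<in>I. real (nat \<lfloor>l i / e i\<rfloor> + 1))"
    unfolding F_def using I by (simp add: card_PiE)
  also have "\<dots> \<le> (\<Prod>i\<in>I. l i / e i + 1)"
    using e l by (intro prod_mono) (auto intro!: of_nat_floor divide_nonneg_pos)
  finally have card: "real (card Z) \<le> (\<Prod>i\<in>I. l i / e i + 1)" .
  have "\<exists>z\<in>Z. norm ((\<Sum>i\<in>I. t i *\<^sub>R u i) - z) \<le> (\<Sum>i\<in>I. e i * norm (u i))"
    if t: "\<And>i. i \<in> I \<Longrightarrow> c i \<le> t i \<and> t i \<le> c i + l i" for t
  proof -
    define k where "k = restrict (\<lambda>i. nat \<lfloor>(t i - c i) / e i\<rfloor>) I"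
    have k: "real (k i) * e i \<le> t i - c i" "t i - c i \<le> real (k i) * e i + e i" if "i \<in> I" for i
    proof -
      have "0 \<le> (t i - c i) / e i" using t[OF that] e[OF that] by simp
      then have "real (k i) = of_int \<lfloor>(t i - c i) / e i\<rfloor>" using that by (simp add: k_def)
      then have "real (k i) \<le> (t i - c i) / e i" "(t i - c i) / e i \<le> real (k i) + 1" by linarith+
      then show "real (k i) * e i \<le> t i - c i" "t i - c i \<le> real (k i) * e i + e i"
        using e[OF that] by (auto simp: field_simps)
    qed
    have kF: "k \<in> F"
    proof -
      have "nat \<lfloor>(t i - c i) / e i\<rfloor> \<le> nat \<lfloor>l i / e i\<rfloor>" if "i \<in> I" for i
        using t[OF that] e[OF that] by (intro nat_mono floor_mono divide_right_mono) auto
      then show ?thesis by (simp add: F_def k_def PiE_iff)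
    qed
    let ?z = "\<Sum>i\<in>I. (c i + real (k i) * e i) *\<^sub>R u i"
    have "(\<Sum>i\<in>I. t i *\<^sub>R u i) - ?z = (\<Sum>i\<in>I. (t i - c i - real (k i) * e i) *\<^sub>R u i)"
      by (simp add: sum_subtractf[symmetric] algebra_simps)
    also have "norm \<dots> \<le> (\<Sum>i\<in>I. \<bar>t i - c i - real (k i) * e i\<bar> * norm (u i))"
      by (rule order_trans[OF norm_sum]) simp
    also have "\<dots> \<le> (\<Sum>i\<in>I. e i * norm (u i))"
      using k by (intro sum_mono mult_right_mono) (auto simp: abs_le_iff, smt (verit) e)
    finally show ?thesis using kF unfolding Z_def by blast
  qed
  then show ?thesis using card finF unfolding Z_def by (intro exI[of _ Z]) (auto simp: Z_def)
qed

lemma mesh_count_ball: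
  fixes z :: "real^'d"
  assumes r: "0 < r" and "0 \<le> \<rho>"
  shows "finite {Q \<in> mesh r. Q \<inter> cball z \<rho> \<noteq> {}}"
    and "real (card {Q \<in> mesh r. Q \<inter> cball z \<rho> \<noteq> {}}) \<le> (2 * \<rho> / r + 2) ^ CARD('d)"
proof -
  define lo where "lo i = \<lfloor>(z $ i - \<rho>) / r\<rfloor>" for i :: 'd
  define hi where "hi i = \<lfloor>(z $ i + \<rho>) / r\<rfloor>" for i :: 'd
  define F where "F = (\<Pi>\<^sub>E i\<in>(UNIV::'d set). {lo i..hi i})"
  have finF: "finite F" unfolding F_def by (intro finite_PiE) auto
  have sub: "{Q \<in> mesh r. Q \<inter> cball z \<rho> \<noteq> {}} \<subseteq> (\<lambda>f. mesh_cube r (vec_lambda f)) ` F"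
  proof
    fix Q assume "Q \<in> {Q \<in> mesh r. Q \<inter> cball z \<rho> \<noteq> {}}"
    then obtain j where j: "Q = mesh_cube r j" and "mesh_cube r j \<inter> cball z \<rho> \<noteq> {}"
      by (auto simp: mesh_def)
    then obtain x where x: "x \<in> mesh_cube r j" "dist z x \<le> \<rho>" by auto
    have "lo i \<le> j $ i \<and> j $ i \<le> hi i" for i
    proof -
      have "\<bar>(x - z) $ i\<bar> \<le> \<rho>" using component_le_norm_cart[of "x - z" i] x(2) by (simp add: dist_norm norm_minus_commute)
      then have 1: "z $ i - \<rho> \<le> x $ i" "x $ i \<le> z $ i + \<rho>" by auto
      have 2: "of_int (j $ i) * r \<le> x $ i" "x $ i < (of_int (j $ i) + 1) * r" using x(1) by (auto simp: mesh_cube_def)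
      have "(z $ i - \<rho>) / r < of_int (j $ i) + 1" "of_int (j $ i) \<le> (z $ i + \<rho>) / r"
        using 1 2 r by (auto simp: field_simps)
      then show ?thesis unfolding lo_def hi_def by linarith
    qed
    then have "vec_nth j \<in> F" by (auto simp: F_def)
    then show "Q \<in> (\<lambda>f. mesh_cube r (vec_lambda f)) ` F"
      using j by (intro image_eqI[of _ _ "vec_nth j"]) auto
  qed
  show "finite {Q \<in> mesh r. Q \<inter> cball z \<rho> \<noteq> {}}" using sub finF by (meson finite_surj)
  have "real (card {Q \<in> mesh r. Q \<inter> cball z \<rho> \<noteq> {}}) \<le> real (card F)"
    using sub finF by (simp add: surj_card_le)
  also have "\<dots> = (\<Prod>i\<in>(UNIV::'d set). real (nat (hi i - lo i + 1)))"
    unfolding F_def by (simp add: card_PiE)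
  also have "\<dots> \<le> (\<Prod>i\<in>(UNIV::'d set). 2 * \<rho> / r + 2)"
  proof (intro prod_mono conjI)
    fix i :: 'd
    have "(z $ i + \<rho>) / r = (z $ i - \<rho>) / r + 2 * \<rho> / r"
      by (simp add: add_divide_distrib[symmetric])
    then have "of_int (hi i) \<le> of_int (lo i) + 1 + 2 * \<rho> / r" unfolding lo_def hi_def by linarith
    moreover have "lo i \<le> hi i" unfolding lo_def hi_def using assms
      by (intro floor_mono divide_right_mono) auto
    ultimately show "real (nat (hi i - lo i + 1)) \<le> 2 * \<rho> / r + 2" by simp
  qed simp
  finally show "real (card {Q \<in> mesh r. Q \<inter> cball z \<rho> \<noteq> {}}) \<le> (2 * \<rho> / r + 2) ^ CARD('d)" by simp
qed

lemma emeasure_cball_le: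
  fixes z :: "real^'d"
  assumes "0 \<le> \<rho>"
  shows "emeasure lborel (cball z \<rho>) \<le> ennreal ((2 * \<rho>) ^ CARD('d))"
proof -
  let ?o = "\<chi> i. \<rho> :: real^'d"
  have "cball z \<rho> \<subseteq> cbox (z - ?o) (z + ?o)"
  proof
    fix x assume x: "x \<in> cball z \<rho>"
    have "\<bar>(x - z) $ i\<bar> \<le> \<rho>" for i
      using component_le_norm_cart[of "x - z" i] x by (simp add: dist_norm norm_minus_commute)
    then show "x \<in> cbox (z - ?o) (z + ?o)"
      by (simp add: mem_box_cart abs_le_iff) (metis add.commute diff_le_eq minus_diff_eq)
  qed
  then have "emeasure lborel (cball z \<rho>) \<le> emeasure lborel (cbox (z - ?o) (z + ?o))"
    by (intro emeasure_mono) auto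
  also have "\<dots> = ennreal (\<Prod>b\<in>Basis. ((z + ?o) - (z - ?o)) \<bullet> b)"
    using assms by (subst emeasure_lborel_cbox) (auto simp: Basis_vec_def inner_axis inner_diff_left inner_add_left)
  also have "(\<Prod>b\<in>Basis. ((z + ?o) - (z - ?o)) \<bullet> b) = (\<Prod>b\<in>(Basis::(real^'d) set). 2 * \<rho>)"
    by (intro prod.cong refl) (auto simp: Basis_vec_def inner_axis inner_diff_left inner_add_left)
  finally show ?thesis by simp
qed

text \<open>Up to constants depending on the dimension, the volume of the set of points of the unit
  ball whose image under \<open>A\<close> has norm at most \<open>r\<close>.\<close>

definition sv_min :: "real \<Rightarrow> real^'d^'d \<Rightarrow> real" where
  "sv_min r A = (\<Prod>i=1..CARD('d). min 1 (r / singular_value A i))"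

text \<open>Up to constants depending on the dimension, the number of balls of radius
  \<open>r\<close> needed to cover the image of the unit ball under \<open>A\<close>.\<close>

definition sv_max :: "real \<Rightarrow> real^'d^'d \<Rightarrow> real" where
  "sv_max r A = (\<Prod>i=1..CARD('d). max 1 (singular_value A i / r))"

lemma sv_min_max:
  fixes A :: "real^'d^'d"
  assumes "invertible A" "0 < r"
  shows "sv_min r A * sv_max r A = 1"
proof -
  have "sv_min r A * sv_max r A = (\<Prod>i=1..CARD('d). min 1 (r / singular_value A i) * max 1 (singular_value A i / r))"
    by (simp add: sv_min_def sv_max_def prod.distrib)
  also have "\<dots> = (\<Prod>i=1..CARD('d). 1)"
    using singular_value_pos[OF assms(1)] assms(2) by (intro prod.cong refl) (auto simp: min_def max_def field_simps)
  finally show ?thesis by simp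
qed

lemma sv_max_ge_1: "1 \<le> sv_max r A"
  unfolding sv_max_def by (intro prod_ge_1) auto

lemma sv_min_pos:
  fixes A :: "real^'d^'d"
  assumes "invertible A" "0 < r"
  shows "0 < sv_min r A"
  unfolding sv_min_def using singular_value_pos[OF assms(1)] assms(2) by (intro prod_pos) auto

lemma ellipsoid_cover:
  fixes A :: "real^'d^'d" and R r :: real
  assumes inv: "invertible A" and R: "0 < R" and r: "0 < r"
  obtains Z where "finite Z" "real (card Z) \<le> (2 * R * CARD('d) + 1) ^ CARD('d) * sv_max r A"
    "(*v) A ` cball 0 R \<subseteq> (\<Union>z\<in>Z. cball z r)"
proof -
  let ?n = "CARD('d)" and ?I = "{1..CARD('d)}"
  obtain v where v: "\<And>i j. i \<in> ?I \<Longrightarrow> j \<in> ?I \<Longrightarrow> v i \<bullet> v j = (if i = j then 1 else 0)"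
    and Av: "\<And>i j. i \<in> ?I \<Longrightarrow> j \<in> ?I \<Longrightarrow> (A *v v i) \<bullet> (A *v v j) = (if i = j then (singular_value A i)\<^sup>2 else 0)"
    and ex: "\<And>x. (\<Sum>i=1..?n. (x \<bullet> v i) *\<^sub>R v i) = x"
    by (rule singular_basis[of A]) blast
  have pos: "0 < singular_value A i" if "i \<in> ?I" for i using singular_value_pos[OF inv that] .
  have nAv: "norm (A *v v i) = singular_value A i" if "i \<in> ?I" for i
    using Av[OF that that] pos[OF that] by (simp add: norm_eq_sqrt_inner)
  \<comment> \<open>With this step each coordinate contributes \<open>r / CARD('d)\<close> to the
    distance, \<open>r\<close> in total.\<close>
  define e where "e i = r / (?n * singular_value A i)" for i
  have e: "0 < e i" if "i \<in> ?I" for i using pos[OF that] r by (simp add: e_def)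
  have R2: "0 \<le> 2 * R" if "i \<in> ?I" for i using R by simp
  obtain Z where Z: "finite Z" "real (card Z) \<le> (\<Prod>i\<in>?I. 2 * R / e i + 1)"
    and cov: "\<And>t. (\<forall>i\<in>?I. - R \<le> t i \<and> t i \<le> - R + 2 * R) \<Longrightarrow>
        \<exists>z\<in>Z. norm ((\<Sum>i\<in>?I. t i *\<^sub>R (A *v v i)) - z) \<le> (\<Sum>i\<in>?I. e i * norm (A *v v i))"
    using parallelepiped_cover[of ?I e "\<lambda>_. 2 * R" "\<lambda>_. - R" "\<lambda>i. A *v v i"] e R2 by blast
  have "(\<Prod>i\<in>?I. 2 * R / e i + 1) \<le> (\<Prod>i\<in>?I. (2 * R * ?n + 1) * max 1 (singular_value A i / r))"
  proof (intro prod_mono conjI)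
    fix i assume i: "i \<in> ?I"
    show "0 \<le> 2 * R / e i + 1" using e[OF i] R by (intro add_nonneg_nonneg divide_nonneg_pos) auto
    have "2 * R / e i + 1 = 2 * R * ?n * (singular_value A i / r) + 1" by (simp add: e_def)
    also have "\<dots> \<le> 2 * R * ?n * max 1 (singular_value A i / r) + max 1 (singular_value A i / r)"
      using R by (intro add_mono mult_left_mono) auto
    finally show "2 * R / e i + 1 \<le> (2 * R * ?n + 1) * max 1 (singular_value A i / r)" by (simp add: algebra_simps)
  qed
  also have "\<dots> = (2 * R * ?n + 1) ^ ?n * sv_max r A" by (simp add: prod.distrib sv_max_def)
  finally have card: "real (card Z) \<le> (2 * R * ?n + 1) ^ ?n * sv_max r A" using Z(2) by simp
  have se: "(\<Sum>i\<in>?I. e i * norm (A *v v i)) = r"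
  proof -
    have "(\<Sum>i\<in>?I. e i * norm (A *v v i)) = (\<Sum>i\<in>?I. r / ?n)"
      using nAv pos by (intro sum.cong refl) (force simp: e_def)
    then show ?thesis by simp
  qed
  have "A *v x \<in> (\<Union>z\<in>Z. cball z r)" if x: "x \<in> cball 0 R" for x
  proof -
    have "- R \<le> x \<bullet> v i \<and> x \<bullet> v i \<le> - R + 2 * R" if "i \<in> ?I" for i
    proof -
      have "\<bar>x \<bullet> v i\<bar> \<le> norm x * 1"
        using Cauchy_Schwarz_ineq2[of x "v i"] v[OF that that] by (simp add: norm_eq_1[THEN iffD2])
      then show ?thesis using x by (simp add: abs_le_iff)
    qed
    then have "\<exists>z\<in>Z. norm ((\<Sum>i\<in>?I. (x \<bullet> v i) *\<^sub>R (A *v v i)) - z) \<le> r"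
      using cov[of "\<lambda>i. x \<bullet> v i"] unfolding se by blast
    moreover have "(\<Sum>i\<in>?I. (x \<bullet> v i) *\<^sub>R (A *v v i)) = A *v x"
      by (subst (2) ex[of x, symmetric]) (simp add: linear_sum[OF matrix_vector_mul_linear] matrix_vector_mult_scaleR)
    ultimately show ?thesis by (auto simp: dist_norm norm_minus_commute)
  qed
  then show thesis using that[of Z] Z(1) card by blast
qed

text \<open>In the singular basis the set lies in a box with sides \<open>l i\<close>. Instead of
  computing the measure of a rotated box, the box is covered by balls of radius comparable to its
  shortest side, and their volumes are added.\<close>

lemma ellipsoid_volume:
  fixes A :: "real^'d^'d" and R r :: real
  assumes inv: "invertible A" and R: "1 \<le> R" and r: "0 < r"
  shows "emeasure lborel {x \<in> cball 0 R. norm (A *v x - z) \<le> r} \<le> ennreal ((8 * CARD('d) * R) ^ CARD('d) * sv_min r A)"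
proof -
  let ?n = "CARD('d)" and ?I = "{1..CARD('d)}"
  let ?S = "{x \<in> cball 0 R. norm (A *v x - z) \<le> r}"
  obtain v where v: "\<And>i j. i \<in> ?I \<Longrightarrow> j \<in> ?I \<Longrightarrow> v i \<bullet> v j = (if i = j then 1 else 0)"
    and Av: "\<And>i j. i \<in> ?I \<Longrightarrow> j \<in> ?I \<Longrightarrow> (A *v v i) \<bullet> (A *v v j) = (if i = j then (singular_value A i)\<^sup>2 else 0)"
    and ex: "\<And>x. (\<Sum>i=1..?n. (x \<bullet> v i) *\<^sub>R v i) = x"
    by (rule singular_basis[of A]) blast
  have pos: "0 < singular_value A i" if "i \<in> ?I" for i using singular_value_pos[OF inv that] .
  have nv: "norm (v i) = 1" if "i \<in> ?I" for i using v[OF that that] by (simp add: norm_eq_1)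
  have nAv: "norm (A *v v i) = singular_value A i" if "i \<in> ?I" for i
    using Av[OF that that] pos[OF that] by (simp add: norm_eq_sqrt_inner)
  define l where "l i = 2 * R * min 1 (r / singular_value A i)" for i
  \<comment> \<open>Lower ends of the coordinate intervals. The inner product
    \<open>(A *v x) \<bullet> (A *v v i)\<close> is the coordinate times the squared singular value,
    which localises the coordinate up to \<open>r / singular_value A i\<close>. Where this exceeds
    1, only \<open>norm x \<le> R\<close> is used.\<close>
  define c where "c i = (if r \<le> singular_value A i then (z \<bullet> (A *v v i)) / (singular_value A i)\<^sup>2 - r / singular_value A i else - R)" for i
  have l: "0 < l i" if "i \<in> ?I" for i using pos[OF that] r R by (simp add: l_def)
  \<comment> \<open>The shortest side as grid step makes \<open>l i / \<epsilon> + 1\<close> at most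
    twice \<open>l i / \<epsilon>\<close>.\<close>
  define \<epsilon> where "\<epsilon> = Min (l ` ?I)"
  have ne: "?I \<noteq> {}" by simp
  have \<epsilon>: "0 < \<epsilon>" "\<And>i. i \<in> ?I \<Longrightarrow> \<epsilon> \<le> l i" using l ne by (auto simp: \<epsilon>_def simp del: atLeastatMost_empty_iff2)
  have \<epsilon>0: "0 < \<epsilon>" if "i \<in> ?I" for i using \<epsilon>(1) .
  obtain Z where Z: "finite Z" "real (card Z) \<le> (\<Prod>i\<in>?I. l i / \<epsilon> + 1)"
    and cov: "\<And>t. (\<forall>i\<in>?I. c i \<le> t i \<and> t i \<le> c i + l i) \<Longrightarrow>
        \<exists>y\<in>Z. norm ((\<Sum>i\<in>?I. t i *\<^sub>R v i) - y) \<le> (\<Sum>i\<in>?I. \<epsilon> * norm (v i))"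
    using parallelepiped_cover[of ?I "\<lambda>_. \<epsilon>" l c v] \<epsilon>0 less_imp_le[OF l] by blast
  have se: "(\<Sum>i\<in>?I. \<epsilon> * norm (v i)) = ?n * \<epsilon>" using nv by simp
  have int: "c i \<le> x \<bullet> v i \<and> x \<bullet> v i \<le> c i + l i" if x: "x \<in> ?S" and i: "i \<in> ?I" for x i
  proof (cases "r \<le> singular_value A i")
    case False
    have "\<bar>x \<bullet> v i\<bar> \<le> R" using Cauchy_Schwarz_ineq2[of x "v i"] nv[OF i] x by simp
    then show ?thesis using False pos[OF i] by (simp add: c_def l_def min_def abs_le_iff field_simps)
  next
    case True
    let ?s = "singular_value A i"
    have "(A *v x) \<bullet> (A *v v i) = (x \<bullet> v i) * ?s\<^sup>2"
    proof -
      have "(A *v x) = (\<Sum>j\<in>?I. (x \<bullet> v j) *\<^sub>R (A *v v j))"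
        by (subst ex[of x, symmetric]) (simp only: linear_sum[OF matrix_vector_mul_linear] matrix_vector_mult_scaleR)
      then have "(A *v x) \<bullet> (A *v v i) = (\<Sum>j\<in>?I. (x \<bullet> v j) * ((A *v v j) \<bullet> (A *v v i)))"
        by (simp add: inner_sum_left)
      also have "\<dots> = (\<Sum>j\<in>?I. if j = i then (x \<bullet> v i) * ?s\<^sup>2 else 0)"
        using Av i by (intro sum.cong refl) auto
      finally show ?thesis using i by simp
    qed
    then have "\<bar>(x \<bullet> v i) * ?s\<^sup>2 - z \<bullet> (A *v v i)\<bar> \<le> norm (A *v x - z) * ?s"
      using Cauchy_Schwarz_ineq2[of "A *v x - z" "A *v v i"] nAv[OF i] by (simp add: inner_diff_left)
    also have "\<dots> \<le> r * ?s" using x pos[OF i] by (intro mult_right_mono) auto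
    finally have a: "\<bar>(x \<bullet> v i) * ?s\<^sup>2 - z \<bullet> (A *v v i)\<bar> \<le> r * ?s" .
    have "(x \<bullet> v i) - (z \<bullet> (A *v v i)) / ?s\<^sup>2 = ((x \<bullet> v i) * ?s\<^sup>2 - z \<bullet> (A *v v i)) / ?s\<^sup>2"
      using pos[OF i] by (simp add: field_simps)
    then have "\<bar>(x \<bullet> v i) - (z \<bullet> (A *v v i)) / ?s\<^sup>2\<bar> \<le> r * ?s / ?s\<^sup>2"
      using a by (simp add: divide_right_mono)
    also have "r * ?s / ?s\<^sup>2 = r / ?s" using pos[OF i] by (simp add: power2_eq_square)
    finally have b: "\<bar>(x \<bullet> v i) - (z \<bullet> (A *v v i)) / ?s\<^sup>2\<bar> \<le> r / ?s" .
    have "l i = 2 * R * (r / ?s)" using True pos[OF i] by (simp add: l_def min_def)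
    moreover have "2 * R * (r / ?s) \<ge> 2 * 1 * (r / ?s)" using R r pos[OF i] by (intro mult_right_mono) auto
    ultimately show ?thesis using b True unfolding c_def by (auto simp: abs_le_iff)
  qed
  have "?S \<subseteq> (\<Union>y\<in>Z. cball y (?n * \<epsilon>))"
  proof
    fix x assume x: "x \<in> ?S"
    have "\<exists>y\<in>Z. norm ((\<Sum>i\<in>?I. (x \<bullet> v i) *\<^sub>R v i) - y) \<le> ?n * \<epsilon>"
      using cov[of "\<lambda>i. x \<bullet> v i"] int[OF x] unfolding se by blast
    then show "x \<in> (\<Union>y\<in>Z. cball y (?n * \<epsilon>))" unfolding ex by (auto simp: dist_norm norm_minus_commute)
  qed
  then have "emeasure lborel ?S \<le> emeasure lborel (\<Union>y\<in>Z. cball y (?n * \<epsilon>))"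
    using Z(1) by (intro emeasure_mono) (auto intro!: sets.finite_UN)
  also have "\<dots> \<le> (\<Sum>y\<in>Z. emeasure lborel (cball y (?n * \<epsilon>)))"
    using Z(1) by (intro emeasure_subadditive_finite) auto
  also have "\<dots> \<le> (\<Sum>y\<in>Z. ennreal ((2 * (?n * \<epsilon>)) ^ ?n))"
    using \<epsilon>(1) by (intro sum_mono emeasure_cball_le) auto
  also have "\<dots> = ennreal (real (card Z) * (2 * (?n * \<epsilon>)) ^ ?n)"
    using \<epsilon>(1) by (simp add: ennreal_mult' ennreal_of_nat_eq_real_of_nat)
  also have "real (card Z) * (2 * (?n * \<epsilon>)) ^ ?n \<le> (\<Prod>i\<in>?I. l i / \<epsilon> + 1) * (2 * (?n * \<epsilon>)) ^ ?n"
    using Z(2) \<epsilon>(1) by (intro mult_right_mono) auto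
  also have "\<dots> = (\<Prod>i\<in>?I. (l i / \<epsilon> + 1) * (2 * (?n * \<epsilon>)))" by (simp only: prod.distrib) (simp add: power_mult_distrib)
  also have "\<dots> \<le> (\<Prod>i\<in>?I. (8 * ?n * R) * min 1 (r / singular_value A i))"
  proof (intro prod_mono conjI)
    fix i assume i: "i \<in> ?I"
    show "0 \<le> (l i / \<epsilon> + 1) * (2 * (?n * \<epsilon>))" using l[OF i] \<epsilon>(1) by (intro mult_nonneg_nonneg add_nonneg_nonneg) auto
    have "(l i / \<epsilon> + 1) * (2 * (?n * \<epsilon>)) = 2 * ?n * (l i + \<epsilon>)" using \<epsilon>(1) by (simp add: field_simps)
    also have "\<dots> \<le> 2 * ?n * (l i + l i)" using \<epsilon>(2)[OF i] by (intro mult_left_mono) auto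
    finally show "(l i / \<epsilon> + 1) * (2 * (?n * \<epsilon>)) \<le> (8 * ?n * R) * min 1 (r / singular_value A i)"
      by (simp add: l_def algebra_simps)
  qed
  also have "\<dots> = (8 * ?n * R) ^ ?n * sv_min r A" by (simp only: prod.distrib) (simp add: sv_min_def power_mult_distrib)
  finally show ?thesis by (simp add: ennreal_leI)
qed

text \<open>Cover the image of the unit ball under \<open>B\<close> by balls of radius
  \<open>\<rho>\<close>, and the image of each under \<open>A\<close> by balls of radius
  \<open>r * \<rho>\<close>. The preimages cover the unit ball, and each has volume at most a
  constant times \<open>sv_min (r * \<rho>) (A ** B)\<close>. Comparison with the volume of the unit
  ball and \<open>sv_min_max\<close> give the bound without exterior powers.\<close>

lemma sv_max_mult:
  "\<exists>K\<ge>1. \<forall>(A::real^'d^'d) B r \<rho>. invertible A \<longrightarrow> invertible B \<longrightarrow> 0 < r \<longrightarrow> 0 < \<rho> \<longrightarrow>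
    sv_max (r * \<rho>) (A ** B) \<le> K * (sv_max r A * sv_max \<rho> B)"
proof -
  let ?n = "CARD('d)"
  define C where "C = (8 * real ?n * 1) ^ ?n"
  define D where "D = (2 * 1 * real ?n + 1) ^ ?n"
  define V where "V = measure lborel (cball (0::real^'d) 1)"
  have V: "V > 0" unfolding V_def using content_cball_pos[of 1 "0::real^'d"] by simp
  have C: "C > 0" by (simp add: C_def)
  have D: "D > 0" unfolding D_def by (intro zero_less_power add_nonneg_pos) auto
  define K where "K = max 1 (D * D * C / V)"
  have "sv_max (r * \<rho>) (A ** B) \<le> K * (sv_max r A * sv_max \<rho> B)"
    if A: "invertible A" and B: "invertible B" and r: "0 < r" and \<rho>: "0 < \<rho>" for A B :: "real^'d^'d" and r \<rho>
  proof -
    have AB: "invertible (A ** B)" using A B by (rule invertible_mult)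
    obtain ZA where ZA: "finite ZA" "real (card ZA) \<le> D * sv_max r A" "(*v) A ` cball 0 1 \<subseteq> (\<Union>z\<in>ZA. cball z r)"
      by (rule ellipsoid_cover[OF A zero_less_one r, folded D_def]) (rule that)
    obtain ZB where ZB: "finite ZB" "real (card ZB) \<le> D * sv_max \<rho> B" "(*v) B ` cball 0 1 \<subseteq> (\<Union>z\<in>ZB. cball z \<rho>)"
      by (rule ellipsoid_cover[OF B zero_less_one \<rho>, folded D_def]) (rule that)
    let ?S = "\<lambda>(y,z). {x \<in> cball 0 1. norm ((A ** B) *v x - (A *v z + \<rho> *\<^sub>R y)) \<le> r * \<rho>}"
    have sub: "cball 0 1 \<subseteq> (\<Union>p\<in>ZA \<times> ZB. ?S p)"
    proof
      fix x :: "real^'d" assume x: "x \<in> cball 0 1"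
      then have "B *v x \<in> (\<Union>z\<in>ZB. cball z \<rho>)" using ZB(3) by blast
      then obtain z where z: "z \<in> ZB" "norm (B *v x - z) \<le> \<rho>"
        by (auto simp: dist_norm norm_minus_commute)
      let ?y = "(1/\<rho>) *\<^sub>R (B *v x - z)"
      have "norm ?y = norm (B *v x - z) / \<rho>" using \<rho> by (simp only: norm_scaleR) simp
      then have "?y \<in> cball 0 1" using z \<rho> by (simp only: mem_cball_0) simp
      then have "A *v ?y \<in> (\<Union>z\<in>ZA. cball z r)" using ZA(3) by blast
      then obtain y where y: "y \<in> ZA" "norm (A *v ?y - y) \<le> r"
        by (auto simp: dist_norm norm_minus_commute simp del: matrix_vector_mult_scaleR)
      have "(A ** B) *v x - (A *v z + \<rho> *\<^sub>R y) = \<rho> *\<^sub>R (A *v ?y - y)"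
        using \<rho> by (simp add: matrix_vector_mult_scaleR scaleR_diff_right matrix_vector_mult_diff_distrib flip: matrix_vector_mul_assoc)
      then have "norm ((A ** B) *v x - (A *v z + \<rho> *\<^sub>R y)) \<le> r * \<rho>" using y \<rho> by (simp add: mult.commute)
      then show "x \<in> (\<Union>p\<in>ZA \<times> ZB. ?S p)" using x y z by auto
    qed
    have meas: "?S p \<in> sets lborel" for p
    proof -
      have "?S p = cball 0 1 \<inter> {x. norm ((A ** B) *v x - (A *v snd p + \<rho> *\<^sub>R fst p)) \<le> r * \<rho>}"
        by (auto simp: split_beta)
      moreover have "closed {x. norm ((A ** B) *v x - (A *v snd p + \<rho> *\<^sub>R fst p)) \<le> r * \<rho>}"
        by (intro closed_Collect_le continuous_intros)
      ultimately have "closed (?S p)" by (simp add: closed_Int)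
      then show ?thesis by simp
    qed
    have "ennreal V = emeasure lborel (cball (0::real^'d) 1)"
      unfolding V_def using emeasure_lborel_cball_finite[of "0::real^'d" 1]
      by (intro emeasure_eq_ennreal_measure[symmetric]) auto
    also have "\<dots> \<le> emeasure lborel (\<Union>p\<in>ZA \<times> ZB. ?S p)"
      using sub meas ZA(1) ZB(1) by (intro emeasure_mono sets.finite_UN) auto
    also have "\<dots> \<le> (\<Sum>p\<in>ZA \<times> ZB. emeasure lborel (?S p))"
      using ZA(1) ZB(1) meas by (intro emeasure_subadditive_finite) auto
    also have "\<dots> \<le> (\<Sum>p\<in>ZA \<times> ZB. ennreal (C * sv_min (r * \<rho>) (A ** B)))"
      unfolding C_def split_beta using ellipsoid_volume[OF AB, of 1 "r * \<rho>"] r \<rho> by (intro sum_mono) auto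
    also have "\<dots> = ennreal (real (card ZA) * real (card ZB) * (C * sv_min (r * \<rho>) (A ** B)))"
      using C sv_min_pos[OF AB, of "r * \<rho>"] r \<rho> by (simp add: ennreal_mult' card_cartesian_product ennreal_of_nat_eq_real_of_nat)
    finally have "V \<le> real (card ZA) * real (card ZB) * (C * sv_min (r * \<rho>) (A ** B))"
      using C sv_min_pos[OF AB, of "r * \<rho>"] r \<rho> by (subst (asm) ennreal_le_iff) auto
    also have "\<dots> \<le> (D * sv_max r A) * (D * sv_max \<rho> B) * (C * sv_min (r * \<rho>) (A ** B))"
      using C sv_min_pos[OF AB, of "r * \<rho>"] r \<rho> ZA ZB D sv_max_ge_1[of r A] by (intro mult_right_mono mult_mono) auto
    finally have "V * sv_max (r * \<rho>) (A ** B) \<le>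
        (D * sv_max r A) * (D * sv_max \<rho> B) * (C * sv_min (r * \<rho>) (A ** B)) * sv_max (r * \<rho>) (A ** B)"
      using sv_max_ge_1[of "r * \<rho>" "A ** B"] by (intro mult_right_mono) auto
    also have "\<dots> = D * D * C * (sv_max r A * sv_max \<rho> B) * (sv_min (r * \<rho>) (A ** B) * sv_max (r * \<rho>) (A ** B))"
      by (simp add: algebra_simps)
    also have "\<dots> = D * D * C * (sv_max r A * sv_max \<rho> B)" using sv_min_max[OF AB, of "r * \<rho>"] r \<rho> by simp
    finally have "sv_max (r * \<rho>) (A ** B) \<le> D * D * C / V * (sv_max r A * sv_max \<rho> B)"
      using V by (simp add: field_simps)
    also have "\<dots> \<le> K * (sv_max r A * sv_max \<rho> B)"
      using sv_max_ge_1[of r A] sv_max_ge_1[of \<rho> B] by (intro mult_right_mono) (auto simp: K_def)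
    finally show ?thesis .
  qed
  then show ?thesis by (intro exI[of _ K]) (simp add: K_def)
qed

subsection \<open>The singular value function\<close>

text \<open>The exponent of the \<open>i\<close>-th of \<open>n\<close> singular values in
  \<open>\<psi>\<close> of order \<open>s\<close>, see \<open>svf_eq_prod\<close>. For
  \<open>0 \<le> s\<close> the exponents are nonnegative, decrease in \<open>i\<close>, increase in
  \<open>s\<close> and add up to \<open>s\<close>; most properties of \<open>\<psi>\<close> follow
  from this.\<close>

definition sv_exp :: "nat \<Rightarrow> real \<Rightarrow> nat \<Rightarrow> real" where
  "sv_exp n s i = (if s \<le> real n then max 0 (min 1 (s - real i + 1)) else s / real n)"

lemma sv_exp_nonneg: "0 \<le> s \<Longrightarrow> 0 \<le> sv_exp n s i"
  by (auto simp: sv_exp_def)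

lemma sv_exp_le_1: "s \<le> real n \<Longrightarrow> sv_exp n s i \<le> 1"
  by (auto simp: sv_exp_def)

lemma sv_exp_mono_s: "0 \<le> s \<Longrightarrow> s \<le> s' \<Longrightarrow> 0 < n \<Longrightarrow> sv_exp n s i \<le> sv_exp n s' i"
proof -
  assume a: "0 \<le> s" "s \<le> s'" "0 < n"
  consider "s' \<le> real n" | "s \<le> real n" "real n < s'" | "real n < s" by linarith
  then show ?thesis
  proof cases
    case 2
    then have "1 \<le> s' / real n" using a by (simp add: field_simps)
    moreover have "sv_exp n s i \<le> 1" using 2 by (simp add: sv_exp_le_1)
    ultimately show ?thesis using 2 by (simp add: sv_exp_def)
  next
    case 3 then show ?thesis using a by (auto simp: sv_exp_def divide_right_mono)
  qed (use a in \<open>auto simp: sv_exp_def\<close>)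
qed

lemma sv_exp_antimono: "sv_exp n s (Suc i) \<le> sv_exp n s i"
  by (auto simp: sv_exp_def)

lemma sum_sv_exp:
  assumes "0 \<le> s" "0 < n"
  shows "(\<Sum>i=1..n. sv_exp n s i) = s"
proof (cases "s \<le> real n")
  case True
  have "(\<Sum>i=1..k. max 0 (min 1 (s - real i + 1))) = min s (real k)" for k
    by (induction k) (use assms in \<open>auto simp: min_def max_def\<close>)
  from this[of n] show ?thesis using True by (simp add: sv_exp_def)
qed (use assms in \<open>simp add: sv_exp_def\<close>)

lemma svf_eq_prod:
  fixes A :: "real^'d^'d" and s :: real
  assumes inv: "invertible A" and s: "0 \<le> s"
  shows "svf s A = (\<Prod>i=1..CARD('d). singular_value A i powr sv_exp CARD('d) s i)"
proof -
  let ?n = "CARD('d)"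
  have pos: "0 < singular_value A i" if "i \<in> {1..?n}" for i using singular_value_pos[OF inv that] .
  consider "s = 0" | "0 < s" "s \<le> ?n" | "s > ?n" using s by linarith
  then show ?thesis
  proof cases
    case 1
    have "(\<Prod>i=1..?n. singular_value A i powr sv_exp ?n s i) = (\<Prod>i=1..?n. 1)"
    proof (intro prod.cong refl)
      fix i assume i: "i \<in> {1..?n}"
      then have "sv_exp ?n s i = 0" using 1 by (auto simp: sv_exp_def)
      then show "singular_value A i powr sv_exp ?n s i = 1" using pos[OF i] by simp
    qed
    then show ?thesis using 1 by (simp add: svf_def)
  next
    case 3
    then have "svf s A = (\<Prod>i=1..?n. singular_value A i) powr (s / real ?n)"
      using s by (simp add: svf_def)
    also have "\<dots> = (\<Prod>i=1..?n. singular_value A i powr (s / real ?n))"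
      by (rule prod_powr_distrib)
    finally show ?thesis using 3 by (simp add: sv_exp_def)
  next
    case 2
    define m where "m = nat \<lceil>s\<rceil>"
    have m: "1 \<le> m" "m \<le> ?n" "real m - 1 < s" "s \<le> real m"
      unfolding m_def using 2 by linarith+
    have sp: "{1..?n} = {1..m - 1} \<union> {m} \<union> {Suc m..?n}" using m by auto
    have "(\<Prod>i=1..?n. singular_value A i powr sv_exp ?n s i) =
        (\<Prod>i=1..m - 1. singular_value A i powr sv_exp ?n s i) * (singular_value A m powr sv_exp ?n s m) *
        (\<Prod>i=Suc m..?n. singular_value A i powr sv_exp ?n s i)"
      proof -
      have "{1..m - 1} \<inter> {m} = {}" "({1..m - 1} \<union> {m}) \<inter> {Suc m..?n} = {}" using m by auto
      then show ?thesis unfolding sp by (simp add: prod.union_disjoint)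
    qed
    also have "(\<Prod>i=Suc m..?n. singular_value A i powr sv_exp ?n s i) = (\<Prod>i=Suc m..?n. 1)"
    proof (intro prod.cong refl)
      fix i assume i: "i \<in> {Suc m..?n}"
      then have "sv_exp ?n s i = 0" using 2 m by (simp add: sv_exp_def max_def min_def)
      then show "singular_value A i powr sv_exp ?n s i = 1" using pos[of i] i by simp
    qed
    also have "(\<Prod>i=1..m - 1. singular_value A i powr sv_exp ?n s i) = (\<Prod>i=1..m - 1. singular_value A i)"
    proof (intro prod.cong refl)
      fix i assume i: "i \<in> {1..m - 1}"
      then have "real i \<le> real m - 1" using m by (auto simp: of_nat_diff)
      then have "sv_exp ?n s i = 1" using 2 m by (simp add: sv_exp_def)
      moreover have "0 < singular_value A i" using pos[of i] i m by auto
      ultimately show "singular_value A i powr sv_exp ?n s i = singular_value A i" by simp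
    qed
    also have "sv_exp ?n s m = s - real m + 1" using 2 m by (simp add: sv_exp_def)
    finally show ?thesis using 2 by (simp add: svf_def Let_def m_def)
  qed
qed

lemma svf_pos:
  fixes A :: "real^'d^'d" and s :: real
  assumes "invertible A" "0 \<le> s"
  shows "0 < svf s A"
  unfolding svf_eq_prod[OF assms]
proof (intro prod_pos)
  fix i assume "i \<in> {1..CARD('d)}"
  then show "0 < singular_value A i powr sv_exp CARD('d) s i"
    using singular_value_pos[OF assms(1)] by (simp add: less_le)
qed

lemma ln_svf:
  fixes A :: "real^'d^'d" and s :: real
  assumes "invertible A" "0 \<le> s"
  shows "ln (svf s A) = (\<Sum>i=1..CARD('d). sv_exp CARD('d) s i * ln (singular_value A i))"
  unfolding svf_eq_prod[OF assms] using singular_value_pos[OF assms(1)]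
  by (subst ln_prod) (auto simp: ln_powr less_le)

lemma svf_zero: "svf 0 A = 1" by (simp add: svf_def)

text \<open>The exponents of order \<open>s'\<close> exceed those of order \<open>s\<close> by
  nonnegative amounts of total \<open>s' - s\<close>, and each of these amounts is the power of a
  number between \<open>c\<close> and \<open>b\<close>.\<close>

lemma svf_ratio:
  fixes A :: "real^'d^'d" and s s' b c :: real
  assumes inv: "invertible A" and s: "0 \<le> s" "s \<le> s'" and c: "0 < c"
    and lo: "\<And>i. i \<in> {1..CARD('d)} \<Longrightarrow> c \<le> singular_value A i"
    and hi: "\<And>i. i \<in> {1..CARD('d)} \<Longrightarrow> singular_value A i \<le> b"
  shows "c powr (s' - s) * svf s A \<le> svf s' A" "svf s' A \<le> b powr (s' - s) * svf s A"
proof -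
  let ?n = "CARD('d)" let ?e = "\<lambda>i. sv_exp CARD('d) s' i - sv_exp CARD('d) s i"
  have s': "0 \<le> s'" using s by simp
  have pos: "0 < singular_value A i" if "i \<in> {1..?n}" for i using singular_value_pos[OF inv that] .
  have one: "1 \<in> {1..?n}" by (simp add: Suc_leI)
  have b: "0 < b" using pos[OF one] hi[OF one] by simp
  have e0: "0 \<le> ?e i" for i using sv_exp_mono_s[OF s, of ?n i] by simp
  have se: "(\<Sum>i=1..?n. ?e i) = s' - s" using sum_sv_exp[of s ?n] sum_sv_exp[of s' ?n] s by (simp add: sum_subtractf)
  have eq: "svf s' A = (\<Prod>i=1..?n. singular_value A i powr ?e i) * svf s A"
    unfolding svf_eq_prod[OF inv s(1)] svf_eq_prod[OF inv s'] prod.distrib[symmetric]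
    by (intro prod.cong refl) (simp add: powr_add[symmetric])
  have *: "(\<Prod>i=1..?n. x powr ?e i) = x powr (s' - s)" if "x > 0" for x
    using that se by (simp add: powr_sum[symmetric])
  have "c powr (s' - s) \<le> (\<Prod>i=1..?n. singular_value A i powr ?e i)"
    unfolding *[OF c, symmetric] using lo c e0 by (intro prod_mono) (auto intro!: powr_mono2)
  then show "c powr (s' - s) * svf s A \<le> svf s' A" unfolding eq
    using svf_pos[OF inv s(1)] by (intro mult_right_mono) auto
  have "(\<Prod>i=1..?n. singular_value A i powr ?e i) \<le> b powr (s' - s)"
    unfolding *[OF b, symmetric] using hi pos e0 by (intro prod_mono conjI powr_mono2) (auto simp: less_imp_le)
  then show "svf s' A \<le> b powr (s' - s) * svf s A" unfolding eq
    using svf_pos[OF inv s(1)] by (intro mult_right_mono) auto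
qed

text \<open>For every \<open>e\<close> in \<open>[0, 1]\<close> one has
  \<open>min 1 x \<le> x powr e\<close>; the condition \<open>s \<le> CARD('d)\<close> puts all
  exponents there.\<close>

lemma sv_min_le_svf:
  fixes A :: "real^'d^'d" and s r :: real
  assumes inv: "invertible A" and s: "0 \<le> s" "s \<le> CARD('d)" and r: "0 < r"
  shows "sv_min r A \<le> r powr s / svf s A"
proof -
  let ?n = "CARD('d)"
  have pos: "0 < singular_value A i" if "i \<in> {1..?n}" for i using singular_value_pos[OF inv that] .
  have "sv_min r A \<le> (\<Prod>i=1..?n. r powr sv_exp ?n s i / singular_value A i powr sv_exp ?n s i)"
    unfolding sv_min_def
  proof (intro prod_mono conjI)
    fix i assume i: "i \<in> {1..?n}"
    let ?x = "r / singular_value A i" and ?e = "sv_exp ?n s i"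
    have x: "0 < ?x" using r pos[OF i] by simp
    have e: "0 \<le> ?e" "?e \<le> 1" using sv_exp_nonneg[OF s(1)] sv_exp_le_1[OF s(2)] by auto
    have "min 1 ?x \<le> ?x powr ?e"
    proof (cases "?x \<le> 1")
      case True
      then have "?x powr 1 \<le> ?x powr ?e" using e x by (intro powr_mono') auto
      then show ?thesis using x True by (simp only: powr_one)
    next
      case False
      then show ?thesis using e by (simp add: ge_one_powr_ge_zero)
    qed
    then show "min 1 ?x \<le> r powr ?e / singular_value A i powr ?e" using r pos[OF i] by (simp add: powr_divide)
    show "0 \<le> min 1 ?x" using x by simp
  qed
  also have "\<dots> = r powr s / svf s A"
    unfolding svf_eq_prod[OF inv s(1)] prod_dividef
    using r sum_sv_exp[OF s(1), of ?n] by (simp add: powr_sum[symmetric])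
  finally show ?thesis .
qed

text \<open>If \<open>r\<close> is comparable to the last singular value with positive exponent,
  then \<open>max 1 x\<close> and \<open>x powr sv_exp CARD('d) s i\<close> at
  \<open>x = singular_value A i / r\<close> nearly agree: the exponent is 1 before this index and 0
  after it, and at the index itself \<open>x\<close> lies in \<open>[a, 1]\<close>.\<close>

lemma sv_max_le_svf:
  fixes A :: "real^'d^'d" and s r a :: real
  assumes inv: "invertible A" and s: "0 < s" "s \<le> CARD('d)" and r: "0 < r" and a: "0 < a" "a \<le> 1"
    and m: "singular_value A (nat \<lceil>s\<rceil>) \<le> r" "a * r \<le> singular_value A (nat \<lceil>s\<rceil>)"
  shows "sv_max r A \<le> (1 / a) ^ CARD('d) * (svf s A / r powr s)"
proof -
  let ?n = "CARD('d)" let ?m = "nat \<lceil>s\<rceil>"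
  have mm: "1 \<le> ?m" "?m \<le> ?n" "real ?m - 1 < s" "s \<le> real ?m" using s by linarith+
  have s0: "0 \<le> s" using s by simp
  have pos: "0 < singular_value A i" if "i \<in> {1..?n}" for i using singular_value_pos[OF inv that] .
  have "sv_max r A \<le> (\<Prod>i=1..?n. (1 / a) * (singular_value A i powr sv_exp ?n s i / r powr sv_exp ?n s i))"
    unfolding sv_max_def
  proof (intro prod_mono conjI)
    fix i assume i: "i \<in> {1..?n}"
    let ?x = "singular_value A i / r" and ?e = "sv_exp ?n s i"
    have x: "0 < ?x" using r pos[OF i] by simp
    have e: "0 \<le> ?e" "?e \<le> 1" using sv_exp_nonneg[OF s0] sv_exp_le_1[OF s(2)] by auto
    have "a * max 1 ?x \<le> ?x powr ?e"
    proof (cases "i \<le> ?m")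
      case True
      then have "a * r \<le> singular_value A i" using singular_value_antimono[of i ?m A] i mm m by simp
      then have ax: "a \<le> ?x" using r by (simp add: field_simps)
      show ?thesis
      proof (cases "i = ?m")
        case True
        have "?x \<le> 1" using True m r by simp
        have "a powr 1 \<le> a powr ?e" using e a by (intro powr_mono') auto
        also have "\<dots> \<le> ?x powr ?e" using ax a e by (intro powr_mono2) auto
        finally show ?thesis using \<open>?x \<le> 1\<close> a by (simp add: max_def)
      next
        case False
        then have "real i \<le> real ?m - 1" using True by linarith
        then have "?e = 1" using mm s by (simp add: sv_exp_def)
        then have "?x powr ?e = ?x" using x by (simp only: powr_one)
        moreover have "a * ?x \<le> ?x" using mult_right_mono[OF a(2), of ?x] x by simp
        ultimately show ?thesis using ax by (auto simp: max_def)
      qed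
    next
      case False
      then have "singular_value A i \<le> r" using singular_value_antimono[of ?m i A] i mm m by simp
      then have "?x \<le> 1" using r by simp
      moreover have "?e = 0"
      proof -
        have "real ?m + 1 \<le> real i" using False by linarith
        then have "s - real i + 1 \<le> 0" using mm by linarith
        then show ?thesis using s by (simp add: sv_exp_def)
      qed
      ultimately have "?x powr ?e = 1" "max 1 ?x = 1" using powr_zero_eq_one[of ?x] x by (auto simp only: max_def split: if_splits)
      then show ?thesis using a by simp
    qed
    then have "max 1 ?x * a \<le> ?x powr ?e" by (simp only: mult.commute)
    then have "max 1 ?x \<le> ?x powr ?e / a" using pos_le_divide_eq[OF a(1), of "max 1 ?x" "?x powr ?e"] by blast
    then have "max 1 ?x \<le> (1 / a) * ?x powr ?e" by (simp only: times_divide_eq_left mult_1_left)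
    then show "max 1 ?x \<le> (1 / a) * (singular_value A i powr ?e / r powr ?e)" using r pos[OF i] by (simp add: powr_divide)
    show "0 \<le> max 1 ?x" by simp
  qed
  also have "\<dots> = (1 / a) ^ ?n * (svf s A / r powr s)"
    unfolding svf_eq_prod[OF inv s0] prod.distrib prod_dividef
    using r sum_sv_exp[OF s0, of ?n] by (simp add: powr_sum[symmetric] power_one_over field_simps)
  finally show ?thesis .
qed

lemma ln_sv_max:
  fixes A :: "real^'d^'d" and r :: real
  assumes inv: "invertible A" and r: "0 < r"
  shows "ln (sv_max r A) = (\<Sum>i=1..CARD('d). max 0 (ln (singular_value A i) - ln r))"
proof -
  have "ln (sv_max r A) = (\<Sum>i=1..CARD('d). ln (max 1 (singular_value A i / r)))"
    unfolding sv_max_def by (intro ln_prod) (auto simp: less_max_iff_disj)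
  also have "\<dots> = (\<Sum>i=1..CARD('d). max 0 (ln (singular_value A i) - ln r))"
  proof (intro sum.cong refl)
    fix i assume "i \<in> {1..CARD('d)}"
    then have p: "0 < singular_value A i" using singular_value_pos[OF inv] by blast
    show "ln (max 1 (singular_value A i / r)) = max 0 (ln (singular_value A i) - ln r)"
    proof (cases "r \<le> singular_value A i")
      case True
      then have "1 \<le> singular_value A i / r" "ln r \<le> ln (singular_value A i)" using r p by auto
      then show ?thesis using r p by (simp add: max_def ln_div)
    next
      case False
      then have "singular_value A i / r < 1" "ln (singular_value A i) < ln r" using r p by auto
      then show ?thesis by (simp add: max_def)
    qed
  qed
  finally show ?thesis .
qed

lemma ln_sv_max_singular_value:
  fixes A :: "real^'d^'d"
  assumes inv: "invertible A" and m: "m \<in> {1..CARD('d)}"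
  shows "ln (sv_max (singular_value A m) A) = (\<Sum>i=1..m. ln (singular_value A i)) - real m * ln (singular_value A m)"
proof -
  let ?f = "\<lambda>i. max 0 (ln (singular_value A i) - ln (singular_value A m))"
  have c: "0 < singular_value A i" if "i \<in> {1..CARD('d)}" for i using singular_value_pos[OF inv that] .
  have sp: "{1..CARD('d)} = {1..m} \<union> {Suc m..CARD('d)}" using m by auto
  have 1: "(\<Sum>i=Suc m..CARD('d). ?f i) = 0"
  proof (intro sum.neutral ballI)
    fix i assume "i \<in> {Suc m..CARD('d)}"
    then have "singular_value A i \<le> singular_value A m" "0 < singular_value A i"
      using m singular_value_antimono[of m i A] c[of i] by auto
    then have "ln (singular_value A i) \<le> ln (singular_value A m)" by simp
    then show "?f i = 0" by simp
  qed
  have 2: "(\<Sum>i=1..m. ?f i) = (\<Sum>i=1..m. ln (singular_value A i) - ln (singular_value A m))"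
  proof (intro sum.cong refl)
    fix i assume "i \<in> {1..m}"
    then have "singular_value A m \<le> singular_value A i" "0 < singular_value A m"
      using m singular_value_antimono[of i m A] c[of m] by auto
    then have "ln (singular_value A m) \<le> ln (singular_value A i)" by simp
    then show "?f i = ln (singular_value A i) - ln (singular_value A m)" by simp
  qed
  have "ln (sv_max (singular_value A m) A) = (\<Sum>i=1..m. ?f i) + (\<Sum>i=Suc m..CARD('d). ?f i)"
    unfolding ln_sv_max[OF inv c[OF m]] sp by (rule sum.union_disjoint) auto
  then show ?thesis unfolding 1 2 by (simp add: sum_subtractf)
qed

lemma sum_by_parts:
  fixes e x :: "nat \<Rightarrow> real"
  shows "(\<Sum>i=1..N. e i * x i) = (\<Sum>m=1..N. (e m - e (Suc m)) * (\<Sum>i=1..m. x i)) + e (Suc N) * (\<Sum>i=1..N. x i)"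
  by (induction N) (auto simp: algebra_simps)

text \<open>
  With \<open>r = \<alpha>\<^sub>m A\<close> and \<open>\<rho> = \<alpha>\<^sub>m B\<close> the covering numbers compare the
  products of the \<open>m\<close> largest singular values.
\<close>

lemma svf_submult:
  "\<exists>K\<ge>1. \<forall>(A::real^'d^'d) B s. invertible A \<longrightarrow> invertible B \<longrightarrow> 0 \<le> s \<longrightarrow>
    svf s (A ** B) \<le> K powr (1 + s) * (svf s A * svf s B)"
proof -
  let ?n = "CARD('d)"
  obtain K where K: "1 \<le> K" "\<And>(A::real^'d^'d) B r \<rho>. invertible A \<Longrightarrow> invertible B \<Longrightarrow> 0 < r \<Longrightarrow> 0 < \<rho> \<Longrightarrow>
    sv_max (r * \<rho>) (A ** B) \<le> K * (sv_max r A * sv_max \<rho> B)"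
    using sv_max_mult by blast
  define X where "X A m = (\<Sum>i=1..m. ln (singular_value A i))" for A :: "real^'d^'d" and m :: nat
  have X: "X (A ** B) m \<le> X A m + X B m + ln K" if A: "invertible A" and B: "invertible B" and m: "m \<in> {1..?n}"
    for A B :: "real^'d^'d" and m
  proof -
    let ?r = "singular_value A m" and ?p = "singular_value B m"
    have r: "0 < ?r" "0 < ?p" using singular_value_pos A B m by blast+
    have AB: "invertible (A ** B)" using A B by (rule invertible_mult)
    note top = ln_sv_max_singular_value[OF _ m, folded X_def]
    \<comment> \<open>For the product the positive parts are only estimated from below, while for
      \<open>A\<close> and \<open>B\<close> at their own \<open>m\<close>-th singular values
      \<open>ln_sv_max_singular_value\<close> is an equality. The terms with \<open>ln ?r\<close>
      and \<open>ln ?p\<close> then cancel.\<close>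
    have "X (A ** B) m - real m * ln (?r * ?p) = (\<Sum>i=1..m. ln (singular_value (A ** B) i) - ln (?r * ?p))"
      by (simp add: X_def sum_subtractf)
    also have "\<dots> \<le> (\<Sum>i=1..m. max 0 (ln (singular_value (A ** B) i) - ln (?r * ?p)))"
      by (intro sum_mono) auto
    also have "\<dots> \<le> (\<Sum>i=1..?n. max 0 (ln (singular_value (A ** B) i) - ln (?r * ?p)))"
      using m by (intro sum_mono2) auto
    also have "\<dots> = ln (sv_max (?r * ?p) (A ** B))" using ln_sv_max[OF AB, of "?r * ?p"] r by simp
    also have "\<dots> \<le> ln (K * (sv_max ?r A * sv_max ?p B))"
    proof -
      have "1 \<le> sv_max (?r * ?p) (A ** B)" by (rule sv_max_ge_1)
      then show ?thesis using K(2)[OF A B r] by (subst ln_le_cancel_iff) auto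
    qed
    also have "\<dots> = ln K + ln (sv_max ?r A) + ln (sv_max ?p B)"
      using K(1) sv_max_ge_1[of ?r A] sv_max_ge_1[of ?p B] by (simp add: ln_mult)
    also have "\<dots> = ln K + (X A m - real m * ln ?r) + (X B m - real m * ln ?p)" using top[OF A] top[OF B] by simp
    finally show ?thesis using r by (simp add: ln_mult algebra_simps)
  qed
  have "svf s (A ** B) \<le> K powr (1 + s) * (svf s A * svf s B)"
    if A: "invertible A" and B: "invertible B" and s: "0 \<le> s" for A B :: "real^'d^'d" and s
  proof -
    have AB: "invertible (A ** B)" using A B by (rule invertible_mult)
    let ?e = "sv_exp ?n s"
    have parts: "ln (svf s C) = (\<Sum>m=1..?n. (?e m - ?e (Suc m)) * X C m) + ?e (Suc ?n) * X C ?n"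
      if C: "invertible C" for C :: "real^'d^'d"
      unfolding ln_svf[OF C s] X_def by (rule sum_by_parts)
    \<comment> \<open>The weights of the summation by parts are nonnegative because the exponents
      decrease, and they telescope to the first exponent, so the error is that multiple of
      \<open>ln K\<close>. The bound \<open>1 + s\<close> also covers \<open>s\<close> beyond the
      dimension, where the first exponent is \<open>s / CARD('d)\<close>.\<close>
    have de: "0 \<le> ?e m - ?e (Suc m)" for m using sv_exp_antimono[of ?n s m] by simp
    have tele: "(\<Sum>m=1..k. ?e m - ?e (Suc m)) + ?e (Suc k) = ?e 1" for k by (induction k) auto
    have e1: "?e 1 \<le> 1 + s"
    proof -
      have "s * 1 \<le> s * real ?n" using s by (intro mult_left_mono) (auto simp: Suc_leI)
      then have "s / real ?n \<le> s" by (simp add: divide_le_eq)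
      then show ?thesis using s by (auto simp: sv_exp_def)
    qed
    have "ln (svf s (A ** B)) \<le> (\<Sum>m=1..?n. (?e m - ?e (Suc m)) * (X A m + X B m + ln K)) + ?e (Suc ?n) * (X A ?n + X B ?n + ln K)"
      unfolding parts[OF AB] using X[OF A B] de sv_exp_nonneg[OF s] by (intro add_mono sum_mono mult_left_mono) auto
    also have "\<dots> = ln (svf s A) + ln (svf s B) + ((\<Sum>m=1..?n. ?e m - ?e (Suc m)) + ?e (Suc ?n)) * ln K"
    proof -
      have "(\<Sum>m=1..k. d m * (a m + b m + c)) = (\<Sum>m=1..k. d m * a m) + (\<Sum>m=1..k. d m * b m) + (\<Sum>m=1..k. d m) * c"
        for d a b :: "nat \<Rightarrow> real" and c k by (simp add: sum.distrib distrib_left sum_distrib_right)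
      then show ?thesis unfolding parts[OF A] parts[OF B] by (simp only:) (simp add: algebra_simps)
    qed
    also have "\<dots> = ln (svf s A) + ln (svf s B) + ?e 1 * ln K" by (simp only: tele)
    also have "\<dots> \<le> ln (svf s A) + ln (svf s B) + (1 + s) * ln K"
      using e1 K(1) by (intro add_left_mono mult_right_mono) auto
    also have "\<dots> = ln (K powr (1 + s) * (svf s A * svf s B))"
      using K(1) svf_pos[OF A s] svf_pos[OF B s] by (simp add: ln_mult ln_powr)
    finally show ?thesis using K(1) svf_pos[OF A s] svf_pos[OF B s] svf_pos[OF AB s] by (subst (asm) ln_le_cancel_iff) auto
  qed
  then show ?thesis using K(1) by blast
qed

section \<open>Superadditive sequences\<close>

text \<open>Subtracting \<open>C\<close> makes the sequence superadditive, so its averages tend to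
  their supremum \<open>L\<close>. The bound \<open>x k \<le> real k * L + C\<close> holds for every
  \<open>k\<close>, not only asymptotically; this is what turns negative pressure into geometric
  bounds.\<close>

lemma fekete_superadditive:
  fixes x :: "nat \<Rightarrow> real"
  assumes super: "\<And>j k. x j + x k - C \<le> x (j + k)" and ub: "\<And>k. x k \<le> M * real k" and C: "0 \<le> C"
  shows "\<exists>L. (\<lambda>k. x k / real k) \<longlonglongrightarrow> L \<and> (\<forall>k. x k \<le> real k * L + C)"
proof -
  define y where "y k = x k - C" for k
  have sup: "y j + y k \<le> y (j + k)" for j k using super[of j k] by (simp add: y_def)
  define A where "A = (\<lambda>k. y k / real k) ` {1..}"
  have bdd: "bdd_above A"
  proof (rule bdd_aboveI)
    fix z assume "z \<in> A"
    then obtain k where k: "k \<ge> 1" "z = y k / real k" by (auto simp: A_def)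
    have "y k \<le> M * real k" using ub[of k] C by (simp add: y_def)
    then show "z \<le> M" using k by (simp add: divide_le_eq)
  qed
  define L where "L = Sup A"
  have yL: "y k \<le> real k * L" if "k \<ge> 1" for k
  proof -
    have "y k / real k \<le> L" unfolding L_def using bdd that by (intro cSup_upper) (auto simp: A_def)
    then show ?thesis using that by (simp add: field_simps)
  qed
  have "(\<lambda>k. y k / real k) \<longlonglongrightarrow> L"
  proof (rule LIMSEQ_I)
    fix e :: real assume e: "0 < e"
    have "L - e / 2 < Sup A" using e by (simp add: L_def)
    then obtain z where "z \<in> A" "L - e / 2 < z" using less_cSupD[of A "L - e / 2"] by (auto simp: A_def)
    then obtain N where N: "N \<ge> 1" "L - e / 2 < y N / real N" by (auto simp: A_def)
    then have yN: "real N * (L - e / 2) \<le> y N" by (simp add: field_simps)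
    define D where "D = Max ((\<lambda>j. \<bar>y j\<bar>) ` {..<N})"
    have D: "\<bar>y j\<bar> \<le> D" if "j < N" for j unfolding D_def using that by (intro Max_ge) auto
    have mult: "real n * y N + y j \<le> y (n * N + j)" for n j
    proof (induction n)
      case (Suc n)
      have "real (Suc n) * y N + y j = y N + (real n * y N + y j)" by (simp add: algebra_simps)
      also have "\<dots> \<le> y N + y (n * N + j)" using Suc by simp
      also have "\<dots> \<le> y (Suc n * N + j)" using sup[of N "n * N + j"] by (simp add: add.assoc)
      finally show ?case .
    qed simp
    \<comment> \<open>Absorbs the incomplete last block, whose length is less than
      \<open>N\<close>.\<close>
    define B where "B = D + real N * \<bar>L - e / 2\<bar>"
    have low: "real k * (L - e / 2) - B \<le> y k" for k
    proof -
      define n j where "n = k div N" and "j = k mod N"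
      have k: "k = n * N + j" "j < N" using N by (auto simp: n_def j_def)
      define w where "w = L - e / 2"
      have "real j * w \<le> real j * \<bar>w\<bar>" by (intro mult_left_mono) auto
      also have "\<dots> \<le> real N * \<bar>w\<bar>" using k by (intro mult_right_mono) auto
      finally have 1: "real j * w \<le> real N * \<bar>w\<bar>" .
      have 2: "real k * w = real n * (real N * w) + real j * w" by (simp add: k algebra_simps)
      have 3: "real n * (real N * w) \<le> real n * y N" using yN by (intro mult_left_mono) (auto simp: w_def)
      have 4: "- D \<le> y j" using D[OF k(2)] by simp
      have 5: "real n * y N + y j \<le> y k" using mult[of n j] by (simp add: k(1)[symmetric])
      have "real k * w - (D + real N * \<bar>w\<bar>) \<le> real n * (real N * w) - D" unfolding 2 using 1 by simp
      also have "\<dots> \<le> real n * y N + y j" using 3 4 by simp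
      finally show ?thesis using 5 unfolding B_def w_def by simp
    qed
    obtain k0 where k0: "real k0 > 2 * \<bar>B\<bar> / e" using reals_Archimedean2 by blast
    have "norm (y k / real k - L) < e" if "k \<ge> max 1 k0" for k
    proof -
      have k: "k \<ge> 1" "real k > 2 * \<bar>B\<bar> / e" using that k0 by (auto intro: less_le_trans)
      then have "\<bar>B\<bar> < real k * (e / 2)" using e by (simp add: field_simps)
      then have "real k * (L - e) < y k" using low[of k] by (simp add: algebra_simps)
      then have "L - e < y k / real k" using k by (simp add: field_simps)
      moreover have "y k / real k \<le> L" using yL[OF k(1)] k by (simp add: field_simps)
      ultimately show ?thesis using e by (simp add: abs_less_iff)
    qed
    then show "\<exists>no. \<forall>n\<ge>no. norm (y n / real n - L) < e" by blast
  qed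
  moreover have "(\<lambda>k. C / real k) \<longlonglongrightarrow> 0" by (rule lim_const_over_n)
  ultimately have "(\<lambda>k. y k / real k + C / real k) \<longlonglongrightarrow> L + 0" by (rule tendsto_add)
  then have "(\<lambda>k. x k / real k) \<longlonglongrightarrow> L" by (simp add: y_def diff_divide_distrib)
  moreover have "x k \<le> real k * L + C" for k
  proof (cases "k = 0")
    case True then show ?thesis using super[of 0 0] by simp
  next
    case False then show ?thesis using yL[of k] by (simp add: y_def)
  qed
  ultimately show ?thesis by blast
qed

text \<open>The increments lie between two positive multiples of \<open>s' - s\<close>, so
  \<open>P\<close> is continuous and strictly increasing; at \<open>- P 0 / c\<close> it has climbed
  to a nonnegative value.\<close>

lemma bilipschitz_zero:
  fixes P :: "real \<Rightarrow> real"
  assumes c: "0 < c" and lo: "\<And>s s'. 0 \<le> s \<Longrightarrow> s \<le> s' \<Longrightarrow> c * (s' - s) \<le> P s' - P s"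
    and hi: "\<And>s s'. 0 \<le> s \<Longrightarrow> s \<le> s' \<Longrightarrow> P s' - P s \<le> C * (s' - s)" and P0: "P 0 \<le> 0"
  shows "\<exists>d\<ge>0. P d = 0 \<and> (\<forall>s\<ge>0. (P s < 0 \<longleftrightarrow> s < d) \<and> (0 < P s \<longleftrightarrow> d < s))"
proof -
  have C: "0 \<le> C" using lo[of 0 1] hi[of 0 1] c by simp
  let ?b = "- P 0 / c"
  have b: "0 \<le> ?b" using P0 c by (simp add: field_simps)
  have "c * (?b - 0) \<le> P ?b - P 0" by (rule lo) (use b in auto)
  then have Pb: "0 \<le> P ?b" using c by simp
  have "C-lipschitz_on {0..} P"
  proof (rule lipschitz_onI)
    fix x y :: real assume xy: "x \<in> {0..}" "y \<in> {0..}"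
    show "dist (P x) (P y) \<le> C * dist x y"
    proof (cases "x \<le> y")
      case True
      have "0 \<le> c * (y - x)" using True c by simp
      then show ?thesis using True xy lo[of x y] hi[of x y] by (simp add: dist_real_def)
    next
      case False
      then have "0 \<le> c * (x - y)" using c by simp
      then show ?thesis using False xy lo[of y x] hi[of y x] by (simp add: dist_real_def)
    qed
  qed (rule C)
  then have "continuous_on {0..?b} P"
    using lipschitz_on_continuous_on continuous_on_subset[of "{0..}" P "{0..?b}"] by fastforce
  then obtain d where d: "0 \<le> d" "P d = 0" using IVT'[of P 0 0 ?b] P0 Pb b by auto
  have "(P s < 0 \<longleftrightarrow> s < d) \<and> (0 < P s \<longleftrightarrow> d < s)" if s: "0 \<le> s" for s
  proof (cases s d rule: linorder_cases)
    case less
    then have "0 < c * (d - s)" using c by simp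
    then show ?thesis using less lo[of s d] s d by simp
  next
    case greater
    then have "0 < c * (s - d)" using c by simp
    then show ?thesis using greater lo[of d s] s d by simp
  qed (use d in auto)
  then show ?thesis using d by blast
qed

section \<open>Word sums\<close>

lemma words_iff: "u \<in> words n0 \<longleftrightarrow> set u \<subseteq> {1..n0}"
  by (auto simp: words_def words_of_length_def)

lemma words_of_length_iff: "u \<in> words_of_length n0 k \<longleftrightarrow> u \<in> words n0 \<and> length u = k"
  by (auto simp: words_def words_of_length_def)

lemma words_append [simp]: "u @ v \<in> words n0 \<longleftrightarrow> u \<in> words n0 \<and> v \<in> words n0"
  by (auto simp: words_iff)

lemma words_Nil [simp]: "[] \<in> words n0" by (simp add: words_iff)

lemma words_Cons [simp]: "i # u \<in> words n0 \<longleftrightarrow> i \<in> {1..n0} \<and> u \<in> words n0"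
  by (auto simp: words_iff)

lemma words_take: "u \<in> words n0 \<Longrightarrow> take k u \<in> words n0"
  by (meson set_take_subset subset_trans words_iff)

lemma words_drop: "u \<in> words n0 \<Longrightarrow> drop k u \<in> words n0"
  by (meson set_drop_subset subset_trans words_iff)

lemma finite_words_of_length [simp]: "finite (words_of_length n0 k)"
  unfolding words_of_length_def using finite_lists_length_eq[of "{1..n0}" k] by (simp add: conj_commute)

lemma words_of_length_0: "words_of_length n0 0 = {[]}"
  by (auto simp: words_of_length_def)

lemma countable_words [simp]: "countable (words n0)"
  unfolding words_def by (intro countable_UN) (auto intro: countable_finite)

lemma bij_betw_append_words:
  "bij_betw (\<lambda>(u, v). u @ v) (words_of_length n0 j \<times> words_of_length n0 k) (words_of_length n0 (j + k))"
proof (rule bij_betw_imageI)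
  show "inj_on (\<lambda>(u, v). u @ v) (words_of_length n0 j \<times> words_of_length n0 k)"
    by (auto simp: inj_on_def words_of_length_def)
  show "(\<lambda>(u, v). u @ v) ` (words_of_length n0 j \<times> words_of_length n0 k) = words_of_length n0 (j + k)"
  proof
    show "words_of_length n0 (j + k) \<subseteq> (\<lambda>(u, v). u @ v) ` (words_of_length n0 j \<times> words_of_length n0 k)"
    proof
      fix w assume w: "w \<in> words_of_length n0 (j + k)"
      then have "(take j w, drop j w) \<in> words_of_length n0 j \<times> words_of_length n0 k"
        by (auto simp: words_of_length_iff words_take words_drop)
      then show "w \<in> (\<lambda>(u, v). u @ v) ` (words_of_length n0 j \<times> words_of_length n0 k)"
        by (rule rev_image_eqI) simp
    qed
  qed (auto simp: words_of_length_iff)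
qed

lemma sum_words_append:
  fixes f :: "nat list \<Rightarrow> 'a::comm_monoid_add"
  shows "(\<Sum>w\<in>words_of_length n0 (j + k). f w) = (\<Sum>u\<in>words_of_length n0 j. \<Sum>v\<in>words_of_length n0 k. f (u @ v))"
proof -
  have "(\<Sum>w\<in>words_of_length n0 (j + k). f w) = (\<Sum>(u, v)\<in>words_of_length n0 j \<times> words_of_length n0 k. f (u @ v))"
    using sum.reindex_bij_betw[OF bij_betw_append_words, of f n0 j k, symmetric] by (simp add: split_beta)
  then show ?thesis by (simp add: sum.cartesian_product)
qed

lemma word_prob_append: "word_prob p (u @ v) = word_prob p u * word_prob p v"
  by (simp add: word_prob_def)

lemma sum_words_1: "(\<Sum>u\<in>words_of_length n0 1. f u) = (\<Sum>i=1..n0. f [i])"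
proof -
  have "words_of_length n0 1 = (\<lambda>i. [i]) ` {1..n0}"
    by (auto simp: words_of_length_def length_Suc_conv)
  then show ?thesis by (simp add: sum.reindex inj_on_def)
qed

lemma word_mat_append: "word_mat T (u @ v) = word_mat T u ** word_mat T v"
  by (induction u) (auto simp: word_mat_def matrix_mul_assoc)

locale affine_words =
  fixes n0 :: nat and T :: "nat \<Rightarrow> real^'d^'d" and p :: "nat \<Rightarrow> real" and a b K :: real
  assumes T_invertible: "\<And>i. i \<in> {1..n0} \<Longrightarrow> invertible (T i)"
    and a: "0 < a" "a < 1" "\<And>i x. i \<in> {1..n0} \<Longrightarrow> a * norm x \<le> norm (T i *v x)"
    and b: "0 < b" "b < 1" "\<And>i x. i \<in> {1..n0} \<Longrightarrow> norm (T i *v x) \<le> b * norm x"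
    and K: "1 \<le> K" "\<And>(A::real^'d^'d) B s. invertible A \<Longrightarrow> invertible B \<Longrightarrow> 0 \<le> s \<Longrightarrow>
      svf s (A ** B) \<le> K powr (1 + s) * (svf s A * svf s B)"
    and p_nonneg: "\<And>i. i \<in> {1..n0} \<Longrightarrow> 0 \<le> p i"
    and p_sum: "(\<Sum>i=1..n0. p i) = 1"
begin

abbreviation W :: "nat \<Rightarrow> nat list set" where "W k \<equiv> words_of_length n0 k"

abbreviation psi :: "real \<Rightarrow> nat list \<Rightarrow> real" where "psi s u \<equiv> svf s (word_mat T u)"

abbreviation pw :: "nat list \<Rightarrow> real" where "pw u \<equiv> word_prob p u"

lemma word_mat_invertible: "u \<in> words n0 \<Longrightarrow> invertible (word_mat T u)"
proof (induction u)
  case Nil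
  have "mat 1 ** mat 1 = (mat 1 :: real^'d^'d)" by simp
  then show ?case unfolding word_mat_def invertible_def by auto
next
  case (Cons i u)
  then have "invertible (T i ** word_mat T u)" using T_invertible by (intro invertible_mult) auto
  then show ?case by (simp add: word_mat_def)
qed

lemma word_mat_bounds:
  assumes "u \<in> words n0"
  shows "a ^ length u * norm x \<le> norm (word_mat T u *v x)" "norm (word_mat T u *v x) \<le> b ^ length u * norm x"
proof -
  have "a ^ length u * norm x \<le> norm (word_mat T u *v x) \<and> norm (word_mat T u *v x) \<le> b ^ length u * norm x"
    using assms
  proof (induction u)
    case (Cons i u)
    have eq: "word_mat T (i # u) *v x = T i *v (word_mat T u *v x)"
      by (simp add: word_mat_def matrix_vector_mul_assoc)
    have i: "i \<in> {1..n0}" using Cons by simp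
    have "a ^ length (i # u) * norm x = a * (a ^ length u * norm x)" by simp
    also have "\<dots> \<le> a * norm (word_mat T u *v x)" using Cons a by (intro mult_left_mono) auto
    also have "\<dots> \<le> norm (word_mat T (i # u) *v x)" unfolding eq by (rule a(3)[OF i])
    finally have 1: "a ^ length (i # u) * norm x \<le> norm (word_mat T (i # u) *v x)" .
    have "norm (word_mat T (i # u) *v x) \<le> b * norm (word_mat T u *v x)" unfolding eq by (rule b(3)[OF i])
    also have "\<dots> \<le> b * (b ^ length u * norm x)" using Cons b by (intro mult_left_mono) auto
    also have "\<dots> = b ^ length (i # u) * norm x" by simp
    finally show ?case using 1 by simp
  qed (simp add: word_mat_def)
  then show "a ^ length u * norm x \<le> norm (word_mat T u *v x)" "norm (word_mat T u *v x) \<le> b ^ length u * norm x" by auto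
qed

lemma sv_bounds:
  assumes "u \<in> words n0" "m \<in> {1..CARD('d)}"
  shows "a ^ length u \<le> singular_value (word_mat T u) m" "singular_value (word_mat T u) m \<le> b ^ length u"
  using word_mat_bounds[OF assms(1)] by (auto intro!: singular_value_lower singular_value_upper assms(2))

lemma sv_append_bounds:
  assumes u: "u \<in> words n0" and v: "v \<in> words n0" and m: "m \<in> {1..CARD('d)}"
  shows "singular_value (word_mat T u) m * a ^ length v \<le> singular_value (word_mat T (u @ v)) m"
    and "singular_value (word_mat T (u @ v)) m \<le> singular_value (word_mat T u) m * b ^ length v"
  unfolding word_mat_append using word_mat_bounds[OF v] word_mat_invertible[OF v] a(1) b(1)
  by (auto intro!: singular_value_mult_lower singular_value_mult_upper m)

lemma psi_pos: "u \<in> words n0 \<Longrightarrow> 0 \<le> s \<Longrightarrow> 0 < psi s u"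
  by (intro svf_pos word_mat_invertible)

lemma psi_ratio:
  assumes u: "u \<in> words n0" and s: "0 \<le> s" "s \<le> s'"
  shows "a powr (real (length u) * (s' - s)) * psi s u \<le> psi s' u"
    and "psi s' u \<le> b powr (real (length u) * (s' - s)) * psi s u"
proof -
  have c: "0 < a ^ length u" using a by simp
  note * = svf_ratio[OF word_mat_invertible[OF u] s c sv_bounds[OF u], simplified]
  have "(a ^ length u) powr (s' - s) = a powr (real (length u) * (s' - s))"
       "(b ^ length u) powr (s' - s) = b powr (real (length u) * (s' - s))"
    using a b by (simp_all add: powr_powr[symmetric] powr_realpow)
  then show "a powr (real (length u) * (s' - s)) * psi s u \<le> psi s' u"
    and "psi s' u \<le> b powr (real (length u) * (s' - s)) * psi s u"
    using * by auto
qed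

lemma psi_bounds:
  assumes u: "u \<in> words n0" and s: "0 \<le> s"
  shows "a powr (real (length u) * s) \<le> psi s u" "psi s u \<le> 1"
proof -
  show "a powr (real (length u) * s) \<le> psi s u" using psi_ratio(1)[OF u order_refl s] by (simp add: svf_zero)
  have "psi s u \<le> b powr (real (length u) * s)" using psi_ratio(2)[OF u order_refl s] by (simp add: svf_zero)
  also have "\<dots> \<le> 1 powr (real (length u) * s)" using b s by (intro powr_mono2) auto
  finally show "psi s u \<le> 1" by simp
qed

lemma psi_append_le:
  assumes "u \<in> words n0" "v \<in> words n0" "0 \<le> s"
  shows "psi s (u @ v) \<le> K powr (1 + s) * (psi s u * psi s v)"
  unfolding word_mat_append using assms by (intro K word_mat_invertible)

text \<open>Appending \<open>v\<close> multiplies every singular value by at least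
  \<open>a ^ length v\<close>, and the exponents add up to \<open>s\<close>.\<close>

lemma psi_append_ge:
  assumes u: "u \<in> words n0" and v: "v \<in> words n0" and s: "0 \<le> s"
  shows "psi s u * a powr (real (length v) * s) \<le> psi s (u @ v)"
proof -
  have uv: "u @ v \<in> words n0" using u v by simp
  let ?e = "sv_exp CARD('d) s"
  have "psi s u * a powr (real (length v) * s) =
      (\<Prod>i=1..CARD('d). singular_value (word_mat T u) i powr ?e i * (a ^ length v) powr ?e i)"
  proof -
    have "(\<Prod>i=1..CARD('d). (a ^ length v) powr ?e i) = (a ^ length v) powr s"
      using sum_sv_exp[OF s, of "CARD('d)"] a by (simp add: powr_sum[symmetric])
    also have "\<dots> = a powr (real (length v) * s)" using a by (simp add: powr_powr[symmetric] powr_realpow)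
    finally show ?thesis by (simp add: prod.distrib svf_eq_prod[OF word_mat_invertible[OF u] s])
  qed
  also have "\<dots> \<le> (\<Prod>i=1..CARD('d). singular_value (word_mat T (u @ v)) i powr ?e i)"
  proof (intro prod_mono conjI)
    fix i assume i: "i \<in> {1..CARD('d)}"
    have p: "0 < singular_value (word_mat T u) i" using singular_value_pos[OF word_mat_invertible[OF u] i] .
    have "singular_value (word_mat T u) i powr ?e i * (a ^ length v) powr ?e i = (singular_value (word_mat T u) i * a ^ length v) powr ?e i"
      using p a by (simp add: powr_mult)
    also have "\<dots> \<le> singular_value (word_mat T (u @ v)) i powr ?e i"
      using sv_append_bounds(1)[OF u v i] p a sv_exp_nonneg[OF s] by (intro powr_mono2) auto
    finally show "singular_value (word_mat T u) i powr ?e i * (a ^ length v) powr ?e i \<le> singular_value (word_mat T (u @ v)) i powr ?e i" .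
  qed (simp add: a)
  also have "\<dots> = psi s (u @ v)" by (simp add: svf_eq_prod[OF word_mat_invertible[OF uv] s])
  finally show ?thesis .
qed

lemma pw_nonneg: "u \<in> words n0 \<Longrightarrow> 0 \<le> pw u"
  unfolding word_prob_def using p_nonneg by (intro prod_list_nonneg) (auto simp: words_iff)

lemma sum_pw: "(\<Sum>u\<in>W k. pw u) = 1"
proof (induction k)
  case 0 show ?case by (simp add: words_of_length_0 word_prob_def)
next
  case (Suc k)
  have "(\<Sum>u\<in>W (1 + k). pw u) = (\<Sum>u\<in>W 1. pw u * (\<Sum>v\<in>W k. pw v))"
    by (simp only: sum_words_append word_prob_append sum_distrib_left)
  also have "\<dots> = (\<Sum>i=1..n0. pw [i])" by (simp only: Suc mult_1_right sum_words_1)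
  also have "\<dots> = 1" using p_sum by (simp add: word_prob_def)
  finally show ?case by simp
qed

lemma pw_le_1:
  assumes "u \<in> words n0"
  shows "pw u \<le> 1"
proof -
  have "pw u \<le> (\<Sum>u\<in>W (length u). pw u)"
    using assms by (intro member_le_sum) (auto simp: words_of_length_iff pw_nonneg)
  then show ?thesis by (simp only: sum_pw)
qed

lemma pw_append_le: "u \<in> words n0 \<Longrightarrow> v \<in> words n0 \<Longrightarrow> pw (u @ v) \<le> pw u"
  using mult_left_mono[OF pw_le_1 pw_nonneg, of v u] by (simp add: word_prob_append)

end

context affine_words
begin

subsection \<open>Cut sets\<close>

definition cut_index :: "real \<Rightarrow> nat" where
  "cut_index s = min (nat \<lceil>s\<rceil>) CARD('d)"

lemma cut_index_range: "0 < s \<Longrightarrow> cut_index s \<in> {1..CARD('d)}"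
  by (auto simp: cut_index_def Suc_leI)

abbreviation alpha :: "real \<Rightarrow> nat list \<Rightarrow> real" where
  "alpha s u \<equiv> singular_value (word_mat T u) (cut_index s)"

abbreviation cut :: "real \<Rightarrow> real \<Rightarrow> nat list set" where "cut s r \<equiv> cut_set n0 T s r"

lemma cut_iff: "u \<in> cut s r \<longleftrightarrow> u \<in> words n0 \<and> u \<noteq> [] \<and> alpha s u \<le> r \<and> r < alpha s (butlast u)"
  by (simp add: cut_set_def Let_def cut_index_def)

lemma alpha_take:
  assumes u: "u \<in> words n0" and s: "0 < s" and jk: "j \<le> k"
  shows "alpha s (take k u) \<le> alpha s (take j u)"
proof -
  have m: "cut_index s \<in> {1..CARD('d)}" using cut_index_range[OF s] .
  have eq: "take k u = take j u @ drop j (take k u)" using jk by (metis append_take_drop_id min.absorb1 take_take)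
  have w: "take j u \<in> words n0" "drop j (take k u) \<in> words n0" using u by (auto simp: words_take words_drop)
  have "alpha s (take k u) \<le> alpha s (take j u) * b ^ length (drop j (take k u))"
    by (subst eq) (rule sv_append_bounds(2)[OF w m])
  also have "\<dots> \<le> alpha s (take j u) * 1"
    using b singular_value_nonneg[OF m] by (intro mult_left_mono power_le_one) auto
  finally show ?thesis by simp
qed

text \<open>The last letter lowers the selected singular value at most by the factor
  \<open>a\<close>, so on a cut set this singular value is comparable with \<open>r\<close>.\<close>

lemma cut_lower:
  assumes u: "u \<in> cut s r" and s: "0 < s"
  shows "a * r < alpha s u"
proof -
  have m: "cut_index s \<in> {1..CARD('d)}" using cut_index_range[OF s] .
  have u': "u \<in> words n0" "u \<noteq> []" "r < alpha s (butlast u)" using u by (auto simp: cut_iff)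
  have eq: "u = butlast u @ [last u]" using u' by simp
  have w: "butlast u \<in> words n0" "[last u] \<in> words n0" using u' eq by (metis words_append)+
  have "a * r < alpha s (butlast u) * a ^ length [last u]" using u' a by (simp add: mult.commute)
  also have "\<dots> \<le> alpha s (butlast u @ [last u])" by (rule sv_append_bounds(1)[OF w m])
  finally show ?thesis using eq by simp
qed

lemma cut_power:
  assumes u: "u \<in> cut s r" and s: "0 < s"
  shows "a ^ length u \<le> r" "r < b ^ (length u - 1)"
proof -
  have m: "cut_index s \<in> {1..CARD('d)}" using cut_index_range[OF s] .
  have u': "u \<in> words n0" "alpha s u \<le> r" "r < alpha s (butlast u)" using u by (auto simp: cut_iff)
  show "a ^ length u \<le> r" using sv_bounds(1)[OF u'(1) m] u'(2) by simp
  have "butlast u \<in> words n0" using u'(1) by (auto simp: words_iff dest: in_set_butlastD)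
  from sv_bounds(2)[OF this m] show "r < b ^ (length u - 1)" using u'(3) by simp
qed

lemma cut_length:
  assumes u: "u \<in> cut s r" and s: "0 < s" and r: "0 < r"
  shows "ln r / ln a \<le> length u" "length u \<le> ln r / ln b + 1"
proof -
  have "ln (a ^ length u) \<le> ln r" using cut_power(1)[OF u s] a r by (subst ln_le_cancel_iff) auto
  then have "real (length u) * ln a \<le> ln r" using a by (simp add: ln_realpow)
  then show "ln r / ln a \<le> length u" using a by (simp add: divide_le_eq)
  have "ln r \<le> ln (b ^ (length u - 1))" using cut_power(2)[OF u s] b r by (subst ln_le_cancel_iff) auto
  then have "ln r \<le> real (length u - 1) * ln b" using b by (simp add: ln_realpow)
  then have "real (length u - 1) \<le> ln r / ln b" using b by (simp add: le_divide_eq)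
  then show "length u \<le> ln r / ln b + 1" by linarith
qed

lemma cut_words: "u \<in> cut s r \<Longrightarrow> u \<in> words n0" by (simp add: cut_iff)

lemma cut_prefix_ex:
  assumes x: "x \<in> words n0" and s: "0 < s" and r: "r < 1" and le: "alpha s x \<le> r"
  shows "\<exists>j\<le>length x. take j x \<in> cut s r"
proof -
  have m: "cut_index s \<in> {1..CARD('d)}" using cut_index_range[OF s] .
  define j where "j = (LEAST j. alpha s (take j x) \<le> r)"
  have ex: "alpha s (take (length x) x) \<le> r" using le by simp
  have j: "alpha s (take j x) \<le> r" unfolding j_def using ex by (rule LeastI)
  have jl: "j \<le> length x" unfolding j_def using ex by (rule Least_le)
  \<comment> \<open>The empty word does not qualify because \<open>r < 1\<close>, so the minimal
    prefix has a predecessor that still exceeds \<open>r\<close>.\<close>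
  have "1 \<le> alpha s []" using sv_bounds(1)[of "[]", OF _ m] by simp
  then have j0: "j \<noteq> 0" using j r by (cases j) auto
  then have "\<not> alpha s (take (j - 1) x) \<le> r" using not_less_Least[of "j - 1" "\<lambda>j. alpha s (take j x) \<le> r"] by (simp add: j_def[symmetric])
  moreover have "butlast (take j x) = take (j - 1) x" using jl by (simp add: butlast_take)
  ultimately have "take j x \<in> cut s r" using j j0 jl x by (auto simp: cut_iff words_take)
  then show ?thesis using jl by blast
qed

lemma cut_prefix_unique:
  assumes x: "x \<in> words n0" and s: "0 < s" and "take i x \<in> cut s r" "take j x \<in> cut s r" "i \<le> length x" "j \<le> length x"
  shows "i = j"
proof -
  have False if ij: "i < j" "j \<le> length x" "take i x \<in> cut s r" "take j x \<in> cut s r" for i j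
  proof -
    have "butlast (take j x) = take (j - 1) x" using ij by (simp add: butlast_take)
    then have "r < alpha s (take (j - 1) x)" using ij by (simp add: cut_iff)
    also have "\<dots> \<le> alpha s (take i x)" using ij by (intro alpha_take[OF x s]) auto
    also have "\<dots> \<le> r" using ij by (simp add: cut_iff)
    finally show False by simp
  qed
  then show ?thesis using assms by (meson linorder_neqE_nat)
qed

lemma finite_cut:
  assumes s: "0 < s" and r: "0 < r"
  shows "finite (cut s r)"
proof (rule finite_subset)
  show "cut s r \<subseteq> (\<Union>k\<in>{..nat \<lceil>ln r / ln b + 1\<rceil>}. W k)"
  proof
    fix u assume u: "u \<in> cut s r"
    have "length u \<le> nat \<lceil>ln r / ln b + 1\<rceil>" using cut_length(2)[OF u s r] by linarith
    then show "u \<in> (\<Union>k\<in>{..nat \<lceil>ln r / ln b + 1\<rceil>}. W k)" using u by (auto simp: words_of_length_iff cut_iff)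
  qed
qed auto

text \<open>A cut set is a complete prefix code: the selected singular value decreases along
  prefixes, so every sufficiently long word has exactly one prefix in the set. The condition
  \<open>b ^ L \<le> r\<close> says that words of length \<open>L\<close> are long enough. Cut set
  sums can thus be compared with sums over words of one fixed length.\<close>

lemma bij_betw_cut:
  assumes s: "0 < s" and r: "0 < r" "r < 1" and L: "b ^ L \<le> r"
  shows "bij_betw (\<lambda>(u, v). u @ v) (SIGMA u:cut s r. W (L - length u)) (W L)"
proof (rule bij_betw_imageI)
  have m: "cut_index s \<in> {1..CARD('d)}" using cut_index_range[OF s] .
  have len: "length u \<le> L" if "u \<in> cut s r" for u
  proof (rule ccontr)
    assume "\<not> length u \<le> L"
    then have "b ^ (length u - 1) \<le> b ^ L" using b by (intro power_decreasing) auto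
    then show False using cut_power(2)[OF that s] L by simp
  qed
  show "inj_on (\<lambda>(u, v). u @ v) (SIGMA u:cut s r. W (L - length u))"
  proof (rule inj_onI, clarsimp)
    fix u v u' v' assume u: "u \<in> cut s r" "u' \<in> cut s r" and v: "v \<in> W (L - length u)" "v' \<in> W (L - length u')"
      and eq: "u @ v = u' @ v'"
    have w: "u @ v \<in> words n0" using u v by (auto simp: cut_iff words_of_length_iff)
    have "take (length u) (u @ v) = u" "take (length u') (u @ v) = u'" by (simp, simp add: eq)
    moreover have "length u' \<le> length (u @ v)" by (simp add: eq)
    ultimately have "length u = length u'"
      using cut_prefix_unique[OF w s, of "length u" r "length u'"] u by simp
    then show "u = u' \<and> v = v'" using eq by simp
  qed
  show "(\<lambda>(u, v). u @ v) ` (SIGMA u:cut s r. W (L - length u)) = W L"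
  proof
    show "(\<lambda>(u, v). u @ v) ` (SIGMA u:cut s r. W (L - length u)) \<subseteq> W L"
      using len by (auto simp: words_of_length_iff cut_iff)
    show "W L \<subseteq> (\<lambda>(u, v). u @ v) ` (SIGMA u:cut s r. W (L - length u))"
    proof
      fix x assume "x \<in> W L"
      then have x: "x \<in> words n0" "length x = L" by (auto simp: words_of_length_iff)
      have "alpha s x \<le> r" using sv_bounds(2)[OF x(1) m] L x(2) by simp
      then obtain j where j: "j \<le> length x" "take j x \<in> cut s r" using cut_prefix_ex[OF x(1) s r(2)] by blast
      then have "(take j x, drop j x) \<in> (SIGMA u:cut s r. W (L - length u))"
        using x by (auto simp: words_of_length_iff words_drop)
      then show "x \<in> (\<lambda>(u, v). u @ v) ` (SIGMA u:cut s r. W (L - length u))" by (rule rev_image_eqI) simp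
    qed
  qed
qed

lemma sum_cut:
  fixes f :: "nat list \<Rightarrow> real"
  assumes s: "0 < s" and r: "0 < r" "r < 1" and L: "b ^ L \<le> r"
  shows "(\<Sum>x\<in>W L. f x) = (\<Sum>u\<in>cut s r. \<Sum>v\<in>W (L - length u). f (u @ v))"
proof -
  have "(\<Sum>x\<in>W L. f x) = (\<Sum>(u, v)\<in>(SIGMA u:cut s r. W (L - length u)). f (u @ v))"
    using sum.reindex_bij_betw[OF bij_betw_cut[OF assms], of f, symmetric] by (simp add: split_beta)
  also have "\<dots> = (\<Sum>u\<in>cut s r. \<Sum>v\<in>W (L - length u). f (u @ v))"
    using finite_cut[OF s r(1)] by (intro sum.Sigma[symmetric]) auto
  finally show ?thesis .
qed

lemma power_le_ex:
  assumes "0 < r"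
  shows "\<exists>L. b ^ L \<le> r"
  using real_arch_pow_inv[OF assms b(2)] less_imp_le by blast

lemma sum_pw_cut:
  assumes s: "0 < s" and r: "0 < r" "r < 1"
  shows "(\<Sum>u\<in>cut s r. pw u) = 1"
proof -
  obtain L where L: "b ^ L \<le> r" using power_le_ex[OF r(1)] by blast
  have "1 = (\<Sum>u\<in>cut s r. \<Sum>v\<in>W (L - length u). pw (u @ v))"
    using sum_cut[OF s r L, of pw] by (simp only: sum_pw)
  also have "\<dots> = (\<Sum>u\<in>cut s r. pw u)"
    by (simp only: word_prob_append sum_distrib_left[symmetric] sum_pw mult_1_right)
  finally show ?thesis by simp
qed

lemma measure_cylinder_pw: "u \<in> words n0 \<Longrightarrow> measure (bernoulli_measure n0 p) (cylinder n0 u) = pw u"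
  using p_nonneg p_sum by (rule measure_cylinder)

subsection \<open>Moment sums\<close>

definition term_q :: "real \<Rightarrow> real \<Rightarrow> nat list \<Rightarrow> real" where
  "term_q q s u = psi s u powr (1 - q) * pw u powr q"

definition sum_q :: "real \<Rightarrow> real \<Rightarrow> nat \<Rightarrow> real" where
  "sum_q q s k = (\<Sum>u\<in>W k. term_q q s u)"

text \<open>For words of probability 0 the value is \<open>ln 0 = 0\<close>; in the means it carries
  weight 0.\<close>

definition info :: "real \<Rightarrow> nat list \<Rightarrow> real" where
  "info s u = ln (inverse (psi s u) * pw u)"

definition mean_info :: "real \<Rightarrow> nat \<Rightarrow> real" where
  "mean_info s k = (\<Sum>u\<in>W k. pw u * info s u)"

lemma term_q_nonneg: "0 \<le> term_q q s u" by (simp add: term_q_def)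

lemma sum_q_nonneg: "0 \<le> sum_q q s k" by (simp add: sum_q_def sum_nonneg term_q_nonneg)

lemma crit_sum_eq:
  "q \<noteq> 1 \<Longrightarrow> crit_sum n0 T p q s r = (\<Sum>u\<in>cut s r. term_q q s u)"
  "crit_sum n0 T p 1 s r = (\<Sum>u\<in>cut s r. pw u * info s u)"
  by (auto simp: crit_sum_def term_q_def info_def measure_cylinder_pw cut_words intro!: sum.cong)

definition submult_const :: "real \<Rightarrow> real" where "submult_const s = (1 + s) * ln K"

lemma submult_const_nonneg: "0 \<le> s \<Longrightarrow> 0 \<le> submult_const s"
  using K(1) by (simp add: submult_const_def)

lemma exp_submult_const: "exp (submult_const s) = K powr (1 + s)"
  using K(1) by (simp add: submult_const_def powr_def)

text \<open>For \<open>q \<ge> 1\<close> the exponent \<open>1 - q\<close> is nonpositive, so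
  submultiplicativity of \<open>\<psi>\<close> turns into supermultiplicativity of the terms; for
  \<open>q \<le> 1\<close> the direction is kept, see \<open>term_q_append_le\<close>.\<close>

lemma term_q_append_ge:
  assumes u: "u \<in> words n0" and v: "v \<in> words n0" and s: "0 \<le> s" and q: "1 \<le> q"
  shows "exp (- (q - 1) * submult_const s) * (term_q q s u * term_q q s v) \<le> term_q q s (u @ v)"
proof -
  have uv: "u @ v \<in> words n0" using u v by simp
  have "(K powr (1 + s) * (psi s u * psi s v)) powr (1 - q) \<le> psi s (u @ v) powr (1 - q)"
    using psi_append_le[OF u v s] psi_pos[OF uv s] q by (intro powr_mono2') auto
  moreover have "(K powr (1 + s) * (psi s u * psi s v)) powr (1 - q) =
      exp (- (q - 1) * submult_const s) * (psi s u powr (1 - q) * psi s v powr (1 - q))"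
    using psi_pos[OF u s] psi_pos[OF v s] by (simp add: powr_mult exp_submult_const[symmetric] exp_powr_real algebra_simps)
  ultimately have "exp (- (q - 1) * submult_const s) * (psi s u powr (1 - q) * psi s v powr (1 - q)) * (pw u * pw v) powr q
      \<le> psi s (u @ v) powr (1 - q) * (pw u * pw v) powr q" by (intro mult_right_mono) auto
  then show ?thesis
    using pw_nonneg[OF u] pw_nonneg[OF v] by (simp add: term_q_def word_prob_append powr_mult mult_ac)
qed

lemma term_q_append_le:
  assumes u: "u \<in> words n0" and v: "v \<in> words n0" and s: "0 \<le> s" and q: "q \<le> 1"
  shows "term_q q s (u @ v) \<le> exp ((1 - q) * submult_const s) * (term_q q s u * term_q q s v)"
proof -
  have uv: "u @ v \<in> words n0" using u v by simp
  have "psi s (u @ v) powr (1 - q) \<le> (K powr (1 + s) * (psi s u * psi s v)) powr (1 - q)"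
    using psi_append_le[OF u v s] psi_pos[OF uv s] q by (intro powr_mono2) auto
  moreover have "(K powr (1 + s) * (psi s u * psi s v)) powr (1 - q) =
      exp ((1 - q) * submult_const s) * (psi s u powr (1 - q) * psi s v powr (1 - q))"
    using psi_pos[OF u s] psi_pos[OF v s] by (simp add: powr_mult exp_submult_const[symmetric] exp_powr_real algebra_simps)
  ultimately have "psi s (u @ v) powr (1 - q) * (pw u * pw v) powr q
      \<le> exp ((1 - q) * submult_const s) * (psi s u powr (1 - q) * psi s v powr (1 - q)) * (pw u * pw v) powr q"
    by (intro mult_right_mono) auto
  then show ?thesis
    using pw_nonneg[OF u] pw_nonneg[OF v] by (simp add: term_q_def word_prob_append powr_mult mult_ac)
qed

text \<open>Serves to pad a word to a whole number of blocks: further letters do not raise the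
  probability, and they lower \<open>\<psi>\<close> at most by a power of \<open>a\<close>.\<close>

lemma term_q_extend_le:
  assumes u: "u \<in> words n0" and z: "z \<in> words n0" and s: "0 \<le> s" and q: "1 \<le> q"
  shows "term_q q s (u @ z) \<le> a powr (real (length z) * s * (1 - q)) * term_q q s u"
proof -
  have "psi s (u @ z) powr (1 - q) \<le> (psi s u * a powr (real (length z) * s)) powr (1 - q)"
    using psi_append_ge[OF u z s] psi_pos[OF u s] a q by (intro powr_mono2') auto
  also have "\<dots> = a powr (real (length z) * s * (1 - q)) * psi s u powr (1 - q)"
    using psi_pos[OF u s] by (simp add: powr_mult powr_powr)
  finally have "psi s (u @ z) powr (1 - q) * pw (u @ z) powr q
      \<le> (a powr (real (length z) * s * (1 - q)) * psi s u powr (1 - q)) * pw u powr q"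
    using pw_append_le[OF u z] pw_nonneg[of "u @ z"] u z q by (intro mult_mono powr_mono2) auto
  then show ?thesis by (simp add: term_q_def mult_ac)
qed

lemma sum_q_append_ge:
  assumes s: "0 \<le> s" and q: "1 \<le> q"
  shows "exp (- (q - 1) * submult_const s) * (sum_q q s j * sum_q q s k) \<le> sum_q q s (j + k)"
proof -
  have "exp (- (q - 1) * submult_const s) * (sum_q q s j * sum_q q s k) =
     (\<Sum>u\<in>W j. \<Sum>v\<in>W k. exp (- (q - 1) * submult_const s) * (term_q q s u * term_q q s v))"
    unfolding sum_q_def sum_product by (simp only: sum_distrib_left)
  also have "\<dots> \<le> (\<Sum>u\<in>W j. \<Sum>v\<in>W k. term_q q s (u @ v))"
    by (intro sum_mono term_q_append_ge s q) (auto simp: words_of_length_iff)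
  finally show ?thesis by (simp add: sum_q_def sum_words_append)
qed

lemma sum_q_append_le:
  assumes s: "0 \<le> s" and q: "q \<le> 1"
  shows "sum_q q s (j + k) \<le> exp ((1 - q) * submult_const s) * (sum_q q s j * sum_q q s k)"
proof -
  have "sum_q q s (j + k) = (\<Sum>u\<in>W j. \<Sum>v\<in>W k. term_q q s (u @ v))"
    by (simp add: sum_q_def sum_words_append)
  also have "\<dots> \<le> (\<Sum>u\<in>W j. \<Sum>v\<in>W k. exp ((1 - q) * submult_const s) * (term_q q s u * term_q q s v))"
    by (intro sum_mono term_q_append_le s q) (auto simp: words_of_length_iff)
  also have "\<dots> = exp ((1 - q) * submult_const s) * (sum_q q s j * sum_q q s k)"
    unfolding sum_q_def sum_product by (simp only: sum_distrib_left)
  finally show ?thesis .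
qed

lemma sum_q_pos:
  assumes s: "0 \<le> s"
  shows "0 < sum_q q s k"
proof -
  have "\<exists>u\<in>W k. 0 < pw u"
  proof (rule ccontr)
    assume "\<not> ?thesis"
    then have "(\<Sum>u\<in>W k. pw u) \<le> 0" by (intro sum_nonpos) (auto simp: not_less)
    then show False by (simp only: sum_pw)
  qed
  then obtain u where u: "u \<in> W k" "0 < pw u" by blast
  then have "0 < term_q q s u" using psi_pos[of u s] s by (simp add: term_q_def words_of_length_iff)
  also have "\<dots> \<le> sum_q q s k" unfolding sum_q_def using u by (intro member_le_sum) (auto simp: term_q_nonneg)
  finally show ?thesis .
qed

lemma term_q_ratio:
  assumes u: "u \<in> words n0" and s: "0 \<le> s" "s \<le> s'" and q: "1 \<le> q"
  shows "b powr (real (length u) * (s' - s) * (1 - q)) * term_q q s u \<le> term_q q s' u"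
    and "term_q q s' u \<le> a powr (real (length u) * (s' - s) * (1 - q)) * term_q q s u"
proof -
  have s': "0 \<le> s'" using s by simp
  note pos = psi_pos[OF u s(1)] psi_pos[OF u s']
  have "(b powr (real (length u) * (s' - s)) * psi s u) powr (1 - q) \<le> psi s' u powr (1 - q)"
    using psi_ratio(2)[OF u s] pos q by (intro powr_mono2') auto
  then have "b powr (real (length u) * (s' - s) * (1 - q)) * psi s u powr (1 - q) * pw u powr q \<le> psi s' u powr (1 - q) * pw u powr q"
    using pos by (intro mult_right_mono) (auto simp: powr_mult powr_powr)
  then show "b powr (real (length u) * (s' - s) * (1 - q)) * term_q q s u \<le> term_q q s' u" by (simp add: term_q_def mult.assoc)
  have "psi s' u powr (1 - q) \<le> (a powr (real (length u) * (s' - s)) * psi s u) powr (1 - q)"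
    using psi_ratio(1)[OF u s] pos a q by (intro powr_mono2') auto
  then have "psi s' u powr (1 - q) * pw u powr q \<le> a powr (real (length u) * (s' - s) * (1 - q)) * psi s u powr (1 - q) * pw u powr q"
    using pos by (intro mult_right_mono) (auto simp: powr_mult powr_powr)
  then show "term_q q s' u \<le> a powr (real (length u) * (s' - s) * (1 - q)) * term_q q s u" by (simp add: term_q_def mult.assoc)
qed

lemma sum_q_zero_le:
  assumes q: "1 \<le> q"
  shows "sum_q q 0 k \<le> 1"
proof -
  have "sum_q q 0 k \<le> (\<Sum>u\<in>W k. pw u)"
    unfolding sum_q_def
  proof (intro sum_mono)
    fix u assume "u \<in> W k"
    then have u: "0 \<le> pw u" "pw u \<le> 1" by (auto simp: words_of_length_iff pw_nonneg pw_le_1)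
    have "pw u powr q \<le> pw u powr 1" using u q by (intro powr_mono') auto
    then show "term_q q 0 u \<le> pw u" using u by (simp add: term_q_def svf_zero)
  qed
  then show ?thesis by (simp only: sum_pw)
qed

lemma info_append_ge:
  assumes u: "u \<in> words n0" "0 < pw u" and v: "v \<in> words n0" "0 < pw v" and s: "0 \<le> s"
  shows "info s u + info s v - submult_const s \<le> info s (u @ v)"
proof -
  have uv: "u @ v \<in> words n0" using u v by simp
  have i: "info s w = ln (pw w) - ln (psi s w)" if "w \<in> words n0" "0 < pw w" for w
    using that psi_pos[OF that(1) s] by (simp add: info_def ln_mult ln_inverse)
  have "ln (psi s (u @ v)) \<le> ln (K powr (1 + s) * (psi s u * psi s v))"
    using psi_append_le[OF u(1) v(1) s] psi_pos[OF uv s] by (subst ln_le_cancel_iff) auto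
  also have "\<dots> = submult_const s + ln (psi s u) + ln (psi s v)"
    using psi_pos[OF u(1) s] psi_pos[OF v(1) s] by (simp add: ln_mult exp_submult_const[symmetric])
  finally show ?thesis
    using u v i[OF u] i[OF v] i[OF uv] by (simp add: word_prob_append ln_mult)
qed

text \<open>Weighting by the probability removes the words on which \<open>info\<close> is only a
  default value.\<close>

lemma pw_info_append_ge:
  assumes u: "u \<in> words n0" and v: "v \<in> words n0" and s: "0 \<le> s"
  shows "pw u * pw v * (info s u + info s v - submult_const s) \<le> pw (u @ v) * info s (u @ v)"
proof (cases "pw u = 0 \<or> pw v = 0")
  case True then show ?thesis by (auto simp: word_prob_append)
next
  case False
  then have "0 < pw u" "0 < pw v" using pw_nonneg u v by (auto simp: less_le)
  then show ?thesis using info_append_ge[OF u _ v _ s]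
    by (simp only: word_prob_append) (intro mult_left_mono, auto)
qed

lemma mean_info_append_ge:
  assumes s: "0 \<le> s"
  shows "mean_info s j + mean_info s k - submult_const s \<le> mean_info s (j + k)"
proof -
  have "(\<Sum>u\<in>W j. \<Sum>v\<in>W k. pw u * pw v * (info s u + info s v - submult_const s)) \<le> mean_info s (j + k)"
    unfolding mean_info_def sum_words_append
    by (intro sum_mono pw_info_append_ge s) (auto simp: words_of_length_iff)
  also have "(\<Sum>u\<in>W j. \<Sum>v\<in>W k. pw u * pw v * (info s u + info s v - submult_const s)) =
      (\<Sum>u\<in>W j. pw u * (info s u * (\<Sum>v\<in>W k. pw v) + (\<Sum>v\<in>W k. pw v * info s v) - submult_const s * (\<Sum>v\<in>W k. pw v)))"
    by (intro sum.cong refl) (simp add: sum_distrib_left sum.distrib sum_subtractf algebra_simps)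
  also have "\<dots> = (\<Sum>u\<in>W j. pw u * info s u + pw u * (mean_info s k - submult_const s))"
    unfolding sum_pw mean_info_def[symmetric] by (intro sum.cong refl) (simp add: algebra_simps)
  also have "\<dots> = mean_info s j + (mean_info s k - submult_const s)"
    by (simp only: sum.distrib sum_distrib_right[symmetric] sum_pw mean_info_def[of s j] mult_1_left)
  finally show ?thesis by simp
qed

lemma info_le:
  assumes u: "u \<in> words n0" and s: "0 \<le> s"
  shows "info s u \<le> - s * ln a * real (length u)"
proof (cases "pw u = 0")
  case True then show ?thesis using a s by (simp add: info_def mult_nonpos_nonneg mult_nonneg_nonpos)
next
  case False
  then have p: "0 < pw u" using pw_nonneg[OF u] by simp
  have "ln (a powr (real (length u) * s)) \<le> ln (psi s u)"
    using psi_bounds(1)[OF u s] a psi_pos[OF u s] by (subst ln_le_cancel_iff) auto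
  then have "real (length u) * s * ln a \<le> ln (psi s u)" using a by (simp add: ln_powr)
  moreover have "ln (pw u) \<le> 0" using pw_le_1[OF u] p by simp
  moreover have "info s u = ln (pw u) - ln (psi s u)" using p psi_pos[OF u s] by (simp add: info_def ln_mult ln_inverse)
  ultimately show ?thesis by (simp add: algebra_simps)
qed

lemma mean_info_ratio:
  assumes s: "0 \<le> s" "s \<le> s'"
  shows "- ln b * (s' - s) * real k \<le> mean_info s' k - mean_info s k"
    and "mean_info s' k - mean_info s k \<le> - ln a * (s' - s) * real k"
proof -
  have s': "0 \<le> s'" using s by simp
  have *: "pw u * (- ln b * (s' - s) * real k) \<le> pw u * info s' u - pw u * info s u \<and>
      pw u * info s' u - pw u * info s u \<le> pw u * (- ln a * (s' - s) * real k)" if "u \<in> W k" for u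
  proof (cases "pw u = 0")
    case False
    have u: "u \<in> words n0" "length u = k" using that by (auto simp: words_of_length_iff)
    have p: "0 < pw u" using pw_nonneg[OF u(1)] False by simp
    note pos = psi_pos[OF u(1) s(1)] psi_pos[OF u(1) s']
    have "info s' u - info s u = ln (psi s u) - ln (psi s' u)" using p pos by (simp add: info_def ln_mult ln_inverse)
    moreover have "ln (a powr (real k * (s' - s)) * psi s u) \<le> ln (psi s' u)"
      using psi_ratio(1)[OF u(1) s] u pos a by (subst ln_le_cancel_iff) auto
    moreover have "ln (psi s' u) \<le> ln (b powr (real k * (s' - s)) * psi s u)"
      using psi_ratio(2)[OF u(1) s] u pos b by (subst ln_le_cancel_iff) auto
    ultimately have "- ln b * (s' - s) * real k \<le> info s' u - info s u" "info s' u - info s u \<le> - ln a * (s' - s) * real k"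
      using a b pos by (auto simp: ln_mult ln_powr algebra_simps)
    then show ?thesis using p unfolding right_diff_distrib[symmetric] by (intro conjI mult_left_mono) auto
  qed simp
  have "(\<Sum>u\<in>W k. pw u * (- ln b * (s' - s) * real k)) \<le> mean_info s' k - mean_info s k"
    unfolding mean_info_def sum_subtractf[symmetric] using * by (intro sum_mono) blast
  then show "- ln b * (s' - s) * real k \<le> mean_info s' k - mean_info s k" by (simp only: sum_distrib_right[symmetric] sum_pw mult_1_left)
  have "mean_info s' k - mean_info s k \<le> (\<Sum>u\<in>W k. pw u * (- ln a * (s' - s) * real k))"
    unfolding mean_info_def sum_subtractf[symmetric] using * by (intro sum_mono) blast
  then show "mean_info s' k - mean_info s k \<le> - ln a * (s' - s) * real k" by (simp only: sum_distrib_right[symmetric] sum_pw mult_1_left)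
qed

lemma mean_info_zero_le: "mean_info 0 k \<le> 0"
  unfolding mean_info_def
proof (intro sum_nonpos mult_nonneg_nonpos)
  fix u assume "u \<in> W k"
  then have u: "u \<in> words n0" by (simp add: words_of_length_iff)
  show "0 \<le> pw u" using pw_nonneg[OF u] .
  show "info 0 u \<le> 0" using info_le[OF u, of 0] by simp
qed

subsection \<open>Pressure\<close>

text \<open>At \<open>q = 1\<close> the sum \<open>sum_q\<close> is constantly 1;
  \<open>mean_info\<close> is its derivative in \<open>q\<close> at that point and takes over the
  role of the logarithm.\<close>

definition log_sum :: "real \<Rightarrow> real \<Rightarrow> nat \<Rightarrow> real" where
  "log_sum q s k = (if q = 1 then mean_info s k else ln (sum_q q s k))"

definition pressure :: "real \<Rightarrow> real \<Rightarrow> real" where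
  "pressure q s = lim (\<lambda>k. log_sum q s k / real k)"

definition defect :: "real \<Rightarrow> real \<Rightarrow> real" where
  "defect q s = (if q = 1 then 1 else q - 1) * submult_const s"

lemma log_sum_ratio:
  assumes q: "1 \<le> q" and s: "0 \<le> s" "s \<le> s'"
  defines "h \<equiv> (if q = 1 then 1 else q - 1)"
  shows "h * (- ln b) * (s' - s) * real k \<le> log_sum q s' k - log_sum q s k"
    and "log_sum q s' k - log_sum q s k \<le> h * (- ln a) * (s' - s) * real k"
proof -
  have "h * (- ln b) * (s' - s) * real k \<le> log_sum q s' k - log_sum q s k \<and>
        log_sum q s' k - log_sum q s k \<le> h * (- ln a) * (s' - s) * real k"
  proof (cases "q = 1")
    case True then show ?thesis using mean_info_ratio[OF s, of k] by (simp add: h_def log_sum_def)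
  next
    case False
    have s': "0 \<le> s'" using s by simp
    note pos = sum_q_pos[OF s(1), of q k] sum_q_pos[OF s', of q k]
    let ?e = "real k * (s' - s) * (1 - q)"
    have "b powr ?e * sum_q q s k \<le> sum_q q s' k"
      unfolding sum_q_def sum_distrib_left
      using term_q_ratio(1)[OF _ s q] by (intro sum_mono) (auto simp: words_of_length_iff)
    then have "ln (b powr ?e * sum_q q s k) \<le> ln (sum_q q s' k)" using pos b by (subst ln_le_cancel_iff) auto
    then have 1: "?e * ln b + ln (sum_q q s k) \<le> ln (sum_q q s' k)" using pos b by (simp add: ln_mult ln_powr)
    have "sum_q q s' k \<le> a powr ?e * sum_q q s k"
      unfolding sum_q_def sum_distrib_left
      using term_q_ratio(2)[OF _ s q] by (intro sum_mono) (auto simp: words_of_length_iff)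
    then have "ln (sum_q q s' k) \<le> ln (a powr ?e * sum_q q s k)" using pos a by (subst ln_le_cancel_iff) auto
    then have "ln (sum_q q s' k) \<le> ?e * ln a + ln (sum_q q s k)" using pos a by (simp add: ln_mult ln_powr)
    with 1 show ?thesis using False by (simp add: h_def log_sum_def algebra_simps)
  qed
  then show "h * (- ln b) * (s' - s) * real k \<le> log_sum q s' k - log_sum q s k"
    and "log_sum q s' k - log_sum q s k \<le> h * (- ln a) * (s' - s) * real k" by auto
qed

lemma log_sum_zero_le: "1 \<le> q \<Longrightarrow> log_sum q 0 k \<le> 0"
  using sum_q_zero_le[of q k] sum_q_pos[of 0 q k] mean_info_zero_le[of k] by (simp add: log_sum_def)

lemma log_sum_super:
  assumes q: "1 \<le> q" and s: "0 \<le> s"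
  shows "log_sum q s j + log_sum q s k - defect q s \<le> log_sum q s (j + k)"
proof (cases "q = 1")
  case True then show ?thesis using mean_info_append_ge[OF s] by (simp add: log_sum_def defect_def)
next
  case False
  have "ln (exp (- (q - 1) * submult_const s) * (sum_q q s j * sum_q q s k)) \<le> ln (sum_q q s (j + k))"
    using sum_q_append_ge[OF s q, of j k] sum_q_pos[OF s, of q] by (subst ln_le_cancel_iff) auto
  moreover have "ln (exp (- (q - 1) * submult_const s) * (sum_q q s j * sum_q q s k)) =
      - (q - 1) * submult_const s + (ln (sum_q q s j) + ln (sum_q q s k))"
    using sum_q_pos[OF s, of q j] sum_q_pos[OF s, of q k] by (simp only: ln_mult_pos exp_gt_zero mult_pos_pos ln_exp)
  ultimately show ?thesis using False by (simp add: log_sum_def defect_def algebra_simps)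
qed

lemma pressure_limit:
  assumes q: "1 \<le> q" and s: "0 \<le> s"
  shows "(\<lambda>k. log_sum q s k / real k) \<longlonglongrightarrow> pressure q s"
    and "log_sum q s k \<le> real k * pressure q s + defect q s"
proof -
  let ?h = "(if q = 1 then 1 else q - 1)"
  have ub: "log_sum q s k \<le> (?h * (- ln a) * s) * real k" for k
    using log_sum_ratio(2)[OF q order_refl s, of k] log_sum_zero_le[OF q, of k] by simp
  have "0 \<le> defect q s" using submult_const_nonneg[OF s] q by (simp add: defect_def)
  then obtain L where L: "(\<lambda>k. log_sum q s k / real k) \<longlonglongrightarrow> L" "\<forall>k. log_sum q s k \<le> real k * L + defect q s"
    using fekete_superadditive[of "log_sum q s", OF log_sum_super[OF q s] ub] by blast
  then have "pressure q s = L" unfolding pressure_def by (intro limI)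
  then show "(\<lambda>k. log_sum q s k / real k) \<longlonglongrightarrow> pressure q s"
    and "log_sum q s k \<le> real k * pressure q s + defect q s" using L by auto
qed

text \<open>The bounds for the increments of \<open>log_sum\<close> are linear in \<open>k\<close>
  and survive the limit: the slopes of the pressure lie between positive multiples of
  \<open>- ln b\<close> and \<open>- ln a\<close>.\<close>

lemma pressure_zero:
  assumes q: "1 \<le> q"
  shows "\<exists>d\<ge>0. pressure q d = 0 \<and> (\<forall>s\<ge>0. (pressure q s < 0 \<longleftrightarrow> s < d) \<and> (0 < pressure q s \<longleftrightarrow> d < s))"
proof -
  let ?h = "(if q = 1 then 1 else q - 1)"
  show ?thesis
  proof (rule bilipschitz_zero[of "?h * (- ln b)" _ "?h * (- ln a)"])
    have "0 < - ln b" using b by simp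
    then show "0 < ?h * (- ln b)" using q by (intro mult_pos_pos) auto
    fix s s' :: real assume s: "0 \<le> s" "s \<le> s'"
    have lim: "(\<lambda>k. log_sum q s' k / real k - log_sum q s k / real k) \<longlonglongrightarrow> pressure q s' - pressure q s"
      using s by (intro tendsto_diff pressure_limit q) auto
    show "?h * (- ln b) * (s' - s) \<le> pressure q s' - pressure q s"
    proof (rule tendsto_lowerbound[OF lim])
      show "\<forall>\<^sub>F k in sequentially. ?h * (- ln b) * (s' - s) \<le> log_sum q s' k / real k - log_sum q s k / real k"
        using eventually_gt_at_top[of 0]
      proof eventually_elim
        case (elim k)
        then show ?case using log_sum_ratio(1)[OF q s, of k] unfolding diff_divide_distrib[symmetric] by (subst le_divide_eq) simp
      qed
    qed simp
    show "pressure q s' - pressure q s \<le> ?h * (- ln a) * (s' - s)"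
    proof (rule tendsto_upperbound[OF lim])
      show "\<forall>\<^sub>F k in sequentially. log_sum q s' k / real k - log_sum q s k / real k \<le> ?h * (- ln a) * (s' - s)"
        using eventually_gt_at_top[of 0]
      proof eventually_elim
        case (elim k)
        then show ?case using log_sum_ratio(2)[OF q s, of k] unfolding diff_divide_distrib[symmetric] by (subst divide_le_eq) simp
      qed
    qed simp
  next
    show "pressure q 0 \<le> 0"
    proof (rule tendsto_upperbound[OF pressure_limit(1)[OF q order_refl]])
      show "\<forall>\<^sub>F k in sequentially. log_sum q 0 k / real k \<le> 0"
        using log_sum_zero_le[OF q] by (intro always_eventually allI divide_nonpos_nonneg) auto
    qed simp
  qed
qed

end

text \<open>For negative arguments the bound is moved to \<open>y = - x\<close> by
  \<open>(1 + y + y\<^sup>2 / 2) * (1 - y + y\<^sup>2) \<ge> 1\<close>, where the first factor is at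
  most \<open>exp y\<close>.\<close>

lemma exp_le_quadratic:
  fixes x :: real
  assumes "\<bar>x\<bar> \<le> 1"
  shows "exp x \<le> 1 + x + x\<^sup>2"
proof (cases "0 \<le> x")
  case True
  then show ?thesis using assms by (intro exp_bound) auto
next
  case False
  define y where "y = - x"
  have y: "0 \<le> y" using False by (simp add: y_def)
  have e: "1 + y + y\<^sup>2 / 2 \<le> exp y" using exp_lower_Taylor_quadratic[OF y] .
  have "1 \<le> (1 + y + y\<^sup>2 / 2) * (1 - y + y\<^sup>2)"
  proof -
    have "(1 + y + y\<^sup>2 / 2) * (1 - y + y\<^sup>2) = 1 + (y\<^sup>2 / 2 + y ^ 3 / 2 + y ^ 4 / 2)"
      by (simp add: algebra_simps add_divide_distrib diff_divide_distrib power2_eq_square power3_eq_cube power4_eq_xxxx)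
    then show ?thesis using y by simp
  qed
  also have "\<dots> \<le> exp y * (1 - y + y\<^sup>2)"
  proof (rule mult_right_mono[OF e])
    have "0 \<le> (y - 1 / 2)\<^sup>2 + 3 / 4" by (intro add_nonneg_nonneg) auto
    then show "0 \<le> 1 - y + y\<^sup>2" by (simp add: power2_eq_square algebra_simps)
  qed
  finally have "exp x \<le> exp x * (exp y * (1 - y + y\<^sup>2))" by simp
  also have "\<dots> = 1 + x + x\<^sup>2" by (simp add: y_def exp_minus_inverse flip: mult.assoc)
  finally show ?thesis .
qed

lemma sum_power_le_geometric:
  fixes x :: real
  assumes "0 \<le> x" "x < 1"
  shows "(\<Sum>k=l..n. x ^ k) \<le> x ^ l / (1 - x)"
proof (cases "l \<le> n")
  case True
  have "(\<Sum>k=l..n. x ^ k) = (x ^ l - x ^ Suc n) / (1 - x)" using sum_gp[of x l n] True assms by simp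
  also have "\<dots> \<le> x ^ l / (1 - x)" using assms by (intro divide_right_mono) auto
  finally show ?thesis .
qed (use assms in auto)

lemma eventually_unit_interval: "\<forall>\<^sub>F r in at_right (0::real). 0 < r \<and> r < 1"
  by (rule eventually_at_rightI[of 0 1]) auto

section \<open>Cut set sums for \<open>q > 1\<close>\<close>

context affine_words
begin

lemma filterlim_ln_ratio:
  fixes c :: real
  assumes "0 < c" "c < 1"
  shows "filterlim (\<lambda>r. ln r / ln c) at_top (at_right 0)"
proof -
  have "0 < - ln c" using assms by simp
  then have c: "0 < 1 / (- ln c)" by (rule divide_pos_pos[OF zero_less_one])
  have "filterlim (\<lambda>r. - ln r) at_top (at_right (0::real))"
    using ln_at_0 by (simp add: filterlim_uminus_at_top)
  then have "filterlim (\<lambda>r. 1 / (- ln c) * - ln r) at_top (at_right (0::real))"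
    by (rule filterlim_tendsto_pos_mult_at_top[OF tendsto_const c])
  then show ?thesis by simp
qed

lemma sum_words_le:
  assumes F: "F \<subseteq> words n0" "\<And>u. u \<in> F \<Longrightarrow> l \<le> length u \<and> length u \<le> n" and f: "\<And>u. 0 \<le> (f u :: real)"
  shows "(\<Sum>u\<in>F. f u) \<le> (\<Sum>k=l..n. \<Sum>u\<in>W k. f u)"
proof -
  have "F \<subseteq> (\<Union>k\<in>{l..n}. W k)" using F by (auto simp: words_of_length_iff)
  then have "(\<Sum>u\<in>F. f u) \<le> (\<Sum>u\<in>(\<Union>k\<in>{l..n}. W k). f u)" using f by (intro sum_mono2) auto
  also have "\<dots> = (\<Sum>k=l..n. \<Sum>u\<in>W k. f u)"
    by (intro sum.UNION_disjoint) (auto simp: words_of_length_iff)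
  finally show ?thesis .
qed

lemma sum_le_geometric:
  fixes f :: "nat list \<Rightarrow> real" and C x :: real
  assumes F: "finite F" "F \<subseteq> words n0" "\<And>u. u \<in> F \<Longrightarrow> l \<le> length u"
    and f: "\<And>u. 0 \<le> f u" and le: "\<And>k. (\<Sum>u\<in>W k. f u) \<le> C * x ^ k" and x: "0 < x" "x < 1"
  shows "(\<Sum>u\<in>F. f u) \<le> C * x ^ l / (1 - x)"
proof -
  have C: "0 \<le> C"
  proof -
    have "0 \<le> (\<Sum>u\<in>W 0. f u)" using f by (intro sum_nonneg)
    then show ?thesis using le[of 0] by simp
  qed
  define n where "n = Max (length ` F)"
  have "(\<Sum>u\<in>F. f u) \<le> (\<Sum>k=l..n. \<Sum>u\<in>W k. f u)"
    using F f by (intro sum_words_le) (auto simp: n_def)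
  also have "\<dots> \<le> (\<Sum>k=l..n. C * x ^ k)" using le by (intro sum_mono)
  also have "\<dots> = C * (\<Sum>k=l..n. x ^ k)" by (simp add: sum_distrib_left)
  also have "\<dots> \<le> C * (x ^ l / (1 - x))" using x C by (intro mult_left_mono sum_power_le_geometric) auto
  finally show ?thesis by simp
qed

lemma sum_q_le_exp:
  assumes q: "1 < q" and s: "0 \<le> s"
  shows "sum_q q s k \<le> exp (defect q s) * exp (pressure q s) ^ k"
proof -
  have "exp (ln (sum_q q s k)) \<le> exp (real k * pressure q s + defect q s)"
    using pressure_limit(2)[of q s k] q s by (simp add: log_sum_def)
  also have "\<dots> = exp (defect q s) * exp (pressure q s) ^ k" by (simp add: exp_add exp_of_nat_mult)
  finally show ?thesis using sum_q_pos[OF s, of q k] by simp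
qed

text \<open>With negative pressure the sum over all words is dominated by a geometric series, and it
  bounds every cut set sum, uniformly in \<open>r\<close>.\<close>

lemma crit_sum_bounded_gt1:
  assumes q: "1 < q" and s: "0 < s" and P: "pressure q s < 0"
  shows "\<exists>B. \<forall>r. 0 < r \<and> r < 1 \<longrightarrow> crit_sum n0 T p q s r \<le> B"
proof (intro exI allI impI)
  fix r :: real assume r: "0 < r \<and> r < 1"
  have "(\<Sum>u\<in>cut s r. term_q q s u) \<le> exp (defect q s) * exp (pressure q s) ^ 0 / (1 - exp (pressure q s))"
    using q s r P sum_q_le_exp[OF q, of s]
    by (intro sum_le_geometric) (auto simp: finite_cut term_q_nonneg sum_q_def cut_words)
  then show "crit_sum n0 T p q s r \<le> exp (defect q s) * exp (pressure q s) ^ 0 / (1 - exp (pressure q s))"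
    using q by (simp add: crit_sum_eq)
qed

text \<open>
  The product of the normalised block sums of \<open>term_q\<close> over blocks of length \<open>N\<close> is a
  probability weight, which supermultiplicativity compares with \<open>term_q\<close> itself.
\<close>

primrec block_weight :: "real \<Rightarrow> real \<Rightarrow> nat \<Rightarrow> nat \<Rightarrow> nat list \<Rightarrow> real" where
  "block_weight q s N 0 x = 1"
| "block_weight q s N (Suc n) x = term_q q s (take N x) / sum_q q s N * block_weight q s N n (drop N x)"

lemma block_weight_append:
  "length x = j * N \<Longrightarrow> block_weight q s N (j + m) (x @ y) = block_weight q s N j x * block_weight q s N m y"
  by (induction j arbitrary: x) auto

lemma sum_block_weight:
  assumes s: "0 \<le> s"
  shows "(\<Sum>x\<in>W (n * N). block_weight q s N n x) = 1"
proof (induction n)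
  case 0 show ?case by (simp add: words_of_length_0)
next
  case (Suc n)
  have "(\<Sum>x\<in>W (Suc n * N). block_weight q s N (Suc n) x) =
      (\<Sum>u\<in>W N. \<Sum>v\<in>W (n * N). term_q q s u / sum_q q s N * block_weight q s N n v)"
    unfolding mult_Suc sum_words_append by (intro sum.cong refl) (auto simp: words_of_length_iff)
  also have "\<dots> = (\<Sum>u\<in>W N. term_q q s u / sum_q q s N)" by (simp only: sum_distrib_left[symmetric] Suc mult_1_right)
  also have "\<dots> = 1" using sum_q_pos[OF s, of q N] by (simp add: sum_divide_distrib[symmetric] sum_q_def)
  finally show ?case .
qed

lemma term_q_Nil_pos: "0 \<le> s \<Longrightarrow> 0 < term_q q s []"
  using psi_pos[of "[]" s] by (simp add: term_q_def word_prob_def)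

text \<open>Each further block costs the constant of \<open>term_q_append_ge\<close> and a division
  by the block sum, so \<open>j\<close> blocks give the \<open>j\<close>-th power of the product of
  the two. The term of the empty word starts the induction.\<close>

lemma block_weight_le:
  assumes s: "0 \<le> s" and q: "1 \<le> q" and x: "x \<in> W (j * N)"
  shows "block_weight q s N j x \<le> term_q q s x / (term_q q s [] * (exp (- (q - 1) * submult_const s) * sum_q q s N) ^ j)"
  using x
proof (induction j arbitrary: x)
  case 0
  then show ?case using term_q_Nil_pos[OF s, of q] by (simp add: words_of_length_0)
next
  case (Suc j)
  let ?c = "exp (- (q - 1) * submult_const s)" and ?S = "sum_q q s N"
  let ?u = "take N x" and ?v = "drop N x"
  have w: "?u \<in> words n0" "?v \<in> words n0" "?v \<in> W (j * N)"
    using Suc.prems by (auto simp: words_of_length_iff words_take words_drop)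
  have S: "0 < ?S" using sum_q_pos[OF s] .
  have pos: "0 < term_q q s [] * (?c * ?S) ^ j" using S term_q_Nil_pos[OF s, of q] by simp
  have "block_weight q s N (Suc j) x = term_q q s ?u / ?S * block_weight q s N j ?v" by simp
  also have "\<dots> \<le> term_q q s ?u / ?S * (term_q q s ?v / (term_q q s [] * (?c * ?S) ^ j))"
    using Suc.IH[OF w(3)] S by (intro mult_left_mono) (auto simp: term_q_nonneg)
  also have "\<dots> = ?c * (term_q q s ?u * term_q q s ?v) / (term_q q s [] * (?c * ?S) ^ Suc j)"
    using S by (simp add: field_simps)
  also have "\<dots> \<le> term_q q s (?u @ ?v) / (term_q q s [] * (?c * ?S) ^ Suc j)"
    using term_q_append_ge[OF w(1,2) s q] S term_q_Nil_pos[OF s, of q] by (intro divide_right_mono) auto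
  finally show ?case by simp
qed

lemma cut_length_le:
  assumes "u \<in> cut s r" "0 < s" "b ^ L \<le> r"
  shows "length u \<le> L"
proof (rule ccontr)
  assume "\<not> length u \<le> L"
  then have "b ^ (length u - 1) \<le> b ^ L" using b by (intro power_decreasing) auto
  then show False using cut_power(2)[OF assms(1,2)] assms(3) by simp
qed

text \<open>The block weights spread mass 1 over the words of length \<open>n * N\<close>, hence
  over the cut set. Below a cut word they carry at most a constant times its term, divided by a
  power of \<open>k\<close> with one factor per block it spans. Since \<open>k > 1\<close> and the
  number of blocks is at least \<open>ln r / ln a / N\<close>, the cut set sum has to grow.\<close>

lemma crit_sum_at_top_gt1:
  assumes q: "1 < q" and s: "0 < s" and P: "0 < pressure q s"
  shows "filterlim (crit_sum n0 T p q s) at_top (at_right 0)"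
proof -
  have s0: "0 \<le> s" and q1: "1 \<le> q" using s q by auto
  let ?c = "exp (- (q - 1) * submult_const s)"
  have "\<forall>\<^sub>F N in sequentially. pressure q s / 2 < log_sum q s N / real N"
    using order_tendstoD(1)[OF pressure_limit(1)[OF q1 s0], of "pressure q s / 2"] P by simp
  moreover have "\<forall>\<^sub>F N in sequentially. 2 * defect q s / pressure q s + 1 < real N"
    using filterlim_real_sequentially unfolding filterlim_at_top_dense by blast
  moreover have "\<forall>\<^sub>F N in sequentially. 0 < (N::nat)" by (rule eventually_gt_at_top)
  ultimately have "\<forall>\<^sub>F N in sequentially. 0 < N \<and> defect q s < log_sum q s N"
  proof eventually_elim
    case (elim N)
    then have "real N * (pressure q s / 2) < log_sum q s N" by (simp add: field_simps)
    moreover have "defect q s < real N * (pressure q s / 2)" using elim P by (simp add: field_simps)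
    ultimately show ?case using elim by simp
  qed
  then obtain N where N: "0 < N" "defect q s < log_sum q s N" by (auto simp: eventually_sequentially)
  \<comment> \<open>The growth per block after paying the constant of supermultiplicativity;
    \<open>N\<close> has been taken so large that this exceeds 1.\<close>
  define k where "k = ?c * sum_q q s N"
  have "exp (defect q s) < sum_q q s N"
    using N q sum_q_pos[OF s0, of q N] by (simp add: log_sum_def) (metis exp_less_mono exp_ln)
  then have "?c * exp (defect q s) < k" by (simp add: k_def)
  moreover have "?c * exp (defect q s) = 1" using q by (simp add: defect_def exp_add[symmetric] algebra_simps)
  ultimately have k: "1 < k" by simp
  \<comment> \<open>A cut word is padded by \<open>e \<le> N\<close> letters to a multiple of
    \<open>N\<close>. This constant accounts for the number of paddings and for the loss in
    \<open>term_q_extend_le\<close>.\<close>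
  define B where "B = (\<Sum>e\<le>N. real (card (W e))) * (a powr (real N * s * (1 - q)) / term_q q s [])"
  have A: "0 < a powr (real N * s * (1 - q))" using a by simp
  have B: "0 < B"
  proof -
    have "0 < real (card (W 0))" by (simp add: words_of_length_0)
    also have "\<dots> \<le> (\<Sum>e\<le>N. real (card (W e)))" by (intro member_le_sum) auto
    finally show ?thesis using A term_q_Nil_pos[OF s0, of q] by (simp add: B_def)
  qed
  have main: "k powr (ln r / ln a / real N) / B \<le> crit_sum n0 T p q s r" if r: "0 < r" "r < 1" for r
  proof -
    obtain L0 where L0: "b ^ L0 \<le> r" using power_le_ex[OF r(1)] by blast
    define n where "n = L0"
    have bn: "b ^ (n * N) \<le> r"
    proof -
      have "b ^ (n * N) \<le> b ^ n" using b N by (intro power_decreasing) auto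
      then show ?thesis using L0 by (simp add: n_def)
    qed
    let ?l = "ln r / ln a / real N"
    have each: "(\<Sum>y\<in>W (n * N - length u). block_weight q s N n (u @ y)) \<le> B * (term_q q s u / k powr ?l)"
      if u: "u \<in> cut s r" for u
    proof -
      have uw: "u \<in> words n0" using u by (rule cut_words)
      have len: "length u \<le> n * N" using cut_length_le[OF u s bn] .
      \<comment> \<open>The number of blocks needed to contain \<open>u\<close>:
        \<open>length u / N\<close> rounded up.\<close>
      define j where "j = (length u + N - 1) div N"
      have j1: "length u \<le> j * N"
        using N div_mult_mod_eq[of "length u + N - 1" N] mod_less_divisor[OF N(1), of "length u + N - 1"] unfolding j_def by linarith
      have j2: "j * N < length u + N"
        using N div_mult_mod_eq[of "length u + N - 1" N] unfolding j_def by linarith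
      have jn: "j \<le> n"
      proof -
        have "j * N < (n + 1) * N" using j2 len by simp
        then have "j < n + 1" by (simp only: mult_less_cancel2)
        then show ?thesis by simp
      qed
      define e where "e = j * N - length u"
      have e: "e \<le> N" using j2 by (simp add: e_def)
      have split: "n * N - length u = e + (n - j) * N"
        using j1 jn by (simp add: e_def diff_mult_distrib)
      have "(\<Sum>y\<in>W (n * N - length u). block_weight q s N n (u @ y)) =
          (\<Sum>z\<in>W e. \<Sum>y\<in>W ((n - j) * N). block_weight q s N (j + (n - j)) ((u @ z) @ y))"
        unfolding split sum_words_append using jn by simp
      also have "\<dots> = (\<Sum>z\<in>W e. block_weight q s N j (u @ z) * (\<Sum>y\<in>W ((n - j) * N). block_weight q s N (n - j) y))"
        unfolding sum_distrib_left using j1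
        by (intro sum.cong refl block_weight_append) (auto simp: words_of_length_iff e_def)
      also have "\<dots> = (\<Sum>z\<in>W e. block_weight q s N j (u @ z))" by (simp only: sum_block_weight[OF s0] mult_1_right)
      also have "\<dots> \<le> (\<Sum>z\<in>W e. a powr (real N * s * (1 - q)) * term_q q s u / (term_q q s [] * k powr ?l))"
      proof (intro sum_mono)
        fix z assume z: "z \<in> W e"
        then have zw: "z \<in> words n0" "length z = e" by (auto simp: words_of_length_iff)
        have "u @ z \<in> W (j * N)" using uw zw j1 by (auto simp: words_of_length_iff e_def)
        from block_weight_le[OF s0 q1 this]
        have "block_weight q s N j (u @ z) \<le> term_q q s (u @ z) / (term_q q s [] * k ^ j)" by (simp add: k_def)
        also have "\<dots> \<le> (a powr (real N * s * (1 - q)) * term_q q s u) / (term_q q s [] * k powr ?l)"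
        proof (intro frac_le)
          have "term_q q s (u @ z) \<le> a powr (real e * s * (1 - q)) * term_q q s u"
            using term_q_extend_le[OF uw zw(1) s0 q1] zw by simp
          also have "\<dots> \<le> a powr (real N * s * (1 - q)) * term_q q s u"
          proof (rule mult_right_mono[OF powr_mono'])
            have "real e * (s * (q - 1)) \<le> real N * (s * (q - 1))" using e s q by (intro mult_right_mono) auto
            then show "real N * s * (1 - q) \<le> real e * s * (1 - q)" by (simp add: algebra_simps)
          qed (use a in \<open>auto simp: term_q_nonneg\<close>)
          finally show "term_q q s (u @ z) \<le> a powr (real N * s * (1 - q)) * term_q q s u" .
          have "ln r / ln a \<le> real j * real N" using cut_length(1)[OF u s r(1)] j1 by (metis le_trans of_nat_le_iff of_nat_mult order_trans)
          then have "?l \<le> real j" using N pos_divide_le_eq[of "real N" "ln r / ln a" "real j"] by simp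
          then have "k powr ?l \<le> k powr real j" using k by (intro powr_mono) auto
          then show "term_q q s [] * k powr ?l \<le> term_q q s [] * k ^ j"
            using k term_q_Nil_pos[OF s0, of q] by (simp add: powr_realpow)
          show "0 < term_q q s [] * k powr ?l" using k term_q_Nil_pos[OF s0, of q] by simp
        qed (auto simp: term_q_nonneg)
        finally show "block_weight q s N j (u @ z) \<le> a powr (real N * s * (1 - q)) * term_q q s u / (term_q q s [] * k powr ?l)" .
      qed
      also have "\<dots> = real (card (W e)) * (a powr (real N * s * (1 - q)) / term_q q s []) * (term_q q s u / k powr ?l)"
        by simp
      also have "\<dots> \<le> B * (term_q q s u / k powr ?l)"
      proof -
        have "real (card (W e)) \<le> (\<Sum>e\<le>N. real (card (W e)))" using e by (intro member_le_sum) auto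
        then show ?thesis unfolding B_def using A term_q_Nil_pos[OF s0, of q]
          by (intro mult_right_mono) (auto simp: term_q_nonneg)
      qed
      finally show ?thesis .
    qed
    have "1 = (\<Sum>u\<in>cut s r. \<Sum>y\<in>W (n * N - length u). block_weight q s N n (u @ y))"
      using sum_cut[OF s r bn, of "block_weight q s N n"] by (simp only: sum_block_weight[OF s0])
    also have "\<dots> \<le> (\<Sum>u\<in>cut s r. B * (term_q q s u / k powr ?l))" by (intro sum_mono each)
    also have "\<dots> = B / k powr ?l * crit_sum n0 T p q s r"
      using q by (simp add: crit_sum_eq sum_distrib_left sum_divide_distrib)
    finally show ?thesis using B k by (simp add: field_simps)
  qed
  have "filterlim (\<lambda>r. k powr (ln r / ln a / real N) / B) at_top (at_right 0)"
  proof -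
    have 1: "filterlim (\<lambda>r. (ln k / real N) * (ln r / ln a)) at_top (at_right 0)"
      using filterlim_ln_ratio[OF a(1,2)] k N
      by (intro filterlim_tendsto_pos_mult_at_top[OF tendsto_const]) auto
    have "filterlim (\<lambda>r. (1 / B) * exp ((ln k / real N) * (ln r / ln a))) at_top (at_right 0)"
      using B by (intro filterlim_tendsto_pos_mult_at_top[OF tendsto_const] filterlim_compose[OF exp_at_top 1]) auto
    then show ?thesis using k by (simp add: powr_def mult.commute)
  qed
  then show ?thesis
    by (rule filterlim_at_top_mono) (use eventually_unit_interval main in \<open>auto elim!: eventually_mono\<close>)
qed

subsection \<open>The case \<open>q = 1\<close>\<close>

text \<open>Thus \<open>sum_q (1 - t) s k\<close> is the exponential moment of
  \<open>- t * info s\<close> over the words of length \<open>k\<close>.\<close>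

lemma term_q_eq_exp_info:
  assumes "u \<in> words n0" "0 \<le> s"
  shows "term_q (1 - t) s u = pw u * exp (- t * info s u)"
proof (cases "pw u = 0")
  case False
  then have p: "0 < pw u" using pw_nonneg[OF assms(1)] by simp
  note pos = psi_pos[OF assms]
  have "term_q (1 - t) s u = exp (t * ln (psi s u)) * exp ((1 - t) * ln (pw u))"
    using p pos by (simp add: term_q_def powr_def)
  also have "\<dots> = exp (ln (pw u)) * exp (- t * (ln (pw u) - ln (psi s u)))"
    by (simp add: exp_add[symmetric] algebra_simps)
  finally show ?thesis using p pos by (simp add: info_def ln_mult ln_inverse)
qed (simp add: term_q_def)

text \<open>A Chernoff bound for the lower tail of \<open>info\<close>. For
  \<open>q = 1 - t < 1\<close> the sums are submultiplicative, so an estimate for one block length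
  extends to all lengths. Within a block the mean of \<open>info\<close> is close to
  \<open>N\<close> times the pressure, and for small \<open>t\<close> the exponential moment is
  governed by this mean.\<close>

lemma moment_upper:
  assumes s: "0 \<le> s" and e: "0 < e"
  shows "\<exists>t C. 0 < t \<and> t < 1 \<and> 0 < C \<and> (\<forall>k. sum_q (1 - t) s k \<le> C * exp (- t * (pressure 1 s - e)) ^ k)"
proof -
  let ?G = "pressure 1 s" and ?c = "submult_const s"
  have "\<forall>\<^sub>F N in sequentially. ?G - e / 3 < log_sum 1 s N / real N"
    using order_tendstoD(1)[OF pressure_limit(1)[OF order_refl s], of "?G - e / 3"] e by simp
  moreover have "\<forall>\<^sub>F N in sequentially. 3 * ?c / e < real N"
    using filterlim_real_sequentially unfolding filterlim_at_top_dense by blast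
  moreover have "\<forall>\<^sub>F N in sequentially. 0 < (N::nat)" by (rule eventually_gt_at_top)
  \<comment> \<open>The error \<open>e\<close> is shared in thirds by the mean, the
    submultiplicativity constant and the quadratic term.\<close>
  ultimately have "\<forall>\<^sub>F N in sequentially. 0 < N \<and> real N * (?G - e / 3) < mean_info s N \<and> ?c < real N * (e / 3)"
  proof eventually_elim
    case (elim N)
    then show ?case using e by (auto simp: field_simps log_sum_def)
  qed
  then obtain N where N: "0 < N" "real N * (?G - e / 3) < mean_info s N" "?c < real N * (e / 3)"
    by (auto simp: eventually_sequentially)
  define B where "B = 1 + (\<Sum>u\<in>W N. \<bar>info s u\<bar>)"
  have B1: "1 \<le> B" by (simp add: B_def sum_nonneg)
  have B: "\<bar>info s u\<bar> \<le> B" if "u \<in> W N" for u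
    using member_le_sum[of u "W N" "\<lambda>u. \<bar>info s u\<bar>"] that by (simp add: B_def)
  \<comment> \<open>The first bound keeps \<open>t * info s u\<close> in the range of
    \<open>exp_le_quadratic\<close>; the second limits the quadratic term to its third of the
    error.\<close>
  define t where "t = min (1 / (2 * B)) (real N * (e / 3) / B\<^sup>2)"
  have t: "0 < t" "t * B \<le> 1 / 2" "t * B\<^sup>2 \<le> real N * (e / 3)" "t < 1"
  proof -
    show "0 < t" using B1 N e by (simp add: t_def)
    have "t * B \<le> 1 / (2 * B) * B" using B1 by (intro mult_right_mono) (auto simp: t_def)
    then show tB: "t * B \<le> 1 / 2" using B1 by simp
    have "t * B\<^sup>2 \<le> real N * (e / 3) / B\<^sup>2 * B\<^sup>2" by (intro mult_right_mono) (auto simp: t_def)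
    then show "t * B\<^sup>2 \<le> real N * (e / 3)" using B1 by simp
    have "t * 1 \<le> t * B" using B1 \<open>0 < t\<close> by (intro mult_left_mono) auto
    then show "t < 1" using tB by simp
  qed
  let ?S = "sum_q (1 - t) s"
  have SN: "?S N \<le> exp (- t * mean_info s N + t\<^sup>2 * B\<^sup>2)"
  proof -
    have "?S N \<le> (\<Sum>u\<in>W N. pw u * (1 - t * info s u + t\<^sup>2 * B\<^sup>2))"
      unfolding sum_q_def
    proof (intro sum_mono)
      fix u assume u: "u \<in> W N"
      then have uw: "u \<in> words n0" by (simp add: words_of_length_iff)
      have tb: "\<bar>- t * info s u\<bar> \<le> t * B" using B[OF u] t by (simp add: abs_mult)
      have "exp (- t * info s u) \<le> 1 + (- t * info s u) + (- t * info s u)\<^sup>2"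
        using tb t by (intro exp_le_quadratic) auto
      also have "(- t * info s u)\<^sup>2 \<le> (t * B)\<^sup>2" using tb by (metis abs_ge_zero power2_abs power_mono)
      finally have "exp (- t * info s u) \<le> 1 - t * info s u + t\<^sup>2 * B\<^sup>2" by (simp add: power_mult_distrib)
      then show "term_q (1 - t) s u \<le> pw u * (1 - t * info s u + t\<^sup>2 * B\<^sup>2)"
        unfolding term_q_eq_exp_info[OF uw s] using pw_nonneg[OF uw] by (intro mult_left_mono)
    qed
    also have "\<dots> = (\<Sum>u\<in>W N. pw u) * (1 + t\<^sup>2 * B\<^sup>2) - t * mean_info s N"
      unfolding mean_info_def sum_distrib_left sum_distrib_right sum_subtractf[symmetric] by (intro sum.cong refl) (simp add: algebra_simps)
    also have "\<dots> = 1 + (- t * mean_info s N + t\<^sup>2 * B\<^sup>2)" by (simp add: sum_pw)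
    also have "\<dots> \<le> exp (- t * mean_info s N + t\<^sup>2 * B\<^sup>2)" by (rule exp_ge_add_one_self)
    finally show ?thesis .
  qed
  define x where "x = exp (- t * (?G - e))"
  have blk: "exp (t * ?c) * ?S N \<le> x ^ N"
  proof -
    have "exp (t * ?c) * ?S N \<le> exp (t * ?c) * exp (- t * mean_info s N + t\<^sup>2 * B\<^sup>2)" using SN by (intro mult_left_mono) auto
    also have "\<dots> = exp (t * (?c - mean_info s N + t * B\<^sup>2))" by (simp add: exp_add[symmetric] algebra_simps power2_eq_square)
    also have "\<dots> \<le> exp (t * (- (real N * (?G - e))))"
    proof -
      have "?c - mean_info s N + t * B\<^sup>2 \<le> - (real N * (?G - e))" using N t by (simp add: algebra_simps)
      then have "t * (?c - mean_info s N + t * B\<^sup>2) \<le> t * (- (real N * (?G - e)))"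
        using t by (intro mult_left_mono) auto
      then show ?thesis by (simp only: exp_le_cancel_iff)
    qed
    also have "\<dots> = x ^ N" by (simp add: x_def exp_of_nat_mult[symmetric] algebra_simps)
    finally show ?thesis .
  qed
  define M where "M = (\<Sum>j<N. ?S j)"
  \<comment> \<open>Bounds the price of replacing the exponent \<open>n * N\<close> by
    \<open>k\<close> when the remainder is \<open>j < N\<close>.\<close>
  define y where "y = max 1 (inverse x) ^ N"
  have x0: "0 < x" by (simp add: x_def)
  have it: "?S (n * N + j) \<le> (x ^ N) ^ n * ?S j" for n j
  proof (induction n)
    case (Suc n)
    have "?S (Suc n * N + j) \<le> exp (t * ?c) * (?S N * ?S (n * N + j))"
      using sum_q_append_le[of s "1 - t" N "n * N + j"] s t by (simp add: add.assoc)
    also have "\<dots> = (exp (t * ?c) * ?S N) * ?S (n * N + j)" by simp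
    also have "\<dots> \<le> x ^ N * ((x ^ N) ^ n * ?S j)" using blk Suc x0 by (intro mult_mono) (auto simp: sum_q_nonneg)
    finally show ?case by simp
  qed simp
  have "?S k \<le> (M + 1) * y * x ^ k" for k
  proof -
    define n j where "n = k div N" and "j = k mod N"
    have k: "k = n * N + j" "j < N" using N by (auto simp: n_def j_def)
    have "?S k \<le> (x ^ N) ^ n * ?S j" using it[of n j] by (simp add: k)
    also have "\<dots> = x ^ (n * N) * ?S j" by (simp add: power_mult[symmetric] mult.commute)
    also have "\<dots> \<le> x ^ (n * N) * (M + 1)"
    proof -
      have "?S j \<le> M" unfolding M_def using k by (intro member_le_sum) (auto simp: sum_q_nonneg)
      then show ?thesis using x0 by (intro mult_left_mono) auto
    qed
    also have "x ^ (n * N) = x ^ k * inverse x ^ j" using x0 by (simp add: k power_add power_inverse)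
    also have "x ^ k * inverse x ^ j * (M + 1) \<le> x ^ k * y * (M + 1)"
    proof -
      have "inverse x ^ j \<le> max 1 (inverse x) ^ j" using x0 by (intro power_mono) auto
      also have "\<dots> \<le> y" unfolding y_def using k by (intro power_increasing) auto
      finally show ?thesis using x0 by (intro mult_right_mono mult_left_mono) (auto simp: M_def sum_nonneg sum_q_nonneg add_nonneg_nonneg)
    qed
    finally show ?thesis by (simp add: mult_ac)
  qed
  moreover have "0 < (M + 1) * y"
    by (auto simp: M_def y_def sum_nonneg sum_q_nonneg intro!: mult_pos_pos add_nonneg_pos)
  ultimately show ?thesis using t unfolding x_def by blast
qed

text \<open>By Jensen's inequality for the probability weights on the cut set, the mean of
  \<open>- t * info\<close> is at most \<open>ln Z\<close>. By \<open>moment_upper\<close> the sum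
  \<open>Z\<close> is at most a geometric tail over lengths from \<open>ln r / ln a\<close> on, so
  it tends to 0.\<close>

lemma crit_sum_at_top_1:
  assumes s: "0 < s" and P: "0 < pressure 1 s"
  shows "filterlim (crit_sum n0 T p 1 s) at_top (at_right 0)"
proof -
  have s0: "0 \<le> s" using s by simp
  let ?G = "pressure 1 s"
  obtain t C where t: "0 < t" "t < 1" and C: "0 < C"
    and le: "\<And>k. sum_q (1 - t) s k \<le> C * exp (- t * (?G - ?G / 2)) ^ k"
    using moment_upper[OF s0, of "?G / 2"] P by auto
  define x where "x = exp (- t * (?G - ?G / 2))"
  have x: "0 < x" "x < 1" using t P by (auto simp: x_def)
  have main: "- ln (C / (1 - x)) / t + ?G / 2 * (ln r / ln a) \<le> crit_sum n0 T p 1 s r" if r: "0 < r" "r < 1" for r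
  proof -
    define l where "l = nat \<lceil>ln r / ln a\<rceil>"
    have l: "ln r / ln a \<le> real l" unfolding l_def by linarith
    define Z where "Z = (\<Sum>u\<in>cut s r. term_q (1 - t) s u)"
    have Zle: "Z \<le> C * x ^ l / (1 - x)"
      unfolding Z_def
    proof (rule sum_le_geometric)
      fix u assume "u \<in> cut s r"
      from cut_length(1)[OF this s r(1)] show "l \<le> length u" unfolding l_def by linarith
    qed (use finite_cut[OF s r(1)] le x in \<open>auto simp: cut_words term_q_nonneg sum_q_def[symmetric] x_def\<close>)
    have "\<exists>u\<in>cut s r. 0 < pw u"
    proof (rule ccontr)
      assume "\<not> ?thesis"
      then have "(\<Sum>u\<in>cut s r. pw u) \<le> 0" by (intro sum_nonpos) (auto simp: not_less)
      then show False using sum_pw_cut[OF s r] by simp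
    qed
    then obtain u where u: "u \<in> cut s r" "0 < pw u" by blast
    have "0 < term_q (1 - t) s u" unfolding term_q_eq_exp_info[OF cut_words[OF u(1)] s0] using u by simp
    also have "\<dots> \<le> Z" unfolding Z_def using u finite_cut[OF s r(1)] by (intro member_le_sum) (auto simp: term_q_nonneg)
    finally have Z: "0 < Z" .
    have "(\<Sum>u\<in>cut s r. pw u * (- t * info s u)) \<le> (\<Sum>u\<in>cut s r. pw u * (ln Z + (exp (- t * info s u) / Z - 1)))"
    proof (intro sum_mono mult_left_mono)
      fix u assume u: "u \<in> cut s r"
      \<comment> \<open>Jensen in the form \<open>ln x \<le> x - 1\<close> at
        \<open>x = exp (- t * info s u) / Z\<close>, whose weighted mean is 1.\<close>
      have "- t * info s u - ln Z = ln (exp (- t * info s u) / Z)" using Z by (simp add: ln_div)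
      also have "\<dots> \<le> exp (- t * info s u) / Z - 1" using Z by (intro ln_le_minus_one) auto
      finally show "- t * info s u \<le> ln Z + (exp (- t * info s u) / Z - 1)" by simp
      show "0 \<le> pw u" using pw_nonneg cut_words[OF u] by blast
    qed
    also have "\<dots> = (\<Sum>u\<in>cut s r. pw u * (ln Z - 1) + pw u * exp (- t * info s u) / Z)"
      by (intro sum.cong refl) (simp add: algebra_simps)
    also have "\<dots> = (\<Sum>u\<in>cut s r. pw u) * (ln Z - 1) + (\<Sum>u\<in>cut s r. pw u * exp (- t * info s u)) / Z"
      by (simp add: sum.distrib sum_distrib_right sum_divide_distrib)
    also have "(\<Sum>u\<in>cut s r. pw u * exp (- t * info s u)) = Z"
      unfolding Z_def using term_q_eq_exp_info[OF _ s0] by (intro sum.cong refl) (auto simp: cut_words)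
    finally have "- t * crit_sum n0 T p 1 s r \<le> ln Z"
      using Z by (simp add: sum_pw_cut[OF s r] crit_sum_eq sum_distrib_left mult_ac sum_negf)
    also have "\<dots> \<le> ln (C * x ^ l / (1 - x))" using Zle Z by (subst ln_le_cancel_iff) auto
    also have "\<dots> = ln (C / (1 - x)) + real l * ln x"
      using C x by (simp add: ln_mult ln_div ln_realpow)
    also have "ln x = - t * (?G / 2)" by (simp add: x_def)
    also have "ln (C / (1 - x)) + real l * (- t * (?G / 2)) \<le> ln (C / (1 - x)) - t * (?G / 2 * (ln r / ln a))"
    proof -
      have "(ln r / ln a) * (t * (?G / 2)) \<le> real l * (t * (?G / 2))" using l t P by (intro mult_right_mono) auto
      then show ?thesis by (simp add: algebra_simps)
    qed
    finally have "t * (- ln (C / (1 - x)) / t + ?G / 2 * (ln r / ln a)) \<le> t * crit_sum n0 T p 1 s r"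
      using t by (simp add: algebra_simps)
    then show ?thesis using t by simp
  qed
  have "filterlim (\<lambda>r. - ln (C / (1 - x)) / t + ?G / 2 * (ln r / ln a)) at_top (at_right 0)"
    using P filterlim_ln_ratio[OF a(1,2)]
    by (intro filterlim_tendsto_add_at_top[OF tendsto_const] filterlim_tendsto_pos_mult_at_top[OF tendsto_const]) auto
  then show ?thesis
    by (rule filterlim_at_top_mono) (use eventually_unit_interval main in \<open>auto elim!: eventually_mono\<close>)
qed

lemma mean_info_lower:
  assumes s: "0 \<le> s" and e: "0 < e"
  shows "\<exists>D. \<forall>k. real k * (pressure 1 s - e) - D \<le> mean_info s k"
proof -
  let ?G = "pressure 1 s"
  obtain k0 where k0: "\<And>k. k \<ge> k0 \<Longrightarrow> ?G - e < log_sum 1 s k / real k"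
    using order_tendstoD(1)[OF pressure_limit(1)[OF order_refl s], of "?G - e"] e by (auto simp: eventually_sequentially)
  define D where "D = (\<Sum>k\<le>k0. \<bar>mean_info s k - real k * (?G - e)\<bar>)"
  have D0: "0 \<le> D" by (simp add: D_def sum_nonneg)
  have "real k * (?G - e) - D \<le> mean_info s k" for k
  proof (cases "k \<le> k0")
    case True
    then have "\<bar>mean_info s k - real k * (?G - e)\<bar> \<le> D" unfolding D_def by (intro member_le_sum) auto
    then show ?thesis by simp
  next
    case False
    then show ?thesis using k0[of k] D0 by (simp add: log_sum_def field_simps)
  qed
  then show ?thesis by blast
qed

text \<open>Extend the cut words to length \<open>L\<close>. By superadditivity
  \<open>mean_info s L\<close> is, up to a constant, at least the cut set sum plus the average of
  \<open>mean_info\<close> over the remaining lengths. The upper bound for the former and the linear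
  lower bound for the latter leave the negative pressure times the mean cut length, with an error
  proportional to \<open>e * L\<close>.\<close>

lemma crit_sum_bounded_1:
  assumes s: "0 < s" and P: "pressure 1 s < 0"
  shows "\<exists>B. \<forall>r. 0 < r \<and> r < 1 \<longrightarrow> crit_sum n0 T p 1 s r \<le> B"
proof -
  have s0: "0 \<le> s" using s by simp
  let ?G = "pressure 1 s" and ?C = "submult_const s"
  have lab: "ln a < 0" "ln b < 0" using a b by auto
  \<comment> \<open>Cut words have length at least \<open>ln r / ln a\<close>, while
    \<open>L\<close> is about \<open>ln r / ln b\<close>. With this value the error
    \<open>ln r / ln b * e\<close> is cancelled by \<open>ln r / ln a * ?G\<close>.\<close>
  define e where "e = - ?G * (ln b / ln a)"
  have e: "0 < e" using P lab unfolding e_def by (intro mult_pos_pos divide_neg_neg) auto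
  obtain D where D: "\<And>k. real k * (?G - e) - D \<le> mean_info s k" using mean_info_lower[OF s0 e] by blast
  have "crit_sum n0 T p 1 s r \<le> D + 2 * ?C + e" if r: "0 < r" "r < 1" for r
  proof -
    define L where "L = nat \<lceil>ln r / ln b\<rceil>"
    have lr: "0 < ln r / ln b" using lab r by (simp add: divide_neg_neg)
    have L: "ln r / ln b \<le> real L" "real L \<le> ln r / ln b + 1" unfolding L_def using lr by linarith+
    have bL: "b ^ L \<le> r"
    proof -
      have "real L * ln b \<le> ln r" using L(1) lab by (simp add: divide_le_eq)
      then have "ln (b ^ L) \<le> ln r" using b by (simp add: ln_realpow)
      then show ?thesis using b r by (subst (asm) ln_le_cancel_iff) auto
    qed
    have "(\<Sum>u\<in>cut s r. pw u * info s u + pw u * ((real L - real (length u)) * (?G - e) - D - ?C)) \<le> mean_info s L"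
    proof -
      have "(\<Sum>u\<in>cut s r. pw u * info s u + pw u * ((real L - real (length u)) * (?G - e) - D - ?C)) \<le>
          (\<Sum>u\<in>cut s r. \<Sum>v\<in>W (L - length u). pw u * pw v * (info s u + info s v - ?C))"
      proof (intro sum_mono)
        fix u assume u: "u \<in> cut s r"
        have uw: "u \<in> words n0" using u by (rule cut_words)
        have len: "length u \<le> L" using cut_length_le[OF u s bL] .
        have "(\<Sum>v\<in>W (L - length u). pw u * pw v * (info s u + info s v - ?C)) =
            (\<Sum>v\<in>W (L - length u). pw v * (pw u * (info s u - ?C)) + pw u * (pw v * info s v))"
          by (intro sum.cong refl) (simp add: algebra_simps)
        also have "\<dots> = pw u * (info s u - ?C) + pw u * mean_info s (L - length u)"
          by (simp only: sum.distrib sum_distrib_right[symmetric] sum_distrib_left[symmetric] sum_pw mean_info_def mult_1_left)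
        finally have eq: "(\<Sum>v\<in>W (L - length u). pw u * pw v * (info s u + info s v - ?C)) =
            pw u * info s u + pw u * (mean_info s (L - length u) - ?C)" by (simp add: algebra_simps)
        have "(real L - real (length u)) * (?G - e) - D - ?C \<le> mean_info s (L - length u) - ?C"
          using D[of "L - length u"] len by (simp add: of_nat_diff)
        then show "pw u * info s u + pw u * ((real L - real (length u)) * (?G - e) - D - ?C) \<le>
           (\<Sum>v\<in>W (L - length u). pw u * pw v * (info s u + info s v - ?C))"
          unfolding eq using pw_nonneg[OF uw] by (intro add_left_mono mult_left_mono)
      qed
      also have "\<dots> \<le> (\<Sum>u\<in>cut s r. \<Sum>v\<in>W (L - length u). pw (u @ v) * info s (u @ v))"
        by (intro sum_mono pw_info_append_ge s0) (auto simp: cut_words words_of_length_iff)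
      also have "\<dots> = mean_info s L" unfolding mean_info_def by (rule sum_cut[OF s r bL, symmetric])
      finally show ?thesis .
    qed
    moreover have "(\<Sum>u\<in>cut s r. pw u * ((real L - ln r / ln a) * (?G - e) - D - ?C)) +
        (?G - e) * 0 \<le> (\<Sum>u\<in>cut s r. pw u * ((real L - real (length u)) * (?G - e) - D - ?C))"
    proof -
      have "(\<Sum>u\<in>cut s r. pw u * ((real L - ln r / ln a) * (?G - e) - D - ?C)) \<le>
          (\<Sum>u\<in>cut s r. pw u * ((real L - real (length u)) * (?G - e) - D - ?C))"
      proof (intro sum_mono mult_left_mono diff_right_mono)
        fix u assume u: "u \<in> cut s r"
        show "0 \<le> pw u" using pw_nonneg cut_words[OF u] by blast
        show "(real L - ln r / ln a) * (?G - e) \<le> (real L - real (length u)) * (?G - e)"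
          using cut_length(1)[OF u s r(1)] P e by (intro mult_right_mono_neg) auto
      qed
      then show ?thesis by simp
    qed
    ultimately have "crit_sum n0 T p 1 s r + ((real L - ln r / ln a) * (?G - e) - D - ?C) \<le> mean_info s L"
      by (simp add: sum.distrib crit_sum_eq sum_distrib_right[symmetric] sum_pw_cut[OF s r])
    moreover have "mean_info s L \<le> real L * ?G + ?C"
      using pressure_limit(2)[OF order_refl s0, of L] by (simp add: log_sum_def defect_def)
    ultimately have "crit_sum n0 T p 1 s r \<le> D + 2 * ?C + real L * e + (ln r / ln a) * (?G - e)"
      by (simp add: algebra_simps)
    also have "real L * e \<le> (ln r / ln b + 1) * e" using L(2) e by (intro mult_right_mono) auto
    also have "(ln r / ln a) * (?G - e) \<le> (ln r / ln a) * ?G"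
    proof -
      have "0 \<le> ln r / ln a" using lab r by (simp add: divide_nonpos_neg)
      then show ?thesis using e by (intro mult_left_mono) auto
    qed
    finally have "crit_sum n0 T p 1 s r \<le> D + 2 * ?C + (ln r / ln b + 1) * e + (ln r / ln a) * ?G" by simp
    moreover have "ln r / ln b * e = - (ln r / ln a) * ?G" using lab by (simp add: e_def)
    ultimately show ?thesis by (simp add: algebra_simps)
  qed
  then show ?thesis by blast
qed

subsection \<open>Critical values\<close>

lemma crit_sum_bounded:
  assumes "1 \<le> q" "0 < s" "pressure q s < 0"
  shows "\<exists>B. \<forall>r. 0 < r \<and> r < 1 \<longrightarrow> crit_sum n0 T p q s r \<le> B"
  using crit_sum_bounded_1[of s] crit_sum_bounded_gt1[of q s] assms by (cases "q = 1") auto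

lemma crit_sum_at_top:
  assumes "1 \<le> q" "0 < s" "0 < pressure q s"
  shows "filterlim (crit_sum n0 T p q s) at_top (at_right 0)"
  using crit_sum_at_top_1[of s] crit_sum_at_top_gt1[of q s] assms by (cases "q = 1") auto

text \<open>The behaviour of the cut set sum at \<open>s = d\<close> itself is left open: the
  suprema are determined by boundedness for \<open>s < d\<close> and divergence for
  \<open>s > d\<close>. Bounds \<open>y \<le> 0\<close> are met by the inserted
  \<open>0\<close>.\<close>

lemma crit_eq_ge1:
  assumes q: "1 \<le> q" and d: "0 \<le> d" "\<And>s. 0 \<le> s \<Longrightarrow> (pressure q s < 0 \<longleftrightarrow> s < d) \<and> (0 < pressure q s \<longleftrightarrow> d < s)"
  shows "crit_minus n0 T p q = ereal d" "crit_plus n0 T p q = ereal d"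
proof -
  let ?F = "\<lambda>s r. ereal (crit_sum n0 T p q s r)"
  let ?A = "{ereal s | s. 0 < s \<and> Limsup (at_right 0) (?F s) < \<infinity>}"
  let ?B = "{ereal s | s. 0 < s \<and> Liminf (at_right 0) (?F s) < \<infinity>}"
  have "Liminf (at_right 0) (?F s) \<le> Limsup (at_right 0) (?F s)" for s
    by (intro Liminf_le_Limsup) (simp add: trivial_limit_at_right_real)
  then have AB: "?A \<subseteq> ?B" by (blast intro: le_less_trans)
  have up: "Sup (insert 0 ?B) \<le> ereal d"
  proof (rule Sup_least)
    fix x assume "x \<in> insert 0 ?B"
    then consider "x = 0" | s where "x = ereal s" "0 < s" "Liminf (at_right 0) (?F s) < \<infinity>" by auto
    then show "x \<le> ereal d"
    proof cases
      case 2
      have "s \<le> d"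
      proof (rule ccontr)
        assume "\<not> s \<le> d"
        then have "0 < pressure q s" using d(2)[of s] 2 by simp
        then have "filterlim (crit_sum n0 T p q s) at_top (at_right 0)" using 2 q by (intro crit_sum_at_top)
        then have "(?F s \<longlongrightarrow> \<infinity>) (at_right 0)" by (simp add: tendsto_PInfty_eq_at_top)
        then have "Liminf (at_right 0) (?F s) = \<infinity>" by (intro lim_imp_Liminf) (auto simp: trivial_limit_at_right_real)
        then show False using 2 by simp
      qed
      then show ?thesis using 2 by simp
    qed (use d in simp)
  qed
  have lo: "ereal d \<le> Sup (insert 0 ?A)"
  proof (rule dense_le)
    fix y assume y: "y < ereal d"
    show "y \<le> Sup (insert 0 ?A)"
    proof (cases "y \<le> 0")
      case True then show ?thesis by (intro order_trans[OF True] Sup_upper) simp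
    next
      case False
      then obtain s where s: "y = ereal s" "0 < s" "s < d" using y by (cases y) auto
      then have "pressure q s < 0" using d(2)[of s] by simp
      then obtain B where B: "\<And>r. 0 < r \<and> r < 1 \<Longrightarrow> crit_sum n0 T p q s r \<le> B"
        using crit_sum_bounded[OF q s(2)] by blast
      have "Limsup (at_right 0) (?F s) \<le> ereal B"
        by (intro Limsup_bounded) (use eventually_unit_interval B in \<open>auto elim!: eventually_mono\<close>)
      then have "Limsup (at_right 0) (?F s) < \<infinity>" by (rule le_less_trans) simp
      then show ?thesis using s by (intro Sup_upper) auto
    qed
  qed
  have "Sup (insert 0 ?A) \<le> Sup (insert 0 ?B)" using AB by (intro Sup_subset_mono) auto
  then show "crit_minus n0 T p q = ereal d" "crit_plus n0 T p q = ereal d"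
    using up lo q unfolding crit_minus_def crit_plus_def by (simp_all only: if_True)
qed

text \<open>A renewal argument: a word longer than \<open>L\<close> is a cut word followed by
  another word, so the sum \<open>M k\<close> over all words up to length \<open>k\<close> satisfies
  \<open>M k \<le> M L + M k / 2\<close>. The cut set belongs to \<open>s0\<close> and the terms to
  \<open>s\<close>, because the singular value that defines a cut changes with its
  parameter.\<close>

lemma total_sum_bounded:
  assumes q: "q < 1" and s: "0 \<le> s" and s0: "0 < s0" and r: "0 < r" "r < 1"
    and small: "exp ((1 - q) * submult_const s) * (\<Sum>u\<in>cut s0 r. term_q q s u) \<le> 1 / 2"
  shows "\<exists>B. \<forall>F. finite F \<longrightarrow> F \<subseteq> words n0 \<longrightarrow> (\<Sum>u\<in>F. term_q q s u) \<le> B"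
proof -
  let ?C = "exp ((1 - q) * submult_const s)" and ?Z = "cut s0 r"
  define V where "V k = (\<Union>j\<le>k. W j)" for k
  have V: "u \<in> V k \<longleftrightarrow> u \<in> words n0 \<and> length u \<le> k" for u k by (auto simp: V_def words_of_length_iff)
  have finV: "finite (V k)" for k by (auto simp: V_def)
  define M where "M k = (\<Sum>u\<in>V k. term_q q s u)" for k
  obtain L where L: "b ^ L \<le> r" using power_le_ex[OF r(1)] by blast
  have finZ: "finite ?Z" using finite_cut[OF s0 r(1)] .
  have M: "M k \<le> 2 * M L" for k
  proof -
    have "V k \<subseteq> V L \<union> (\<lambda>(z, v). z @ v) ` (?Z \<times> V k)"
    proof
      fix w assume w: "w \<in> V k"
      show "w \<in> V L \<union> (\<lambda>(z, v). z @ v) ` (?Z \<times> V k)"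
      proof (cases "length w \<le> L")
        case True then show ?thesis using w by (simp add: V)
      next
        case False
        then have "take L w \<in> W L" using w by (auto simp: V words_of_length_iff words_take)
        then have "take L w \<in> (\<lambda>(u, v). u @ v) ` (SIGMA u:?Z. W (L - length u))"
          using bij_betw_imp_surj_on[OF bij_betw_cut[OF s0 r L]] by simp
        then obtain u v where uv: "u \<in> ?Z" "v \<in> W (L - length u)" "take L w = u @ v" by auto
        have eq: "w = u @ (v @ drop L w)" using uv(3) by (metis append.assoc append_take_drop_id)
        have "v @ drop L w \<in> words n0" using w uv(2) by (simp add: V words_of_length_iff words_drop)
        moreover have "length (v @ drop L w) \<le> length w" using arg_cong[OF eq, of length] by simp
        ultimately have "(u, v @ drop L w) \<in> ?Z \<times> V k" using uv(1) w by (simp add: V)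
        then show ?thesis using eq by (intro UnI2 rev_image_eqI) auto
      qed
    qed
    then have "M k \<le> (\<Sum>u\<in>V L \<union> (\<lambda>(z, v). z @ v) ` (?Z \<times> V k). term_q q s u)"
      unfolding M_def using finV finZ by (intro sum_mono2) (auto simp: term_q_nonneg)
    also have "\<dots> \<le> M L + (\<Sum>u\<in>(\<lambda>(z, v). z @ v) ` (?Z \<times> V k). term_q q s u)"
    proof -
      have un: "(\<Sum>u\<in>A \<union> B. term_q q s u) \<le> (\<Sum>u\<in>A. term_q q s u) + (\<Sum>u\<in>B. term_q q s u)" if "finite A" "finite B" for A B
      proof -
        have "(\<Sum>u\<in>A \<union> (B - A). term_q q s u) = (\<Sum>u\<in>A. term_q q s u) + (\<Sum>u\<in>B - A. term_q q s u)"
          using that by (intro sum.union_disjoint) auto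
        also have "(\<Sum>u\<in>B - A. term_q q s u) \<le> (\<Sum>u\<in>B. term_q q s u)"
          using that by (intro sum_mono2) (auto simp: term_q_nonneg)
        finally show ?thesis by simp
      qed
      show ?thesis unfolding M_def by (rule un) (use finV finZ in auto)
    qed
    also have "(\<Sum>u\<in>(\<lambda>(z, v). z @ v) ` (?Z \<times> V k). term_q q s u) \<le> (\<Sum>(z, v)\<in>?Z \<times> V k. term_q q s (z @ v))"
      using finV finZ sum_image_le[of "?Z \<times> V k" "term_q q s" "\<lambda>(z, v). z @ v"]
      by (simp add: split_beta comp_def term_q_nonneg)
    also have "\<dots> \<le> (\<Sum>(z, v)\<in>?Z \<times> V k. ?C * (term_q q s z * term_q q s v))"
      using q s by (intro sum_mono) (auto simp: V cut_words intro!: term_q_append_le)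
    also have "\<dots> = (?C * (\<Sum>u\<in>?Z. term_q q s u)) * M k"
      by (simp only: sum.cartesian_product[symmetric] M_def sum_distrib_left[symmetric] sum_distrib_right[symmetric] mult.assoc)
    also have "\<dots> \<le> 1 / 2 * M k" using small by (intro mult_right_mono) (auto simp: M_def sum_nonneg term_q_nonneg)
    finally show ?thesis by simp
  qed
  have "(\<Sum>u\<in>F. term_q q s u) \<le> 2 * M L" if F: "finite F" "F \<subseteq> words n0" for F
  proof -
    have "F \<subseteq> V (Max (length ` F))" using F by (auto simp: V)
    then have "(\<Sum>u\<in>F. term_q q s u) \<le> M (Max (length ` F))"
      unfolding M_def using finV by (intro sum_mono2) (auto simp: term_q_nonneg)
    then show ?thesis using M order_trans by blast
  qed
  then show ?thesis by blast
qed

text \<open>If the lower limit is finite at \<open>s\<close> and \<open>s' > s\<close>, then at some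
  small scale the terms of order \<open>s'\<close> over the cut set of \<open>s\<close> sum to less
  than the threshold of \<open>total_sum_bounded\<close>, because the cut words are long there. Then
  the sum of order \<open>s'\<close> over all words is bounded, and with it every cut set sum, so
  the upper limit at \<open>s'\<close> is finite too.\<close>

lemma crit_eq_lt1:
  assumes q: "q < 1"
  shows "crit_minus n0 T p q = crit_plus n0 T p q"
proof -
  let ?F = "\<lambda>s r. ereal (crit_sum n0 T p q s r)"
  let ?A = "{ereal s | s. 0 < s \<and> Limsup (at_right 0) (?F s) < \<infinity>}"
  let ?B = "{ereal s | s. 0 < s \<and> Liminf (at_right 0) (?F s) < \<infinity>}"
  have "Liminf (at_right 0) (?F s) \<le> Limsup (at_right 0) (?F s)" for s
    by (intro Liminf_le_Limsup) (simp add: trivial_limit_at_right_real)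
  then have AB: "?A \<subseteq> ?B" by (blast intro: le_less_trans)
  have up: "ereal s' \<in> ?A" if s: "0 < s" "Liminf (at_right 0) (?F s) < \<infinity>" and ss: "s < s'" for s s'
  proof -
    have s': "0 \<le> s'" "0 < s'" using s ss by auto
    have "Liminf (at_right 0) (?F s) \<noteq> \<infinity>" using s(2) by simp
    then have "\<exists>n. Liminf (at_right 0) (?F s) < ereal (real n)" by (simp only: less_PInf_Ex_of_nat)
    then obtain M0 where M0: "Liminf (at_right 0) (?F s) < ereal (real M0)" ..
    define M where "M = max 1 (real M0)"
    let ?C = "exp ((1 - q) * submult_const s')"
    have fr: "\<exists>\<^sub>F r in at_right 0. crit_sum n0 T p q s r \<le> M"
    proof (rule ccontr)
      assume "\<not> ?thesis"
      then have "\<forall>\<^sub>F r in at_right 0. ereal (real M0) \<le> ?F s r"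
        unfolding not_frequently by (auto elim!: eventually_mono simp: M_def not_le)
      then have "ereal (real M0) \<le> Liminf (at_right 0) (?F s)" by (rule Liminf_bounded)
      then show False using M0 by simp
    qed
    have "((\<lambda>r. ?C * M * exp (- ((- ln b * (s' - s) * (1 - q)) * (ln r / ln a)))) \<longlongrightarrow> ?C * M * 0) (at_right 0)"
    proof (intro tendsto_mult tendsto_const)
      have "0 < - ln b * (s' - s) * (1 - q)" using b ss q by (intro mult_pos_pos) auto
      then have "filterlim (\<lambda>r. (- ln b * (s' - s) * (1 - q)) * (ln r / ln a)) at_top (at_right 0)"
        by (intro filterlim_tendsto_pos_mult_at_top[OF tendsto_const _ filterlim_ln_ratio[OF a(1,2)]])
      then have "filterlim (\<lambda>r. - ((- ln b * (s' - s) * (1 - q)) * (ln r / ln a))) at_bot (at_right 0)"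
        by (simp only: filterlim_uminus_at_top[symmetric] filterlim_uminus_at_bot minus_minus)
      then show "((\<lambda>r. exp (- ((- ln b * (s' - s) * (1 - q)) * (ln r / ln a)))) \<longlongrightarrow> 0) (at_right 0)"
        by (rule filterlim_compose[OF exp_at_bot])
    qed
    then have "\<forall>\<^sub>F r in at_right 0. ?C * M * exp (- ((- ln b * (s' - s) * (1 - q)) * (ln r / ln a))) < 1 / 2"
      by (intro order_tendstoD(2)) auto
    with eventually_unit_interval
    have "\<forall>\<^sub>F r in at_right 0. (0 < r \<and> r < 1) \<and> ?C * M * exp (- ((- ln b * (s' - s) * (1 - q)) * (ln r / ln a))) < 1 / 2"
      by (rule eventually_conj)
    from frequently_eventually_frequently[OF fr this]
    obtain r where r: "0 < r" "r < 1" "crit_sum n0 T p q s r \<le> M"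
      "?C * M * exp (- ((- ln b * (s' - s) * (1 - q)) * (ln r / ln a))) < 1 / 2"
      using frequently_ex by blast
    \<comment> \<open>The gain from passing from \<open>s\<close> to \<open>s'\<close> on cut words,
      whose length is at least \<open>ln r / ln a\<close>.\<close>
    define y where "y = exp (- ((- ln b * (s' - s) * (1 - q)) * (ln r / ln a)))"
    have "(\<Sum>u\<in>cut s r. term_q q s' u) \<le> (\<Sum>u\<in>cut s r. y * term_q q s u)"
    proof (intro sum_mono)
      fix u assume u: "u \<in> cut s r"
      have uw: "u \<in> words n0" using u by (rule cut_words)
      have s0: "0 \<le> s" using s by simp
      have "b powr (real (length u) * (s' - s) * (1 - q)) \<le> b powr (ln r / ln a * (s' - s) * (1 - q))"
        using cut_length(1)[OF u s(1) r(1)] b ss q by (intro powr_mono' mult_right_mono) auto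
      also have "b powr (ln r / ln a * (s' - s) * (1 - q)) = y"
      proof -
        have e: "X * (s' - s) * (1 - q) * ln b = - ((- ln b * (s' - s) * (1 - q)) * X)" for X by (simp add: algebra_simps)
        show ?thesis unfolding y_def e[symmetric] using b by (simp add: powr_def)
      qed
      finally have bpy: "b powr (real (length u) * (s' - s) * (1 - q)) \<le> y" .
      have "psi s' u powr (1 - q) \<le> (b powr (real (length u) * (s' - s)) * psi s u) powr (1 - q)"
        using psi_ratio(2)[OF uw s0, of s'] psi_pos[OF uw s'(1)] ss q by (intro powr_mono2) auto
      also have "\<dots> = b powr (real (length u) * (s' - s) * (1 - q)) * psi s u powr (1 - q)"
        using psi_pos[OF uw s0] by (simp add: powr_mult powr_powr)
      also have "\<dots> \<le> y * psi s u powr (1 - q)" by (rule mult_right_mono[OF bpy]) simp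
      finally have "psi s' u powr (1 - q) * pw u powr q \<le> (y * psi s u powr (1 - q)) * pw u powr q"
        by (intro mult_right_mono) auto
      then show "term_q q s' u \<le> y * term_q q s u" by (simp add: term_q_def mult.assoc)
    qed
    also have "\<dots> = y * crit_sum n0 T p q s r" using q by (simp add: crit_sum_eq sum_distrib_left)
    also have "\<dots> \<le> y * M" using r(3) by (intro mult_left_mono) (auto simp: y_def)
    finally have "?C * (\<Sum>u\<in>cut s r. term_q q s' u) \<le> ?C * (y * M)" by (intro mult_left_mono) auto
    also have "\<dots> \<le> 1 / 2" using r(4) unfolding y_def[symmetric] by (simp add: mult_ac)
    finally obtain B where B: "\<And>F. finite F \<Longrightarrow> F \<subseteq> words n0 \<Longrightarrow> (\<Sum>u\<in>F. term_q q s' u) \<le> B"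
      using total_sum_bounded[OF q s'(1) s(1) r(1,2)] by blast
    have "crit_sum n0 T p q s' \<rho> \<le> B" if "0 < \<rho> \<and> \<rho> < 1" for \<rho>
    proof -
      have "cut s' \<rho> \<subseteq> words n0" using cut_words by blast
      then show ?thesis using B[OF finite_cut[OF s'(2)]] that q by (simp add: crit_sum_eq)
    qed
    then have "Limsup (at_right 0) (?F s') \<le> ereal B"
      by (intro Limsup_bounded) (use eventually_unit_interval in \<open>auto elim!: eventually_mono\<close>)
    then have "Limsup (at_right 0) (?F s') < \<infinity>" by (rule le_less_trans) simp
    then show ?thesis using s' by auto
  qed
  have "Inf ?A \<le> Inf ?B"
  proof (rule Inf_greatest)
    fix x assume "x \<in> ?B"
    then obtain s where s: "x = ereal s" "0 < s" "Liminf (at_right 0) (?F s) < \<infinity>" by auto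
    show "Inf ?A \<le> x"
    proof (rule dense_ge)
      fix y assume y: "x < y"
      then obtain s' where s': "x < ereal s'" "ereal s' < y" using ereal_dense2 by blast
      then have "Inf ?A \<le> ereal s'" using up[OF s(2,3), of s'] s by (intro Inf_lower) auto
      then show "Inf ?A \<le> y" using s' by simp
    qed
  qed
  moreover have "Inf ?B \<le> Inf ?A" using AB by (rule Inf_superset_mono)
  ultimately show ?thesis using q by (simp add: crit_minus_def crit_plus_def)
qed

end

section \<open>The coding map as a series\<close>

lemma length_restr [simp]: "length (restr u k) = k" by (simp add: restr_def)

lemma take_restr: "j \<le> k \<Longrightarrow> take j (restr u k) = restr u j"
  by (simp add: restr_def take_map)

lemma restr_Suc: "restr u (Suc k) = restr u k @ [u k]" by (simp add: restr_def)

lemma restr_add: "restr u (k + j) = restr u k @ restr (\<lambda>i. u (k + i)) j"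
  by (induction j) (auto simp: restr_def)

lemma restr_words: "u \<in> inf_words n0 \<Longrightarrow> restr u k \<in> words n0"
  by (auto simp: restr_def words_iff inf_words_def)

lemma shift_inf_words: "u \<in> inf_words n0 \<Longrightarrow> (\<lambda>i. u (k + i)) \<in> inf_words n0"
  by (auto simp: inf_words_def)

lemma cylinder_Nil: "cylinder n0 [] = inf_words n0" by (simp add: cylinder_def restr_def)

lemma cylinder_iff: "u \<in> cylinder n0 w \<longleftrightarrow> u \<in> inf_words n0 \<and> restr u (length w) = w"
  by (simp add: cylinder_def)

context affine_words
begin

abbreviation M :: "(nat \<Rightarrow> nat) measure" where "M \<equiv> bernoulli_measure n0 p"

lemma prob_space_letter: "prob_space (point_measure {1..n0} (\<lambda>i. ennreal (p i)))"
proof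
  show "emeasure (point_measure {1..n0} (\<lambda>i. ennreal (p i))) (space (point_measure {1..n0} (\<lambda>i. ennreal (p i)))) = 1"
    using p_sum p_nonneg by (simp add: space_point_measure emeasure_point_measure_finite del: One_nat_def)
      (subst sum_ennreal, auto)
qed

sublocale bernoulli: prob_space "bernoulli_measure n0 p"
  unfolding bernoulli_measure_def by (intro prob_space_PiM prob_space_letter)

lemma space_M: "space M = inf_words n0"
  by (simp add: bernoulli_measure_def space_PiM space_point_measure inf_words_def PiE_UNIV_domain image_subset_iff Pi_def)

lemma cylinder_sets [measurable]: "cylinder n0 w \<in> sets M"
proof -
  have "cylinder n0 w = {x \<in> space M. \<forall>j\<in>{..<length w}. x j \<in> {w ! j}}"
  proof -
    have "restr x (length w) = w \<longleftrightarrow> (\<forall>j<length w. x j = w ! j)" for x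
      unfolding restr_def by (subst list_eq_iff_nth_eq) auto
    then show ?thesis by (simp add: cylinder_def Ball_def space_M)
  qed
  also have "\<dots> \<in> sets M"
  proof (rule sets.sets_Collect_finite_All)
    fix j assume "j \<in> {..<length w}"
    have "(\<lambda>x. x j) \<in> M \<rightarrow>\<^sub>M point_measure {1..n0} (\<lambda>i. ennreal (p i))"
      unfolding bernoulli_measure_def by (rule measurable_component_singleton) simp
    moreover have "{w ! j} \<inter> {1..n0} \<in> sets (point_measure {1..n0} (\<lambda>i. ennreal (p i)))" by (auto simp: sets_point_measure)
    ultimately have "(\<lambda>x. x j) -` ({w ! j} \<inter> {1..n0}) \<inter> space M \<in> sets M" by (rule measurable_sets)
    also have "(\<lambda>x. x j) -` ({w ! j} \<inter> {1..n0}) \<inter> space M = {x \<in> space M. x j \<in> {w ! j}}"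
      by (auto simp: space_M inf_words_def)
    finally show "{x \<in> space M. x j \<in> {w ! j}} \<in> sets M" .
  qed simp
  finally show ?thesis .
qed

lemma measure_cylinder_M: "w \<in> words n0 \<Longrightarrow> measure M (cylinder n0 w) = pw w"
  by (rule measure_cylinder_pw)

lemma restr_measurable [measurable]:
  fixes g :: "nat list \<Rightarrow> 'b::topological_space"
  shows "(\<lambda>u. g (restr u k)) \<in> borel_measurable M"
proof -
  have "(\<lambda>u. restr u k) \<in> M \<rightarrow>\<^sub>M count_space (W k)"
  proof (rule measurable_count_space_eq2[THEN iffD2])
    show "(\<lambda>u. restr u k) \<in> space M \<rightarrow> W k \<and> (\<forall>w\<in>W k. (\<lambda>u. restr u k) -` {w} \<inter> space M \<in> sets M)"
    proof (intro conjI ballI)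
      fix w assume w: "w \<in> W k"
      then have "(\<lambda>u. restr u k) -` {w} \<inter> space M = cylinder n0 w"
        by (auto simp: space_M cylinder_iff words_of_length_iff)
      then show "(\<lambda>u. restr u k) -` {w} \<inter> space M \<in> sets M" by simp
    qed (auto simp: space_M words_of_length_iff restr_words)
  qed simp
  moreover have "g \<in> count_space (W k) \<rightarrow>\<^sub>M borel" by simp
  ultimately show ?thesis by (rule measurable_compose)
qed

lemma integral_restr:
  fixes g :: "nat list \<Rightarrow> real"
  shows "(\<integral>u. g (restr u k) \<partial>M) = (\<Sum>w\<in>W k. pw w * g w)"
proof -
  have "(\<integral>u. g (restr u k) \<partial>M) = (\<integral>u. (\<Sum>w\<in>W k. indicator (cylinder n0 w) u * g w) \<partial>M)"
  proof (intro Bochner_Integration.integral_cong refl)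
    fix u assume u: "u \<in> space M"
    then have uw: "restr u k \<in> W k" by (simp add: space_M words_of_length_iff restr_words)
    have "(\<Sum>w\<in>W k. indicator (cylinder n0 w) u * g w) = (\<Sum>w\<in>W k. if w = restr u k then g w else 0)"
      using u by (intro sum.cong refl) (auto simp: space_M cylinder_iff words_of_length_iff indicator_def)
    then show "g (restr u k) = (\<Sum>w\<in>W k. indicator (cylinder n0 w) u * g w)" using uw by simp
  qed
  also have "\<dots> = (\<Sum>w\<in>W k. measure M (cylinder n0 w) * g w)"
    by (subst Bochner_Integration.integral_sum)
       (auto simp: bernoulli.emeasure_eq_measure intro!: sum.cong integrable_mult_left)
  finally show ?thesis by (simp add: measure_cylinder_M words_of_length_iff)
qed

definition proj_term :: "(nat list \<Rightarrow> real^'d) \<Rightarrow> (nat \<Rightarrow> nat) \<Rightarrow> nat \<Rightarrow> real^'d" where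
  "proj_term \<omega> u j = word_mat T (restr u j) *v \<omega> (restr u (Suc j))"

text \<open>The coded point without reference to \<open>J\<close>. The series converges for every
  bounded family of translations and is affine in each single translation, which suits the redrawing
  of one coordinate.\<close>

definition proj :: "(nat list \<Rightarrow> real^'d) \<Rightarrow> (nat \<Rightarrow> nat) \<Rightarrow> real^'d" where
  "proj \<omega> u = (\<Sum>j. proj_term \<omega> u j)"

definition bounded_by :: "real \<Rightarrow> (nat list \<Rightarrow> real^'d) \<Rightarrow> bool" where
  "bounded_by R \<omega> \<longleftrightarrow> (\<forall>w\<in>words n0. norm (\<omega> w) \<le> R)"

text \<open>Radius of a ball that contains all coded points when the translations are bounded by
  \<open>R\<close>.\<close>

definition rad :: "real \<Rightarrow> real" where "rad R = R / (1 - b)"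

lemma geometric_b:
  fixes R :: real and f :: "nat \<Rightarrow> real^'d"
  assumes "\<And>j. norm (f j) \<le> b ^ j * R"
  shows "summable f" "norm (suminf f) \<le> rad R"
proof -
  have s: "summable (\<lambda>j. b ^ j * R)" using b by (intro summable_mult2 summable_geometric) auto
  have n: "summable (\<lambda>j. norm (f j))" by (rule summable_comparison_test[OF _ s]) (use assms in auto)
  then show "summable f" by (rule summable_norm_cancel)
  have "norm (suminf f) \<le> (\<Sum>j. norm (f j))" using n by (rule summable_norm)
  also have "\<dots> \<le> (\<Sum>j. b ^ j * R)" using assms n s by (rule suminf_le)
  also have "\<dots> = rad R" using b suminf_mult2[of "\<lambda>j. b ^ j" R] suminf_geometric[of b] summable_geometric[of b]
    by (simp add: rad_def)
  finally show "norm (suminf f) \<le> rad R" .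
qed

text \<open>The tail after \<open>k\<close> terms is the image, under the matrix of the prefix, of a
  series of the same kind, hence of a point of the ball of radius \<open>rad R\<close>.\<close>

lemma proj_split:
  assumes \<omega>: "bounded_by R \<omega>" and u: "u \<in> inf_words n0"
  obtains y where "norm y \<le> rad R" "proj \<omega> u = (\<Sum>j<k. proj_term \<omega> u j) + word_mat T (restr u k) *v y"
proof -
  let ?v = "\<lambda>i. u (k + i)"
  define f where "f j = word_mat T (restr ?v j) *v \<omega> (restr u (Suc (k + j)))" for j
  have b0: "norm (proj_term \<omega> u j) \<le> b ^ j * R" for j
  proof -
    have "norm (proj_term \<omega> u j) \<le> b ^ j * norm (\<omega> (restr u (Suc j)))"
      using word_mat_bounds(2)[OF restr_words[OF u], of j] by (simp add: proj_term_def)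
    also have "\<dots> \<le> b ^ j * R" using \<omega> restr_words[OF u] b by (intro mult_left_mono) (auto simp: bounded_by_def)
    finally show ?thesis .
  qed
  have bf: "norm (f j) \<le> b ^ j * R" for j
  proof -
    have "norm (f j) \<le> b ^ j * norm (\<omega> (restr u (Suc (k + j))))"
      using word_mat_bounds(2)[OF restr_words[OF shift_inf_words[OF u]], of k j] by (simp add: f_def)
    also have "\<dots> \<le> b ^ j * R" using \<omega> restr_words[OF u] b by (intro mult_left_mono) (auto simp: bounded_by_def)
    finally show ?thesis .
  qed
  have eq: "proj_term \<omega> u (j + k) = word_mat T (restr u k) *v f j" for j
    by (simp add: proj_term_def f_def add.commute[of j k] restr_add word_mat_append matrix_vector_mul_assoc)
  have "proj \<omega> u = (\<Sum>j<k. proj_term \<omega> u j) + (\<Sum>j. word_mat T (restr u k) *v f j)"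
    using suminf_split_initial_segment[OF geometric_b(1)[OF b0], of k] unfolding proj_def eq by simp
  also have "(\<Sum>j. word_mat T (restr u k) *v f j) = word_mat T (restr u k) *v suminf f"
    by (rule bounded_linear.suminf[OF matrix_vector_mul_bounded_linear geometric_b(1)[OF bf], symmetric])
  finally show thesis using that[of "suminf f"] geometric_b(2)[OF bf] by blast
qed

lemma norm_proj_le:
  assumes "bounded_by R \<omega>" "u \<in> inf_words n0"
  shows "norm (proj \<omega> u) \<le> rad R"
proof -
  obtain y where "norm y \<le> rad R" "proj \<omega> u = (\<Sum>j<0. proj_term \<omega> u j) + word_mat T (restr u 0) *v y"
    by (rule proj_split[OF assms])
  then show ?thesis by (simp add: restr_def word_mat_def)
qed

lemma word_set_eq:
  "word_set T J \<omega> w = (\<lambda>x. (\<Sum>j<length w. word_mat T (take j w) *v \<omega> (take (Suc j) w)) + word_mat T w *v x) ` J"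
proof -
  have "foldr (\<circ>) (map (\<lambda>j. prefix_map T \<omega> (take j w)) [1..<Suc (length w)]) id x =
      (\<Sum>j<length w. word_mat T (take j w) *v \<omega> (take (Suc j) w)) + word_mat T w *v x" for x
  \<comment> \<open>Induction from the right: a translation belongs to a prefix, so appending a
    letter leaves the earlier maps unchanged, whereas prepending one would change them all.\<close>
  proof (induction w arbitrary: x rule: rev_induct)
    case Nil show ?case by (simp add: word_mat_def)
  next
    case (snoc i w)
    have m: "map (\<lambda>j. prefix_map T \<omega> (take j (w @ [i]))) [1..<Suc (length (w @ [i]))] =
        map (\<lambda>j. prefix_map T \<omega> (take j w)) [1..<Suc (length w)] @ [prefix_map T \<omega> (w @ [i])]"
      by (auto simp del: One_nat_def)
    have fold: "foldr (\<circ>) (map f js @ [g]) id x = foldr (\<circ>) (map f js) id (g x)" for f :: "nat \<Rightarrow> real^'d \<Rightarrow> real^'d" and js g x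
      by (induction js) auto
    have s: "(\<Sum>j<length w. word_mat T (take j (w @ [i])) *v \<omega> (take (Suc j) (w @ [i]))) =
        (\<Sum>j<length w. word_mat T (take j w) *v \<omega> (take (Suc j) w))"
      by (intro sum.cong refl) auto
    show ?case unfolding m fold snoc
      by (simp add: s prefix_map_def word_mat_append matrix_vector_right_distrib matrix_vector_mul_assoc[symmetric])
         (simp add: word_mat_def)
  qed
  then show ?thesis by (simp add: word_set_def)
qed

text \<open>With the same shift, both points are images under the matrix of \<open>restr u k\<close>
  of points in a bounded set, and this matrix contracts by \<open>b ^ k\<close>.\<close>

lemma coding_map_eq_proj:
  assumes J: "compact J" "J \<noteq> {}" and str: "nonautonomous_structure n0 T J \<omega>"
    and \<omega>: "bounded_by R \<omega>" and u: "u \<in> inf_words n0"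
  shows "coding_map T J \<omega> u = proj \<omega> u"
proof -
  let ?x = "coding_map T J \<omega> u"
  obtain B where B: "\<And>y. y \<in> J \<Longrightarrow> norm y \<le> B" using compact_imp_bounded[OF J(1)] by (auto simp: bounded_iff)
  have "norm (?x - proj \<omega> u) \<le> b ^ k * (B + rad R)" if k: "k \<ge> 1" for k
  proof -
    have "?x \<in> (\<Inter>k\<in>{1..}. word_set T J \<omega> (restr u k))" using coding_map_unique(1)[OF J str u] by simp
    then have "?x \<in> word_set T J \<omega> (restr u k)" using k by blast
    then obtain y where y: "y \<in> J" "?x = (\<Sum>j<k. word_mat T (take j (restr u k)) *v \<omega> (take (Suc j) (restr u k))) + word_mat T (restr u k) *v y"
      by (auto simp: word_set_eq)
    have "(\<Sum>j<k. word_mat T (take j (restr u k)) *v \<omega> (take (Suc j) (restr u k))) = (\<Sum>j<k. proj_term \<omega> u j)"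
      by (intro sum.cong refl) (simp add: proj_term_def take_restr)
    moreover obtain z where z: "norm z \<le> rad R" "proj \<omega> u = (\<Sum>j<k. proj_term \<omega> u j) + word_mat T (restr u k) *v z"
      by (rule proj_split[OF \<omega> u])
    ultimately have "?x - proj \<omega> u = word_mat T (restr u k) *v (y - z)" using y by (simp add: matrix_vector_mult_diff_distrib)
    then have "norm (?x - proj \<omega> u) \<le> b ^ k * norm (y - z)" using word_mat_bounds(2)[OF restr_words[OF u], of k] by simp
    also have "\<dots> \<le> b ^ k * (B + rad R)" using B[OF y(1)] z(1) norm_triangle_ineq4[of y z] b by (intro mult_left_mono) auto
    finally show ?thesis .
  qed
  moreover have "(\<lambda>k. b ^ k * (B + rad R)) \<longlonglongrightarrow> 0 * (B + rad R)" using b by (intro tendsto_mult LIMSEQ_power_zero) auto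
  ultimately have "norm (?x - proj \<omega> u) \<le> 0"
    by (intro LIMSEQ_le_const[of "\<lambda>k. b ^ k * (B + rad R)" 0]) auto
  then show ?thesis by simp
qed

lemma proj_measurable_M [measurable]: "proj \<omega> \<in> borel_measurable M"
  unfolding proj_def proj_term_def restr_Suc
proof (intro borel_measurable_suminf)
  fix j
  have "(\<lambda>u. (\<lambda>w. word_mat T (take j w) *v \<omega> w) (restr u (Suc j))) \<in> borel_measurable M" by (rule restr_measurable)
  then show "(\<lambda>u. word_mat T (restr u j) *v \<omega> (restr u j @ [u j])) \<in> borel_measurable M"
    by (simp add: take_restr restr_Suc[symmetric])
qed

text \<open>\<open>mass \<omega> w\<close> is the part of \<open>\<mu>\<^sup>\<omega>\<close> carried by the cylinder of \<open>w\<close>.\<close>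

definition mass :: "(nat list \<Rightarrow> real^'d) \<Rightarrow> nat list \<Rightarrow> (real^'d) set \<Rightarrow> real" where
  "mass \<omega> w A = measure M {u \<in> cylinder n0 w. proj \<omega> u \<in> A}"

lemma mass_sets [measurable]:
  assumes "A \<in> sets borel"
  shows "{u \<in> cylinder n0 w. proj \<omega> u \<in> A} \<in> sets M"
proof -
  have "{u \<in> cylinder n0 w. proj \<omega> u \<in> A} = cylinder n0 w \<inter> (proj \<omega> -` A \<inter> space M)"
    by (auto simp: cylinder_iff space_M)
  then show ?thesis using assms by (metis cylinder_sets measurable_sets proj_measurable_M sets.Int)
qed

lemma mass_nonneg [simp]: "0 \<le> mass \<omega> w A" by (simp add: mass_def)

lemma mass_le: 
  assumes "w \<in> words n0"
  shows "mass \<omega> w A \<le> pw w"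
proof -
  have "mass \<omega> w A \<le> measure M (cylinder n0 w)" unfolding mass_def by (rule bernoulli.finite_measure_mono) auto
  then show ?thesis by (simp add: measure_cylinder_M assms)
qed

lemma measure_nonautonomous:
  assumes J: "compact J" "J \<noteq> {}" and str: "nonautonomous_structure n0 T J \<omega>"
    and \<omega>: "bounded_by R \<omega>" and A: "A \<in> sets borel"
  shows "measure (nonautonomous_measure n0 T p J \<omega>) A = mass \<omega> [] A"
proof -
  have c: "coding_map T J \<omega> u = proj \<omega> u" if "u \<in> space M" for u
    using coding_map_eq_proj[OF J str \<omega>] that by (simp add: space_M)
  then have "coding_map T J \<omega> \<in> borel_measurable M" by (subst measurable_cong[OF c]) auto
  then have "measure (nonautonomous_measure n0 T p J \<omega>) A = measure M (coding_map T J \<omega> -` A \<inter> space M)"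
    unfolding nonautonomous_measure_def using A by (rule measure_distr)
  also have "coding_map T J \<omega> -` A \<inter> space M = {u \<in> cylinder n0 []. proj \<omega> u \<in> A}"
    using c by (auto simp: space_M cylinder_Nil)
  finally show ?thesis by (simp add: mass_def)
qed

lemma sum_mass_le:
  assumes Z: "finite Z" and disj: "\<And>w w'. w \<in> Z \<Longrightarrow> w' \<in> Z \<Longrightarrow> w \<noteq> w' \<Longrightarrow> cylinder n0 w \<inter> cylinder n0 w' = {}"
    and sub: "\<And>w. w \<in> Z \<Longrightarrow> cylinder n0 w \<subseteq> cylinder n0 v" and A: "A \<in> sets borel"
  shows "(\<Sum>w\<in>Z. mass \<omega> w A) \<le> mass \<omega> v A"
proof -
  have "(\<Sum>w\<in>Z. mass \<omega> w A) = measure M (\<Union>w\<in>Z. {u \<in> cylinder n0 w. proj \<omega> u \<in> A})"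
    unfolding mass_def using disj Z A
    by (intro bernoulli.finite_measure_finite_Union[symmetric]) (auto simp: disjoint_family_on_def)
  also have "\<dots> \<le> mass \<omega> v A" unfolding mass_def using sub A by (intro bernoulli.finite_measure_mono) auto
  finally show ?thesis .
qed

lemma mass_extend:
  assumes A: "A \<in> sets borel" and w: "w \<in> words n0"
  shows "mass \<omega> w A = (\<Sum>v\<in>W N. mass \<omega> (w @ v) A)"
proof -
  have "{u \<in> cylinder n0 w. proj \<omega> u \<in> A} = (\<Union>v\<in>W N. {u \<in> cylinder n0 (w @ v). proj \<omega> u \<in> A})"
    by (auto simp: cylinder_iff words_of_length_iff restr_add restr_words shift_inf_words)
  then have "mass \<omega> w A = measure M (\<Union>v\<in>W N. {u \<in> cylinder n0 (w @ v). proj \<omega> u \<in> A})" by (simp add: mass_def)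
  also have "\<dots> = (\<Sum>v\<in>W N. mass \<omega> (w @ v) A)"
    unfolding mass_def
  proof (rule bernoulli.finite_measure_finite_Union)
    show "(\<lambda>v. {u \<in> cylinder n0 (w @ v). proj \<omega> u \<in> A}) ` W N \<subseteq> sets M" using mass_sets[OF A] by blast
    show "disjoint_family_on (\<lambda>v. {u \<in> cylinder n0 (w @ v). proj \<omega> u \<in> A}) (W N)"
      by (auto simp: disjoint_family_on_def cylinder_iff words_of_length_iff)
  qed simp
  finally show ?thesis .
qed

end

section \<open>Mesh cubes\<close>

lemma mesh_cube_unique:
  assumes r: "0 < r" and "Q \<in> mesh r" "Q' \<in> mesh r" "x \<in> Q" "x \<in> Q'"
  shows "Q = Q'"
proof -
  have fl: "j $ i = \<lfloor>x $ i / r\<rfloor>" if "x \<in> mesh_cube r j" for j i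
  proof -
    have "of_int (j $ i) * r \<le> x $ i" "x $ i < (of_int (j $ i) + 1) * r" using that by (auto simp: mesh_cube_def)
    then have "of_int (j $ i) \<le> x $ i / r" "x $ i / r < of_int (j $ i) + 1" using r by (auto simp: field_simps)
    then show ?thesis by linarith
  qed
  obtain j j' where "Q = mesh_cube r j" "Q' = mesh_cube r j'" using assms by (auto simp: mesh_def)
  moreover from this have "j = j'" using fl assms(4,5) by (simp add: vec_eq_iff)
  ultimately show ?thesis by simp
qed

lemma mesh_covers:
  fixes x :: "real^'d"
  assumes r: "0 < r"
  obtains Q where "Q \<in> mesh r" "x \<in> Q"
proof -
  let ?j = "\<chi> i. \<lfloor>x $ i / r\<rfloor>"
  have "x \<in> mesh_cube r ?j"
  proof -
    have "of_int \<lfloor>x $ i / r\<rfloor> \<le> x $ i / r" "x $ i / r < of_int \<lfloor>x $ i / r\<rfloor> + 1" for i by linarith+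
    then have "of_int \<lfloor>x $ i / r\<rfloor> * r \<le> x $ i" "x $ i < (of_int \<lfloor>x $ i / r\<rfloor> + 1) * r" for i
      using r by (simp_all only: pos_le_divide_eq[symmetric] pos_divide_less_eq[symmetric])
    then show ?thesis by (simp add: mesh_cube_def)
  qed
  then show thesis using that by (auto simp: mesh_def)
qed

lemma mesh_borel:
  fixes Q :: "(real^'d) set"
  assumes "Q \<in> mesh r"
  shows "Q \<in> sets borel"
proof -
  obtain j where j: "Q = mesh_cube r j" using assms by (auto simp: mesh_def)
  have "Q = (\<Inter>i. {x. of_int (j $ i) * r \<le> x $ i} \<inter> {x. x $ i < (of_int (j $ i) + 1) * r})"
    by (auto simp: j mesh_cube_def)
  also have "\<dots> \<in> sets borel"
  proof (intro sets.finite_INT sets.Int)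
    fix i
    show "{x::real^'d. of_int (j $ i) * r \<le> x $ i} \<in> sets borel"
      by (intro borel_closed closed_Collect_le continuous_intros)
    show "{x::real^'d. x $ i < (of_int (j $ i) + 1) * r} \<in> sets borel"
      by (intro borel_open open_Collect_less continuous_intros)
  qed auto
  finally show ?thesis .
qed

lemma mesh_cube_diameter:
  fixes x y :: "real^'d" and r :: real
  assumes "Q \<in> mesh r" "x \<in> Q" "y \<in> Q"
  shows "norm (x - y) \<le> CARD('d) * r"
proof -
  obtain j where j: "Q = mesh_cube r j" using assms by (auto simp: mesh_def)
  have "\<bar>(x - y) $ i\<bar> \<le> r" for i
  proof -
    have "of_int (j $ i) * r \<le> x $ i" "x $ i < (of_int (j $ i) + 1) * r"
      "of_int (j $ i) * r \<le> y $ i" "y $ i < (of_int (j $ i) + 1) * r"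
      using assms by (auto simp: j mesh_cube_def)
    then show ?thesis by (simp add: algebra_simps abs_le_iff)
  qed
  then have "(\<Sum>i\<in>UNIV. \<bar>(x - y) $ i\<bar>) \<le> (\<Sum>i\<in>(UNIV::'d set). r)" by (intro sum_mono)
  then show ?thesis using norm_le_l1_cart[of "x - y"] by simp
qed

text \<open>With \<open>\<rho> = rad R\<close> a finite substitute for the mesh: under bounded
  translations no other cube carries mass.\<close>

definition near_cubes :: "real \<Rightarrow> real \<Rightarrow> (real^'d) set set" where
  "near_cubes r \<rho> = {Q \<in> mesh r. Q \<inter> cball 0 \<rho> \<noteq> {}}"

lemma finite_near_cubes: "0 < r \<Longrightarrow> 0 \<le> \<rho> \<Longrightarrow> finite (near_cubes r \<rho>)"
  unfolding near_cubes_def by (rule mesh_count_ball)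

section \<open>Convexity inequalities\<close>

text \<open>For \<open>x > 0\<close> write \<open>x = y * exp t\<close>: the inequality becomes
  \<open>q * (exp t - 1) + 1 \<le> exp (q * t)\<close>, which is convexity of \<open>exp\<close>
  with \<open>t\<close> as a convex combination of 0 and \<open>q * t\<close>.\<close>

lemma powr_tangent:
  fixes x y q :: real
  assumes "0 \<le> x" "0 < y" "1 \<le> q"
  shows "y powr q + q * y powr (q - 1) * (x - y) \<le> x powr q"
proof (cases "x = 0")
  case True
  have "y powr q = y powr (q - 1) * y" using assms powr_add[of y "q - 1" 1] by simp
  then have "y powr q + q * y powr (q - 1) * (x - y) = (1 - q) * (y powr (q - 1) * y)"
    using True by (simp add: algebra_simps)
  also have "\<dots> \<le> 0" using assms by (intro mult_nonpos_nonneg) auto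
  finally show ?thesis using True by simp
next
  case False
  then have x: "0 < x" using assms by simp
  define t where "t = ln (x / y)"
  have xy: "x = y * exp t" using x assms by (simp add: t_def)
  have e: "q * (exp t - 1) + 1 \<le> exp (q * t)"
  proof (cases "q = 1")
    case True
    then show ?thesis by simp
  next
    case False
    have "exp ((1 - 1 / q) *\<^sub>R 0 + (1 / q) *\<^sub>R (q * t)) \<le> (1 - 1 / q) * exp 0 + (1 / q) * exp (q * t)"
      using assms by (intro convex_onD[OF exp_convex]) auto
    then have "exp t \<le> (1 - 1 / q) + (1 / q) * exp (q * t)" using assms by simp
    then have "q * exp t \<le> q * ((1 - 1 / q) + (1 / q) * exp (q * t))" using assms by (intro mult_left_mono) auto
    also have "\<dots> = exp (q * t) + (q - 1)" using assms by (simp add: field_simps)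
    finally have "q * exp t \<le> exp (q * t) + (q - 1)" .
    then show ?thesis by (simp add: algebra_simps)
  qed
  have "y powr q + q * y powr (q - 1) * (x - y) = y powr q * (q * (exp t - 1) + 1)"
  proof -
    have "y powr q = y powr (q - 1) * y" using assms powr_add[of y "q - 1" 1] by simp
    then show ?thesis by (simp add: xy algebra_simps)
  qed
  also have "\<dots> \<le> y powr q * exp (q * t)" using e by (intro mult_left_mono) auto
  also have "\<dots> = x powr q" using assms by (simp add: xy powr_mult exp_powr_real mult.commute)
  finally show ?thesis .
qed

text \<open>Jensen through the tangent at \<open>y = ?P / N\<close>. As \<open>N\<close> is only an
  upper bound for the number of points, a surplus
  \<open>(q - 1) * (N - real (card F)) * y powr q\<close> appears, and it is nonnegative.\<close>

lemma sum_powr_ge: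
  fixes m :: "'a \<Rightarrow> real"
  assumes F: "finite F" "real (card F) \<le> N" "0 < N" and m: "\<And>x. x \<in> F \<Longrightarrow> 0 \<le> m x" and q: "1 \<le> q"
  shows "N powr (1 - q) * (\<Sum>x\<in>F. m x) powr q \<le> (\<Sum>x\<in>F. m x powr q)"
proof -
  let ?P = "\<Sum>x\<in>F. m x"
  have P0: "0 \<le> ?P" using m by (intro sum_nonneg)
  show ?thesis
  proof (cases "?P = 0")
    case True then show ?thesis by (simp add: sum_nonneg)
  next
    case False
    then have P: "0 < ?P" using P0 by simp
    define y where "y = ?P / N"
    have y: "0 < y" using P F by (simp add: y_def)
    have yq: "y powr q = y powr (q - 1) * y" using y powr_add[of y "q - 1" 1] by simp
    have "N * y powr q \<le> real (card F) * y powr q + q * y powr (q - 1) * (?P - real (card F) * y)"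
    proof -
      have "?P = N * y" using F by (simp add: y_def)
      then have "real (card F) * y powr q + q * y powr (q - 1) * (?P - real (card F) * y) =
         N * y powr q + (q - 1) * (N - real (card F)) * y powr q" by (simp add: yq algebra_simps)
      moreover have "0 \<le> (q - 1) * (N - real (card F)) * y powr q" using q F by simp
      ultimately show ?thesis by simp
    qed
    also have "\<dots> = (\<Sum>x\<in>F. y powr q + q * y powr (q - 1) * (m x - y))"
      by (simp add: sum.distrib sum_distrib_left[symmetric] sum_subtractf)
    also have "\<dots> \<le> (\<Sum>x\<in>F. m x powr q)" using m y q by (intro sum_mono powr_tangent)
    finally have "N * y powr q \<le> (\<Sum>x\<in>F. m x powr q)" .
    moreover have "N * y powr q = N powr (1 - q) * ?P powr q"
      using F P by (simp add: y_def powr_divide powr_diff field_simps)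
    ultimately show ?thesis by simp
  qed
qed

text \<open>Entropy on at most \<open>N\<close> points is largest for equal masses; the inequality
  \<open>ln (y / m x) \<le> y / m x - 1\<close> at \<open>y = ?P / N\<close> plays the role of the
  tangent.\<close>

lemma sum_mult_ln_ge:
  fixes m :: "'a \<Rightarrow> real"
  assumes F: "finite F" "real (card F) \<le> N" "0 < N" and m: "\<And>x. x \<in> F \<Longrightarrow> 0 \<le> m x"
  shows "(\<Sum>x\<in>F. m x) * ln ((\<Sum>x\<in>F. m x) / N) \<le> (\<Sum>x\<in>F. m x * ln (m x))"
proof -
  let ?P = "\<Sum>x\<in>F. m x"
  have P0: "0 \<le> ?P" using m by (intro sum_nonneg)
  show ?thesis
  proof (cases "?P = 0")
    case True
    then have "\<forall>x\<in>F. m x = 0" using m F by (simp add: sum_nonneg_eq_0_iff)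
    then show ?thesis using True by simp
  next
    case False
    then have P: "0 < ?P" using P0 by simp
    define y where "y = ?P / N"
    have y: "0 < y" using P F by (simp add: y_def)
    have t: "m x * ln y + m x - y \<le> m x * ln (m x)" if "x \<in> F" for x
    proof (cases "m x = 0")
      case True then show ?thesis using y by simp
    next
      case False
      then have mx: "0 < m x" using m[OF that] by simp
      have "ln (y / m x) \<le> y / m x - 1" using mx y by (intro ln_le_minus_one) auto
      then have "ln y - ln (m x) \<le> y / m x - 1" using mx y by (simp add: ln_div)
      then have "m x * (ln y - ln (m x)) \<le> m x * (y / m x - 1)" using mx by (intro mult_left_mono) auto
      then show ?thesis using mx by (simp add: algebra_simps)
    qed
    have "?P * ln y \<le> ?P * ln y + ?P - real (card F) * y"
    proof -
      have "real (card F) * y \<le> N * y" using F y by (intro mult_right_mono) auto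
      then show ?thesis using F by (simp add: y_def)
    qed
    also have "\<dots> = (\<Sum>x\<in>F. m x * ln y + m x - y)" by (simp add: sum.distrib sum_subtractf sum_distrib_right)
    also have "\<dots> \<le> (\<Sum>x\<in>F. m x * ln (m x))" using t by (intro sum_mono)
    finally show ?thesis by (simp add: y_def)
  qed
qed

lemma sum_powr_le_powr_sum:
  fixes m :: "'a \<Rightarrow> real"
  assumes F: "finite F" and m: "\<And>x. x \<in> F \<Longrightarrow> 0 \<le> m x" and q: "1 \<le> q" and le: "(\<Sum>x\<in>F. m x) \<le> S"
  shows "(\<Sum>x\<in>F. m x powr q) \<le> S powr q"
proof -
  have "0 \<le> (\<Sum>x\<in>F. m x)" using m by (intro sum_nonneg)
  then have S: "0 \<le> S" using le by linarith
  have mS: "m x \<le> S" if "x \<in> F" for x using member_le_sum[of x F m] that F m le by fastforce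
  have pq: "z powr q = z * z powr (q - 1)" if "0 \<le> z" for z
    using that powr_add[of z 1 "q - 1"] by (cases "z = 0") auto
  have "(\<Sum>x\<in>F. m x powr q) \<le> (\<Sum>x\<in>F. m x * S powr (q - 1))"
  proof (intro sum_mono)
    fix x assume x: "x \<in> F"
    have "m x powr (q - 1) \<le> S powr (q - 1)" using m[OF x] mS[OF x] q by (intro powr_mono2) auto
    then show "m x powr q \<le> m x * S powr (q - 1)" using m[OF x] by (simp add: pq mult_left_mono)
  qed
  also have "\<dots> = (\<Sum>x\<in>F. m x) * S powr (q - 1)" by (simp add: sum_distrib_right)
  also have "\<dots> \<le> S * S powr (q - 1)" using le by (intro mult_right_mono) auto
  finally show ?thesis using pq[OF S] by simp
qed

lemma sum_mult_ln_le:
  fixes m :: "'a \<Rightarrow> real"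
  assumes F: "finite F" and m: "\<And>x. x \<in> F \<Longrightarrow> 0 \<le> m x" and S: "(\<Sum>x\<in>F. m x) = S"
  shows "(\<Sum>x\<in>F. m x * ln (m x)) \<le> S * ln S"
proof -
  have mS: "m x \<le> S" if "x \<in> F" for x using member_le_sum[of x F m] that F m S by fastforce
  have "(\<Sum>x\<in>F. m x * ln (m x)) \<le> (\<Sum>x\<in>F. m x * ln S)"
  proof (intro sum_mono)
    fix x assume x: "x \<in> F"
    show "m x * ln (m x) \<le> m x * ln S"
    proof (cases "m x = 0")
      case False
      then have "0 < m x" using m[OF x] by simp
      then show ?thesis using mS[OF x] by (intro mult_left_mono) auto
    qed simp
  qed
  then show ?thesis using S by (simp add: sum_distrib_right[symmetric])
qed

section \<open>Generalized dimensions and logarithmic moments\<close>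

text \<open>The quotient before division by \<open>ln r\<close>. Since \<open>ln r < 0\<close> at
  small scales, lower bounds for it become upper bounds for the dimension and conversely.\<close>

definition qlog :: "real \<Rightarrow> (real^'d) measure \<Rightarrow> real \<Rightarrow> real" where
  "qlog q \<nu> r = (if q = 1 then (\<Sum>\<^sub>\<infinity>Q\<in>mesh r. measure \<nu> Q * ln (measure \<nu> Q))
     else ln (\<Sum>\<^sub>\<infinity>Q\<in>mesh r. measure \<nu> Q powr q) / (q - 1))"

lemma q_quotient_qlog: "q_quotient q \<nu> r = qlog q \<nu> r / ln r"
  by (simp add: q_quotient_def qlog_def)

lemma tendsto_add_div_ln: "((\<lambda>r. s + C / ln r) \<longlongrightarrow> s) (at_right (0::real))"
proof -
  have "((\<lambda>r. C / ln r) \<longlongrightarrow> 0) (at_right (0::real))"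
    by (rule tendsto_divide_0[OF tendsto_const]) (rule filterlim_at_bot_imp_at_infinity[OF ln_at_0])
  then have "((\<lambda>r. s + C / ln r) \<longlongrightarrow> s + 0) (at_right (0::real))" by (intro tendsto_add tendsto_const)
  then show ?thesis by simp
qed

lemma upper_q_dim_le:
  assumes "\<forall>\<^sub>F r in at_right 0. s * ln r - C \<le> qlog q \<nu> r"
  shows "upper_q_dim q \<nu> \<le> ereal s"
proof -
  have "\<forall>\<^sub>F r in at_right 0. ereal (q_quotient q \<nu> r) \<le> ereal (s + (- C) / ln r)"
    using assms eventually_unit_interval
  proof eventually_elim
    case (elim r)
    then have "ln r < 0" by simp
    then have "qlog q \<nu> r / ln r \<le> (s * ln r - C) / ln r" using elim by (intro divide_right_mono_neg) auto
    then show ?case using \<open>ln r < 0\<close> by (simp add: q_quotient_qlog diff_divide_distrib)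
  qed
  then have "upper_q_dim q \<nu> \<le> Limsup (at_right 0) (\<lambda>r. ereal (s + (- C) / ln r))"
    unfolding upper_q_dim_def by (rule Limsup_mono)
  also have "\<dots> = ereal s"
    using tendsto_add_div_ln[of s "- C"] by (intro lim_imp_Limsup) (auto simp: trivial_limit_at_right_real)
  finally show ?thesis .
qed

lemma lower_q_dim_ge:
  assumes "\<forall>\<^sub>F r in at_right 0. qlog q \<nu> r \<le> s * ln r + C"
  shows "ereal s \<le> lower_q_dim q \<nu>"
proof -
  have "\<forall>\<^sub>F r in at_right 0. ereal (s + C / ln r) \<le> ereal (q_quotient q \<nu> r)"
    using assms eventually_unit_interval
  proof eventually_elim
    case (elim r)
    then have "ln r < 0" by simp
    then have "(s * ln r + C) / ln r \<le> qlog q \<nu> r / ln r" using elim by (intro divide_right_mono_neg) auto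
    then show ?case using \<open>ln r < 0\<close> by (simp add: q_quotient_qlog add_divide_distrib)
  qed
  then have "Liminf (at_right 0) (\<lambda>r. ereal (s + C / ln r)) \<le> lower_q_dim q \<nu>"
    unfolding lower_q_dim_def by (rule Liminf_mono)
  moreover have "Liminf (at_right 0) (\<lambda>r. ereal (s + C / ln r)) = ereal s"
    using tendsto_add_div_ln[of s C] by (intro lim_imp_Liminf) (auto simp: trivial_limit_at_right_real)
  ultimately show ?thesis by simp
qed

section \<open>Upper bounds for the dimension of every admissible family\<close>

context affine_words
begin

lemma mass_outside:
  assumes \<omega>: "bounded_by R \<omega>" and Q: "Q \<inter> cball 0 (rad R) = {}"
  shows "mass \<omega> w Q = 0"
proof -
  have "{u \<in> cylinder n0 w. proj \<omega> u \<in> Q} = {}"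
  proof (intro equals0I)
    fix u assume "u \<in> {u \<in> cylinder n0 w. proj \<omega> u \<in> Q}"
    then have "proj \<omega> u \<in> Q \<inter> cball 0 (rad R)" using norm_proj_le[OF \<omega>, of u] by (auto simp: cylinder_iff)
    then show False using Q by blast
  qed
  then show ?thesis unfolding mass_def by (simp only: measure_empty)
qed

lemma sum_mass_cubes:
  assumes r: "0 < r" and F: "finite F" "F \<subseteq> mesh r" and w: "w \<in> words n0"
    and cov: "\<And>u. u \<in> cylinder n0 w \<Longrightarrow> proj \<omega> u \<in> \<Union>F"
  shows "(\<Sum>Q\<in>F. mass \<omega> w Q) = pw w"
proof -
  have "(\<Sum>Q\<in>F. mass \<omega> w Q) = measure M (\<Union>Q\<in>F. {u \<in> cylinder n0 w. proj \<omega> u \<in> Q})"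
    unfolding mass_def
  proof (rule bernoulli.finite_measure_finite_Union[symmetric])
    show "(\<lambda>Q. {u \<in> cylinder n0 w. proj \<omega> u \<in> Q}) ` F \<subseteq> sets M" using F mesh_borel mass_sets by blast
    show "disjoint_family_on (\<lambda>Q. {u \<in> cylinder n0 w. proj \<omega> u \<in> Q}) F"
      using F mesh_cube_unique[OF r] by (fastforce simp: disjoint_family_on_def)
  qed (rule F)
  also have "(\<Union>Q\<in>F. {u \<in> cylinder n0 w. proj \<omega> u \<in> Q}) = cylinder n0 w" using cov by auto
  finally show ?thesis using w by (simp add: measure_cylinder_M)
qed

lemma proj_near_cube:
  assumes "bounded_by R \<omega>" "0 < r" "u \<in> inf_words n0"
  shows "proj \<omega> u \<in> \<Union>(near_cubes r (rad R))"
proof -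
  obtain Q where "Q \<in> mesh r" "proj \<omega> u \<in> Q" by (rule mesh_covers[OF assms(2)])
  moreover have "proj \<omega> u \<in> cball 0 (rad R)" using norm_proj_le[OF assms(1,3)] by simp
  ultimately show ?thesis unfolding near_cubes_def by blast
qed

lemma sum_mass_near_cubes:
  assumes \<omega>: "bounded_by R \<omega>" and R: "0 < R" and r: "0 < r" and w: "w \<in> words n0"
  shows "(\<Sum>Q\<in>near_cubes r (rad R). mass \<omega> w Q) = pw w"
proof (rule sum_mass_cubes[OF r _ _ w])
  show "finite (near_cubes r (rad R) :: (real^'d) set set)" using R b r by (intro finite_near_cubes) (auto simp: rad_def)
qed (use proj_near_cube[OF \<omega> r] in \<open>auto simp: near_cubes_def cylinder_iff\<close>)

lemma qlog_eq:
  assumes J: "compact J" "J \<noteq> {}" and str: "nonautonomous_structure n0 T J \<omega>"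
    and \<omega>: "bounded_by R \<omega>" and R: "0 < R" and r: "0 < r"
  shows "qlog q (nonautonomous_measure n0 T p J \<omega>) r =
    (if q = 1 then (\<Sum>Q\<in>near_cubes r (rad R). mass \<omega> [] Q * ln (mass \<omega> [] Q))
     else ln (\<Sum>Q\<in>near_cubes r (rad R). mass \<omega> [] Q powr q) / (q - 1))"
proof -
  have R0: "0 \<le> rad R" using R b by (simp add: rad_def)
  have *: "(\<Sum>\<^sub>\<infinity>Q\<in>mesh r. g (measure (nonautonomous_measure n0 T p J \<omega>) Q)) = (\<Sum>Q\<in>near_cubes r (rad R). g (mass \<omega> [] Q))"
    if g: "g 0 = 0" for g :: "real \<Rightarrow> real"
  proof -
    have "(\<Sum>\<^sub>\<infinity>Q\<in>mesh r. g (measure (nonautonomous_measure n0 T p J \<omega>) Q)) = (\<Sum>\<^sub>\<infinity>Q\<in>near_cubes r (rad R). g (mass \<omega> [] Q))"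
    proof (rule infsum_cong_neutral)
      fix Q :: "(real^'d) set" assume "Q \<in> mesh r - near_cubes r (rad R)"
      then have Q: "Q \<in> mesh r" "Q \<inter> cball 0 (rad R) = {}" by (auto simp: near_cubes_def)
      show "g (measure (nonautonomous_measure n0 T p J \<omega>) Q) = 0"
        using measure_nonautonomous[OF J str \<omega> mesh_borel[OF Q(1)]] mass_outside[OF \<omega> Q(2)] g by simp
    next
      fix Q :: "(real^'d) set" assume "Q \<in> mesh r \<inter> near_cubes r (rad R)"
      then have Q: "Q \<in> mesh r" by simp
      show "g (measure (nonautonomous_measure n0 T p J \<omega>) Q) = g (mass \<omega> [] Q)"
        using measure_nonautonomous[OF J str \<omega> mesh_borel[OF Q]] by simp
    qed (auto simp: near_cubes_def)
    also have "\<dots> = (\<Sum>Q\<in>near_cubes r (rad R). g (mass \<omega> [] Q))"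
      by (rule infsum_finite[OF finite_near_cubes[OF r R0]])
    finally show ?thesis .
  qed
  show ?thesis unfolding qlog_def using *[of "\<lambda>x. x * ln x"] *[of "\<lambda>x. x powr q"] by simp
qed

text \<open>The image of the cylinder of \<open>w\<close> lies in a translate of the image of a ball under \<open>T\<^sub>w\<close>.\<close>

lemma cylinder_mesh_cover:
  assumes R: "0 < R"
  shows "\<exists>C>0. \<forall>\<omega> w r. bounded_by R \<omega> \<longrightarrow> w \<in> words n0 \<longrightarrow> 0 < r \<longrightarrow>
    (\<exists>F. finite F \<and> F \<subseteq> near_cubes r (rad R) \<and> real (card F) \<le> C * sv_max r (word_mat T w) \<and>
       (\<forall>u\<in>cylinder n0 w. proj \<omega> u \<in> \<Union>F))"
proof -
  have R0: "0 < rad R" using R b by (simp add: rad_def)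
  define C where "C = 4 ^ CARD('d) * (2 * rad R * CARD('d) + 1) ^ CARD('d)"
  have "\<exists>F. finite F \<and> F \<subseteq> near_cubes r (rad R) \<and> real (card F) \<le> C * sv_max r (word_mat T w) \<and>
       (\<forall>u\<in>cylinder n0 w. proj \<omega> u \<in> \<Union>F)"
    if \<omega>: "bounded_by R \<omega>" and w: "w \<in> words n0" and r: "0 < r" for \<omega> w r
  proof -
    obtain Z where Z: "finite Z" "real (card Z) \<le> (2 * rad R * CARD('d) + 1) ^ CARD('d) * sv_max r (word_mat T w)"
      "(*v) (word_mat T w) ` cball 0 (rad R) \<subseteq> (\<Union>z\<in>Z. cball z r)"
      by (rule ellipsoid_cover[OF word_mat_invertible[OF w] R0 r])
    define k where "k = length w"
    define c where "c = (\<Sum>j<k. word_mat T (take j w) *v \<omega> (take (Suc j) w))"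
    define F where "F = (\<Union>z\<in>Z. {Q \<in> mesh r. Q \<inter> cball (c + z) r \<noteq> {}}) \<inter> near_cubes r (rad R)"
    have fin: "finite {Q \<in> mesh r. Q \<inter> cball (c + z) r \<noteq> {}}" for z using mesh_count_ball(1)[OF r, of r] r by simp
    have "real (card F) \<le> real (card (\<Union>z\<in>Z. {Q \<in> mesh r. Q \<inter> cball (c + z) r \<noteq> {}}))"
      unfolding F_def using Z(1) fin by (intro of_nat_mono card_mono) auto
    also have "\<dots> \<le> (\<Sum>z\<in>Z. real (card {Q \<in> mesh r. Q \<inter> cball (c + z) r \<noteq> {}}))"
      using card_UN_le[OF Z(1), of "\<lambda>z. {Q \<in> mesh r. Q \<inter> cball (c + z) r \<noteq> {}}"] by (simp flip: of_nat_sum)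
    also have "\<dots> \<le> (\<Sum>z\<in>Z. 4 ^ CARD('d))"
    proof (intro sum_mono)
      fix z
      have "2 * r / r + 2 = 4" using r by simp
      then show "real (card {Q \<in> mesh r. Q \<inter> cball (c + z) r \<noteq> {}}) \<le> 4 ^ CARD('d)"
        using mesh_count_ball(2)[OF r, of r "c + z"] r by simp
    qed
    also have "\<dots> = 4 ^ CARD('d) * real (card Z)" by simp
    also have "\<dots> \<le> C * sv_max r (word_mat T w)" unfolding C_def using Z(2) by (simp add: mult.assoc)
    finally have card: "real (card F) \<le> C * sv_max r (word_mat T w)" .
    have "proj \<omega> u \<in> \<Union>F" if u: "u \<in> cylinder n0 w" for u
    proof -
      have ui: "u \<in> inf_words n0" and uk: "restr u k = w" using u by (auto simp: cylinder_iff k_def)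
      obtain y where y: "norm y \<le> rad R" "proj \<omega> u = (\<Sum>j<k. proj_term \<omega> u j) + word_mat T (restr u k) *v y"
        by (rule proj_split[OF \<omega> ui])
      have "(\<Sum>j<k. proj_term \<omega> u j) = c"
        unfolding c_def uk[symmetric] by (intro sum.cong refl) (simp add: proj_term_def take_restr)
      then have eq: "proj \<omega> u = c + word_mat T w *v y" using y uk by simp
      have "word_mat T w *v y \<in> (*v) (word_mat T w) ` cball 0 (rad R)" using y(1) by (intro imageI) simp
      then have "word_mat T w *v y \<in> (\<Union>z\<in>Z. cball z r)" using Z(3) by blast
      then obtain z where z: "z \<in> Z" "norm (word_mat T w *v y - z) \<le> r" by (auto simp: dist_norm norm_minus_commute)
      have in1: "proj \<omega> u \<in> cball (c + z) r" unfolding eq using z(2) by (simp add: dist_norm norm_minus_commute)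
      have in2: "proj \<omega> u \<in> cball 0 (rad R)" using norm_proj_le[OF \<omega> ui] by simp
      obtain Q where Q: "Q \<in> mesh r" "proj \<omega> u \<in> Q" by (rule mesh_covers[OF r])
      have "Q \<in> F" unfolding F_def near_cubes_def using Q in1 in2 z(1) by blast
      then show ?thesis using Q by blast
    qed
    moreover have "finite F" unfolding F_def using Z(1) fin by auto
    ultimately show ?thesis using card by (intro exI[of _ F]) (auto simp: F_def)
  qed
  moreover have "0 < C" unfolding C_def using R0 by (intro mult_pos_pos zero_less_power add_nonneg_pos) auto
  ultimately show ?thesis by blast
qed

text \<open>The cylinders of \<open>Z\<close> split the measure into parts. A part spread over at
  most \<open>N w\<close> cubes has at least the \<open>q\<close>-th moment of a uniform
  distribution on \<open>N w\<close> cubes. For \<open>q > 1\<close> the moments of the parts add up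
  to at most that of the whole, since \<open>q\<close>-th powers are superadditive; for
  \<open>q = 1\<close> the function \<open>x * ln x\<close> plays this role.\<close>

lemma qlog_ge:
  assumes J: "compact J" "J \<noteq> {}" and str: "nonautonomous_structure n0 T J \<omega>"
    and \<omega>: "bounded_by R \<omega>" and R: "0 < R" and r: "0 < r" and q: "1 \<le> q"
    and Z: "finite Z" "Z \<subseteq> words n0" and disj: "\<And>w w'. w \<in> Z \<Longrightarrow> w' \<in> Z \<Longrightarrow> w \<noteq> w' \<Longrightarrow> cylinder n0 w \<inter> cylinder n0 w' = {}"
    and Zs: "(\<Sum>w\<in>Z. pw w) = 1"
    and N: "\<And>w. w \<in> Z \<Longrightarrow> 0 < N w \<and> (\<exists>F. finite F \<and> F \<subseteq> near_cubes r (rad R) \<and> real (card F) \<le> N w \<and>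
       (\<forall>u\<in>cylinder n0 w. proj \<omega> u \<in> \<Union>F))"
  shows "(if q = 1 then (\<Sum>w\<in>Z. pw w * ln (pw w / N w)) else ln (\<Sum>w\<in>Z. N w powr (1 - q) * pw w powr q) / (q - 1))
    \<le> qlog q (nonautonomous_measure n0 T p J \<omega>) r"
proof -
  let ?N = "near_cubes r (rad R)"
  have R0: "0 \<le> rad R" using R b by (simp add: rad_def)
  have finN: "finite ?N" using finite_near_cubes[OF r R0] .
  have mesh: "?N \<subseteq> mesh r" by (auto simp: near_cubes_def)
  have le: "(\<Sum>w\<in>Z. mass \<omega> w Q) \<le> mass \<omega> [] Q" if "Q \<in> ?N" for Q
    using that mesh mesh_borel by (intro sum_mass_le Z disj) (auto simp: cylinder_Nil cylinder_iff)
  have F: "\<exists>F. finite F \<and> F \<subseteq> ?N \<and> real (card F) \<le> N w \<and> (\<Sum>Q\<in>F. mass \<omega> w Q) = pw w" if w: "w \<in> Z" for w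
  proof -
    obtain F where F: "finite F" "F \<subseteq> ?N" "real (card F) \<le> N w" "\<forall>u\<in>cylinder n0 w. proj \<omega> u \<in> \<Union>F" using N[OF w] by blast
    then have "(\<Sum>Q\<in>F. mass \<omega> w Q) = pw w" using Z w mesh by (intro sum_mass_cubes[OF r]) auto
    then show ?thesis using F by blast
  qed
  note tot = sum_mass_near_cubes[OF \<omega> R r]
  show ?thesis
  proof (cases "q = 1")
    case False
    then have q1: "1 < q" using q by simp
    have "(\<Sum>w\<in>Z. N w powr (1 - q) * pw w powr q) \<le> (\<Sum>w\<in>Z. \<Sum>Q\<in>?N. mass \<omega> w Q powr q)"
    proof (intro sum_mono)
      fix w assume w: "w \<in> Z"
      obtain F where F: "finite F" "F \<subseteq> ?N" "real (card F) \<le> N w" "(\<Sum>Q\<in>F. mass \<omega> w Q) = pw w" using F[OF w] by blast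
      have "N w powr (1 - q) * pw w powr q \<le> (\<Sum>Q\<in>F. mass \<omega> w Q powr q)"
        using sum_powr_ge[OF F(1,3), of "mass \<omega> w" q] N[OF w] q F(4) by simp
      also have "\<dots> \<le> (\<Sum>Q\<in>?N. mass \<omega> w Q powr q)" using F finN by (intro sum_mono2) auto
      finally show "N w powr (1 - q) * pw w powr q \<le> (\<Sum>Q\<in>?N. mass \<omega> w Q powr q)" .
    qed
    also have "\<dots> = (\<Sum>Q\<in>?N. \<Sum>w\<in>Z. mass \<omega> w Q powr q)" by (rule sum.swap)
    also have "\<dots> \<le> (\<Sum>Q\<in>?N. mass \<omega> [] Q powr q)" using le q Z by (intro sum_mono sum_powr_le_powr_sum) auto
    finally have *: "(\<Sum>w\<in>Z. N w powr (1 - q) * pw w powr q) \<le> (\<Sum>Q\<in>?N. mass \<omega> [] Q powr q)" .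
    have "0 < (\<Sum>w\<in>Z. N w powr (1 - q) * pw w powr q)"
    proof -
      have "\<exists>w\<in>Z. 0 < pw w"
      proof (rule ccontr)
        assume "\<not> ?thesis"
        then have "(\<Sum>w\<in>Z. pw w) \<le> 0" by (intro sum_nonpos) (auto simp: not_less)
        then show False using Zs by simp
      qed
      then obtain w where w: "w \<in> Z" "0 < pw w" by blast
      then have "0 < N w powr (1 - q) * pw w powr q" using N[OF w(1)] by simp
      also have "\<dots> \<le> (\<Sum>w\<in>Z. N w powr (1 - q) * pw w powr q)" using w Z by (intro member_le_sum) auto
      finally show ?thesis .
    qed
    then have "ln (\<Sum>w\<in>Z. N w powr (1 - q) * pw w powr q) \<le> ln (\<Sum>Q\<in>?N. mass \<omega> [] Q powr q)"
      using * by (subst ln_le_cancel_iff) auto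
    then show ?thesis using False q1 by (simp add: qlog_eq[OF J str \<omega> R r] divide_right_mono)
  next
    case True
    \<comment> \<open>The function \<open>x * ln x\<close> is not monotone, so the inequality
      \<open>le\<close> does not suffice here. Equality holds because both sides have total mass 1
      over the near cubes.\<close>
    have eq: "(\<Sum>w\<in>Z. mass \<omega> w Q) = mass \<omega> [] Q" if Q: "Q \<in> ?N" for Q
    proof -
      have "(\<Sum>Q\<in>?N. \<Sum>w\<in>Z. mass \<omega> w Q) = (\<Sum>w\<in>Z. \<Sum>Q\<in>?N. mass \<omega> w Q)" by (rule sum.swap)
      also have "\<dots> = (\<Sum>w\<in>Z. pw w)" using tot Z(2) by (intro sum.cong refl) blast
      finally have "(\<Sum>Q\<in>?N. mass \<omega> [] Q - (\<Sum>w\<in>Z. mass \<omega> w Q)) = pw [] - (\<Sum>w\<in>Z. pw w)"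
        unfolding sum_subtractf using tot[of "[]"] by simp
      then have "(\<Sum>Q\<in>?N. mass \<omega> [] Q - (\<Sum>w\<in>Z. mass \<omega> w Q)) = 0"
      proof -
        have p1: "pw [] = 1" by (simp add: word_prob_def)
        show "(\<Sum>Q\<in>?N. mass \<omega> [] Q - (\<Sum>w\<in>Z. mass \<omega> w Q)) = pw [] - (\<Sum>w\<in>Z. pw w) \<Longrightarrow> ?thesis"
          by (simp only: Zs p1 diff_self)
      qed
      then have "\<forall>Q\<in>?N. mass \<omega> [] Q - (\<Sum>w\<in>Z. mass \<omega> w Q) = 0"
        using le finN by (subst (asm) sum_nonneg_eq_0_iff) auto
      then show ?thesis using Q by simp
    qed
    have "(\<Sum>w\<in>Z. pw w * ln (pw w / N w)) \<le> (\<Sum>w\<in>Z. \<Sum>Q\<in>?N. mass \<omega> w Q * ln (mass \<omega> w Q))"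
    proof (intro sum_mono)
      fix w assume w: "w \<in> Z"
      obtain F where F: "finite F" "F \<subseteq> ?N" "real (card F) \<le> N w" "(\<Sum>Q\<in>F. mass \<omega> w Q) = pw w" using F[OF w] by blast
      \<comment> \<open>The cubes of \<open>F\<close> already carry the whole mass of the
        cylinder.\<close>
      have "mass \<omega> w Q = 0" if "Q \<in> ?N - F" for Q
      proof -
        have "(\<Sum>Q\<in>?N - F. mass \<omega> w Q) = 0"
          using tot[of w] w Z(2) F sum_diff[OF finN F(2), of "mass \<omega> w"] by auto
        then show ?thesis using that finN by (subst (asm) sum_nonneg_eq_0_iff) auto
      qed
      then have "(\<Sum>Q\<in>F. mass \<omega> w Q * ln (mass \<omega> w Q)) = (\<Sum>Q\<in>?N. mass \<omega> w Q * ln (mass \<omega> w Q))"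
        using F finN by (intro sum.mono_neutral_left) auto
      moreover have "pw w * ln (pw w / N w) \<le> (\<Sum>Q\<in>F. mass \<omega> w Q * ln (mass \<omega> w Q))"
        using sum_mult_ln_ge[OF F(1,3), of "mass \<omega> w"] N[OF w] F(4) by simp
      ultimately show "pw w * ln (pw w / N w) \<le> (\<Sum>Q\<in>?N. mass \<omega> w Q * ln (mass \<omega> w Q))" by simp
    qed
    also have "\<dots> = (\<Sum>Q\<in>?N. \<Sum>w\<in>Z. mass \<omega> w Q * ln (mass \<omega> w Q))" by (rule sum.swap)
    also have "\<dots> \<le> (\<Sum>Q\<in>?N. mass \<omega> [] Q * ln (mass \<omega> [] Q))" using eq Z by (intro sum_mono sum_mult_ln_le) auto
    finally show ?thesis using True by (simp add: qlog_eq[OF J str \<omega> R r])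
  qed
qed

lemma cylinder_cut_disjoint:
  assumes s: "0 < s" and u: "u \<in> cut s r" "u' \<in> cut s r" "u \<noteq> u'"
  shows "cylinder n0 u \<inter> cylinder n0 u' = {}"
proof (intro equals0I)
  fix x assume "x \<in> cylinder n0 u \<inter> cylinder n0 u'"
  then have x: "x \<in> inf_words n0" "restr x (length u) = u" "restr x (length u') = u'" by (auto simp: cylinder_iff)
  let ?L = "max (length u) (length u')"
  have "take (length u) (restr x ?L) = u" "take (length u') (restr x ?L) = u'" using x by (simp_all add: take_restr)
  then have "length u = length u'"
    using cut_prefix_unique[OF restr_words[OF x(1)] s, of "length u" ?L r "length u'"] u by simp
  then show False using x u(3) by metis
qed

text \<open>On a cut set the selected singular value is comparable with \<open>r\<close>, so
  \<open>sv_max_le_svf\<close> bounds the number of cubes by a constant times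
  \<open>psi s w / r powr s\<close>. This extracts \<open>s * ln r\<close> from the bound of
  \<open>qlog_ge\<close> and leaves the cut set sum. Positive pressure makes that sum at least 1 at
  small scales, so its contribution is nonnegative.\<close>

lemma upper_dim_le_pressure:
  assumes J: "compact J" "J \<noteq> {}" and str: "nonautonomous_structure n0 T J \<omega>"
    and \<omega>: "bounded_by R \<omega>" and R: "0 < R" and q: "1 \<le> q" and s: "0 < s" "s \<le> real CARD('d)" and P: "0 < pressure q s"
  shows "upper_q_dim q (nonautonomous_measure n0 T p J \<omega>) \<le> ereal s"
proof -
  let ?\<nu> = "nonautonomous_measure n0 T p J \<omega>"
  obtain C where C: "0 < C" and cov: "\<And>\<omega> w r. bounded_by R \<omega> \<Longrightarrow> w \<in> words n0 \<Longrightarrow> 0 < r \<Longrightarrow>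
    (\<exists>F. finite F \<and> F \<subseteq> near_cubes r (rad R) \<and> real (card F) \<le> C * sv_max r (word_mat T w) \<and>
       (\<forall>u\<in>cylinder n0 w. proj \<omega> u \<in> \<Union>F))"
    using cylinder_mesh_cover[OF R] by blast
  define D where "D = C * (1 / a) ^ CARD('d)"
  have D: "0 < D" using C a by (simp add: D_def)
  have s0: "0 \<le> s" using s by simp
  have cs: "cut_index s = nat \<lceil>s\<rceil>" using s by (simp add: cut_index_def)
  have main: "s * ln r - ln D \<le> qlog q ?\<nu> r" if r: "0 < r" "r < 1" and F1: "1 \<le> crit_sum n0 T p q s r" for r
  proof -
    define N where "N w = D * (psi s w / r powr s)" for w
    have N: "0 < N w" if "w \<in> cut s r" for w
      using D psi_pos[OF cut_words[OF that] s0] r by (simp add: N_def)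
    have "(if q = 1 then (\<Sum>w\<in>cut s r. pw w * ln (pw w / N w)) else ln (\<Sum>w\<in>cut s r. N w powr (1 - q) * pw w powr q) / (q - 1))
      \<le> qlog q ?\<nu> r"
    proof (rule qlog_ge[OF J str \<omega> R r(1) q])
      fix w assume w: "w \<in> cut s r"
      have ww: "w \<in> words n0" using w by (rule cut_words)
      have "sv_max r (word_mat T w) \<le> (1 / a) ^ CARD('d) * (psi s w / r powr s)"
        using w cut_lower[OF w s(1)] a r s by (intro sv_max_le_svf word_mat_invertible ww) (auto simp: cut_iff cs)
      then have "C * sv_max r (word_mat T w) \<le> N w"
        unfolding N_def D_def mult.assoc using C by (intro mult_left_mono) auto
      then show "0 < N w \<and> (\<exists>F. finite F \<and> F \<subseteq> near_cubes r (rad R) \<and> real (card F) \<le> N w \<and> (\<forall>u\<in>cylinder n0 w. proj \<omega> u \<in> \<Union>F))"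
        using cov[OF \<omega> ww r(1)] N[OF w] by (meson order_trans)
    qed (use s r finite_cut cut_words sum_pw_cut cylinder_cut_disjoint[OF s(1)] in auto)
    moreover have "s * ln r - ln D \<le> (if q = 1 then (\<Sum>w\<in>cut s r. pw w * ln (pw w / N w)) else ln (\<Sum>w\<in>cut s r. N w powr (1 - q) * pw w powr q) / (q - 1))"
    proof (cases "q = 1")
      case True
      have "(\<Sum>w\<in>cut s r. pw w * ln (pw w / N w)) = (\<Sum>w\<in>cut s r. pw w * info s w + pw w * (s * ln r - ln D))"
      proof (intro sum.cong refl)
        fix w assume w: "w \<in> cut s r"
        have ww: "w \<in> words n0" using w by (rule cut_words)
        note pos = psi_pos[OF ww s0]
        show "pw w * ln (pw w / N w) = pw w * info s w + pw w * (s * ln r - ln D)"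
        proof (cases "pw w = 0")
          case False
          then have p: "0 < pw w" using pw_nonneg[OF ww] by simp
          have "ln (pw w / N w) = ln (pw w) - (ln D + (ln (psi s w) - s * ln r))"
            using p N[OF w] D pos r by (simp add: N_def ln_div ln_mult ln_powr)
          moreover have "info s w = ln (pw w) - ln (psi s w)" using p pos by (simp add: info_def ln_mult ln_inverse)
          ultimately have "ln (pw w / N w) = info s w + (s * ln r - ln D)" by simp
          then show ?thesis by (simp only: distrib_left)
        qed simp
      qed
      also have "\<dots> = crit_sum n0 T p q s r + (s * ln r - ln D)"
        using True by (simp add: crit_sum_eq sum.distrib sum_distrib_right[symmetric] sum_pw_cut[OF s(1) r])
      finally show ?thesis using True F1 by simp
    next
      case False
      then have q1: "1 < q" using q by simp
      have "(\<Sum>w\<in>cut s r. N w powr (1 - q) * pw w powr q) = (\<Sum>w\<in>cut s r. (D * r powr (- s)) powr (1 - q) * term_q q s w)"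
      proof (intro sum.cong refl)
        fix w assume w: "w \<in> cut s r"
        note pos = psi_pos[OF cut_words[OF w] s0]
        have "N w = (D * r powr (- s)) * psi s w" by (simp add: N_def powr_minus divide_inverse)
        then have "N w powr (1 - q) = (D * r powr (- s)) powr (1 - q) * psi s w powr (1 - q)"
          using D pos by (simp add: powr_mult)
        then show "N w powr (1 - q) * pw w powr q = (D * r powr (- s)) powr (1 - q) * term_q q s w"
          by (simp add: term_q_def)
      qed
      also have "\<dots> = (D * r powr (- s)) powr (1 - q) * crit_sum n0 T p q s r"
        using False by (simp add: crit_sum_eq sum_distrib_left)
      finally have "ln (\<Sum>w\<in>cut s r. N w powr (1 - q) * pw w powr q) = (1 - q) * (ln D - s * ln r) + ln (crit_sum n0 T p q s r)"
        using F1 D r by (simp add: ln_mult ln_powr)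
      also have "\<dots> \<ge> (q - 1) * (s * ln r - ln D)" using F1 by (simp add: algebra_simps)
      finally have "s * ln r - ln D \<le> ln (\<Sum>w\<in>cut s r. N w powr (1 - q) * pw w powr q) / (q - 1)"
        using q1 by (simp add: pos_le_divide_eq mult.commute)
      then show ?thesis using False by simp
    qed
    ultimately show ?thesis by simp
  qed
  have "\<forall>\<^sub>F r in at_right 0. 1 \<le> crit_sum n0 T p q s r"
    using crit_sum_at_top[OF q s(1) P] unfolding filterlim_at_top by blast
  with eventually_unit_interval have "\<forall>\<^sub>F r in at_right 0. s * ln r - ln D \<le> qlog q ?\<nu> r"
    by eventually_elim (use main in blast)
  then show ?thesis by (rule upper_q_dim_le)
qed

text \<open>One cylinder, that of the empty word, together with all near cubes, whose number is at
  most a constant times \<open>r powr (- real CARD('d))\<close>.\<close>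

lemma upper_dim_le_card:
  assumes J: "compact J" "J \<noteq> {}" and str: "nonautonomous_structure n0 T J \<omega>"
    and \<omega>: "bounded_by R \<omega>" and R: "0 < R" and q: "1 \<le> q"
  shows "upper_q_dim q (nonautonomous_measure n0 T p J \<omega>) \<le> ereal (CARD('d))"
proof -
  let ?\<nu> = "nonautonomous_measure n0 T p J \<omega>"
  have R0: "0 < rad R" using R b by (simp add: rad_def)
  define D where "D = (2 * rad R + 2) ^ CARD('d)"
  have D: "0 < D" using R0 by (simp add: D_def)
  have main: "real CARD('d) * ln r - ln D \<le> qlog q ?\<nu> r" if r: "0 < r" "r < 1" for r
  proof -
    define N where "N = D * r powr (- real CARD('d))"
    have N: "0 < N" using D r by (simp add: N_def)
    have pwN: "pw [] = 1" by (simp add: word_prob_def)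
    have "real (card (near_cubes r (rad R) :: (real^'d) set set)) \<le> (2 * rad R / r + 2) ^ CARD('d)"
      unfolding near_cubes_def by (rule mesh_count_ball(2)[OF r(1) less_imp_le[OF R0]])
    also have "\<dots> \<le> ((2 * rad R + 2) / r) ^ CARD('d)"
    proof (rule power_mono)
      have "2 \<le> 2 / r" using r by (simp add: pos_le_divide_eq)
      then show "2 * rad R / r + 2 \<le> (2 * rad R + 2) / r" by (simp add: add_divide_distrib)
    qed (use r R0 in simp)
    also have "\<dots> = N" using r by (simp add: N_def D_def power_divide powr_minus powr_realpow divide_inverse power_mult_distrib power_inverse)
    finally have card: "real (card (near_cubes r (rad R) :: (real^'d) set set)) \<le> N" .
    have "(if q = 1 then (\<Sum>w\<in>{[]}. pw w * ln (pw w / N)) else ln (\<Sum>w\<in>{[]}. N powr (1 - q) * pw w powr q) / (q - 1)) \<le> qlog q ?\<nu> r"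
    proof (rule qlog_ge[OF J str \<omega> R r(1) q])
      show "0 < N \<and> (\<exists>F. finite F \<and> F \<subseteq> near_cubes r (rad R) \<and> real (card F) \<le> N \<and> (\<forall>u\<in>cylinder n0 w. proj \<omega> u \<in> \<Union>F))" for w
      proof (intro conjI exI[of _ "near_cubes r (rad R)"] ballI)
        fix u assume "u \<in> cylinder n0 w"
        then show "proj \<omega> u \<in> \<Union>(near_cubes r (rad R))" by (intro proj_near_cube[OF \<omega> r(1)]) (simp add: cylinder_iff)
      qed (use N card finite_near_cubes[OF r(1) less_imp_le[OF R0]] in auto)
    qed (auto simp: pwN)
    moreover have "ln N = ln D - real CARD('d) * ln r" using D r by (simp add: N_def ln_mult ln_powr)
    moreover have "ln (N powr (1 - q)) / (q - 1) = - ln N" if "q \<noteq> 1" using N that by (simp add: ln_powr field_simps)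
    moreover have "ln (1 / N) = - ln N" using N by (simp add: ln_div)
    ultimately show ?thesis by (auto simp: pwN split: if_splits)
  qed
  have "\<forall>\<^sub>F r in at_right 0. real CARD('d) * ln r - ln D \<le> qlog q ?\<nu> r"
    using eventually_unit_interval by eventually_elim (use main in blast)
  then show ?thesis by (rule upper_q_dim_le)
qed

end

section \<open>Random translations\<close>

text \<open>The density may be unbounded, but the sets where it exceeds \<open>n\<close> shrink to a
  null set, so for large \<open>n\<close> the exceptional set has mass at most
  \<open>\<epsilon>\<close>. Points of norm above \<open>R\<close> are put into it as well, which
  gives the regular part bounded support.\<close>

lemma absolutely_continuous_split:
  fixes P :: "(real^'d) measure"
  assumes P: "prob_space P" "sets P = sets borel" "absolutely_continuous lborel P" and bnd: "AE x in P. norm x \<le> R"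
    and e: "0 < \<epsilon>"
  shows "\<exists>H B. H \<in> sets borel \<and> 0 < B \<and> (\<forall>x. norm x > R \<longrightarrow> x \<in> H) \<and> emeasure P H \<le> ennreal \<epsilon> \<and>
    (\<forall>A\<in>sets borel. emeasure P (A - H) \<le> ennreal B * emeasure lborel A)"
proof -
  interpret P: prob_space P by fact
  have sp: "space P = UNIV" using sets_eq_imp_space_eq[OF P(2)] by simp
  define f where "f = RN_deriv lborel P"
  have f [measurable]: "f \<in> borel_measurable lborel" unfolding f_def by simp
  then have fb [measurable]: "f \<in> borel_measurable borel" by simp
  have dens: "density lborel f = P"
    unfolding f_def by (rule sigma_finite_measure.density_RN_deriv[OF sigma_finite_lborel P(3)]) (simp add: P(2))
  have em: "emeasure P A = (\<integral>\<^sup>+x. f x * indicator A x \<partial>lborel)" if "A \<in> sets borel" for A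
    using that by (subst dens[symmetric]) (simp add: emeasure_density)
  have "(\<integral>\<^sup>+x. f x \<partial>lborel) = 1" using em[of UNIV] P.emeasure_space_1 sp by simp
  then have "AE x in lborel. f x \<noteq> \<infinity>" by (intro nn_integral_PInf_AE) auto
  then have "AE x in P. f x \<noteq> \<infinity>" using absolutely_continuous_AE[of P lborel "\<lambda>x. f x \<noteq> \<infinity>"] P by simp
  then have "AE x in P. f x \<noteq> \<infinity> \<and> norm x \<le> R" using bnd by eventually_elim simp
  define G where "G n = {x. of_nat n < f x} \<union> {x. norm x > R}" for n
  have G [measurable]: "G n \<in> sets borel" for n unfolding G_def by measurable
  have dec: "decseq G" unfolding G_def by (intro decseq_SucI) (auto intro: le_less_trans[rotated])
  have "emeasure P {x \<in> space P. \<forall>n. x \<in> G n} = 0"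
  proof (rule emeasure_eq_0_AE)
    show "AE x in P. \<not> (\<forall>n. x \<in> G n)"
      using \<open>AE x in P. f x \<noteq> \<infinity> \<and> norm x \<le> R\<close>
    proof eventually_elim
      case (elim x)
      then obtain n where "f x < of_nat n" using ennreal_Ex_less_of_nat[of "f x"] by (auto simp: less_top)
      then have "x \<notin> G n" using elim by (auto simp: G_def)
      then show ?case by blast
    qed
  qed
  moreover have "{x \<in> space P. \<forall>n. x \<in> G n} = (\<Inter>n. G n)" by (auto simp: sp)
  ultimately have "emeasure P (\<Inter>n. G n) = 0" by simp
  moreover have "(\<lambda>n. emeasure P (G n)) \<longlonglongrightarrow> emeasure P (\<Inter>n. G n)"
  proof (rule Lim_emeasure_decseq[OF _ dec])
    show "range G \<subseteq> sets P" unfolding P(2) using G by blast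
    show "emeasure P (G i) \<noteq> \<infinity>" for i using P.emeasure_finite[of "G i"] by simp
  qed
  ultimately have lim: "(\<lambda>n. emeasure P (G n)) \<longlonglongrightarrow> 0" by (simp only:)
  from order_tendstoD(2)[OF lim, of "ennreal \<epsilon>"] have "\<forall>\<^sub>F n in sequentially. emeasure P (G n) < ennreal \<epsilon>"
    using e by simp
  then obtain n where n: "emeasure P (G n) < ennreal \<epsilon>" by (auto simp only: eventually_sequentially)
  have "emeasure P (A - G n) \<le> ennreal (real n + 1) * emeasure lborel A" if A: "A \<in> sets borel" for A
  proof -
    have "emeasure P (A - G n) = (\<integral>\<^sup>+x. f x * indicator (A - G n) x \<partial>lborel)" using A by (intro em) auto
    also have "\<dots> \<le> (\<integral>\<^sup>+x. ennreal (real n + 1) * indicator A x \<partial>lborel)"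
    proof (intro nn_integral_mono)
      fix x :: "real^'d"
      have "f x \<le> ennreal (real n + 1)" if "x \<notin> G n"
      proof -
        have "f x \<le> of_nat n" using that by (simp add: G_def not_less)
        also have "\<dots> \<le> ennreal (real n + 1)" by (simp add: ennreal_of_nat_eq_real_of_nat)
        finally show ?thesis .
      qed
      then show "f x * indicator (A - G n) x \<le> ennreal (real n + 1) * indicator A x"
        by (auto simp: indicator_def)
    qed
    also have "\<dots> = ennreal (real n + 1) * emeasure lborel A" using A by (simp add: nn_integral_cmult_indicator)
    finally show ?thesis .
  qed
  moreover have "norm x > R \<longrightarrow> x \<in> G n" for x by (simp add: G_def)
  moreover have "0 < real n + 1" by simp
  ultimately show ?thesis using G[of n] n less_imp_le[OF n] by blast
qed

locale random_affine_words = affine_words n0 T p a b K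
  for n0 and T :: "nat \<Rightarrow> real^'d^'d" and p a b K +
  fixes P :: "(real^'d) measure" and R :: real
  assumes P: "prob_space P" "sets P = sets borel" "absolutely_continuous lborel P"
    and R: "0 < R" "AE x in P. norm x \<le> R"
begin

abbreviation \<Omega> :: "(nat list \<Rightarrow> real^'d) measure" where "\<Omega> \<equiv> translation_measure n0 P"

sublocale omega: prob_space "translation_measure n0 P"
  unfolding translation_measure_def by (intro prob_space_PiM P)

lemma space_P: "space P = UNIV" using sets_eq_imp_space_eq[OF P(2)] by simp

lemma coord_measurable [measurable]: "w \<in> words n0 \<Longrightarrow> (\<lambda>\<xi>. \<xi> w) \<in> borel_measurable \<Omega>"
proof -
  assume w: "w \<in> words n0"
  have "(\<lambda>\<xi>. \<xi> w) \<in> \<Omega> \<rightarrow>\<^sub>M P" unfolding translation_measure_def using w by (rule measurable_component_singleton)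
  then show ?thesis using measurable_cong_sets[OF refl P(2)] by blast
qed

lemma AE_bounded: "AE \<xi> in \<Omega>. bounded_by R \<xi>"
proof -
  have "AE \<xi> in \<Omega>. norm (\<xi> w) \<le> R" if w: "w \<in> words n0" for w
  proof -
    interpret product_prob_space "\<lambda>_::nat list. P" "words n0"
      using P(1) by (simp add: product_prob_space_def product_prob_space_axioms_def product_sigma_finite_def prob_space_imp_sigma_finite)
    show ?thesis unfolding translation_measure_def using w R(2) by (intro AE_component)
  qed
  then have "AE \<xi> in \<Omega>. \<forall>w\<in>words n0. norm (\<xi> w) \<le> R" by (intro AE_ball_countable[THEN iffD2]) auto
  then show ?thesis by (simp add: bounded_by_def)
qed

lemma AE_in:
  assumes "AE x in P. x \<in> D"
  shows "AE \<xi> in \<Omega>. \<forall>w\<in>words n0. \<xi> w \<in> D"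
proof -
  interpret product_prob_space "\<lambda>_::nat list. P" "words n0"
    using P(1) by (simp add: product_prob_space_def product_prob_space_axioms_def product_sigma_finite_def prob_space_imp_sigma_finite)
  have "AE \<xi> in \<Omega>. \<xi> w \<in> D" if "w \<in> words n0" for w
    unfolding translation_measure_def using that assms by (intro AE_component)
  then show ?thesis by (intro AE_ball_countable[THEN iffD2]) auto
qed

text \<open>Redrawing one coordinate independently leaves the product law unchanged. The rule for
  adding a coordinate to a product is applied to an index that is already present, where adding
  means overwriting.\<close>

lemma nn_integral_resample:
  assumes w: "w \<in> words n0" and F [measurable]: "F \<in> borel_measurable \<Omega>"
  shows "(\<integral>\<^sup>+\<xi>. F \<xi> \<partial>\<Omega>) = (\<integral>\<^sup>+\<xi>. (\<integral>\<^sup>+x. F (\<xi>(w := x)) \<partial>P) \<partial>\<Omega>)"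
proof -
  interpret P: prob_space P by (rule P)
  interpret PO: pair_sigma_finite P \<Omega> by unfold_locales
  have ins: "insert w (words n0) = words n0" using w by (rule insert_absorb)
  have d: "distr (P \<Otimes>\<^sub>M \<Omega>) \<Omega> (\<lambda>(x, X). X(w := x)) = \<Omega>"
    using distr_pair_PiM_eq_PiM[of "words n0" "\<lambda>_. P" w] P(1) unfolding translation_measure_def ins by simp
  have m: "(\<lambda>(x, X). X(w := x)) \<in> P \<Otimes>\<^sub>M \<Omega> \<rightarrow>\<^sub>M \<Omega>"
    using measurable_add_dim[of w "words n0" "\<lambda>_. P"] measurable_compose[OF measurable_pair_swap' measurable_add_dim[of w "words n0" "\<lambda>_. P"]]
    unfolding translation_measure_def ins by (simp add: split_beta' comp_def)
  have "(\<integral>\<^sup>+\<xi>. F \<xi> \<partial>distr (P \<Otimes>\<^sub>M \<Omega>) \<Omega> (\<lambda>(x, X). X(w := x))) = (\<integral>\<^sup>+z. F ((\<lambda>(x, X). X(w := x)) z) \<partial>(P \<Otimes>\<^sub>M \<Omega>))"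
    by (rule nn_integral_distr[OF m]) (simp add: F)
  then have "(\<integral>\<^sup>+\<xi>. F \<xi> \<partial>\<Omega>) = (\<integral>\<^sup>+z. F ((\<lambda>(x, X). X(w := x)) z) \<partial>(P \<Otimes>\<^sub>M \<Omega>))"
    by (simp only: d)
  also have "\<dots> = (\<integral>\<^sup>+\<xi>. (\<integral>\<^sup>+x. F (\<xi>(w := x)) \<partial>P) \<partial>\<Omega>)"
    using PO.nn_integral_snd[of "\<lambda>z. F ((\<lambda>(x, X). X(w := x)) z)"] measurable_compose[OF m F] by simp
  finally show ?thesis .
qed

lemma proj_term_upd:
  assumes "w = restr u (Suc n)"
  shows "proj_term (\<xi>(w := x)) u j = proj_term (\<xi>(w := 0)) u j + (if j = n then word_mat T (restr u n) *v x else 0)"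
proof (cases "j = n")
  case True then show ?thesis using assms by (simp add: proj_term_def)
next
  case False
  then have "restr u (Suc j) \<noteq> w" using assms by (metis Suc_inject length_restr)
  then show ?thesis using False by (simp add: proj_term_def)
qed

text \<open>The translation of the prefix of length \<open>Suc n\<close> enters the series along
  \<open>u\<close> in exactly one term, through the matrix of \<open>restr u n\<close>.\<close>

lemma proj_upd:
  assumes \<xi>: "bounded_by R \<xi>" and u: "u \<in> inf_words n0" and w: "w = restr u (Suc n)"
  shows "proj (\<xi>(w := x)) u = proj (\<xi>(w := 0)) u + word_mat T (restr u n) *v x"
proof -
  have b0: "norm (proj_term (\<xi>(w := 0)) u j) \<le> b ^ j * R" for j
  proof -
    have "norm (proj_term (\<xi>(w := 0)) u j) \<le> b ^ j * norm ((\<xi>(w := 0)) (restr u (Suc j)))"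
      using word_mat_bounds(2)[OF restr_words[OF u], of j] by (simp add: proj_term_def)
    also have "\<dots> \<le> b ^ j * R" using \<xi> restr_words[OF u] b R by (intro mult_left_mono) (auto simp: bounded_by_def)
    finally show ?thesis .
  qed
  have s1: "summable (proj_term (\<xi>(w := 0)) u)" using geometric_b(1)[OF b0] .
  have "(\<lambda>j. if j = n then word_mat T (restr u n) *v x else 0) sums (\<Sum>j\<in>{n}. if j = n then word_mat T (restr u n) *v x else 0)"
    by (rule sums_finite) auto
  then have s2: "(\<lambda>j. if j = n then word_mat T (restr u n) *v x else 0) sums (word_mat T (restr u n) *v x)" by simp
  have "proj (\<xi>(w := x)) u = (\<Sum>j. proj_term (\<xi>(w := 0)) u j + (if j = n then word_mat T (restr u n) *v x else 0))"
    unfolding proj_def proj_term_upd[OF w, of \<xi> x] by simp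
  also have "\<dots> = proj (\<xi>(w := 0)) u + word_mat T (restr u n) *v x"
    unfolding proj_def using suminf_add[OF s1 sums_summable[OF s2]] sums_unique[OF s2] by simp
  finally show ?thesis .
qed

lemma proj_measurable_\<Omega> [measurable]:
  assumes u: "u \<in> inf_words n0"
  shows "(\<lambda>\<xi>. proj \<xi> u) \<in> borel_measurable \<Omega>"
  unfolding proj_def
proof (intro borel_measurable_suminf)
  fix j
  have [measurable]: "(\<lambda>\<xi>. \<xi> (restr u (Suc j))) \<in> borel_measurable \<Omega>" using restr_words[OF u] by (rule coord_measurable)
  have "(\<lambda>x. word_mat T (restr u j) *v x) \<in> borel_measurable borel"
    by (intro borel_measurable_continuous_onI continuous_intros)
  from measurable_compose[OF _ this] show "(\<lambda>\<xi>. proj_term \<xi> u j) \<in> borel_measurable \<Omega>"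
    unfolding proj_term_def by measurable
qed

text \<open>Joint measurability, as required by Fubini: each term of the series is a finite sum over
  words of a cylinder indicator times a linear image of one coordinate.\<close>

lemma proj_measurable_pair [measurable]: "(\<lambda>(\<xi>, u). proj \<xi> u) \<in> borel_measurable (\<Omega> \<Otimes>\<^sub>M M)"
  unfolding proj_def split_beta'
proof (intro borel_measurable_suminf)
  fix j
  have "(\<lambda>z. \<Sum>w\<in>W (Suc j). indicator (cylinder n0 w) (snd z) *\<^sub>R (word_mat T (take j w) *v (fst z w))) \<in> borel_measurable (\<Omega> \<Otimes>\<^sub>M M)"
  proof (intro borel_measurable_sum borel_measurable_scaleR)
    fix w assume "w \<in> W (Suc j)"
    then have [measurable]: "(\<lambda>\<xi>. \<xi> w) \<in> borel_measurable \<Omega>" by (intro coord_measurable) (simp add: words_of_length_iff)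
    have "(\<lambda>x. word_mat T (take j w) *v x) \<in> borel_measurable borel"
      by (intro borel_measurable_continuous_onI continuous_intros)
    from measurable_compose[OF _ this] show "(\<lambda>z. word_mat T (take j w) *v (fst z w)) \<in> borel_measurable (\<Omega> \<Otimes>\<^sub>M M)"
      by measurable
  qed measurable
  moreover have "proj_term (fst z) (snd z) j = (\<Sum>w\<in>W (Suc j). indicator (cylinder n0 w) (snd z) *\<^sub>R (word_mat T (take j w) *v (fst z w)))"
    if "z \<in> space (\<Omega> \<Otimes>\<^sub>M M)" for z
  proof -
    have u: "snd z \<in> inf_words n0" using that by (auto simp: space_pair_measure space_M)
    let ?r = "restr (snd z) (Suc j)"
    have r: "?r \<in> W (Suc j)" using restr_words[OF u] by (simp add: words_of_length_iff)
    have "(\<Sum>w\<in>W (Suc j). indicator (cylinder n0 w) (snd z) *\<^sub>R (word_mat T (take j w) *v (fst z w))) =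
        (\<Sum>w\<in>W (Suc j). if w = ?r then word_mat T (take j ?r) *v (fst z ?r) else 0)"
      using u by (intro sum.cong refl) (auto simp: cylinder_iff words_of_length_iff indicator_def)
    also have "\<dots> = proj_term (fst z) (snd z) j" using r by (simp add: proj_term_def take_restr)
    finally show ?thesis by simp
  qed
  ultimately show "(\<lambda>z. proj_term (fst z) (snd z) j) \<in> borel_measurable (\<Omega> \<Otimes>\<^sub>M M)"
    by (subst measurable_cong) auto
qed

subsection \<open>Small ball estimates\<close>

text \<open>Independence in pointwise form: the value ignores the translations of all prefixes of
  \<open>u\<close> longer than \<open>n\<close>. When such a translation is redrawn,
  \<open>F\<close> can be treated as a constant.\<close>

definition path_indep :: "(nat \<Rightarrow> nat) \<Rightarrow> nat \<Rightarrow> ((nat list \<Rightarrow> real^'d) \<Rightarrow> 'c) \<Rightarrow> bool" where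
  "path_indep u n F \<longleftrightarrow> (\<forall>\<xi>\<in>space \<Omega>. \<forall>j\<ge>n. \<forall>x. F (\<xi>(restr u (Suc j) := x)) = F \<xi>)"

lemma path_indepD: "path_indep u n F \<Longrightarrow> \<xi> \<in> space \<Omega> \<Longrightarrow> n \<le> j \<Longrightarrow> F (\<xi>(restr u (Suc j) := x)) = F \<xi>"
  by (simp add: path_indep_def)

lemma path_indep_mono: "path_indep u n F \<Longrightarrow> n \<le> m \<Longrightarrow> path_indep u m F"
  by (auto simp: path_indep_def)

text \<open>
  The law of the translation is split into a part with bounded density and an exceptional part
  of mass at most \<open>\<epsilon>\<close>. The first letter of the path after \<open>n\<close> whose translation is not
  exceptional provides the smoothing; the price for having to wait for it is a factor of order
  \<open>\<epsilon>\<close> per letter.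
\<close>

lemma small_ball_iterate:
  assumes H: "H \<in> sets borel" "\<And>x. norm x > R \<Longrightarrow> x \<in> H" "emeasure P H \<le> ennreal \<epsilon>"
    and B: "0 < B" "\<And>A. A \<in> sets borel \<Longrightarrow> emeasure P (A - H) \<le> ennreal B * emeasure lborel A"
    and \<epsilon>: "0 < \<epsilon>" and u: "u \<in> inf_words n0" and r: "0 < r"
    and F: "F \<in> borel_measurable \<Omega>" "path_indep u n F" and Y: "Y \<in> borel_measurable \<Omega>" "path_indep u n Y"
  shows "(\<integral>\<^sup>+\<xi>. F \<xi> * indicator {\<xi>. norm (proj \<xi> u - Y \<xi>) \<le> r} \<xi> \<partial>\<Omega>) \<le>
    ennreal ((\<Sum>j<k. \<epsilon> ^ j * (B * (8 * CARD('d) * max 1 R) ^ CARD('d)) * sv_min r (word_mat T (restr u (n + j)))) + \<epsilon> ^ k) * (\<integral>\<^sup>+\<xi>. F \<xi> \<partial>\<Omega>)"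
  using F Y
proof (induction k arbitrary: n F)
  case 0
  then show ?case by (auto intro!: nn_integral_mono simp: indicator_def)
next
  case (Suc k)
  note [measurable] = Suc.prems(1,3) H(1) proj_measurable_\<Omega>[OF u]
  let ?C = "B * (8 * CARD('d) * max 1 R) ^ CARD('d)"
  let ?\<phi> = "\<lambda>n. sv_min r (word_mat T (restr u n))"
  let ?I = "\<integral>\<^sup>+\<xi>. F \<xi> \<partial>\<Omega>"
  define w where "w = restr u (Suc n)"
  have w: "w \<in> words n0" using restr_words[OF u] by (simp add: w_def)
  have [measurable]: "(\<lambda>\<xi>. \<xi> w) \<in> borel_measurable \<Omega>" using w by (rule coord_measurable)
  have C: "0 < ?C" using B by (intro mult_pos_pos zero_less_power) auto
  have \<phi>: "0 < ?\<phi> n" for n using sv_min_pos[OF word_mat_invertible[OF restr_words[OF u]] r] .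
  \<comment> \<open>The translation at \<open>w\<close> is either regular (\<open>G1\<close>) or
    exceptional (\<open>F2\<close>). The weight \<open>F2\<close> looks at the coordinate
    \<open>w\<close> but at no later one on the path, so the induction hypothesis applies to it one
    level further down.\<close>
  define G1 where "G1 \<xi> = F \<xi> * indicator {\<xi>. norm (proj \<xi> u - Y \<xi>) \<le> r} \<xi> * indicator (- H) (\<xi> w)" for \<xi>
  define F2 where "F2 \<xi> = F \<xi> * indicator H (\<xi> w)" for \<xi>
  have G1m: "G1 \<in> borel_measurable \<Omega>" unfolding G1_def by measurable
  have F2m: "F2 \<in> borel_measurable \<Omega>" unfolding F2_def by measurable
  have split: "F \<xi> * indicator {\<xi>. norm (proj \<xi> u - Y \<xi>) \<le> r} \<xi> = G1 \<xi> + F2 \<xi> * indicator {\<xi>. norm (proj \<xi> u - Y \<xi>) \<le> r} \<xi>" for \<xi>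
    by (auto simp: G1_def F2_def indicator_def)
  have "(\<integral>\<^sup>+\<xi>. G1 \<xi> \<partial>\<Omega>) = (\<integral>\<^sup>+\<xi>. (\<integral>\<^sup>+x. G1 (\<xi>(w := x)) \<partial>P) \<partial>\<Omega>)" by (rule nn_integral_resample[OF w G1m])
  also have "\<dots> \<le> (\<integral>\<^sup>+\<xi>. ennreal (?C * ?\<phi> n) * F \<xi> \<partial>\<Omega>)"
  proof (rule nn_integral_mono_AE)
    show "AE \<xi> in \<Omega>. (\<integral>\<^sup>+x. G1 (\<xi>(w := x)) \<partial>P) \<le> ennreal (?C * ?\<phi> n) * F \<xi>"
      using AE_bounded AE_space
    proof eventually_elim
      case (elim \<xi>)
      \<comment> \<open>With the other translations fixed, the event says that the matrix of
        \<open>restr u n\<close> maps the redrawn \<open>x\<close> into a ball around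
        \<open>z\<close>; \<open>ellipsoid_volume\<close> bounds the volume of this set.\<close>
      define z where "z = Y \<xi> - proj (\<xi>(w := 0)) u"
      let ?A = "{x \<in> cball 0 (max 1 R). norm (word_mat T (restr u n) *v x - z) \<le> r}"
      have Ab: "?A \<in> sets borel"
      proof -
        have "?A = cball 0 (max 1 R) \<inter> {x. norm (word_mat T (restr u n) *v x - z) \<le> r}" by auto
        moreover have "closed {x. norm (word_mat T (restr u n) *v x - z) \<le> r}" by (intro closed_Collect_le continuous_intros)
        ultimately show ?thesis by (simp add: closed_Int borel_closed)
      qed
      have "G1 (\<xi>(w := x)) \<le> F \<xi> * indicator (?A - H) x" for x
      proof -
        have 1: "F (\<xi>(w := x)) = F \<xi>" unfolding w_def by (rule path_indepD[OF Suc.prems(2) elim(2) order_refl])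
        have 2: "Y (\<xi>(w := x)) = Y \<xi>" unfolding w_def by (rule path_indepD[OF Suc.prems(4) elim(2) order_refl])
        have 3: "proj (\<xi>(w := x)) u - Y \<xi> = word_mat T (restr u n) *v x - z"
          by (subst proj_upd[OF elim(1) u w_def, of x]) (simp add: z_def)
        have "norm x \<le> max 1 R" if "x \<notin> H" using H(2)[of x] that by (cases "norm x > R") auto
        then show ?thesis unfolding G1_def using 1 2 3 by (auto simp: indicator_def)
      qed
      then have "(\<integral>\<^sup>+x. G1 (\<xi>(w := x)) \<partial>P) \<le> (\<integral>\<^sup>+x. F \<xi> * indicator (?A - H) x \<partial>P)" by (intro nn_integral_mono)
      also have "\<dots> = F \<xi> * emeasure P (?A - H)"
        by (rule nn_integral_cmult_indicator) (simp only: P(2) sets.Diff[OF Ab H(1)])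
      also have "\<dots> \<le> F \<xi> * (ennreal B * emeasure lborel ?A)" using B(2)[OF Ab] by (intro mult_left_mono) auto
      also have "\<dots> \<le> F \<xi> * (ennreal B * ennreal ((8 * CARD('d) * max 1 R) ^ CARD('d) * ?\<phi> n))"
        by (intro mult_left_mono ellipsoid_volume word_mat_invertible restr_words u r) simp_all
      also have "\<dots> = ennreal (?C * ?\<phi> n) * F \<xi>"
        using B(1) by (subst ennreal_mult'[symmetric]) (auto simp: mult_ac)
      finally show ?case .
    qed
  qed
  also have "\<dots> = ennreal (?C * ?\<phi> n) * ?I" by (rule nn_integral_cmult) measurable
  finally have part1: "(\<integral>\<^sup>+\<xi>. G1 \<xi> \<partial>\<Omega>) \<le> ennreal (?C * ?\<phi> n) * ?I" .
  have F2I: "(\<integral>\<^sup>+\<xi>. F2 \<xi> \<partial>\<Omega>) \<le> ennreal \<epsilon> * ?I"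
  proof -
    have "(\<integral>\<^sup>+\<xi>. F2 \<xi> \<partial>\<Omega>) = (\<integral>\<^sup>+\<xi>. (\<integral>\<^sup>+x. F2 (\<xi>(w := x)) \<partial>P) \<partial>\<Omega>)" by (rule nn_integral_resample[OF w F2m])
    also have "\<dots> \<le> (\<integral>\<^sup>+\<xi>. ennreal \<epsilon> * F \<xi> \<partial>\<Omega>)"
    proof (intro nn_integral_mono)
      fix \<xi> assume "\<xi> \<in> space \<Omega>"
      then have 1: "F (\<xi>(w := x)) = F \<xi>" for x unfolding w_def by (rule path_indepD[OF Suc.prems(2) _ order_refl])
      have "(\<integral>\<^sup>+x. F2 (\<xi>(w := x)) \<partial>P) = (\<integral>\<^sup>+x. F \<xi> * indicator H x \<partial>P)" by (simp add: F2_def 1)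
      also have "\<dots> = F \<xi> * emeasure P H"
        by (rule nn_integral_cmult_indicator) (simp only: P(2) H(1))
      also have "\<dots> \<le> F \<xi> * ennreal \<epsilon>" using H(3) by (intro mult_left_mono) auto
      finally show "(\<integral>\<^sup>+x. F2 (\<xi>(w := x)) \<partial>P) \<le> ennreal \<epsilon> * F \<xi>" by (simp add: mult.commute)
    qed
    also have "\<dots> = ennreal \<epsilon> * ?I" by (rule nn_integral_cmult) measurable
    finally show ?thesis .
  qed
  have F2i: "path_indep u (Suc n) F2"
    unfolding path_indep_def
  proof (intro ballI allI impI)
    fix \<xi> j x assume \<xi>: "\<xi> \<in> space \<Omega>" and j: "Suc n \<le> j"
    have "restr u (Suc j) \<noteq> w" using j unfolding w_def by (metis Suc_n_not_le_n length_restr Suc_inject)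
    then have 2: "(\<xi>(restr u (Suc j) := x)) w = \<xi> w" by simp
    have 1: "F (\<xi>(restr u (Suc j) := x)) = F \<xi>" by (rule path_indepD[OF Suc.prems(2) \<xi>]) (use j in simp)
    show "F2 (\<xi>(restr u (Suc j) := x)) = F2 \<xi>" by (simp only: F2_def 1 2)
  qed
  define S where "S = (\<Sum>j<k. \<epsilon> ^ j * ?C * ?\<phi> (Suc n + j)) + \<epsilon> ^ k"
  have S: "0 \<le> S" unfolding S_def using \<epsilon> B(1) \<phi> by (intro add_nonneg_nonneg sum_nonneg mult_nonneg_nonneg) (auto intro: less_imp_le)
  have part2: "(\<integral>\<^sup>+\<xi>. F2 \<xi> * indicator {\<xi>. norm (proj \<xi> u - Y \<xi>) \<le> r} \<xi> \<partial>\<Omega>) \<le> ennreal S * (\<integral>\<^sup>+\<xi>. F2 \<xi> \<partial>\<Omega>)"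
    unfolding S_def by (rule Suc.IH[OF F2m F2i Suc.prems(3) path_indep_mono[OF Suc.prems(4)]]) simp
  have "(\<integral>\<^sup>+\<xi>. F \<xi> * indicator {\<xi>. norm (proj \<xi> u - Y \<xi>) \<le> r} \<xi> \<partial>\<Omega>) =
      (\<integral>\<^sup>+\<xi>. G1 \<xi> \<partial>\<Omega>) + (\<integral>\<^sup>+\<xi>. F2 \<xi> * indicator {\<xi>. norm (proj \<xi> u - Y \<xi>) \<le> r} \<xi> \<partial>\<Omega>)"
  proof -
    note [measurable] = F2m
    have "(\<lambda>\<xi>. F2 \<xi> * indicator {\<xi>. norm (proj \<xi> u - Y \<xi>) \<le> r} \<xi>) \<in> borel_measurable \<Omega>" by measurable
    then show ?thesis unfolding split by (rule nn_integral_add[OF G1m])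
  qed
  also have "\<dots> \<le> ennreal (?C * ?\<phi> n) * ?I + ennreal S * (ennreal \<epsilon> * ?I)"
    using part1 part2 F2I by (intro add_mono order_trans[OF part2 mult_left_mono]) auto
  also have "\<dots> = ennreal (?C * ?\<phi> n + S * \<epsilon>) * ?I"
  proof -
    have gen: "ennreal A * I + ennreal S * (ennreal e * I) = ennreal (A + S * e) * I"
      if "0 \<le> A" "0 \<le> S" "0 \<le> e" for A S e and I :: ennreal
      using that by (simp add: ennreal_mult' distrib_right mult.assoc)
    have "0 \<le> ?C * ?\<phi> n" by (rule less_imp_le[OF mult_pos_pos[OF C \<phi>]])
    then show ?thesis using S \<epsilon> by (intro gen) auto
  qed
  also have "?C * ?\<phi> n + S * \<epsilon> = (\<Sum>j<Suc k. \<epsilon> ^ j * ?C * ?\<phi> (n + j)) + \<epsilon> ^ Suc k"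
  proof -
    have "(\<Sum>j<Suc k. \<epsilon> ^ j * D * f j) = D * f 0 + (\<Sum>j<k. \<epsilon> ^ j * D * f (Suc j)) * \<epsilon>" for D and f :: "nat \<Rightarrow> real"
      unfolding sum.lessThan_Suc_shift sum_distrib_right by (simp add: mult_ac)
    from this[of ?C "\<lambda>j. ?\<phi> (n + j)"] show ?thesis unfolding S_def by (simp add: distrib_right)
  qed
  finally show ?case .
qed

lemma sv_min_append_le:
  assumes u: "u \<in> words n0" and v: "v \<in> words n0" and r: "0 < r"
  shows "sv_min r (word_mat T (u @ v)) \<le> (1 / a) ^ (length v * CARD('d)) * sv_min r (word_mat T u)"
proof -
  have uv: "u @ v \<in> words n0" using u v by simp
  have "sv_min r (word_mat T (u @ v)) \<le> (\<Prod>i=1..CARD('d). (1 / a) ^ length v * min 1 (r / singular_value (word_mat T u) i))"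
    unfolding sv_min_def
  proof (intro prod_mono conjI)
    fix i assume i: "i \<in> {1..CARD('d)}"
    let ?x = "singular_value (word_mat T u) i" and ?y = "singular_value (word_mat T (u @ v)) i"
    have x: "0 < ?x" "0 < ?y" using singular_value_pos word_mat_invertible u uv i by blast+
    have al: "0 < a ^ length v" "a ^ length v \<le> 1" using a by (auto intro: power_le_one)
    have "r / ?y \<le> r / (?x * a ^ length v)"
      using sv_append_bounds(1)[OF u v i] x al r by (intro divide_left_mono) auto
    also have "\<dots> = (1 / a) ^ length v * (r / ?x)" by (simp add: power_one_over field_simps)
    finally have 1: "r / ?y \<le> (1 / a) ^ length v * (r / ?x)" .
    have 2: "1 \<le> (1 / a) ^ length v" using al by (simp add: power_one_over)
    show "min 1 (r / ?y) \<le> (1 / a) ^ length v * min 1 (r / ?x)"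
      using 1 2 by (auto simp: min_def)
    show "0 \<le> min 1 (r / ?y)" using x r by simp
  qed
  also have "\<dots> = (1 / a) ^ (length v * CARD('d)) * sv_min r (word_mat T u)"
    by (simp only: prod.distrib sv_min_def prod_constant card_atLeastAtMost) (simp add: power_mult)
  finally show ?thesis .
qed

lemma small_ball:
  "\<exists>C>0. \<forall>u n r F Y. u \<in> inf_words n0 \<longrightarrow> 0 < r \<longrightarrow> F \<in> borel_measurable \<Omega> \<longrightarrow> path_indep u n F \<longrightarrow>
     Y \<in> borel_measurable \<Omega> \<longrightarrow> path_indep u n Y \<longrightarrow> (\<integral>\<^sup>+\<xi>. F \<xi> \<partial>\<Omega>) < \<infinity> \<longrightarrow>
     (\<integral>\<^sup>+\<xi>. F \<xi> * indicator {\<xi>. norm (proj \<xi> u - Y \<xi>) \<le> r} \<xi> \<partial>\<Omega>) \<le>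
       ennreal (C * sv_min r (word_mat T (restr u n))) * (\<integral>\<^sup>+\<xi>. F \<xi> \<partial>\<Omega>)"
proof -
  \<comment> \<open>By \<open>sv_min_append_le\<close> one more letter enlarges
    \<open>sv_min\<close> by at most \<open>(1 / a) ^ CARD('d)\<close>. A waiting cost of half the
    reciprocal makes the terms of \<open>small_ball_iterate\<close> decay with ratio 1/2.\<close>
  define \<epsilon> where "\<epsilon> = a ^ CARD('d) / 2"
  have ad: "0 < a ^ CARD('d)" "a ^ CARD('d) \<le> 1" using a by (auto intro: power_le_one)
  have \<epsilon>: "0 < \<epsilon>" "\<epsilon> < 1" using ad by (auto simp: \<epsilon>_def)
  obtain H B where H: "H \<in> sets borel" "\<And>x. norm x > R \<Longrightarrow> x \<in> H" "emeasure P H \<le> ennreal \<epsilon>"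
    and B: "0 < B" "\<And>A. A \<in> sets borel \<Longrightarrow> emeasure P (A - H) \<le> ennreal B * emeasure lborel A"
    using absolutely_continuous_split[OF P R(2) \<epsilon>(1)] by blast
  define C where "C = B * (8 * CARD('d) * max 1 R) ^ CARD('d)"
  have C: "0 < C" unfolding C_def using B by (intro mult_pos_pos zero_less_power) auto
  have "(\<integral>\<^sup>+\<xi>. F \<xi> * indicator {\<xi>. norm (proj \<xi> u - Y \<xi>) \<le> r} \<xi> \<partial>\<Omega>) \<le>
       ennreal (2 * C * sv_min r (word_mat T (restr u n))) * (\<integral>\<^sup>+\<xi>. F \<xi> \<partial>\<Omega>)"
    if u: "u \<in> inf_words n0" and r: "0 < r" and F: "F \<in> borel_measurable \<Omega>" "path_indep u n F"
      and Y: "Y \<in> borel_measurable \<Omega>" "path_indep u n Y" and fin: "(\<integral>\<^sup>+\<xi>. F \<xi> \<partial>\<Omega>) < \<infinity>" for u n r and F :: "_ \<Rightarrow> ennreal" and Y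
  proof -
    let ?\<phi> = "\<lambda>n. sv_min r (word_mat T (restr u n))"
    have \<phi>: "0 < ?\<phi> n" for n using sv_min_pos[OF word_mat_invertible[OF restr_words[OF u]] r] .
    obtain i where i: "(\<integral>\<^sup>+\<xi>. F \<xi> \<partial>\<Omega>) = ennreal i" "0 \<le> i" using fin by (cases "\<integral>\<^sup>+\<xi>. F \<xi> \<partial>\<Omega>") auto
    let ?L = "\<integral>\<^sup>+\<xi>. F \<xi> * indicator {\<xi>. norm (proj \<xi> u - Y \<xi>) \<le> r} \<xi> \<partial>\<Omega>"
    have bound: "?L \<le> ennreal ((2 * C * ?\<phi> n + \<epsilon> ^ k) * i)" for k
    proof -
      have "(\<Sum>j<k. \<epsilon> ^ j * C * ?\<phi> (n + j)) \<le> (\<Sum>j<k. C * ?\<phi> n * (1 / 2) ^ j)"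
      proof (intro sum_mono)
        fix j
        have "?\<phi> (n + j) \<le> (1 / a) ^ (j * CARD('d)) * ?\<phi> n"
          unfolding restr_add using sv_min_append_le[OF restr_words[OF u] restr_words[OF shift_inf_words[OF u]] r, of n n j] by simp
        then have "\<epsilon> ^ j * C * ?\<phi> (n + j) \<le> \<epsilon> ^ j * C * ((1 / a) ^ (j * CARD('d)) * ?\<phi> n)"
          using \<epsilon> C by (intro mult_left_mono) auto
        also have "\<dots> = C * ?\<phi> n * (\<epsilon> * (1 / a) ^ CARD('d)) ^ j"
          by (simp add: power_mult_distrib power_mult[symmetric] mult_ac)
        also have "\<epsilon> * (1 / a) ^ CARD('d) = 1 / 2" using a ad by (simp add: \<epsilon>_def power_one_over)
        finally show "\<epsilon> ^ j * C * ?\<phi> (n + j) \<le> C * ?\<phi> n * (1 / 2) ^ j" .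
      qed
      also have "\<dots> = C * ?\<phi> n * (\<Sum>j<k. (1 / 2) ^ j)" by (simp add: sum_distrib_left)
      also have "\<dots> \<le> C * ?\<phi> n * 2"
      proof -
        have "(\<Sum>j<k. (1 / 2) ^ j) = 2 * (1 - (1 / 2) ^ k :: real)" by (simp add: sum_gp_strict)
        then have "(\<Sum>j<k. (1 / 2) ^ j) \<le> (2::real)" by simp
        then show ?thesis using C \<phi>[of n] by (intro mult_left_mono) auto
      qed
      finally have le: "(\<Sum>j<k. \<epsilon> ^ j * C * ?\<phi> (n + j)) + \<epsilon> ^ k \<le> 2 * C * ?\<phi> n + \<epsilon> ^ k" by simp
      have "?L \<le> ennreal ((\<Sum>j<k. \<epsilon> ^ j * C * ?\<phi> (n + j)) + \<epsilon> ^ k) * ennreal i"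
        unfolding i(1)[symmetric] C_def by (rule small_ball_iterate[OF H B \<epsilon>(1) u r F Y])
      also have "\<dots> \<le> ennreal (2 * C * ?\<phi> n + \<epsilon> ^ k) * ennreal i" using le by (intro mult_right_mono ennreal_leI) auto
      also have "\<dots> = ennreal ((2 * C * ?\<phi> n + \<epsilon> ^ k) * i)" using i(2) by (simp add: ennreal_mult'')
      finally show ?thesis .
    qed
    have nn: "0 \<le> (2 * C * ?\<phi> n + \<epsilon> ^ k) * i" for k using C \<phi>[of n] \<epsilon> i(2) by (intro mult_nonneg_nonneg add_nonneg_nonneg) (auto intro: less_imp_le)
    have "?L < \<infinity>" using bound[of 0] by (rule le_less_trans) simp
    then obtain l where l: "?L = ennreal l" "0 \<le> l" by (cases ?L) auto
    have "l \<le> (2 * C * ?\<phi> n + \<epsilon> ^ k) * i" for k using bound[of k] nn[of k] unfolding l(1) by (subst (asm) ennreal_le_iff) auto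
    \<comment> \<open>Waiting for ever has probability 0: as the integral of \<open>F\<close> is
      finite, the remainder \<open>\<epsilon> ^ k * i\<close> vanishes in the limit.\<close>
    moreover have "(\<lambda>k. (2 * C * ?\<phi> n + \<epsilon> ^ k) * i) \<longlonglongrightarrow> (2 * C * ?\<phi> n + 0) * i"
      using \<epsilon> by (intro tendsto_intros LIMSEQ_power_zero) auto
    ultimately have "l \<le> (2 * C * ?\<phi> n) * i" using LIMSEQ_le_const[of "\<lambda>k. (2 * C * ?\<phi> n + \<epsilon> ^ k) * i"] by auto
    then have "ennreal l \<le> ennreal ((2 * C * ?\<phi> n) * i)" by (rule ennreal_leI)
    then show ?thesis unfolding l(1) i(1) using i(2) by (simp add: ennreal_mult'')
  qed
  then show ?thesis using C by (intro exI[of _ "2 * C"]) auto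
qed

end

section \<open>Lower bounds for \<open>q > 1\<close>\<close>

text \<open>Either the sum is at most \<open>t\<close>, or one summand is at least half of it, or
  every summand is smaller than half. In the last case \<open>S - X v\<close> exceeds both
  \<open>S / 2\<close> and \<open>t / 2\<close>, and \<open>S powr (q - 1)\<close> is replaced by a
  power of \<open>S - X v\<close>. This decouples \<open>X v\<close> from its cofactor, for every
  real \<open>q > 1\<close>.\<close>

lemma rosenthal_pointwise:
  fixes X :: "'i \<Rightarrow> real"
  assumes V: "finite V" and X: "\<And>v. v \<in> V \<Longrightarrow> 0 \<le> X v" and q: "1 < q" and t: "0 \<le> t"
  defines "S \<equiv> (\<Sum>v\<in>V. X v)"
  shows "S powr q \<le> t powr (q - 1) * S + 2 powr q * (\<Sum>v\<in>V. X v powr q)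
    + 2 powr (q - 1) * (\<Sum>v\<in>V. X v * (if t / 2 < S - X v then (S - X v) powr (q - 1) else 0))"
proof -
  have S0: "0 \<le> S" unfolding S_def using X by (intro sum_nonneg)
  have pq: "z powr q = z * z powr (q - 1)" if "0 \<le> z" for z :: real
    using that powr_add[of z 1 "q - 1"] by (cases "z = 0") auto
  have XS: "X v \<le> S" if "v \<in> V" for v unfolding S_def using member_le_sum[of v V X] that V X by fastforce
  have n1: "0 \<le> t powr (q - 1) * S" using S0 by simp
  have n2: "0 \<le> 2 powr q * (\<Sum>v\<in>V. X v powr q)" by (simp add: sum_nonneg)
  have n3: "0 \<le> 2 powr (q - 1) * (\<Sum>v\<in>V. X v * (if t / 2 < S - X v then (S - X v) powr (q - 1) else 0))"
    using X by (intro mult_nonneg_nonneg sum_nonneg) auto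
  consider "S \<le> t" | v where "t < S" "v \<in> V" "S / 2 \<le> X v" | "t < S" "\<And>v. v \<in> V \<Longrightarrow> X v < S / 2"
    by (meson linorder_not_le)
  then show ?thesis
  proof cases
    case 1
    have "S powr q \<le> t powr (q - 1) * S"
      using S0 1 q by (simp add: pq mult.commute[of S]) (intro mult_right_mono powr_mono2, auto)
    then show ?thesis using n2 n3 by linarith
  next
    case 2
    have "S powr q \<le> (2 * X v) powr q" using 2 S0 q by (intro powr_mono2) auto
    also have "\<dots> = 2 powr q * X v powr q" using X[OF 2(2)] by (simp add: powr_mult)
    also have "\<dots> \<le> 2 powr q * (\<Sum>v\<in>V. X v powr q)"
      using 2(2) V by (intro mult_left_mono member_le_sum) auto
    finally show ?thesis using n1 n3 by linarith
  next
    case 3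
    have "S powr q = (\<Sum>v\<in>V. X v * S powr (q - 1))" using S0 by (simp add: pq S_def sum_distrib_right)
    also have "\<dots> \<le> (\<Sum>v\<in>V. 2 powr (q - 1) * (X v * (if t / 2 < S - X v then (S - X v) powr (q - 1) else 0)))"
    proof (intro sum_mono)
      fix v assume v: "v \<in> V"
      have c: "t / 2 < S - X v" "S \<le> 2 * (S - X v)" using 3(2)[OF v] 3(1) by auto
      have "S powr (q - 1) \<le> (2 * (S - X v)) powr (q - 1)" using c S0 q by (intro powr_mono2) auto
      also have "\<dots> = 2 powr (q - 1) * (S - X v) powr (q - 1)" by (subst powr_mult) (use XS[OF v] in auto)
      finally have "X v * S powr (q - 1) \<le> X v * (2 powr (q - 1) * (S - X v) powr (q - 1))"
        using X[OF v] by (intro mult_left_mono)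
      then show "X v * S powr (q - 1) \<le> 2 powr (q - 1) * (X v * (if t / 2 < S - X v then (S - X v) powr (q - 1) else 0))"
        using c by (simp add: mult_ac)
    qed
    finally show ?thesis using n1 n2 by (simp add: sum_distrib_left)
  qed
qed

section \<open>Comparison of mesh moments at neighbouring scales\<close>

context affine_words
begin

lemma sum_mass_mesh_le:
  assumes r: "0 < r" and F: "finite F" "F \<subseteq> mesh r" and w: "w \<in> words n0"
  shows "(\<Sum>Q\<in>F. mass \<omega> w Q) \<le> pw w"
proof -
  have "(\<Sum>Q\<in>F. mass \<omega> w Q) = measure M (\<Union>Q\<in>F. {u \<in> cylinder n0 w. proj \<omega> u \<in> Q})"
    unfolding mass_def
  proof (rule bernoulli.finite_measure_finite_Union[symmetric])
    show "(\<lambda>Q. {u \<in> cylinder n0 w. proj \<omega> u \<in> Q}) ` F \<subseteq> sets M" using F mesh_borel mass_sets by blast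
    show "disjoint_family_on (\<lambda>Q. {u \<in> cylinder n0 w. proj \<omega> u \<in> Q}) F"
      using F mesh_cube_unique[OF r] by (fastforce simp: disjoint_family_on_def)
  qed (rule F)
  also have "\<dots> \<le> measure M (cylinder n0 w)" by (intro bernoulli.finite_measure_mono) auto
  finally show ?thesis using w by (simp add: measure_cylinder_M)
qed

text \<open>Almost sure bounds are obtained at dyadic scales only, and this passes to all
  \<open>r\<close>. A cube of side \<open>r\<close> meets at most \<open>(2 * d + 2) ^ d\<close>
  near cubes of side \<open>\<rho>\<close>, with \<open>d\<close> the dimension, which enters
  through Jensen; a cube of side \<open>\<rho>\<close> meets at most \<open>(4 * d + 2) ^ d\<close>
  near cubes of side \<open>r\<close>. The set \<open>V\<close> is the empty word for
  \<open>q > 1\<close> and a set of good words for \<open>q = 1\<close>.\<close>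

lemma mesh_moment_compare:
  fixes V :: "nat list set"
  assumes \<omega>: "bounded_by R \<omega>" and R: "0 < R" and r: "0 < r" "r \<le> \<rho>" "\<rho> \<le> 2 * r" and q: "1 < q"
  defines "G \<equiv> \<lambda>Q. \<Sum>w\<in>V. mass \<omega> w Q"
  shows "(\<Sum>Q\<in>near_cubes r (rad R). G Q powr q) \<le>
    ((2 * real CARD('d) + 2) ^ CARD('d)) powr (q - 1) * (4 * real CARD('d) + 2) ^ CARD('d) * (\<Sum>Q\<in>near_cubes \<rho> (rad R). G Q powr q)"
proof -
  let ?L = "(2 * real CARD('d) + 2) ^ CARD('d)" and ?L' = "(4 * real CARD('d) + 2) ^ CARD('d)"
  let ?A = "near_cubes r (rad R) :: (real^'d) set set" and ?B = "near_cubes \<rho> (rad R) :: (real^'d) set set"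
  have \<rho>: "0 < \<rho>" using r by simp
  have R0: "0 \<le> rad R" using R b by (simp add: rad_def)
  have fin: "finite ?A" "finite ?B" using finite_near_cubes r \<rho> R0 by blast+
  define N where "N Q' = {Q \<in> ?B. Q \<inter> Q' \<noteq> {}}" for Q'
  have finN: "finite (N Q')" for Q' using fin by (simp add: N_def)
  have L: "0 < ?L" by simp
  have G0: "0 \<le> G Q" for Q by (simp add: G_def sum_nonneg)
  have one: "G Q' powr q \<le> ?L powr (q - 1) * (\<Sum>Q\<in>N Q'. G Q powr q)" if Q': "Q' \<in> ?A" for Q'
  proof -
    have m: "Q' \<in> mesh r" using Q' by (simp add: near_cubes_def)
    obtain y where y: "y \<in> Q'" using Q' by (auto simp: near_cubes_def)
    have "N Q' \<subseteq> {Q \<in> mesh \<rho>. Q \<inter> cball y (CARD('d) * r) \<noteq> {}}"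
    proof
      fix Q assume Q: "Q \<in> N Q'"
      then obtain x where x: "x \<in> Q" "x \<in> Q'" by (auto simp: N_def)
      have "x \<in> cball y (CARD('d) * r)" using mesh_cube_diameter[OF m y x(2)] by (simp add: dist_norm)
      then show "Q \<in> {Q \<in> mesh \<rho>. Q \<inter> cball y (CARD('d) * r) \<noteq> {}}" using Q x by (auto simp: N_def near_cubes_def)
    qed
    then have "real (card (N Q')) \<le> real (card {Q \<in> mesh \<rho>. Q \<inter> cball y (CARD('d) * r) \<noteq> {}})"
      using mesh_count_ball(1)[OF \<rho>, of "CARD('d) * r" y] r by (intro of_nat_mono card_mono) auto
    also have "\<dots> \<le> (2 * (CARD('d) * r) / \<rho> + 2) ^ CARD('d)" using mesh_count_ball(2)[OF \<rho>, of "CARD('d) * r" y] r by simp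
    also have "\<dots> \<le> ?L"
    proof (intro power_mono add_right_mono)
      have "2 * (real CARD('d) * r) \<le> 2 * real CARD('d) * \<rho>" using r by (simp add: mult_left_mono)
      then show "2 * (real CARD('d) * r) / \<rho> \<le> 2 * real CARD('d)" using \<rho> by (simp add: divide_le_eq)
    qed (use r \<rho> in simp)
    finally have cN: "real (card (N Q')) \<le> ?L" .
    have Nb: "Q \<in> sets borel" if "Q \<in> N Q'" for Q using that mesh_borel[of Q \<rho>] by (simp add: N_def near_cubes_def)
    have "mass \<omega> w Q' \<le> (\<Sum>Q\<in>N Q'. mass \<omega> w Q)" for w
    proof -
      have sub: "{u \<in> cylinder n0 w. proj \<omega> u \<in> Q'} \<subseteq> (\<Union>Q\<in>N Q'. {u \<in> cylinder n0 w. proj \<omega> u \<in> Q})"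
      proof
        fix u assume u: "u \<in> {u \<in> cylinder n0 w. proj \<omega> u \<in> Q'}"
        obtain Q where Q: "Q \<in> mesh \<rho>" "proj \<omega> u \<in> Q" by (rule mesh_covers[OF \<rho>])
        have "proj \<omega> u \<in> cball 0 (rad R)" using norm_proj_le[OF \<omega>, of u] u by (simp add: cylinder_iff)
        then have "Q \<in> N Q'" unfolding N_def near_cubes_def using Q u by blast
        then show "u \<in> (\<Union>Q\<in>N Q'. {u \<in> cylinder n0 w. proj \<omega> u \<in> Q})" using Q u by blast
      qed
      have "mass \<omega> w Q' \<le> measure M (\<Union>Q\<in>N Q'. {u \<in> cylinder n0 w. proj \<omega> u \<in> Q})"
        unfolding mass_def using sub finN mass_sets[OF Nb] by (intro bernoulli.finite_measure_mono sets.finite_UN) auto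
      also have "\<dots> \<le> (\<Sum>Q\<in>N Q'. mass \<omega> w Q)"
        unfolding mass_def using finN mass_sets[OF Nb] by (intro bernoulli.finite_measure_subadditive_finite) auto
      finally show ?thesis .
    qed
    then have "G Q' \<le> (\<Sum>w\<in>V. \<Sum>Q\<in>N Q'. mass \<omega> w Q)" unfolding G_def by (intro sum_mono)
    also have "\<dots> = (\<Sum>Q\<in>N Q'. G Q)" unfolding G_def by (rule sum.swap)
    finally have "G Q' powr q \<le> (\<Sum>Q\<in>N Q'. G Q) powr q" using q G0 by (intro powr_mono2) auto
    also have "\<dots> = ?L powr (q - 1) * (?L powr (1 - q) * (\<Sum>Q\<in>N Q'. G Q) powr q)"
      using L by (simp add: powr_add[symmetric] mult.assoc[symmetric])
    also have "\<dots> \<le> ?L powr (q - 1) * (\<Sum>Q\<in>N Q'. G Q powr q)"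
      using sum_powr_ge[OF finN cN L, of G q] q G0 by (intro mult_left_mono) auto
    finally show ?thesis .
  qed
  have cnt: "real (card {Q' \<in> ?A. Q \<inter> Q' \<noteq> {}}) \<le> ?L'" if Q: "Q \<in> ?B" for Q
  proof -
    have m: "Q \<in> mesh \<rho>" using Q by (simp add: near_cubes_def)
    obtain y where y: "y \<in> Q" using Q by (auto simp: near_cubes_def)
    have "{Q' \<in> ?A. Q \<inter> Q' \<noteq> {}} \<subseteq> {Q' \<in> mesh r. Q' \<inter> cball y (CARD('d) * \<rho>) \<noteq> {}}"
    proof
      fix Q' assume Q': "Q' \<in> {Q' \<in> ?A. Q \<inter> Q' \<noteq> {}}"
      then obtain x where x: "x \<in> Q" "x \<in> Q'" by auto
      have "x \<in> cball y (CARD('d) * \<rho>)" using mesh_cube_diameter[OF m y x(1)] by (simp add: dist_norm)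
      then show "Q' \<in> {Q' \<in> mesh r. Q' \<inter> cball y (CARD('d) * \<rho>) \<noteq> {}}" using Q' x by (auto simp: near_cubes_def)
    qed
    then have "real (card {Q' \<in> ?A. Q \<inter> Q' \<noteq> {}}) \<le> real (card {Q' \<in> mesh r. Q' \<inter> cball y (CARD('d) * \<rho>) \<noteq> {}})"
      using mesh_count_ball(1)[OF r(1), of "CARD('d) * \<rho>" y] \<rho> by (intro of_nat_mono card_mono) auto
    also have "\<dots> \<le> (2 * (CARD('d) * \<rho>) / r + 2) ^ CARD('d)" using mesh_count_ball(2)[OF r(1), of "CARD('d) * \<rho>" y] \<rho> by simp
    also have "\<dots> \<le> ?L'"
    proof (intro power_mono add_right_mono)
      have "2 * (real CARD('d) * \<rho>) \<le> 2 * (real CARD('d) * (2 * r))" using r by (intro mult_left_mono) auto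
      then show "2 * (real CARD('d) * \<rho>) / r \<le> 4 * real CARD('d)" using r by (simp add: divide_le_eq)
    qed (use r \<rho> in simp)
    finally show ?thesis .
  qed
  have "(\<Sum>Q'\<in>?A. G Q' powr q) \<le> (\<Sum>Q'\<in>?A. ?L powr (q - 1) * (\<Sum>Q\<in>N Q'. G Q powr q))"
    using one by (intro sum_mono)
  also have "\<dots> = ?L powr (q - 1) * (\<Sum>Q'\<in>?A. \<Sum>Q\<in>?B. if Q \<inter> Q' \<noteq> {} then G Q powr q else 0)"
    unfolding N_def using fin by (simp add: sum_distrib_left sum.inter_filter)
  also have "(\<Sum>Q'\<in>?A. \<Sum>Q\<in>?B. if Q \<inter> Q' \<noteq> {} then G Q powr q else 0) =
      (\<Sum>Q\<in>?B. \<Sum>Q'\<in>?A. if Q \<inter> Q' \<noteq> {} then G Q powr q else 0)" by (rule sum.swap)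
  also have "\<dots> = (\<Sum>Q\<in>?B. real (card {Q' \<in> ?A. Q \<inter> Q' \<noteq> {}}) * G Q powr q)"
    using fin by (simp add: sum.inter_filter[symmetric])
  also have "?L powr (q - 1) * \<dots> \<le> ?L powr (q - 1) * (\<Sum>Q\<in>?B. ?L' * G Q powr q)"
    using cnt by (intro mult_left_mono sum_mono mult_right_mono) auto
  finally show ?thesis by (simp add: sum_distrib_left mult.assoc)
qed

end

section \<open>Expected moments of cylinder masses\<close>

context random_affine_words
begin

lemma mass_measurable [measurable]:
  assumes Q: "Q \<in> sets borel"
  shows "(\<lambda>\<xi>. mass \<xi> w Q) \<in> borel_measurable \<Omega>"
proof -
  define A where "A = {z \<in> space (\<Omega> \<Otimes>\<^sub>M M). (case z of (\<xi>, u) \<Rightarrow> proj \<xi> u) \<in> Q} \<inter> {z \<in> space (\<Omega> \<Otimes>\<^sub>M M). snd z \<in> cylinder n0 w}"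
  have "A \<in> sets (\<Omega> \<Otimes>\<^sub>M M)"
  proof -
    have 1: "{z \<in> space (\<Omega> \<Otimes>\<^sub>M M). (case z of (\<xi>, u) \<Rightarrow> proj \<xi> u) \<in> Q} \<in> sets (\<Omega> \<Otimes>\<^sub>M M)"
      using measurable_sets[OF proj_measurable_pair Q] by (simp add: vimage_def Int_def conj_commute)
    have 2: "{z \<in> space (\<Omega> \<Otimes>\<^sub>M M). snd z \<in> cylinder n0 w} \<in> sets (\<Omega> \<Otimes>\<^sub>M M)"
      using measurable_sets[OF measurable_snd[of \<Omega> M] cylinder_sets[of w]] by (simp add: vimage_def Int_def conj_commute)
    show ?thesis unfolding A_def using 1 2 by (rule sets.Int)
  qed
  then have "(\<lambda>\<xi>. emeasure M (Pair \<xi> -` A)) \<in> borel_measurable \<Omega>" by (rule bernoulli.measurable_emeasure_Pair)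
  then have "(\<lambda>\<xi>. enn2real (emeasure M (Pair \<xi> -` A))) \<in> borel_measurable \<Omega>" by measurable
  moreover have "mass \<xi> w Q = enn2real (emeasure M (Pair \<xi> -` A))" if "\<xi> \<in> space \<Omega>" for \<xi>
  proof -
    have "Pair \<xi> -` A = {u \<in> cylinder n0 w. proj \<xi> u \<in> Q}"
      using that by (auto simp: A_def space_pair_measure space_M cylinder_iff)
    then show ?thesis by (simp add: mass_def measure_def)
  qed
  ultimately show ?thesis by (subst measurable_cong) auto
qed

text \<open>The words coded in the cylinder of \<open>w\<close> have left the path \<open>u\<close>
  by level \<open>Suc n\<close>, so none of their prefixes longer than \<open>n\<close> is a prefix
  of \<open>u\<close>.\<close>

lemma mass_path_indep:
  assumes u: "u \<in> inf_words n0" and n: "n < length w" and w: "restr u (Suc n) \<noteq> take (Suc n) w"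
  shows "path_indep u n (\<lambda>\<xi>. mass \<xi> w Q)"
  unfolding path_indep_def
proof (intro ballI allI impI)
  fix \<xi> :: "nat list \<Rightarrow> real^'d" and j x assume j: "n \<le> j"
  have "proj (\<xi>(restr u (Suc j) := x)) v = proj \<xi> v" if v: "v \<in> cylinder n0 w" for v
  proof -
    have "restr v (Suc i) \<noteq> restr u (Suc j)" for i
    proof
      assume eq: "restr v (Suc i) = restr u (Suc j)"
      then have "i = j" by (metis Suc_inject length_restr)
      then have "take (Suc n) (restr v (Suc j)) = take (Suc n) (restr u (Suc j))" using eq by simp
      then have "restr v (Suc n) = restr u (Suc n)" using j by (simp add: take_restr)
      moreover have "restr v (Suc n) = take (Suc n) w"
        using v n take_restr[of "Suc n" "length w" v] by (simp add: cylinder_iff)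
      ultimately show False using w by simp
    qed
    then have "proj_term (\<xi>(restr u (Suc j) := x)) v i = proj_term \<xi> v i" for i by (simp add: proj_term_def)
    then show ?thesis by (simp add: proj_def)
  qed
  then have "{v \<in> cylinder n0 w. proj (\<xi>(restr u (Suc j) := x)) v \<in> Q} = {v \<in> cylinder n0 w. proj \<xi> v \<in> Q}" by auto
  then show "mass (\<xi>(restr u (Suc j) := x)) w Q = mass \<xi> w Q" by (simp add: mass_def)
qed

text \<open>Fubini turns the expectation into an integral over the words \<open>u\<close> of the
  cylinder. The cube lies in a ball of radius \<open>CARD('d) * r\<close> about any of its points,
  so \<open>small_ball\<close> applies with a constant centre. The weight ignores only the
  translations on the path from the level of \<open>w\<close> on, which is why the matrix of
  \<open>butlast w\<close> appears.\<close>

lemma expectation_mass_le: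
  "\<exists>C>0. \<forall>w (r::real) Q F. w \<in> words n0 \<longrightarrow> w \<noteq> [] \<longrightarrow> 0 < r \<longrightarrow> Q \<in> mesh r \<longrightarrow> F \<in> borel_measurable \<Omega> \<longrightarrow>
     (\<forall>\<xi>. 0 \<le> F \<xi>) \<longrightarrow> (\<exists>B. \<forall>\<xi>. F \<xi> \<le> B) \<longrightarrow> (\<forall>u\<in>cylinder n0 w. path_indep u (length w - 1) F) \<longrightarrow>
     omega.expectation (\<lambda>\<xi>. mass \<xi> w Q * F \<xi>) \<le>
       C * sv_min (CARD('d) * r) (word_mat T (butlast w)) * pw w * omega.expectation (F :: _ \<Rightarrow> real)"
proof -
  obtain C where C: "0 < C" and ball: "\<And>u n r F Y. u \<in> inf_words n0 \<Longrightarrow> 0 < r \<Longrightarrow> F \<in> borel_measurable \<Omega> \<Longrightarrow> path_indep u n F \<Longrightarrow>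
     Y \<in> borel_measurable \<Omega> \<Longrightarrow> path_indep u n Y \<Longrightarrow> (\<integral>\<^sup>+\<xi>. F \<xi> \<partial>\<Omega>) < \<infinity> \<Longrightarrow>
     (\<integral>\<^sup>+\<xi>. F \<xi> * indicator {\<xi>. norm (proj \<xi> u - Y \<xi>) \<le> r} \<xi> \<partial>\<Omega>) \<le>
       ennreal (C * sv_min r (word_mat T (restr u n))) * (\<integral>\<^sup>+\<xi>. F \<xi> \<partial>\<Omega>)"
    using small_ball by blast
  have "omega.expectation (\<lambda>\<xi>. mass \<xi> w Q * F \<xi>) \<le>
       C * sv_min (CARD('d) * r) (word_mat T (butlast w)) * pw w * omega.expectation F"
    if w: "w \<in> words n0" "w \<noteq> []" and r: "0 < r" and Q: "Q \<in> mesh r" and F: "F \<in> borel_measurable \<Omega>"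
      and F0: "\<And>\<xi>. 0 \<le> F \<xi>" and FB: "\<And>\<xi>. F \<xi> \<le> B" and ind: "\<And>u. u \<in> cylinder n0 w \<Longrightarrow> path_indep u (length w - 1) F"
    for w Q B and r :: real and F :: "(nat list \<Rightarrow> real^'d) \<Rightarrow> real"
  proof (cases "Q = {}")
    case True
    then have "mass \<xi> w Q = 0" for \<xi> by (simp add: mass_def)
    moreover have "0 \<le> sv_min (CARD('d) * r) (word_mat T (butlast w))"
      using sv_min_pos[of "word_mat T (butlast w)" "CARD('d) * r"] word_mat_invertible[of "butlast w"] w(1) r
      by (auto simp: words_iff dest: in_set_butlastD intro: less_imp_le)
    ultimately show ?thesis using C F0 pw_nonneg[OF w(1)] by (auto intro!: mult_nonneg_nonneg Bochner_Integration.integral_nonneg)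
  next
    case False
    note [measurable] = F
    have Qb [measurable]: "Q \<in> sets borel" using mesh_borel[OF Q] .
    obtain y where y: "y \<in> Q" using False by blast
    interpret PM: pair_sigma_finite \<Omega> M by unfold_locales
    let ?\<phi> = "sv_min (CARD('d) * r) (word_mat T (butlast w))"
    have bw: "butlast w \<in> words n0" using w(1) by (auto simp: words_iff dest: in_set_butlastD)
    have r': "0 < CARD('d) * r" using r by simp
    have \<phi>: "0 < ?\<phi>" using sv_min_pos[OF word_mat_invertible[OF bw] r'] .
    have intF: "integrable \<Omega> F" using F0 FB by (intro omega.integrable_const_bound[of _ B]) auto
    let ?f = "\<lambda>\<xi>. ennreal (F \<xi>)"
    have I: "(\<integral>\<^sup>+\<xi>. ?f \<xi> \<partial>\<Omega>) = ennreal (omega.expectation F)" using intF F0 by (intro nn_integral_eq_integral) auto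
    have meas: "(\<lambda>(\<xi>, u). ?f \<xi> * (indicator (cylinder n0 w) u * indicator Q (proj \<xi> u))) \<in> borel_measurable (\<Omega> \<Otimes>\<^sub>M M)"
    proof -
      have "(\<lambda>z. indicator Q ((\<lambda>(\<xi>, u). proj \<xi> u) z) :: ennreal) \<in> borel_measurable (\<Omega> \<Otimes>\<^sub>M M)"
        by (rule measurable_compose[OF proj_measurable_pair]) simp
      then show ?thesis unfolding split_beta' by measurable
    qed
    have "(\<integral>\<^sup>+\<xi>. ennreal (mass \<xi> w Q * F \<xi>) \<partial>\<Omega>) = (\<integral>\<^sup>+\<xi>. (\<integral>\<^sup>+u. ?f \<xi> * (indicator (cylinder n0 w) u * indicator Q (proj \<xi> u)) \<partial>M) \<partial>\<Omega>)"
    proof (intro nn_integral_cong)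
      fix \<xi>
      have "(\<integral>\<^sup>+u. indicator (cylinder n0 w) u * indicator Q (proj \<xi> u) \<partial>M) = (\<integral>\<^sup>+u. indicator {u \<in> cylinder n0 w. proj \<xi> u \<in> Q} u \<partial>M)"
        by (intro nn_integral_cong) (auto simp: indicator_def)
      also have "\<dots> = ennreal (mass \<xi> w Q)"
        using mass_sets[OF Qb] by (simp add: mass_def bernoulli.emeasure_eq_measure)
      finally have "(\<integral>\<^sup>+u. ?f \<xi> * (indicator (cylinder n0 w) u * indicator Q (proj \<xi> u)) \<partial>M) = ?f \<xi> * ennreal (mass \<xi> w Q)"
        by (subst nn_integral_cmult) auto
      then show "ennreal (mass \<xi> w Q * F \<xi>) = (\<integral>\<^sup>+u. ?f \<xi> * (indicator (cylinder n0 w) u * indicator Q (proj \<xi> u)) \<partial>M)"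
        using F0 by (simp add: ennreal_mult' mult.commute)
    qed
    also have "\<dots> = (\<integral>\<^sup>+u. (\<integral>\<^sup>+\<xi>. ?f \<xi> * (indicator (cylinder n0 w) u * indicator Q (proj \<xi> u)) \<partial>\<Omega>) \<partial>M)"
      by (rule PM.Fubini'[OF meas, symmetric])
    also have "\<dots> \<le> (\<integral>\<^sup>+u. ennreal (C * ?\<phi> * omega.expectation F) * indicator (cylinder n0 w) u \<partial>M)"
    proof (intro nn_integral_mono)
      fix u
      show "(\<integral>\<^sup>+\<xi>. ?f \<xi> * (indicator (cylinder n0 w) u * indicator Q (proj \<xi> u)) \<partial>\<Omega>) \<le> ennreal (C * ?\<phi> * omega.expectation F) * indicator (cylinder n0 w) u"
      proof (cases "u \<in> cylinder n0 w")
        case True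
        then have u: "u \<in> inf_words n0" "restr u (length w) = w" by (auto simp: cylinder_iff)
        have e1: "restr u (length w - 1) = butlast w"
          using u(2) take_restr[of "length w - 1" "length w" u] by (simp add: butlast_conv_take)
        have e2: "(\<integral>\<^sup>+\<xi>. ?f \<xi> * indicator {\<xi>. norm (proj \<xi> u - y) \<le> CARD('d) * r} \<xi> \<partial>\<Omega>) \<le>
            ennreal (C * sv_min (CARD('d) * r) (word_mat T (restr u (length w - 1)))) * (\<integral>\<^sup>+\<xi>. ?f \<xi> \<partial>\<Omega>)"
          using ind[OF True] by (intro ball u r') (auto simp: I path_indep_def)
        have e3: "(\<integral>\<^sup>+\<xi>. ?f \<xi> * (indicator (cylinder n0 w) u * indicator Q (proj \<xi> u)) \<partial>\<Omega>) \<le>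
            (\<integral>\<^sup>+\<xi>. ?f \<xi> * indicator {\<xi>. norm (proj \<xi> u - y) \<le> CARD('d) * r} \<xi> \<partial>\<Omega>)"
          using mesh_cube_diameter[OF Q _ y] by (intro nn_integral_mono mult_left_mono) (auto simp: indicator_def)
        have "(\<integral>\<^sup>+\<xi>. ?f \<xi> * (indicator (cylinder n0 w) u * indicator Q (proj \<xi> u)) \<partial>\<Omega>) \<le>
            ennreal (C * ?\<phi>) * ennreal (omega.expectation F)"
          using order_trans[OF e3 e2] unfolding e1 I .
        also have "\<dots> = ennreal (C * ?\<phi> * omega.expectation F)"
          using C \<phi> by (intro ennreal_mult'[symmetric] mult_nonneg_nonneg) auto
        finally show ?thesis using True by simp
      qed simp
    qed
    also have "\<dots> = ennreal (C * ?\<phi> * omega.expectation F) * ennreal (pw w)"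
      by (simp add: nn_integral_cmult_indicator bernoulli.emeasure_eq_measure measure_cylinder_M[OF w(1)])
    also have "\<dots> = ennreal (C * ?\<phi> * pw w * omega.expectation F)"
      using pw_nonneg[OF w(1)] by (subst ennreal_mult''[symmetric]) (auto simp: mult_ac)
    finally have le: "(\<integral>\<^sup>+\<xi>. ennreal (mass \<xi> w Q * F \<xi>) \<partial>\<Omega>) \<le> ennreal (C * ?\<phi> * pw w * omega.expectation F)" .
    have "mass \<xi> w Q * F \<xi> \<le> 1 * B" for \<xi>
      using order_trans[OF mass_le[OF w(1)] pw_le_1[OF w(1)]] F0 FB by (intro mult_mono) auto
    then have "AE \<xi> in \<Omega>. norm (mass \<xi> w Q * F \<xi>) \<le> 1 * B" using F0 by (intro AE_I2) (simp add: abs_mult)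
    then have "integrable \<Omega> (\<lambda>\<xi>. mass \<xi> w Q * F \<xi>)" by (intro omega.integrable_const_bound[of _ "1 * B"]) auto
    then have "(\<integral>\<^sup>+\<xi>. ennreal (mass \<xi> w Q * F \<xi>) \<partial>\<Omega>) = ennreal (omega.expectation (\<lambda>\<xi>. mass \<xi> w Q * F \<xi>))"
      using F0 by (intro nn_integral_eq_integral) auto
    with le have "ennreal (omega.expectation (\<lambda>\<xi>. mass \<xi> w Q * F \<xi>)) \<le> ennreal (C * ?\<phi> * pw w * omega.expectation F)" by simp
    moreover have "0 \<le> C * ?\<phi> * pw w * omega.expectation F"
      using C \<phi> pw_nonneg[OF w(1)] Bochner_Integration.integral_nonneg[of \<Omega> F] F0 by (intro mult_nonneg_nonneg) auto
    ultimately show ?thesis by (simp only: ennreal_le_iff)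
  qed
  then show ?thesis using C by (intro exI[of _ C]) blast
qed

lemma integrable_mass_powr:
  assumes Q: "Q \<in> sets borel" and w: "w \<in> words n0" and q: "0 \<le> q"
  shows "integrable \<Omega> (\<lambda>\<xi>. mass \<xi> w Q powr q)"
proof (rule omega.integrable_const_bound[of _ 1])
  note [measurable] = Q
  show "(\<lambda>\<xi>. mass \<xi> w Q powr q) \<in> borel_measurable \<Omega>" by measurable
  have "mass \<xi> w Q powr q \<le> 1 powr q" for \<xi>
    using mass_le[OF w, of \<xi> Q] pw_le_1[OF w] q by (intro powr_mono2) auto
  then show "AE \<xi> in \<Omega>. norm (mass \<xi> w Q powr q) \<le> 1" by simp
qed

lemma integrable_mass: "Q \<in> sets borel \<Longrightarrow> w \<in> words n0 \<Longrightarrow> integrable \<Omega> (\<lambda>\<xi>. mass \<xi> w Q)"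
  using integrable_mass_powr[of Q w 1] by simp

lemma sum_expectation_mass_le:
  assumes r: "0 < r" and F: "finite F" "F \<subseteq> mesh r" and w: "w \<in> words n0"
  shows "(\<Sum>Q\<in>F. omega.expectation (\<lambda>\<xi>. mass \<xi> w Q)) \<le> pw w"
proof -
  have int: "integrable \<Omega> (\<lambda>\<xi>. mass \<xi> w Q)" if "Q \<in> F" for Q
    using that F mesh_borel by (intro integrable_mass w) blast
  have "(\<Sum>Q\<in>F. omega.expectation (\<lambda>\<xi>. mass \<xi> w Q)) = omega.expectation (\<lambda>\<xi>. \<Sum>Q\<in>F. mass \<xi> w Q)"
    using int by (intro Bochner_Integration.integral_sum[symmetric]) auto
  also have "\<dots> \<le> omega.expectation (\<lambda>\<xi>. pw w)"
    using int sum_mass_mesh_le[OF r F w] by (intro integral_mono Bochner_Integration.integrable_sum) auto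
  finally show ?thesis by (simp add: omega.prob_space)
qed

text \<open>The mass of \<open>w\<close> is split over its extensions by \<open>N\<close> letters,
  and \<open>rosenthal_pointwise\<close> is applied. In the mixed term the factor \<open>G v\<close>
  involves only the sibling cylinders, so it ignores the translations on a path through
  \<open>w @ v\<close> from the level of \<open>w @ v\<close> on, and
  \<open>expectation_mass_le\<close> bounds the expected product. A suitable level \<open>t\<close>
  allows this term to be absorbed by the left side.\<close>

lemma moment_recursion:
  assumes q: "1 < q" and N: "0 < N"
  shows "\<exists>C>0. \<forall>w (r::real) Q. w \<in> words n0 \<longrightarrow> 0 < r \<longrightarrow> Q \<in> mesh r \<longrightarrow>
    omega.expectation (\<lambda>\<xi>. mass \<xi> w Q powr q) \<le>
      2 powr (q + 1) * (\<Sum>v\<in>W N. omega.expectation (\<lambda>\<xi>. mass \<xi> (w @ v) Q powr q)) +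
      2 * (C * sv_min (CARD('d) * r) (word_mat T w) * pw w) powr (q - 1) * omega.expectation (\<lambda>\<xi>. mass \<xi> w Q)"
proof -
  obtain C0 where C0: "0 < C0" and ex: "\<And>w (r::real) Q F. w \<in> words n0 \<Longrightarrow> w \<noteq> [] \<Longrightarrow> 0 < r \<Longrightarrow> Q \<in> mesh r \<Longrightarrow> F \<in> borel_measurable \<Omega> \<Longrightarrow>
     (\<forall>\<xi>. 0 \<le> F \<xi>) \<Longrightarrow> (\<exists>B. \<forall>\<xi>. F \<xi> \<le> B) \<Longrightarrow> (\<forall>u\<in>cylinder n0 w. path_indep u (length w - 1) F) \<Longrightarrow>
     omega.expectation (\<lambda>\<xi>. mass \<xi> w Q * F \<xi>) \<le>
       C0 * sv_min (CARD('d) * r) (word_mat T (butlast w)) * pw w * omega.expectation (F :: _ \<Rightarrow> real)"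
    using expectation_mass_le by blast
  \<comment> \<open>Accounts for replacing the matrix of \<open>butlast (w @ v)\<close> by that of
    \<open>w\<close>, fewer than \<open>N\<close> letters apart.\<close>
  define C1 where "C1 = C0 * (1 / a) ^ (N * CARD('d))"
  have C1: "0 < C1" using C0 a by (simp add: C1_def)
  define C where "C = 2 powr (q + 1) * C1"
  have C: "0 < C" using C1 by (simp add: C_def)
  have "omega.expectation (\<lambda>\<xi>. mass \<xi> w Q powr q) \<le>
      2 powr (q + 1) * (\<Sum>v\<in>W N. omega.expectation (\<lambda>\<xi>. mass \<xi> (w @ v) Q powr q)) +
      2 * (C * sv_min (CARD('d) * r) (word_mat T w) * pw w) powr (q - 1) * omega.expectation (\<lambda>\<xi>. mass \<xi> w Q)"
    if w: "w \<in> words n0" and r: "0 < r" and Q: "Q \<in> mesh r" for w Q and r :: real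
  proof (cases "pw w = 0")
    case True
    have "mass \<xi> w Q = 0" for \<xi> using mass_le[OF w, of \<xi> Q] True mass_nonneg[of \<xi> w Q] by linarith
    then show ?thesis using q by (auto intro!: mult_nonneg_nonneg sum_nonneg Bochner_Integration.integral_nonneg)
  next
    case False
    then have pw: "0 < pw w" using pw_nonneg[OF w] by simp
    have Qb [measurable]: "Q \<in> sets borel" using mesh_borel[OF Q] .
    let ?r = "CARD('d) * r"
    have r': "0 < ?r" using r by simp
    define \<beta> where "\<beta> = C1 * sv_min ?r (word_mat T w) * pw w"
    have \<beta>: "0 < \<beta>" using C1 pw sv_min_pos[OF word_mat_invertible[OF w] r'] by (simp add: \<beta>_def)
    \<comment> \<open>Chosen so that \<open>2 powr (q - 1) * \<beta> * (2 / t) = 1 / 2\<close>: the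
      mixed term becomes half of the moment that is being estimated.\<close>
    define t where "t = 2 powr (q + 1) * \<beta>"
    have t: "0 < t" using \<beta> by (simp add: t_def)
    have tC: "t = C * sv_min ?r (word_mat T w) * pw w" by (simp add: t_def \<beta>_def C_def)
    define S where "S \<xi> = mass \<xi> w Q" for \<xi>
    define X where "X v \<xi> = mass \<xi> (w @ v) Q" for v \<xi>
    define G where "G v \<xi> = (if t / 2 < S \<xi> - X v \<xi> then (S \<xi> - X v \<xi>) powr (q - 1) else 0)" for v \<xi>
    have [measurable]: "S \<in> borel_measurable \<Omega>" "X v \<in> borel_measurable \<Omega>" for v unfolding S_def X_def by measurable
    have Gm [measurable]: "G v \<in> borel_measurable \<Omega>" for v unfolding G_def by measurable
    have SX: "S \<xi> = (\<Sum>v\<in>W N. X v \<xi>)" for \<xi> unfolding S_def X_def by (rule mass_extend[OF Qb w])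
    have X0: "0 \<le> X v \<xi>" for v \<xi> by (simp add: X_def)
    have S1: "0 \<le> S \<xi>" "S \<xi> \<le> 1" for \<xi> using mass_le[OF w, of \<xi> Q] pw_le_1[OF w] by (auto simp: S_def)
    have XS: "X v \<xi> \<le> S \<xi>" if "v \<in> W N" for v \<xi> unfolding SX using that X0 by (intro member_le_sum) auto
    have pq: "z powr q = z * z powr (q - 1)" if "0 \<le> z" for z :: real
      using that powr_add[of z 1 "q - 1"] by (cases "z = 0") auto
    have G0: "0 \<le> G v \<xi>" for v \<xi> by (simp add: G_def)
    \<comment> \<open>A Markov-type bound: on the event \<open>t / 2 < S \<xi> - X v \<xi>\<close>
      the power \<open>q - 1\<close> of the difference is at most \<open>2 / t\<close> times its
      power \<open>q\<close>.\<close>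
    have GS: "G v \<xi> \<le> 2 / t * S \<xi> powr q" if v: "v \<in> W N" for v \<xi>
    proof (cases "t / 2 < S \<xi> - X v \<xi>")
      case True
      let ?y = "S \<xi> - X v \<xi>"
      have y: "0 < ?y" "?y \<le> S \<xi>" using True t X0[of v \<xi>] by auto
      have "t / 2 * ?y powr (q - 1) \<le> ?y * ?y powr (q - 1)" using True by (intro mult_right_mono) auto
      also have "\<dots> = ?y powr q" using y by (simp add: pq)
      also have "\<dots> \<le> S \<xi> powr q" using y q by (intro powr_mono2) auto
      finally show ?thesis using True t by (simp add: G_def field_simps)
    qed (use t in \<open>simp add: G_def\<close>)
    have Sq1: "S \<xi> powr q \<le> 1" for \<xi> using S1[of \<xi>] q powr_mono2[of q "S \<xi>" 1] by simp
    have intSq: "integrable \<Omega> (\<lambda>\<xi>. S \<xi> powr q)" using integrable_mass_powr[OF Qb w, of q] q by (simp add: S_def)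
    have intS: "integrable \<Omega> S" by (rule omega.integrable_const_bound[of _ 1]) (use S1 in auto)
    have wv: "w @ v \<in> words n0" if "v \<in> W N" for v using that w by (simp add: words_of_length_iff)
    have intXq: "integrable \<Omega> (\<lambda>\<xi>. X v \<xi> powr q)" if "v \<in> W N" for v
      using integrable_mass_powr[OF Qb wv[OF that], of q] q by (simp add: X_def)
    have G2t: "G v \<xi> \<le> 2 / t" if "v \<in> W N" for v \<xi>
    proof -
      have "2 / t * S \<xi> powr q \<le> 2 / t * 1" using Sq1[of \<xi>] t by (intro mult_left_mono) auto
      then show ?thesis using GS[OF that, of \<xi>] by simp
    qed
    have intG: "integrable \<Omega> (G v)" if "v \<in> W N" for v
      by (rule omega.integrable_const_bound[of _ "2 / t"]) (use G0 G2t[OF that] in auto)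
    have intXG: "integrable \<Omega> (\<lambda>\<xi>. X v \<xi> * G v \<xi>)" if v: "v \<in> W N" for v
    proof (rule omega.integrable_const_bound[of _ "1 * (2 / t)"])
      have "X v \<xi> * G v \<xi> \<le> 1 * (2 / t)" for \<xi>
        using X0 XS[OF v, of \<xi>] S1(2)[of \<xi>] G0 G2t[OF v] by (intro mult_mono) (auto intro: order_trans)
      then show "AE \<xi> in \<Omega>. norm (X v \<xi> * G v \<xi>) \<le> 1 * (2 / t)" using X0 G0 by (intro AE_I2) (simp add: abs_mult)
    qed measurable
    have EXG: "omega.expectation (\<lambda>\<xi>. X v \<xi> * G v \<xi>) \<le> \<beta> * pw v * (2 / t * omega.expectation (\<lambda>\<xi>. S \<xi> powr q))" if v: "v \<in> W N" for v
    proof -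
      have vl: "v \<in> words n0" "length v = N" using v by (auto simp: words_of_length_iff)
      have "omega.expectation (\<lambda>\<xi>. X v \<xi> * G v \<xi>) \<le> C0 * sv_min ?r (word_mat T (butlast (w @ v))) * pw (w @ v) * omega.expectation (G v)"
        unfolding X_def
      proof (rule ex[OF wv[OF v] _ r Q Gm])
        show "\<forall>u\<in>cylinder n0 (w @ v). path_indep u (length (w @ v) - 1) (G v)"
        proof
          fix u assume u: "u \<in> cylinder n0 (w @ v)"
          let ?n = "length (w @ v) - 1"
          have ui: "u \<in> inf_words n0" "restr u (Suc ?n) = w @ v" using u N vl by (auto simp: cylinder_iff)
          have "path_indep u ?n (\<lambda>\<xi>. mass \<xi> (w @ v') Q)" if v': "v' \<in> W N - {v}" for v'
          proof (rule mass_path_indep[OF ui(1)])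
            have l': "length v' = N" using v' by (simp add: words_of_length_iff)
            show "?n < length (w @ v')" using N vl l' by simp
            show "restr u (Suc ?n) \<noteq> take (Suc ?n) (w @ v')" unfolding ui(2) using v' vl l' N by auto
          qed
          then have "(\<Sum>v'\<in>W N - {v}. X v' (\<xi>(restr u (Suc j) := x))) = (\<Sum>v'\<in>W N - {v}. X v' \<xi>)" if "\<xi> \<in> space \<Omega>" "?n \<le> j" for \<xi> j x
            using that unfolding X_def by (intro sum.cong refl path_indepD) auto
          moreover have "S \<xi> - X v \<xi> = (\<Sum>v'\<in>W N - {v}. X v' \<xi>)" for \<xi>
            using v unfolding SX by (simp add: sum.remove)
          ultimately show "path_indep u ?n (G v)" unfolding path_indep_def G_def by simp
        qed
        show "\<exists>B. \<forall>\<xi>. G v \<xi> \<le> B" using G2t[OF v] by blast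
      qed (use N vl G0 in auto)
      also have "\<dots> \<le> \<beta> * pw v * omega.expectation (G v)"
      proof (rule mult_right_mono)
        have "v \<noteq> []" using N vl by auto
        then have "butlast (w @ v) = w @ butlast v" by (simp add: butlast_append)
        moreover have bv: "butlast v \<in> words n0" using vl(1) by (auto simp: words_iff dest: in_set_butlastD)
        ultimately have "sv_min ?r (word_mat T (butlast (w @ v))) \<le> (1 / a) ^ (length (butlast v) * CARD('d)) * sv_min ?r (word_mat T w)"
          using sv_min_append_le[OF w bv r'] by simp
        also have "\<dots> \<le> (1 / a) ^ (N * CARD('d)) * sv_min ?r (word_mat T w)"
          using a vl sv_min_pos[OF word_mat_invertible[OF w] r'] by (intro mult_right_mono power_increasing) auto
        finally have "C0 * sv_min ?r (word_mat T (butlast (w @ v))) \<le> C0 * ((1 / a) ^ (N * CARD('d)) * sv_min ?r (word_mat T w))"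
          using C0 by (intro mult_left_mono) auto
        then have "C0 * sv_min ?r (word_mat T (butlast (w @ v))) * pw (w @ v) \<le> C0 * ((1 / a) ^ (N * CARD('d)) * sv_min ?r (word_mat T w)) * pw (w @ v)"
          using pw_nonneg[OF wv[OF v]] by (rule mult_right_mono)
        then show "C0 * sv_min ?r (word_mat T (butlast (w @ v))) * pw (w @ v) \<le> \<beta> * pw v"
          by (simp add: \<beta>_def C1_def word_prob_append mult_ac)
      qed (use G0 in \<open>auto intro: Bochner_Integration.integral_nonneg\<close>)
      also have "\<dots> \<le> \<beta> * pw v * (2 / t * omega.expectation (\<lambda>\<xi>. S \<xi> powr q))"
      proof (rule mult_left_mono)
        have "omega.expectation (G v) \<le> omega.expectation (\<lambda>\<xi>. 2 / t * S \<xi> powr q)"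
          using GS[OF v] intSq intG[OF v] by (intro integral_mono) auto
        then show "omega.expectation (G v) \<le> 2 / t * omega.expectation (\<lambda>\<xi>. S \<xi> powr q)" by simp
      qed (use \<beta> pw_nonneg[OF vl(1)] in simp)
      finally show ?thesis .
    qed
    have "omega.expectation (\<lambda>\<xi>. S \<xi> powr q) \<le> omega.expectation (\<lambda>\<xi>. t powr (q - 1) * S \<xi> + 2 powr q * (\<Sum>v\<in>W N. X v \<xi> powr q)
        + 2 powr (q - 1) * (\<Sum>v\<in>W N. X v \<xi> * G v \<xi>))"
    proof (rule integral_mono[OF intSq])
      show "integrable \<Omega> (\<lambda>\<xi>. t powr (q - 1) * S \<xi> + 2 powr q * (\<Sum>v\<in>W N. X v \<xi> powr q) + 2 powr (q - 1) * (\<Sum>v\<in>W N. X v \<xi> * G v \<xi>))"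
        using intS intXq intXG by (intro Bochner_Integration.integrable_add integrable_mult_right Bochner_Integration.integrable_sum) auto
      show "S \<xi> powr q \<le> t powr (q - 1) * S \<xi> + 2 powr q * (\<Sum>v\<in>W N. X v \<xi> powr q) + 2 powr (q - 1) * (\<Sum>v\<in>W N. X v \<xi> * G v \<xi>)" for \<xi>
        using rosenthal_pointwise[of "W N" "\<lambda>v. X v \<xi>" q t] X0 q t unfolding SX[symmetric] G_def by simp
    qed
    also have "\<dots> = t powr (q - 1) * omega.expectation S + 2 powr q * (\<Sum>v\<in>W N. omega.expectation (\<lambda>\<xi>. X v \<xi> powr q))
        + 2 powr (q - 1) * (\<Sum>v\<in>W N. omega.expectation (\<lambda>\<xi>. X v \<xi> * G v \<xi>))"
    proof -
      have lin: "omega.expectation (\<lambda>\<xi>. c1 * S \<xi> + c2 * A \<xi> + c3 * B \<xi>) = c1 * omega.expectation S + c2 * omega.expectation A + c3 * omega.expectation B"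
        if "integrable \<Omega> A" "integrable \<Omega> B" for A B and c1 c2 c3 :: real
        using that intS by simp
      have "integrable \<Omega> (\<lambda>\<xi>. \<Sum>v\<in>W N. X v \<xi> powr q)" "integrable \<Omega> (\<lambda>\<xi>. \<Sum>v\<in>W N. X v \<xi> * G v \<xi>)"
        using intXq intXG by (auto intro!: Bochner_Integration.integrable_sum)
      from lin[OF this] show ?thesis using intXq intXG by (simp add: Bochner_Integration.integral_sum)
    qed
    also have "\<dots> \<le> t powr (q - 1) * omega.expectation S + 2 powr q * (\<Sum>v\<in>W N. omega.expectation (\<lambda>\<xi>. X v \<xi> powr q))
        + 1 / 2 * omega.expectation (\<lambda>\<xi>. S \<xi> powr q)"
    proof (rule add_left_mono)
      have "(\<Sum>v\<in>W N. omega.expectation (\<lambda>\<xi>. X v \<xi> * G v \<xi>)) \<le> (\<Sum>v\<in>W N. pw v * (\<beta> * (2 / t * omega.expectation (\<lambda>\<xi>. S \<xi> powr q))))"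
        using EXG by (intro sum_mono) (simp add: mult_ac)
      also have "\<dots> = \<beta> * (2 / t * omega.expectation (\<lambda>\<xi>. S \<xi> powr q))" by (simp only: sum_distrib_right[symmetric] sum_pw mult_1_left)
      finally have "2 powr (q - 1) * (\<Sum>v\<in>W N. omega.expectation (\<lambda>\<xi>. X v \<xi> * G v \<xi>)) \<le> 2 powr (q - 1) * (\<beta> * (2 / t * omega.expectation (\<lambda>\<xi>. S \<xi> powr q)))"
        by (intro mult_left_mono) auto
      also have "\<dots> = (2 powr (q - 1) * \<beta> * (2 / t)) * omega.expectation (\<lambda>\<xi>. S \<xi> powr q)" by simp
      also have "2 powr (q - 1) * \<beta> * (2 / t) = 1 / 2"
      proof -
        have "2 powr (q + 1) = 2 powr (q - 1) * 4" using powr_add[of 2 "q - 1" 2] by (simp add: add.commute)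
        then show ?thesis using \<beta> by (simp add: t_def field_simps)
      qed
      finally show "2 powr (q - 1) * (\<Sum>v\<in>W N. omega.expectation (\<lambda>\<xi>. X v \<xi> * G v \<xi>)) \<le> 1 / 2 * omega.expectation (\<lambda>\<xi>. S \<xi> powr q)" .
    qed
    finally have "omega.expectation (\<lambda>\<xi>. S \<xi> powr q) \<le> 2 * (t powr (q - 1) * omega.expectation S) + 2 * (2 powr q * (\<Sum>v\<in>W N. omega.expectation (\<lambda>\<xi>. X v \<xi> powr q)))"
      by simp
    also have "2 * (2 powr q * (\<Sum>v\<in>W N. omega.expectation (\<lambda>\<xi>. X v \<xi> powr q))) = 2 powr (q + 1) * (\<Sum>v\<in>W N. omega.expectation (\<lambda>\<xi>. X v \<xi> powr q))"
      by (simp add: powr_add)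
    finally show ?thesis unfolding tC[symmetric] S_def X_def by (simp add: mult.assoc add.commute)
  qed
  then show ?thesis using C by (intro exI[of _ C]) blast
qed

end

text \<open>A Borel-Cantelli argument: multiplied by \<open>(2 ^ n) powr \<beta>\<close> the
  expectations decay with ratio \<open>(1 / 2) powr (\<alpha> - \<beta>) < 1\<close>, so the sum of
  these variables has finite expectation. It is almost surely finite, and each term is at most the
  sum.\<close>

lemma (in prob_space) AE_bounded_of_expectation:
  fixes Z :: "nat \<Rightarrow> 'a \<Rightarrow> real"
  assumes Z: "\<And>n. integrable M (Z n)" "\<And>n x. 0 \<le> Z n x" and le: "\<And>n. expectation (Z n) \<le> B * ((1 / 2) ^ n) powr \<alpha>"
    and \<beta>: "\<beta> < \<alpha>"
  shows "AE x in M. \<exists>c. \<forall>n. Z n x \<le> c * ((1 / 2) ^ n) powr \<beta>"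
proof -
  define Y where "Y n x = (2 ^ n) powr \<beta> * Z n x" for n x
  have Ym [measurable]: "Y n \<in> borel_measurable M" for n unfolding Y_def using Z(1) by measurable
  have Y0: "0 \<le> Y n x" for n x using Z(2) by (simp add: Y_def)
  have pw: "(2 ^ n) powr \<beta> * ((1 / 2) ^ n) powr \<beta> = (1::real)" for n
    by (simp add: powr_mult[symmetric] power_mult_distrib[symmetric])
  define x where "x = (1 / 2) powr (\<alpha> - \<beta>)"
  have x: "0 < x" "x < 1" using \<beta> powr_less_mono2_neg[of "- (\<alpha> - \<beta>)" 1 2] by (auto simp: x_def powr_divide powr_minus)
  have B: "0 \<le> B"
  proof -
    have "0 \<le> expectation (Z 0)" using Z(2) by (intro integral_nonneg_AE) auto
    then show ?thesis using le[of 0] by simp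
  qed
  have EY: "expectation (Y n) \<le> B * x ^ n" for n
  proof -
    have "expectation (Y n) = (2 ^ n) powr \<beta> * expectation (Z n)" by (simp add: Y_def[abs_def])
    also have "\<dots> \<le> (2 ^ n) powr \<beta> * (B * ((1 / 2) ^ n) powr \<alpha>)" using le by (intro mult_left_mono) auto
    also have "((1 / 2) ^ n) powr \<alpha> = ((1 / 2) ^ n) powr \<beta> * ((1 / 2) ^ n) powr (\<alpha> - \<beta>)" for n :: nat
      by (simp add: powr_add[symmetric])
    also have "(2 ^ n) powr \<beta> * (B * (((1 / 2) ^ n) powr \<beta> * ((1 / 2) ^ n) powr (\<alpha> - \<beta>))) =
        ((2 ^ n) powr \<beta> * ((1 / 2) ^ n) powr \<beta>) * (B * ((1 / 2) ^ n) powr (\<alpha> - \<beta>))" by simp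
    also have "\<dots> = B * ((1 / 2) ^ n) powr (\<alpha> - \<beta>)" by (simp only: pw mult_1_left)
    also have "((1 / 2) ^ n) powr (\<alpha> - \<beta>) = x ^ n"
    proof -
      have "((1 / 2) ^ n) powr (\<alpha> - \<beta>) = ((1 / 2) powr real n) powr (\<alpha> - \<beta>)" by (subst powr_realpow) auto
      also have "\<dots> = x powr real n" by (simp add: x_def powr_powr mult.commute)
      also have "\<dots> = x ^ n" using x by (simp add: powr_realpow)
      finally show ?thesis .
    qed
    finally show ?thesis .
  qed
  have "(\<integral>\<^sup>+\<omega>. (\<Sum>n. ennreal (Y n \<omega>)) \<partial>M) = (\<Sum>n. \<integral>\<^sup>+\<omega>. ennreal (Y n \<omega>) \<partial>M)"
    by (rule nn_integral_suminf) measurable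
  also have "\<dots> \<le> (\<Sum>n. ennreal (B * x ^ n))"
  proof (rule suminf_le)
    fix n
    have "integrable M (Y n)" unfolding Y_def using Z(1) by simp
    then have "(\<integral>\<^sup>+\<omega>. ennreal (Y n \<omega>) \<partial>M) = ennreal (expectation (Y n))" using Y0 by (intro nn_integral_eq_integral) auto
    then show "(\<integral>\<^sup>+\<omega>. ennreal (Y n \<omega>) \<partial>M) \<le> ennreal (B * x ^ n)" using EY by (simp add: ennreal_leI)
  qed auto
  also have "\<dots> = ennreal (\<Sum>n. B * x ^ n)"
    using B x by (intro suminf_ennreal2 summable_mult summable_geometric) auto
  also have "\<dots> < \<infinity>" by simp
  finally have "AE \<omega> in M. (\<Sum>n. ennreal (Y n \<omega>)) \<noteq> \<infinity>" by (intro nn_integral_PInf_AE) auto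
  then show ?thesis
  proof eventually_elim
    case (elim \<omega>)
    then obtain c where c: "(\<Sum>n. ennreal (Y n \<omega>)) = ennreal c" "0 \<le> c" by (cases "\<Sum>n. ennreal (Y n \<omega>)") auto
    have "Z n \<omega> \<le> c * ((1 / 2) ^ n) powr \<beta>" for n
    proof -
      have "ennreal (Y n \<omega>) = (\<Sum>k\<in>{n}. ennreal (Y k \<omega>))" by simp
      also have "\<dots> \<le> ennreal c" unfolding c(1)[symmetric] by (rule sum_le_suminf) auto
      finally have "Y n \<omega> \<le> c" using c(2) by (simp add: ennreal_le_iff)
      then have "((1 / 2) ^ n) powr \<beta> * Y n \<omega> \<le> ((1 / 2) ^ n) powr \<beta> * c" by (intro mult_left_mono) auto
      moreover have "((1 / 2) ^ n) powr \<beta> * Y n \<omega> = ((2 ^ n) powr \<beta> * ((1 / 2) ^ n) powr \<beta>) * Z n \<omega>"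
        unfolding Y_def by (simp only: mult_ac)
      then have "((1 / 2) ^ n) powr \<beta> * Y n \<omega> = Z n \<omega>" by (simp only: pw mult_1_left)
      ultimately show ?thesis by (simp only: mult.commute[of c])
    qed
    then show ?case by blast
  qed
qed

lemma dyadic_scale:
  fixes r :: real
  assumes "0 < r" "r < 1"
  obtains n :: nat where "r \<le> (1 / 2) ^ n" "(1 / 2) ^ n \<le> 2 * r"
proof -
  define n where "n = nat \<lfloor>log 2 (1 / r)\<rfloor>"
  have l: "0 \<le> log 2 (1 / r)" using assms by simp
  then have n: "real n \<le> log 2 (1 / r)" "log 2 (1 / r) < real n + 1" unfolding n_def by linarith+
  have "2 powr real n \<le> 1 / r" using n(1) assms by (simp add: le_log_iff)
  then have "r \<le> (1 / 2) ^ n" using assms by (simp add: powr_realpow power_one_over field_simps)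
  moreover have "1 / r < 2 powr (real n + 1)" using n(2) assms by (simp add: log_less_iff)
  then have "(1 / 2) ^ n \<le> 2 * r" using assms by (simp add: powr_add powr_realpow power_one_over field_simps)
  ultimately show thesis using that by blast
qed

context random_affine_words
begin

text \<open>Every step of the recursion costs the factor \<open>2 powr (q + 1)\<close>. Negative
  pressure makes the moment sums decay geometrically in the length, so \<open>N\<close> can be
  chosen with \<open>?A * exp (pressure q s) ^ N \<le> 1 / 2\<close>. The recursion is then iterated
  to infinite depth and its inhomogeneous terms form a geometric series.\<close>

lemma expected_moment:
  assumes q: "1 < q" and s: "0 \<le> s" "s \<le> real CARD('d)" and P: "pressure q s < 0"
  shows "\<exists>B. \<forall>r F. 0 < r \<longrightarrow> finite F \<longrightarrow> F \<subseteq> mesh r \<longrightarrow>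
    (\<Sum>Q\<in>F. omega.expectation (\<lambda>\<xi>. mass \<xi> [] Q powr q)) \<le> B * r powr (s * (q - 1))"
proof -
  let ?A = "2 powr (q + 1)"
  have x: "exp (pressure q s) < 1" using P by simp
  obtain N0 where N0: "exp (pressure q s) ^ N0 < 1 / (2 * ?A)"
    using real_arch_pow_inv[of "1 / (2 * ?A)" "exp (pressure q s)"] x by auto
  define N where "N = Suc N0"
  have N: "0 < N" by (simp add: N_def)
  have AN: "?A * exp (pressure q s) ^ N \<le> 1 / 2"
  proof -
    have "exp (pressure q s) ^ N \<le> exp (pressure q s) ^ N0" using x unfolding N_def by (intro power_decreasing) auto
    then have "?A * exp (pressure q s) ^ N \<le> ?A * (1 / (2 * ?A))" using N0 by (intro mult_left_mono) auto
    then show ?thesis by simp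
  qed
  obtain C where C: "0 < C" and rec: "\<And>w (r::real) Q. w \<in> words n0 \<Longrightarrow> 0 < r \<Longrightarrow> Q \<in> mesh r \<Longrightarrow>
    omega.expectation (\<lambda>\<xi>. mass \<xi> w Q powr q) \<le>
      ?A * (\<Sum>v\<in>W N. omega.expectation (\<lambda>\<xi>. mass \<xi> (w @ v) Q powr q)) +
      2 * (C * sv_min (CARD('d) * r) (word_mat T w) * pw w) powr (q - 1) * omega.expectation (\<lambda>\<xi>. mass \<xi> w Q)"
    using moment_recursion[OF q N] by blast
  define D where "D = 2 * (C * real CARD('d) powr s) powr (q - 1)"
  have D: "0 < D" using C by (simp add: D_def)
  have main: "(\<Sum>Q\<in>F. omega.expectation (\<lambda>\<xi>. mass \<xi> [] Q powr q)) \<le> 2 * D * exp (defect q s) * r powr (s * (q - 1))"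
    if r: "0 < r" and F: "finite F" "F \<subseteq> mesh r" for r :: real and F
  proof -
    define m where "m w = (\<Sum>Q\<in>F. omega.expectation (\<lambda>\<xi>. mass \<xi> w Q powr q))" for w
    let ?E = "D * r powr (s * (q - 1))"
    have Qb: "Q \<in> sets borel" if "Q \<in> F" for Q using that F mesh_borel by blast
    note tot = sum_expectation_mass_le[OF r F]
    have mrec: "m w \<le> ?A * (\<Sum>v\<in>W N. m (w @ v)) + ?E * term_q q s w" if w: "w \<in> words n0" for w
    proof -
      let ?b = "C * sv_min (CARD('d) * r) (word_mat T w) * pw w"
      have dr: "0 < CARD('d) * r" using r by simp
      have sv0: "0 < sv_min (CARD('d) * r) (word_mat T w)" using sv_min_pos[OF word_mat_invertible[OF w] dr] .
      have "m w \<le> (\<Sum>Q\<in>F. ?A * (\<Sum>v\<in>W N. omega.expectation (\<lambda>\<xi>. mass \<xi> (w @ v) Q powr q)) + 2 * ?b powr (q - 1) * omega.expectation (\<lambda>\<xi>. mass \<xi> w Q))"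
        unfolding m_def using rec[OF w r] F by (intro sum_mono) auto
      also have "\<dots> = ?A * (\<Sum>Q\<in>F. \<Sum>v\<in>W N. omega.expectation (\<lambda>\<xi>. mass \<xi> (w @ v) Q powr q)) + 2 * ?b powr (q - 1) * (\<Sum>Q\<in>F. omega.expectation (\<lambda>\<xi>. mass \<xi> w Q))"
        by (simp only: sum.distrib sum_distrib_left)
      also have "(\<Sum>Q\<in>F. \<Sum>v\<in>W N. omega.expectation (\<lambda>\<xi>. mass \<xi> (w @ v) Q powr q)) = (\<Sum>v\<in>W N. m (w @ v))"
        unfolding m_def by (rule sum.swap)
      also have "2 * ?b powr (q - 1) * (\<Sum>Q\<in>F. omega.expectation (\<lambda>\<xi>. mass \<xi> w Q)) \<le> 2 * ?b powr (q - 1) * pw w"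
        using tot[OF w] by (intro mult_left_mono) auto
      also have "2 * ?b powr (q - 1) * pw w \<le> ?E * term_q q s w"
      proof (cases "pw w = 0")
        case True
        then show ?thesis using D by (simp add: term_q_nonneg)
      next
        case False
        then have p: "0 < pw w" using pw_nonneg[OF w] by simp
        note ps = psi_pos[OF w s(1)]
        \<comment> \<open>Here \<open>s \<le> real CARD('d)\<close> enters; the bound supplies the
          factor \<open>r powr (s * (q - 1))\<close> and turns the probability into a term of order
          \<open>s\<close>.\<close>
        have "sv_min (CARD('d) * r) (word_mat T w) \<le> (CARD('d) * r) powr s / psi s w"
          by (rule sv_min_le_svf[OF word_mat_invertible[OF w] s dr])
        then have "?b powr (q - 1) \<le> (C * ((CARD('d) * r) powr s / psi s w) * pw w) powr (q - 1)"
          using q C p sv0 by (intro powr_mono2 mult_right_mono mult_left_mono) auto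
        also have "\<dots> = (C * real CARD('d) powr s) powr (q - 1) * r powr (s * (q - 1)) * (psi s w powr (1 - q) * pw w powr (q - 1))"
        proof -
          have "C * ((CARD('d) * r) powr s / psi s w) * pw w = (C * real CARD('d) powr s) * (r powr s) * (psi s w powr (-1) * pw w)"
            using r ps by (simp add: powr_mult powr_minus divide_inverse)
          moreover have "((C * real CARD('d) powr s) * (r powr s) * (psi s w powr (-1) * pw w)) powr (q - 1) =
              (C * real CARD('d) powr s) powr (q - 1) * (r powr s) powr (q - 1) * ((psi s w powr (-1)) powr (q - 1) * pw w powr (q - 1))"
            using C p ps by (simp only: powr_mult)
          moreover have "(psi s w powr (-1)) powr (q - 1) = psi s w powr (1 - q)" by (simp only: powr_powr) simp
          ultimately show ?thesis by (simp only: powr_powr)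
        qed
        finally have "2 * ?b powr (q - 1) * pw w \<le>
            2 * ((C * real CARD('d) powr s) powr (q - 1) * r powr (s * (q - 1)) * (psi s w powr (1 - q) * pw w powr (q - 1))) * pw w"
          using p by (intro mult_right_mono mult_left_mono) auto
        also have "\<dots> = ?E * (psi s w powr (1 - q) * (pw w powr (q - 1) * pw w))" by (simp add: D_def)
        also have "pw w powr (q - 1) * pw w = pw w powr q" using p powr_add[of "pw w" "q - 1" 1] by simp
        finally show ?thesis by (simp add: term_q_def)
      qed
      finally show ?thesis by simp
    qed
    \<comment> \<open>A crude bound for the last level of the iteration, without any gain in
      \<open>r\<close>; it disappears as the depth grows.\<close>
    have mtriv: "m w \<le> term_q q s w" if w: "w \<in> words n0" for w
    proof -
      have "m w = omega.expectation (\<lambda>\<xi>. \<Sum>Q\<in>F. mass \<xi> w Q powr q)"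
        unfolding m_def using integrable_mass_powr[OF Qb w, of _ q] q by (intro Bochner_Integration.integral_sum[symmetric]) auto
      also have "\<dots> \<le> omega.expectation (\<lambda>\<xi>. pw w powr q)"
      proof (rule integral_mono)
        show "integrable \<Omega> (\<lambda>\<xi>. \<Sum>Q\<in>F. mass \<xi> w Q powr q)"
          using integrable_mass_powr[OF Qb w, of _ q] q by (intro Bochner_Integration.integrable_sum) auto
        show "(\<Sum>Q\<in>F. mass \<xi> w Q powr q) \<le> pw w powr q" for \<xi>
          using F q sum_mass_mesh_le[OF r F w] by (intro sum_powr_le_powr_sum) auto
      qed simp
      also have "\<dots> = 1 * pw w powr q" by (simp add: omega.prob_space)
      also have "\<dots> \<le> psi s w powr (1 - q) * pw w powr q"
      proof (rule mult_right_mono)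
        have "1 powr (1 - q) \<le> psi s w powr (1 - q)" using psi_bounds(2)[OF w s(1)] psi_pos[OF w s(1)] q by (intro powr_mono2') auto
        then show "1 \<le> psi s w powr (1 - q)" by simp
      qed simp
      finally show ?thesis by (simp add: term_q_def)
    qed
    have step: "(\<Sum>w\<in>W (j * N). m w) \<le> ?A * (\<Sum>w\<in>W (Suc j * N). m w) + ?E * sum_q q s (j * N)" for j
    proof -
      have "(\<Sum>w\<in>W (j * N). m w) \<le> (\<Sum>w\<in>W (j * N). ?A * (\<Sum>v\<in>W N. m (w @ v)) + ?E * term_q q s w)"
        using mrec by (intro sum_mono) (auto simp: words_of_length_iff)
      also have "\<dots> = ?A * (\<Sum>w\<in>W (j * N). \<Sum>v\<in>W N. m (w @ v)) + ?E * sum_q q s (j * N)"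
        by (simp only: sum.distrib sum_distrib_left sum_q_def)
      also have "(\<Sum>w\<in>W (j * N). \<Sum>v\<in>W N. m (w @ v)) = (\<Sum>w\<in>W (Suc j * N). m w)"
        by (simp add: sum_words_append[symmetric] add.commute)
      finally show ?thesis .
    qed
    have it: "m [] \<le> ?A ^ J * (\<Sum>w\<in>W (J * N). m w) + ?E * (\<Sum>j<J. ?A ^ j * sum_q q s (j * N))" for J
    proof (induction J)
      case 0 show ?case by (simp add: words_of_length_0)
    next
      case (Suc J)
      have "?A ^ J * (\<Sum>w\<in>W (J * N). m w) \<le> ?A ^ J * (?A * (\<Sum>w\<in>W (Suc J * N). m w) + ?E * sum_q q s (J * N))"
        using step by (intro mult_left_mono) auto
      then show ?case using Suc by (simp add: algebra_simps)
    qed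
    have geo: "?A ^ j * sum_q q s (j * N) \<le> exp (defect q s) * (1 / 2) ^ j" for j
    proof -
      have "?A ^ j * sum_q q s (j * N) \<le> ?A ^ j * (exp (defect q s) * exp (pressure q s) ^ (j * N))"
        using sum_q_le_exp[OF q s(1)] by (intro mult_left_mono) auto
      also have "\<dots> = exp (defect q s) * (?A * exp (pressure q s) ^ N) ^ j"
        by (simp add: power_mult_distrib power_mult[symmetric] mult_ac)
      also have "\<dots> \<le> exp (defect q s) * (1 / 2) ^ j" using AN by (intro mult_left_mono power_mono) auto
      finally show ?thesis .
    qed
    have "m [] \<le> exp (defect q s) * (1 / 2) ^ J + ?E * (exp (defect q s) * 2)" for J
    proof -
      have "?A ^ J * (\<Sum>w\<in>W (J * N). m w) \<le> ?A ^ J * sum_q q s (J * N)"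
        unfolding sum_q_def using mtriv by (intro mult_left_mono sum_mono) (auto simp: words_of_length_iff)
      also have "\<dots> \<le> exp (defect q s) * (1 / 2) ^ J" by (rule geo)
      finally have 1: "?A ^ J * (\<Sum>w\<in>W (J * N). m w) \<le> exp (defect q s) * (1 / 2) ^ J" .
      have "(\<Sum>j<J. ?A ^ j * sum_q q s (j * N)) \<le> (\<Sum>j<J. exp (defect q s) * (1 / 2) ^ j)" using geo by (intro sum_mono)
      also have "\<dots> = exp (defect q s) * (2 * (1 - (1 / 2) ^ J))" by (simp add: sum_distrib_left[symmetric] sum_gp_strict)
      also have "\<dots> \<le> exp (defect q s) * 2" by (intro mult_left_mono) auto
      finally have "?E * (\<Sum>j<J. ?A ^ j * sum_q q s (j * N)) \<le> ?E * (exp (defect q s) * 2)" using D by (intro mult_left_mono) auto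
      then show ?thesis using it[of J] 1 by linarith
    qed
    moreover have "(\<lambda>J. exp (defect q s) * (1 / 2) ^ J + ?E * (exp (defect q s) * 2)) \<longlonglongrightarrow> exp (defect q s) * 0 + ?E * (exp (defect q s) * 2)"
      by (intro tendsto_intros LIMSEQ_power_zero) auto
    ultimately have "m [] \<le> exp (defect q s) * 0 + ?E * (exp (defect q s) * 2)"
      by (intro LIMSEQ_le_const[of _ _ "m []"]) auto
    then show ?thesis by (simp add: m_def mult_ac)
  qed
  then show ?thesis by blast
qed

text \<open>Expected moments at dyadic scales decay with exponent \<open>s * (q - 1)\<close>. The
  smaller exponent for \<open>s'\<close> makes the normalised moments summable, hence almost surely
  bounded, and \<open>mesh_moment_compare\<close> fills in the scales in between.\<close>

lemma AE_lower_dim_gt1: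
  assumes q: "1 < q" and s: "0 < s" "s \<le> real CARD('d)" and P: "pressure q s < 0" and s': "s' < s"
    and J: "compact J" "J \<noteq> {}" and str: "AE \<xi> in \<Omega>. nonautonomous_structure n0 T J \<xi>"
  shows "AE \<xi> in \<Omega>. ereal s' \<le> lower_q_dim q (nonautonomous_measure n0 T p J \<xi>)"
proof -
  have R0: "0 \<le> rad R" using R(1) b by (simp add: rad_def)
  obtain B where B: "\<And>r F. 0 < r \<Longrightarrow> finite F \<Longrightarrow> F \<subseteq> mesh r \<Longrightarrow>
    (\<Sum>Q\<in>F. omega.expectation (\<lambda>\<xi>. mass \<xi> [] Q powr q)) \<le> B * r powr (s * (q - 1))"
    using expected_moment[OF q less_imp_le[OF s(1)] s(2) P] by blast
  let ?F = "\<lambda>n. near_cubes ((1 / 2) ^ n) (rad R) :: (real^'d) set set"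
  define Z where "Z n \<xi> = (\<Sum>Q\<in>?F n. mass \<xi> [] Q powr q)" for n \<xi>
  have fin: "finite (?F n)" for n by (rule finite_near_cubes[OF _ R0]) simp
  have im: "integrable \<Omega> (\<lambda>\<xi>. mass \<xi> [] Q powr q)" if "Q \<in> ?F n" for Q n
    using that q by (intro integrable_mass_powr mesh_borel[of Q "(1 / 2) ^ n"]) (auto simp: near_cubes_def)
  have intZ: "integrable \<Omega> (Z n)" for n
    unfolding Z_def using im by (intro Bochner_Integration.integrable_sum) auto
  have EZ: "omega.expectation (Z n) \<le> B * ((1 / 2) ^ n) powr (s * (q - 1))" for n
  proof -
    have "omega.expectation (Z n) = (\<Sum>Q\<in>?F n. omega.expectation (\<lambda>\<xi>. mass \<xi> [] Q powr q))"
      unfolding Z_def using im by (intro Bochner_Integration.integral_sum) auto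
    also have "\<dots> \<le> B * ((1 / 2) ^ n) powr (s * (q - 1))" using fin by (intro B) (auto simp: near_cubes_def)
    finally show ?thesis .
  qed
  have lt: "s' * (q - 1) < s * (q - 1)" using s' q by simp
  have Z0: "0 \<le> Z n \<xi>" for n \<xi> by (simp add: Z_def sum_nonneg)
  have "AE \<xi> in \<Omega>. \<exists>c. \<forall>n. Z n \<xi> \<le> c * ((1 / 2) ^ n) powr (s' * (q - 1))"
    by (rule omega.AE_bounded_of_expectation[OF intZ Z0 EZ lt])
  then show ?thesis using AE_bounded str
  proof eventually_elim
    case (elim \<xi>)
    then obtain c0 where c0: "\<And>n. Z n \<xi> \<le> c0 * ((1 / 2) ^ n) powr (s' * (q - 1))" by blast
    define c where "c = max 1 c0"
    have c: "Z n \<xi> \<le> c * ((1 / 2) ^ n) powr (s' * (q - 1))" for n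
      using c0[of n] by (rule order_trans) (intro mult_right_mono, auto simp: c_def)
    define D where "D = ((2 * real CARD('d) + 2) ^ CARD('d)) powr (q - 1) * (4 * real CARD('d) + 2) ^ CARD('d)"
    have D: "0 < D" unfolding D_def by (intro mult_pos_pos zero_less_power) (auto simp: add_nonneg_pos)
    define h where "h = \<bar>s'\<bar> * ln 2 + ln (D * c) / (q - 1)"
    have main: "qlog q (nonautonomous_measure n0 T p J \<xi>) r \<le> s' * ln r + h" if r: "0 < r" "r < 1" for r
    proof -
      obtain n where n: "r \<le> (1 / 2) ^ n" "(1 / 2) ^ n \<le> 2 * r" by (rule dyadic_scale[OF r])
      let ?S = "\<Sum>Q\<in>near_cubes r (rad R). mass \<xi> [] Q powr q"
      have "?S \<le> D * Z n \<xi>" unfolding Z_def D_def using mesh_moment_compare[OF elim(2) R(1) r(1) n q, of "{[]}"] by simp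
      also have "\<dots> \<le> D * (c * ((1 / 2) ^ n) powr (s' * (q - 1)))" using c D by (intro mult_left_mono) auto
      finally have le: "?S \<le> D * (c * ((1 / 2) ^ n) powr (s' * (q - 1)))" .
      have S: "0 < ?S"
      proof -
        note tot = sum_mass_near_cubes[OF elim(2) R(1) r(1) words_Nil]
        have "\<exists>Q\<in>near_cubes r (rad R). mass \<xi> [] Q \<noteq> 0"
        proof (rule ccontr)
          assume "\<not> ?thesis"
          then have "(\<Sum>Q\<in>near_cubes r (rad R). mass \<xi> [] Q) = 0" by (intro sum.neutral) auto
          then show False using tot by (simp add: word_prob_def)
        qed
        then obtain Q where Q: "Q \<in> near_cubes r (rad R)" "mass \<xi> [] Q \<noteq> 0" by blast
        have "0 < mass \<xi> [] Q powr q" using Q by simp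
        also have "\<dots> \<le> ?S" using Q finite_near_cubes[OF r(1) R0] by (intro member_le_sum) auto
        finally show ?thesis .
      qed
      have c1: "0 < c" by (simp add: c_def)
      have "ln ?S \<le> ln (D * (c * ((1 / 2) ^ n) powr (s' * (q - 1))))" using le S by (subst ln_le_cancel_iff) auto
      also have "\<dots> = ln (D * c) + s' * (q - 1) * ln ((1 / 2) ^ n)" using D c1 by (simp add: ln_mult ln_powr)
      finally have "ln ?S / (q - 1) \<le> (ln (D * c) + s' * (q - 1) * ln ((1 / 2) ^ n)) / (q - 1)" using q by (intro divide_right_mono) auto
      also have "\<dots> = ln (D * c) / (q - 1) + s' * ln ((1 / 2) ^ n)" using q by (simp add: add_divide_distrib)
      also have "s' * ln ((1 / 2) ^ n) \<le> s' * ln r + \<bar>s'\<bar> * ln 2"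
      proof -
        have "ln r \<le> ln ((1 / 2) ^ n)" using n(1) r by (subst ln_le_cancel_iff) auto
        moreover have "ln ((1 / 2) ^ n) \<le> ln (2 * r)" using n(2) r by (subst ln_le_cancel_iff) auto
        ultimately have "\<bar>ln ((1 / 2) ^ n) - ln r\<bar> \<le> ln 2" using r by (simp add: ln_mult)
        then have "\<bar>s' * (ln ((1 / 2) ^ n) - ln r)\<bar> \<le> \<bar>s'\<bar> * ln 2" unfolding abs_mult by (intro mult_left_mono) auto
        then show ?thesis by (simp add: algebra_simps abs_le_iff)
      qed
      finally show ?thesis using q by (simp add: qlog_eq[OF J elim(3,2) R(1) r(1)] h_def)
    qed
    have "\<forall>\<^sub>F r in at_right 0. qlog q (nonautonomous_measure n0 T p J \<xi>) r \<le> s' * ln r + h"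
      using eventually_unit_interval by eventually_elim (use main in blast)
    then show ?case by (rule lower_q_dim_ge)
  qed
qed

text \<open>Covers the critical value 0, below which there is no positive \<open>s\<close> for the
  probabilistic bounds.\<close>

lemma lower_dim_nonneg:
  assumes q: "1 \<le> q" and J: "compact J" "J \<noteq> {}" and str: "nonautonomous_structure n0 T J \<xi>" and \<xi>: "bounded_by R \<xi>"
  shows "0 \<le> lower_q_dim q (nonautonomous_measure n0 T p J \<xi>)"
proof -
  have R0: "0 \<le> rad R" using R(1) b by (simp add: rad_def)
  have main: "qlog q (nonautonomous_measure n0 T p J \<xi>) r \<le> 0 * ln r + 0" if r: "0 < r" "r < 1" for r
  proof -
    have fin: "finite (near_cubes r (rad R) :: (real^'d) set set)" by (rule finite_near_cubes[OF r(1) R0])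
    have m1: "mass \<xi> [] Q \<le> 1" for Q using order_trans[OF mass_le pw_le_1, of "[]"] by simp
    have tot: "(\<Sum>Q\<in>near_cubes r (rad R). mass \<xi> [] Q) \<le> 1"
      using sum_mass_mesh_le[OF r(1) fin, of "[]" \<xi>] by (auto simp: near_cubes_def word_prob_def)
    show ?thesis
    proof (cases "q = 1")
      case True
      have "(\<Sum>Q\<in>near_cubes r (rad R). mass \<xi> [] Q * ln (mass \<xi> [] Q)) \<le> 0"
      proof (intro sum_nonpos)
        fix Q
        show "mass \<xi> [] Q * ln (mass \<xi> [] Q) \<le> 0"
        proof (cases "mass \<xi> [] Q = 0")
          case False
          then have "0 < mass \<xi> [] Q" using mass_nonneg[of \<xi> "[]" Q] by linarith
          then show ?thesis using m1[of Q] by (intro mult_nonneg_nonpos) auto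
        qed simp
      qed
      then show ?thesis using True by (simp add: qlog_eq[OF J str \<xi> R(1) r(1)])
    next
      case False
      have "(\<Sum>Q\<in>near_cubes r (rad R). mass \<xi> [] Q powr q) \<le> 1 powr q"
        using fin tot q by (intro sum_powr_le_powr_sum) auto
      then have "ln (\<Sum>Q\<in>near_cubes r (rad R). mass \<xi> [] Q powr q) \<le> 0"
        using sum_nonneg[of "near_cubes r (rad R)" "\<lambda>Q. mass \<xi> [] Q powr q"] by (cases "(\<Sum>Q\<in>near_cubes r (rad R). mass \<xi> [] Q powr q) = 0") auto
      then show ?thesis using False q by (simp add: qlog_eq[OF J str \<xi> R(1) r(1)] divide_nonpos_pos)
    qed
  qed
  have "\<forall>\<^sub>F r in at_right 0. qlog q (nonautonomous_measure n0 T p J \<xi>) r \<le> 0 * ln r + 0"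
    using eventually_unit_interval by eventually_elim (use main in blast)
  then have "ereal 0 \<le> lower_q_dim q (nonautonomous_measure n0 T p J \<xi>)" by (rule lower_q_dim_ge)
  then show ?thesis by (simp add: zero_ereal_def)
qed

end

section \<open>Lower bounds for \<open>q = 1\<close>\<close>

context affine_words
begin

text \<open>A positive part is the number itself plus its negative part, and the negative part of
  \<open>z\<close> is at most \<open>exp (- t * z) / t\<close>. The mean is bounded by
  \<open>pressure_limit\<close> and the exponential moment by \<open>moment_upper\<close>, so
  control of the lower tail yields control of the upper one.\<close>

lemma info_excess_le:
  assumes s: "0 \<le> s" and e: "0 < e"
  shows "\<exists>C. \<forall>k. (\<Sum>u\<in>W k. pw u * max 0 (info s u - real k * pressure 1 s)) \<le> e * real k + C"
proof -
  obtain t C where t: "0 < t" "t < 1" and C: "0 < C"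
    and le: "\<And>k. sum_q (1 - t) s k \<le> C * exp (- t * (pressure 1 s - e)) ^ k"
    using moment_upper[OF s e] by blast
  have "(\<Sum>u\<in>W k. pw u * max 0 (info s u - real k * pressure 1 s)) \<le> e * real k + (defect 1 s + C / t)" for k
  proof -
    define g where "g = real k * (pressure 1 s - e)"
    have pt: "pw u * max 0 (info s u - real k * pressure 1 s) \<le>
        pw u * info s u - pw u * g + exp (t * g) / t * term_q (1 - t) s u" if u: "u \<in> W k" for u
    proof -
      have uw: "u \<in> words n0" using u by (simp add: words_of_length_iff)
      define z where "z = info s u - g"
      have z: "info s u - real k * pressure 1 s = z - e * real k" by (simp add: z_def g_def algebra_simps)
      have "1 + - t * z \<le> exp (- t * z)" by (rule exp_ge_add_one_self)
      then have "(1 + - t * z) / t \<le> exp (- t * z) / t" using t by (intro divide_right_mono) auto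
      then have "0 \<le> z + exp (- t * z) / t - 1 / t" using t by (simp add: field_simps)
      moreover have "0 < 1 / t" using t by simp
      moreover have "0 \<le> exp (- t * z) / t" using t by simp
      moreover have "0 \<le> e * real k" using e by simp
      ultimately have "max 0 (z - e * real k) \<le> z + exp (- t * z) / t" by linarith
      then have "pw u * max 0 (z - e * real k) \<le> pw u * (z + exp (- t * z) / t)"
        using pw_nonneg[OF uw] by (intro mult_left_mono) auto
      also have "exp (- t * z) = exp (t * g) * exp (- t * info s u)" by (simp add: z_def exp_add[symmetric] algebra_simps)
      finally show ?thesis unfolding z term_q_eq_exp_info[OF uw s] by (simp add: z_def algebra_simps)
    qed
    have "(\<Sum>u\<in>W k. pw u * max 0 (info s u - real k * pressure 1 s)) \<le>
        (\<Sum>u\<in>W k. pw u * info s u - pw u * g + exp (t * g) / t * term_q (1 - t) s u)"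
      using pt by (intro sum_mono)
    also have "\<dots> = mean_info s k - g + exp (t * g) / t * sum_q (1 - t) s k"
      by (simp add: sum.distrib sum_subtractf mean_info_def sum_q_def sum_pw sum_divide_distrib[symmetric] sum_distrib_left[symmetric] sum_distrib_right[symmetric])
    also have "mean_info s k \<le> real k * pressure 1 s + defect 1 s"
      using pressure_limit(2)[of 1 s k] s by (simp add: log_sum_def)
    also have "exp (t * g) / t * sum_q (1 - t) s k \<le> exp (t * g) / t * (C * exp (- t * (pressure 1 s - e)) ^ k)"
      using le t by (intro mult_left_mono) auto
    also have "\<dots> = C / t * (exp (t * g) * exp (- t * (pressure 1 s - e)) ^ k)" by simp
    also have "exp (t * g) * exp (- t * (pressure 1 s - e)) ^ k = 1"
      by (simp add: g_def exp_of_nat_mult[symmetric] exp_add[symmetric] algebra_simps)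
    finally show ?thesis by (simp add: g_def algebra_simps)
  qed
  then show ?thesis by blast
qed

text \<open>Markov's inequality for the positive part in \<open>info_excess_le\<close>, taken with
  the error \<open>\<delta> * c\<close>.\<close>

lemma info_tail:
  assumes s: "0 \<le> s" and c: "0 < c" and \<delta>: "0 < \<delta>"
  shows "\<exists>C. \<forall>k L. k \<le> L \<longrightarrow> 0 < L \<longrightarrow>
    (\<Sum>u\<in>W k. if c * real L < info s u - real k * pressure 1 s then pw u else 0) \<le> \<delta> + C / real L"
proof -
  obtain C where C: "\<And>k. (\<Sum>u\<in>W k. pw u * max 0 (info s u - real k * pressure 1 s)) \<le> \<delta> * c * real k + C"
    using info_excess_le[OF s mult_pos_pos[OF \<delta> c]] by blast
  have "(\<Sum>u\<in>W k. if c * real L < info s u - real k * pressure 1 s then pw u else 0) \<le> \<delta> + (C / c) / real L"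
    if k: "k \<le> L" "0 < L" for k L
  proof -
    have cL: "0 < c * real L" using c k by simp
    have "(\<Sum>u\<in>W k. if c * real L < info s u - real k * pressure 1 s then pw u else 0) \<le>
        (\<Sum>u\<in>W k. pw u * max 0 (info s u - real k * pressure 1 s) / (c * real L))"
    proof (intro sum_mono)
      fix u assume "u \<in> W k"
      then have p: "0 \<le> pw u" by (intro pw_nonneg) (simp add: words_of_length_iff)
      show "(if c * real L < info s u - real k * pressure 1 s then pw u else 0) \<le> pw u * max 0 (info s u - real k * pressure 1 s) / (c * real L)"
        using cL p by (auto simp: le_divide_eq intro!: mult_left_mono)
    qed
    also have "\<dots> \<le> (\<delta> * c * real k + C) / (c * real L)"
      unfolding sum_divide_distrib[symmetric] using C cL by (intro divide_right_mono) auto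
    also have "\<dots> \<le> (\<delta> * c * real L + C) / (c * real L)"
      using cL k c \<delta> by (intro divide_right_mono add_right_mono mult_left_mono) auto
    also have "\<dots> = \<delta> + (C / c) / real L" using c k by (simp add: field_simps)
    finally show ?thesis .
  qed
  then show ?thesis by blast
qed

lemma sum_words_take:
  fixes f :: "nat list \<Rightarrow> real"
  assumes "k \<le> L"
  shows "(\<Sum>w\<in>W L. if P (take k w) then pw w else 0) = (\<Sum>u\<in>W k. if P u then pw u else 0)"
proof -
  have "(\<Sum>w\<in>W L. if P (take k w) then pw w else 0) = (\<Sum>w\<in>W (k + (L - k)). if P (take k w) then pw w else 0)"
    using assms by simp
  also have "\<dots> = (\<Sum>u\<in>W k. \<Sum>v\<in>W (L - k). if P (take k (u @ v)) then pw (u @ v) else 0)" by (rule sum_words_append)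
  also have "\<dots> = (\<Sum>u\<in>W k. if P u then pw u else 0)"
  proof (intro sum.cong refl)
    fix u assume "u \<in> W k"
    then have "take k (u @ v) = u" for v by (simp add: words_of_length_iff)
    then show "(\<Sum>v\<in>W (L - k). if P (take k (u @ v)) then pw (u @ v) else 0) = (if P u then pw u else 0)"
      by (simp add: word_prob_append sum_distrib_left[symmetric] sum_pw)
  qed
  finally show ?thesis .
qed

text \<open>In \<open>energy_decay\<close> the first condition bounds the energy between words that
  separate after \<open>k\<close> letters, the second the diagonal term. For negative pressure
  \<open>real L * pressure 1 s / 2\<close> lies above the typical value of \<open>info\<close>,
  which leaves room for fluctuations.\<close>

definition good_words :: "real \<Rightarrow> real \<Rightarrow> nat \<Rightarrow> nat list set" where
  "good_words s e L = {w \<in> W L. (\<forall>k\<le>L. info s (take k w) \<le> e * real L) \<and> info s w \<le> real L * pressure 1 s / 2}"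

lemma info_append_le:
  assumes u: "u \<in> words n0" and v: "v \<in> words n0" and s: "0 \<le> s" and p: "pw (u @ v) \<noteq> 0"
  shows "info s (u @ v) \<le> info s u + real (length v) * (- s * ln a)"
proof -
  have pos: "0 < pw (u @ v)" using p pw_nonneg[of "u @ v"] u v by simp
  then have pu: "0 < pw u" using pw_append_le[OF u v] by simp
  note ps = psi_pos[OF u s]
  have "inverse (psi s (u @ v)) * pw (u @ v) \<le> inverse (psi s u * a powr (real (length v) * s)) * pw u"
    using psi_append_ge[OF u v s] pw_append_le[OF u v] ps pos a psi_pos[of "u @ v" s] u v s
    by (intro mult_mono le_imp_inverse_le) auto
  then have "info s (u @ v) \<le> ln (inverse (psi s u * a powr (real (length v) * s)) * pw u)"
    unfolding info_def using pos psi_pos[of "u @ v" s] u v s by (intro ln_mono mult_pos_pos) auto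
  also have "\<dots> = info s u + real (length v) * (- s * ln a)"
    unfolding info_def using ps pu a by (simp add: ln_mult ln_inverse ln_powr)
  finally show ?thesis .
qed

text \<open>
  The maximum over all prefixes is controlled on a grid of bounded size, because \<open>info\<close> grows at
  most linearly along a word.
\<close>

lemma good_words_prob:
  assumes s: "0 \<le> s" and Pn: "pressure 1 s < 0" and e: "0 < e" and \<delta>: "0 < \<delta>"
  shows "\<exists>L0. \<forall>L\<ge>L0. 1 - \<delta> \<le> (\<Sum>w\<in>good_words s e L. pw w)"
proof -
  define c0 where "c0 = - s * ln a"
  have c0: "0 \<le> c0" using s a by (simp add: c0_def mult_nonneg_nonpos)
  \<comment> \<open>Number of grid points: between two of them \<open>info\<close> grows by at most
    about \<open>c0 * L / N\<close>, which is at most half of \<open>e * L\<close>.\<close>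
  obtain N where N: "2 * c0 / e < real N" using reals_Archimedean2 by blast
  have N0: "0 < N" using N c0 e by (cases N) (auto simp: divide_less_0_iff)
  have cN: "c0 / real N \<le> e / 2" using N N0 e by (simp add: field_simps)
  obtain C1 where C1: "\<And>k L. k \<le> L \<Longrightarrow> 0 < L \<Longrightarrow>
      (\<Sum>u\<in>W k. if e / 2 * real L < info s u - real k * pressure 1 s then pw u else 0) \<le> \<delta> / (4 * real N) + C1 / real L"
    using info_tail[of s "e / 2" "\<delta> / (4 * real N)"] s e \<delta> N0 by auto
  obtain C2 where C2: "\<And>k L. k \<le> L \<Longrightarrow> 0 < L \<Longrightarrow>
      (\<Sum>u\<in>W k. if - pressure 1 s / 2 * real L < info s u - real k * pressure 1 s then pw u else 0) \<le> \<delta> / 4 + C2 / real L"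
    using info_tail[of s "- pressure 1 s / 2" "\<delta> / 4"] s Pn \<delta> by auto
  define C where "C = real N * \<bar>C1\<bar> + \<bar>C2\<bar>"
  have C0: "0 \<le> C" by (simp add: C_def)
  obtain L0 where L0: "2 * \<bar>C\<bar> / \<delta> < real L0" using reals_Archimedean2 by blast
  have "1 - \<delta> \<le> (\<Sum>w\<in>good_words s e L. pw w)" if L: "Suc L0 \<le> L" for L
  proof -
    have Lp: "0 < L" using L by simp
    \<comment> \<open>The summand 1 makes \<open>N * h\<close> exceed \<open>L\<close>, so
      \<open>N\<close> multiples of \<open>h\<close> reach every prefix, while the distance to the
      preceding grid point stays at most \<open>L div N\<close>.\<close>
    define h where "h = L div N + 1"
    define A where "A i w \<longleftrightarrow> i * h \<le> L \<and> e / 2 * real L < info s (take (i * h) w)" for i w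
    define B where "B w \<longleftrightarrow> real L * pressure 1 s / 2 < info s w" for w
    have pt: "(if w \<in> good_words s e L then 0 else pw w) \<le> (\<Sum>i<N. if A i w then pw w else 0) + (if B w then pw w else 0)"
      if w: "w \<in> W L" for w
    proof (cases "B w \<or> (\<exists>i<N. A i w)")
      case True
      have p: "0 \<le> pw w" using w by (intro pw_nonneg) (simp add: words_of_length_iff)
      have n: "0 \<le> (\<Sum>i<N. if A i w then pw w else 0)" using p by (intro sum_nonneg) auto
      show ?thesis
      proof (cases "B w")
        case False
        then obtain i where i: "i < N" "A i w" using True by blast
        have "(if A i w then pw w else 0) \<le> (\<Sum>i<N. if A i w then pw w else 0)"
          using i p by (intro member_le_sum) auto
        then show ?thesis using i p False by simp
      qed (use p n in auto)
    next
      case False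
      have wl: "w \<in> words n0" "length w = L" using w by (simp_all add: words_of_length_iff)
      have "info s (take k w) \<le> e * real L" if k: "k \<le> L" for k
      proof (cases "pw (take k w) = 0")
        case True
        \<comment> \<open>A prefix of probability 0 has \<open>info\<close> equal to
          \<open>ln 0 = 0\<close>.\<close>
        then show ?thesis using e by (simp add: info_def)
      next
        case pk: False
        define i where "i = k div h"
        have ih: "i * h \<le> k" by (simp add: i_def)
        have hN: "L < N * h" unfolding h_def using N0 dividend_less_times_div[of N L] by simp
        have "i < N" unfolding i_def using k hN by (intro less_mult_imp_div_less) simp
        moreover have "i * h \<le> L" using ih k by simp
        ultimately have g: "info s (take (i * h) w) \<le> e / 2 * real L" using False by (auto simp: A_def not_less)
        define v where "v = drop (i * h) (take k w)"
        have tk: "take k w = take (i * h) w @ v"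
        proof -
          have "take k w = take (i * h) (take k w) @ v" unfolding v_def by (rule append_take_drop_id[symmetric])
          then show ?thesis using ih by (simp add: min_absorb1)
        qed
        have vw: "v \<in> words n0" unfolding v_def by (intro words_drop words_take wl(1))
        have "length v = k mod h" using k wl ih by (simp add: v_def i_def minus_div_mult_eq_mod)
        moreover have "k mod h < h" by (rule mod_less_divisor) (simp add: h_def)
        ultimately have "length v \<le> L div N" by (simp add: h_def)
        then have "real (length v) \<le> real (L div N)" by simp
        also have "\<dots> \<le> real L / real N" by (rule of_nat_div_le_of_nat)
        finally have lv: "real (length v) \<le> real L / real N" .
        have "info s (take k w) \<le> info s (take (i * h) w) + real (length v) * c0"
          using info_append_le[OF words_take[OF wl(1), of "i * h"] vw s] pk by (simp add: tk[symmetric] c0_def)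
        also have "real (length v) * c0 \<le> real L / real N * c0" using lv c0 by (intro mult_right_mono) auto
        also have "\<dots> = real L * (c0 / real N)" by simp
        also have "\<dots> \<le> real L * (e / 2)" using cN by (intro mult_left_mono) auto
        finally show ?thesis using g by (simp add: mult.commute)
      qed
      then have "w \<in> good_words s e L" using w False by (auto simp: good_words_def B_def not_less)
      then show ?thesis using False by (simp add: sum.neutral)
    qed
    have gf: "good_words s e L \<subseteq> W L" by (auto simp: good_words_def)
    have f1: "(\<Sum>w\<in>W L. if w \<in> good_words s e L then 0 else pw w) = 1 - (\<Sum>w\<in>good_words s e L. pw w)"
    proof -
      have "(\<Sum>w\<in>W L. if w \<in> good_words s e L then 0 else pw w) = (\<Sum>w\<in>W L - good_words s e L. pw w)"
        by (simp add: sum.If_cases set_diff_eq Int_def)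
      also have "\<dots> = (\<Sum>w\<in>W L. pw w) - (\<Sum>w\<in>good_words s e L. pw w)" using gf by (intro sum_diff) auto
      finally show ?thesis by (simp only: sum_pw)
    qed
    have f2: "(\<Sum>w\<in>W L. if w \<in> good_words s e L then 0 else pw w) \<le>
        (\<Sum>w\<in>W L. (\<Sum>i<N. if A i w then pw w else 0) + (if B w then pw w else 0))"
      using pt by (intro sum_mono)
    have f3: "(\<Sum>w\<in>W L. (\<Sum>i<N. if A i w then pw w else 0) + (if B w then pw w else 0)) =
        (\<Sum>i<N. \<Sum>w\<in>W L. if A i w then pw w else 0) + (\<Sum>w\<in>W L. if B w then pw w else 0)"
      by (simp add: sum.distrib sum.swap[of _ "{..<N}"])
    have f4: "(\<Sum>i<N. \<Sum>w\<in>W L. if A i w then pw w else 0) \<le> (\<Sum>i<N. \<delta> / (4 * real N) + \<bar>C1\<bar> / real L)"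
    proof (intro sum_mono)
      fix i
      show "(\<Sum>w\<in>W L. if A i w then pw w else 0) \<le> \<delta> / (4 * real N) + \<bar>C1\<bar> / real L"
      proof (cases "i * h \<le> L")
        case True
        have "(\<Sum>w\<in>W L. if A i w then pw w else 0) = (\<Sum>w\<in>W L. if e / 2 * real L < info s (take (i * h) w) then pw w else 0)"
          using True by (simp add: A_def)
        also have "\<dots> = (\<Sum>u\<in>W (i * h). if e / 2 * real L < info s u then pw u else 0)" by (rule sum_words_take[OF True])
        \<comment> \<open>Subtracting the nonpositive number
          \<open>real (i * h) * pressure 1 s\<close> only enlarges the event and brings it into the
          form of \<open>info_tail\<close>.\<close>
        also have "\<dots> \<le> (\<Sum>u\<in>W (i * h). if e / 2 * real L < info s u - real (i * h) * pressure 1 s then pw u else 0)"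
        proof (intro sum_mono)
          fix u assume "u \<in> W (i * h)"
          then have "0 \<le> pw u" by (intro pw_nonneg) (simp add: words_of_length_iff)
          moreover have "real (i * h) * pressure 1 s \<le> 0" using Pn by (intro mult_nonneg_nonpos) auto
          ultimately show "(if e / 2 * real L < info s u then pw u else 0) \<le> (if e / 2 * real L < info s u - real (i * h) * pressure 1 s then pw u else 0)"
            by auto
        qed
        also have "\<dots> \<le> \<delta> / (4 * real N) + C1 / real L" by (rule C1[OF True Lp])
        also have "\<dots> \<le> \<delta> / (4 * real N) + \<bar>C1\<bar> / real L" by (intro add_left_mono divide_right_mono) auto
        finally show ?thesis .
      next
        case False
        then have "(\<Sum>w\<in>W L. if A i w then pw w else 0) = 0" by (simp add: A_def)
        then show ?thesis using \<delta> by (simp add: add_nonneg_nonneg)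
      qed
    qed
    have f5: "(\<Sum>i<N. \<delta> / (4 * real N) + \<bar>C1\<bar> / real L) = \<delta> / 4 + real N * \<bar>C1\<bar> / real L"
      using N0 by (simp add: field_simps)
    have f6: "(\<Sum>w\<in>W L. if B w then pw w else 0) \<le> \<delta> / 4 + C2 / real L"
    proof -
      have "B w \<longleftrightarrow> - pressure 1 s / 2 * real L < info s w - real L * pressure 1 s" for w by (auto simp: B_def field_simps)
      then show ?thesis using C2[of L L] Lp by simp
    qed
    have f7: "real N * \<bar>C1\<bar> / real L + C2 / real L \<le> \<delta> / 2"
    proof -
      have le: "real N * \<bar>C1\<bar> / real L + C2 / real L \<le> C / real L"
        unfolding C_def add_divide_distrib by (intro add_left_mono divide_right_mono) auto
      have "2 * C / \<delta> < real L" using L0 L C0 by simp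
      then have "C / real L \<le> \<delta> / 2" using \<delta> Lp by (simp add: field_simps)
      then show ?thesis using le by linarith
    qed
    have "1 - (\<Sum>w\<in>good_words s e L. pw w) \<le> (\<Sum>i<N. \<Sum>w\<in>W L. if A i w then pw w else 0) + (\<Sum>w\<in>W L. if B w then pw w else 0)"
      using f2 unfolding f1 f3 .
    also have "\<dots> \<le> (\<delta> / 4 + real N * \<bar>C1\<bar> / real L) + (\<delta> / 4 + C2 / real L)"
      using f4 f6 unfolding f5 by (intro add_mono)
    also have "\<dots> = \<delta> / 2 + (real N * \<bar>C1\<bar> / real L + C2 / real L)" by simp
    also have "\<dots> \<le> \<delta> / 2 + \<delta> / 2" using f7 by (rule add_left_mono)
    finally show ?thesis by simp
  qed
  then show ?thesis by blast
qed

text \<open>The mass of a cube is split as \<open>m = g + (m - g)\<close> with \<open>g\<close> the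
  part coming from \<open>V\<close>. By convexity the split costs \<open>m * ln 2\<close>, the rest
  contributes at most 0, and \<open>ln g \<le> ln y - 1 + g / y\<close> replaces a logarithm by a
  second moment. So an energy bound for part of the mass controls the entropy of the whole.\<close>

lemma entropy_le:
  assumes \<omega>: "bounded_by R \<omega>" and R: "0 < R" and r: "0 < r" and V: "V \<subseteq> W L" and y: "0 < y"
  defines "G \<equiv> \<lambda>Q. \<Sum>w\<in>V. mass \<omega> w Q"
  shows "(\<Sum>Q\<in>near_cubes r (rad R). mass \<omega> [] Q * ln (mass \<omega> [] Q)) \<le>
    (\<Sum>w\<in>V. pw w) * (ln y - 1) + (\<Sum>Q\<in>near_cubes r (rad R). G Q powr 2) / y + ln 2"
proof -
  let ?F = "near_cubes r (rad R) :: (real^'d) set set"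
  have R0: "0 \<le> rad R" using R b by (simp add: rad_def)
  have fin: "finite ?F" by (rule finite_near_cubes[OF r R0])
  have VW: "finite V" "V \<subseteq> words n0" using finite_subset[OF V] V by (auto simp: words_of_length_iff)
  note tot = sum_mass_near_cubes[OF \<omega> R r]
  have "mass \<omega> [] Q * ln (mass \<omega> [] Q) \<le> G Q * (ln y - 1) + G Q powr 2 / y + ln 2 * mass \<omega> [] Q" if Q: "Q \<in> ?F" for Q
  proof -
    have Qb: "Q \<in> sets borel" using Q by (intro mesh_borel[of Q r]) (simp add: near_cubes_def)
    define g where "g = G Q"
    define m where "m = mass \<omega> [] Q"
    have g0: "0 \<le> g" by (simp add: g_def G_def sum_nonneg)
    have "g \<le> (\<Sum>v\<in>W L. mass \<omega> ([] @ v) Q)" unfolding g_def G_def using V by (intro order_trans[OF sum_mono2[OF _ V]]) auto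
    then have gm: "g \<le> m" using mass_extend[OF Qb, of "[]" \<omega> L] by (simp add: m_def)
    have m1: "m \<le> 1" using order_trans[OF mass_le pw_le_1, of "[]"] by (simp add: m_def)
    have "(g + (m - g)) * ln ((g + (m - g)) / 2) \<le> g * ln g + (m - g) * ln (m - g)"
      using sum_mult_ln_ge[of "{True, False}" 2 "\<lambda>x. if x then g else m - g"] g0 gm by simp
    then have "m * ln m - m * ln 2 \<le> g * ln g + (m - g) * ln (m - g)"
      using g0 gm by (cases "m = 0") (auto simp: ln_div algebra_simps)
    moreover have "(m - g) * ln (m - g) \<le> 0"
      using g0 gm m1 by (cases "m = g") (auto intro!: mult_nonneg_nonpos)
    moreover have "g * ln g \<le> g * (ln y - 1) + g powr 2 / y"
    proof (cases "g = 0")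
      case False
      then have gp: "0 < g" using g0 by simp
      have "ln (g / y) \<le> g / y - 1" using gp y by (intro ln_le_minus_one) simp
      then have "ln g \<le> (ln y - 1) + g / y" using gp y by (simp add: ln_div)
      then have "g * ln g \<le> g * ((ln y - 1) + g / y)" using gp by (intro mult_left_mono) auto
      also have "\<dots> = g * (ln y - 1) + g powr 2 / y" using gp by (simp add: distrib_left power2_eq_square)
      finally show ?thesis .
    qed simp
    ultimately show ?thesis unfolding g_def[symmetric] m_def[symmetric] by (simp add: mult.commute)
  qed
  then have "(\<Sum>Q\<in>?F. mass \<omega> [] Q * ln (mass \<omega> [] Q)) \<le> (\<Sum>Q\<in>?F. G Q * (ln y - 1) + G Q powr 2 / y + ln 2 * mass \<omega> [] Q)"
    by (intro sum_mono)
  also have "\<dots> = (\<Sum>Q\<in>?F. G Q) * (ln y - 1) + (\<Sum>Q\<in>?F. G Q powr 2) / y + ln 2 * (\<Sum>Q\<in>?F. mass \<omega> [] Q)"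
    by (simp add: sum.distrib sum_distrib_left sum_distrib_right sum_divide_distrib)
  also have "(\<Sum>Q\<in>?F. G Q) = (\<Sum>w\<in>V. \<Sum>Q\<in>?F. mass \<omega> w Q)" unfolding G_def by (rule sum.swap)
  also have "\<dots> = (\<Sum>w\<in>V. pw w)" using tot VW by (intro sum.cong) auto
  also have "(\<Sum>Q\<in>?F. mass \<omega> [] Q) = 1" using tot[of "[]"] by (simp add: word_prob_def)
  finally show ?thesis by simp
qed

text \<open>Coded words are classified by the first position, among the first \<open>m\<close>, at
  which they leave \<open>w\<close>.\<close>

lemma mass_split_along:
  assumes Q: "Q \<in> sets borel" and w: "w \<in> words n0" and m: "m \<le> length w"
  shows "mass \<omega> [] Q = mass \<omega> (take m w) Q + (\<Sum>k<m. \<Sum>i\<in>{1..n0} - {w ! k}. mass \<omega> (take k w @ [i]) Q)"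
  using m
proof (induction m)
  case (Suc m)
  have "w ! m \<in> set w" using Suc.prems by (intro nth_mem) simp
  then have wm: "w ! m \<in> {1..n0}" using w unfolding words_iff by blast
  have "mass \<omega> (take m w) Q = (\<Sum>i=1..n0. mass \<omega> (take m w @ [i]) Q)"
    using mass_extend[OF Q words_take[OF w], of \<omega> m 1] by (simp add: sum_words_1 del: One_nat_def)
  also have "\<dots> = mass \<omega> (take m w @ [w ! m]) Q + (\<Sum>i\<in>{1..n0} - {w ! m}. mass \<omega> (take m w @ [i]) Q)"
    using wm by (intro sum.remove) auto
  also have "take m w @ [w ! m] = take (Suc m) w" using Suc.prems by (simp add: take_Suc_conv_app_nth)
  finally show ?case using Suc by simp
qed simp

end

section \<open>The energy carried by good words\<close>

context random_affine_words
begin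

text \<open>One factor of the square becomes the full mass, split by the position at which a word
  leaves \<open>w\<close>. On a branch leaving after \<open>k\<close> letters, the mass of
  \<open>w\<close> ignores the translations along the branch from the separation on, so it can serve
  as the weight in \<open>expectation_mass_le\<close>. The diagonal part is bounded by the
  probability of \<open>w\<close>.\<close>

lemma expected_energy:
  "\<exists>C>0. \<forall>L V (r::real) F. V \<subseteq> W L \<longrightarrow> 0 < r \<longrightarrow> finite F \<longrightarrow> F \<subseteq> mesh r \<longrightarrow>
    (\<Sum>Q\<in>F. omega.expectation (\<lambda>\<xi>. (\<Sum>w\<in>V. mass \<xi> w Q) powr 2)) \<le>
      (\<Sum>w\<in>V. pw w * ((\<Sum>k<L. C * sv_min (CARD('d) * r) (word_mat T (take k w)) * pw (take k w)) + pw w))"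
proof -
  obtain C where C: "0 < C" and E: "\<And>w (r::real) Q F. w \<in> words n0 \<Longrightarrow> w \<noteq> [] \<Longrightarrow> 0 < r \<Longrightarrow> Q \<in> mesh r \<Longrightarrow> F \<in> borel_measurable \<Omega> \<Longrightarrow>
     (\<forall>\<xi>. 0 \<le> F \<xi>) \<Longrightarrow> (\<exists>B. \<forall>\<xi>. F \<xi> \<le> B) \<Longrightarrow> (\<forall>u\<in>cylinder n0 w. path_indep u (length w - 1) F) \<Longrightarrow>
     omega.expectation (\<lambda>\<xi>. mass \<xi> w Q * F \<xi>) \<le>
       C * sv_min (CARD('d) * r) (word_mat T (butlast w)) * pw w * omega.expectation (F :: _ \<Rightarrow> real)"
    using expectation_mass_le by blast
  have bound: "(\<Sum>Q\<in>F. omega.expectation (\<lambda>\<xi>. (\<Sum>w\<in>V. mass \<xi> w Q) powr 2)) \<le>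
      (\<Sum>w\<in>V. pw w * ((\<Sum>k<L. C * sv_min (CARD('d) * r) (word_mat T (take k w)) * pw (take k w)) + pw w))"
    if V: "V \<subseteq> W L" and r: "0 < r" and F: "finite F" "F \<subseteq> mesh r" for L V F and r :: real
  proof -
    have finV: "finite V" using finite_subset[OF V] by simp
    have Vw: "w \<in> words n0" "length w = L" if "w \<in> V" for w using that V by (auto simp: words_of_length_iff)
    have Qb: "Q \<in> sets borel" if "Q \<in> F" for Q using that F mesh_borel by blast
    define c where "c w = (\<Sum>k<L. C * sv_min (CARD('d) * r) (word_mat T (take k w)) * pw (take k w)) + pw w" for w
    have sv0: "0 \<le> sv_min (CARD('d) * r) (word_mat T u)" if "u \<in> words n0" for u
      using r sv_min_pos[OF word_mat_invertible[OF that], of "CARD('d) * r"] by simp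
    have m1: "mass \<xi> w Q \<le> 1" if "w \<in> words n0" for \<xi> w Q using order_trans[OF mass_le pw_le_1] that by blast
    have int2: "integrable \<Omega> (\<lambda>\<xi>. mass \<xi> w Q * mass \<xi> w' Q)" if "w \<in> words n0" "w' \<in> words n0" "Q \<in> F" for w w' Q
    proof (rule omega.integrable_const_bound[of _ 1])
      show "AE \<xi> in \<Omega>. norm (mass \<xi> w Q * mass \<xi> w' Q) \<le> 1"
        using m1 that by (intro AE_I2) (simp add: abs_mult mult_le_one)
      show "(\<lambda>\<xi>. mass \<xi> w Q * mass \<xi> w' Q) \<in> borel_measurable \<Omega>" using Qb[OF that(3)] by measurable
    qed
    have int1: "integrable \<Omega> (\<lambda>\<xi>. mass \<xi> w Q)" if "w \<in> words n0" "Q \<in> F" for w Q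
      using integrable_mass[OF Qb[OF that(2)] that(1)] .
    have one: "omega.expectation (\<lambda>\<xi>. mass \<xi> [] Q * mass \<xi> w Q) \<le> c w * omega.expectation (\<lambda>\<xi>. mass \<xi> w Q)"
      if w: "w \<in> V" and Q: "Q \<in> F" for w Q
    proof -
      let ?m = "omega.expectation (\<lambda>\<xi>. mass \<xi> w Q)"
      let ?I = "\<lambda>k. {1..n0} - {w ! k}"
      note ww = Vw[OF w]
      have m0: "0 \<le> ?m" by (intro integral_nonneg_AE) auto
      have xw: "take k w @ [i] \<in> words n0" if "i \<in> ?I k" for k i using that ww words_take by auto
      have pair: "omega.expectation (\<lambda>\<xi>. mass \<xi> (take k w @ [i]) Q * mass \<xi> w Q) \<le>
          C * sv_min (CARD('d) * r) (word_mat T (take k w)) * pw (take k w @ [i]) * ?m" if k: "k < L" and i: "i \<in> ?I k" for k i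
      proof -
        have "path_indep u (length (take k w @ [i]) - 1) (\<lambda>\<xi>. mass \<xi> w Q)" if u: "u \<in> cylinder n0 (take k w @ [i])" for u
        proof -
          have lk: "length (take k w @ [i]) = Suc k" using k ww by simp
          have ui: "u \<in> inf_words n0" "restr u (Suc k) = take k w @ [i]" using u lk by (auto simp: cylinder_iff)
          have "path_indep u k (\<lambda>\<xi>. mass \<xi> w Q)"
            using k ww i by (intro mass_path_indep ui(1)) (auto simp: ui(2) take_Suc_conv_app_nth)
          then show ?thesis using lk by simp
        qed
        then have "omega.expectation (\<lambda>\<xi>. mass \<xi> (take k w @ [i]) Q * mass \<xi> w Q) \<le>
            C * sv_min (CARD('d) * r) (word_mat T (butlast (take k w @ [i]))) * pw (take k w @ [i]) * ?m"
          using m1[OF ww(1)] F Q Qb[OF Q] by (intro E xw[OF i] r) auto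
        then show ?thesis by simp
      qed
      have "omega.expectation (\<lambda>\<xi>. mass \<xi> [] Q * mass \<xi> w Q) =
          omega.expectation (\<lambda>\<xi>. mass \<xi> w Q * mass \<xi> w Q + (\<Sum>k<L. \<Sum>i\<in>?I k. mass \<xi> (take k w @ [i]) Q * mass \<xi> w Q))"
      proof (intro Bochner_Integration.integral_cong refl)
        fix \<xi>
        show "mass \<xi> [] Q * mass \<xi> w Q = mass \<xi> w Q * mass \<xi> w Q + (\<Sum>k<L. \<Sum>i\<in>?I k. mass \<xi> (take k w @ [i]) Q * mass \<xi> w Q)"
          using mass_split_along[OF Qb[OF Q] ww(1), of L \<xi>] ww(2) by (simp add: distrib_right sum_distrib_right)
      qed
      also have "\<dots> = omega.expectation (\<lambda>\<xi>. mass \<xi> w Q * mass \<xi> w Q) +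
          (\<Sum>k<L. \<Sum>i\<in>?I k. omega.expectation (\<lambda>\<xi>. mass \<xi> (take k w @ [i]) Q * mass \<xi> w Q))"
        using int2[OF xw ww(1) Q] int2[OF ww(1) ww(1) Q]
        by (subst Bochner_Integration.integral_add; (subst Bochner_Integration.integral_sum)?; (intro Bochner_Integration.integrable_sum sum.cong refl Bochner_Integration.integral_sum)?; simp)
      also have "\<dots> \<le> pw w * ?m + (\<Sum>k<L. \<Sum>i\<in>?I k. C * sv_min (CARD('d) * r) (word_mat T (take k w)) * pw (take k w @ [i]) * ?m)"
      proof (rule add_mono)
        have "omega.expectation (\<lambda>\<xi>. mass \<xi> w Q * mass \<xi> w Q) \<le> omega.expectation (\<lambda>\<xi>. pw w * mass \<xi> w Q)"
          using int2[OF ww(1) ww(1) Q] int1[OF ww(1) Q] mass_le[OF ww(1)] by (intro integral_mono mult_right_mono) auto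
        then show "omega.expectation (\<lambda>\<xi>. mass \<xi> w Q * mass \<xi> w Q) \<le> pw w * ?m" by simp
      qed (use pair in \<open>intro sum_mono; simp\<close>)
      also have "\<dots> \<le> pw w * ?m + (\<Sum>k<L. C * sv_min (CARD('d) * r) (word_mat T (take k w)) * pw (take k w) * ?m)"
      proof (intro add_left_mono sum_mono)
        fix k assume "k \<in> {..<L}"
        have "(\<Sum>i\<in>?I k. pw (take k w @ [i])) \<le> (\<Sum>i=1..n0. pw (take k w @ [i]))"
          using ww words_take by (intro sum_mono2 pw_nonneg) auto
        also have "\<dots> = pw (take k w)"
          using sum_pw[of 1] by (simp add: word_prob_append sum_distrib_left[symmetric] sum_words_1 del: One_nat_def)
        finally have "C * sv_min (CARD('d) * r) (word_mat T (take k w)) * (\<Sum>i\<in>?I k. pw (take k w @ [i])) * ?m \<le>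
            C * sv_min (CARD('d) * r) (word_mat T (take k w)) * pw (take k w) * ?m"
          using C sv0[OF words_take[OF ww(1)]] m0 by (intro mult_right_mono mult_left_mono) auto
        then show "(\<Sum>i\<in>?I k. C * sv_min (CARD('d) * r) (word_mat T (take k w)) * pw (take k w @ [i]) * ?m) \<le>
            C * sv_min (CARD('d) * r) (word_mat T (take k w)) * pw (take k w) * ?m"
          by (simp add: sum_distrib_left sum_distrib_right)
      qed
      also have "\<dots> = c w * ?m" by (simp add: c_def distrib_right sum_distrib_right)
      finally show ?thesis .
    qed
    have "(\<Sum>Q\<in>F. omega.expectation (\<lambda>\<xi>. (\<Sum>w\<in>V. mass \<xi> w Q) powr 2)) \<le>
        (\<Sum>Q\<in>F. \<Sum>w\<in>V. c w * omega.expectation (\<lambda>\<xi>. mass \<xi> w Q))"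
    proof (intro sum_mono)
      fix Q assume Q: "Q \<in> F"
      have int3: "integrable \<Omega> (\<lambda>\<xi>. \<Sum>w\<in>V. mass \<xi> [] Q * mass \<xi> w Q)"
        using int2[OF _ Vw(1) Q] by (intro Bochner_Integration.integrable_sum) auto
      \<comment> \<open>One factor is enlarged to the full mass because
        \<open>mass_split_along\<close> decomposes the full mass, not the part carried by
        \<open>V\<close>.\<close>
      have le: "(\<Sum>w\<in>V. mass \<xi> w Q) powr 2 \<le> (\<Sum>w\<in>V. mass \<xi> [] Q * mass \<xi> w Q)" for \<xi>
      proof -
        have g0: "0 \<le> (\<Sum>w\<in>V. mass \<xi> w Q)" by (intro sum_nonneg) auto
        have "(\<Sum>w\<in>V. mass \<xi> w Q) \<le> (\<Sum>v\<in>W L. mass \<xi> v Q)" using V by (intro sum_mono2) auto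
        also have "\<dots> = mass \<xi> [] Q" using mass_extend[OF Qb[OF Q], of "[]" \<xi> L] by simp
        finally have "(\<Sum>w\<in>V. mass \<xi> w Q) * (\<Sum>w\<in>V. mass \<xi> w Q) \<le> mass \<xi> [] Q * (\<Sum>w\<in>V. mass \<xi> w Q)"
          using g0 by (intro mult_right_mono) auto
        then show ?thesis using g0 by (simp add: power2_eq_square sum_distrib_left)
      qed
      have "omega.expectation (\<lambda>\<xi>. (\<Sum>w\<in>V. mass \<xi> w Q) powr 2) \<le> omega.expectation (\<lambda>\<xi>. \<Sum>w\<in>V. mass \<xi> [] Q * mass \<xi> w Q)"
        using int3 le by (intro integral_mono_AE' AE_I2) (auto intro!: sum_nonneg)
      also have "\<dots> = (\<Sum>w\<in>V. omega.expectation (\<lambda>\<xi>. mass \<xi> [] Q * mass \<xi> w Q))"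
        using int2[OF _ Vw(1) Q] by (intro Bochner_Integration.integral_sum) auto
      also have "\<dots> \<le> (\<Sum>w\<in>V. c w * omega.expectation (\<lambda>\<xi>. mass \<xi> w Q))" using one Q by (intro sum_mono)
      finally show "omega.expectation (\<lambda>\<xi>. (\<Sum>w\<in>V. mass \<xi> w Q) powr 2) \<le> (\<Sum>w\<in>V. c w * omega.expectation (\<lambda>\<xi>. mass \<xi> w Q))" .
    qed
    also have "\<dots> = (\<Sum>w\<in>V. c w * (\<Sum>Q\<in>F. omega.expectation (\<lambda>\<xi>. mass \<xi> w Q)))"
      by (subst sum.swap) (simp add: sum_distrib_left)
    also have "\<dots> \<le> (\<Sum>w\<in>V. c w * pw w)"
    proof (intro sum_mono mult_left_mono)
      fix w assume w: "w \<in> V"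
      note ww = Vw(1)[OF w]
      show "(\<Sum>Q\<in>F. omega.expectation (\<lambda>\<xi>. mass \<xi> w Q)) \<le> pw w" by (rule sum_expectation_mass_le[OF r F ww])
      show "0 \<le> c w" unfolding c_def using C sv0 pw_nonneg words_take ww by (intro add_nonneg_nonneg sum_nonneg mult_nonneg_nonneg) auto
    qed
    finally show ?thesis by (simp add: c_def mult.commute)
  qed
  show ?thesis by (intro exI[of _ C] conjI allI impI C bound; assumption)
qed

text \<open>By \<open>sv_min_le_svf\<close> an off-diagonal term is at most a constant times
  \<open>((1 / 2) ^ n) powr s * exp (info s (take k w))\<close>, and the diagonal term is at most
  \<open>exp (info s w)\<close>. The two conditions on good words bound these exponentials.\<close>

lemma energy_decay:
  assumes s: "0 < s" "s \<le> real CARD('d)" and Pn: "pressure 1 s < 0" and \<eta>: "0 < \<eta>"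
  shows "\<exists>N e C. 0 < N \<and> 0 < e \<and> (\<forall>n. (\<Sum>Q\<in>near_cubes ((1 / 2) ^ n) (rad R).
      omega.expectation (\<lambda>\<xi>. (\<Sum>w\<in>good_words s e (N * n). mass \<xi> w Q) powr 2)) \<le> C * ((1 / 2) ^ n) powr (s - \<eta>))"
proof -
  have R0: "0 \<le> rad R" using R(1) b by (simp add: rad_def)
  obtain C where C: "0 < C" and E: "\<forall>L V (r::real) F. V \<subseteq> W L \<longrightarrow> 0 < r \<longrightarrow> finite F \<longrightarrow> F \<subseteq> mesh r \<longrightarrow>
    (\<Sum>Q\<in>F. omega.expectation (\<lambda>\<xi>. (\<Sum>w\<in>V. mass \<xi> w Q) powr 2)) \<le>
      (\<Sum>w\<in>V. pw w * ((\<Sum>k<L. C * sv_min (CARD('d) * r) (word_mat T (take k w)) * pw (take k w)) + pw w))"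
    using expected_energy by (elim exE conjE) (rule that)
  \<comment> \<open>Over \<open>N * n\<close> letters half the pressure reaches
    \<open>- s * n * ln 2\<close>, so the diagonal term is at most
    \<open>((1 / 2) ^ n) powr s\<close>.\<close>
  obtain N :: nat where N: "2 * s * ln 2 / - pressure 1 s < real N" using reals_Archimedean2 by blast
  have "0 < 2 * s * ln 2 / - pressure 1 s" using s Pn by (intro divide_pos_pos) auto
  then have N0: "0 < N" using N by (cases N) auto
  \<comment> \<open>With \<open>L = N * n\<close> the square of \<open>exp (e * L)\<close> is
    \<open>((1 / 2) ^ n) powr (- \<eta>)\<close>: one factor comes from the bound on
    \<open>info\<close>, the other pays for the number \<open>L\<close> of terms.\<close>
  define e where "e = \<eta> * ln 2 / (2 * real N)"
  have e: "0 < e" using \<eta> N0 by (simp add: e_def)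
  define B where "B = C * real CARD('d) powr s / e + 1"
  have main: "(\<Sum>Q\<in>near_cubes ((1 / 2) ^ n) (rad R).
      omega.expectation (\<lambda>\<xi>. (\<Sum>w\<in>good_words s e (N * n). mass \<xi> w Q) powr 2)) \<le> B * ((1 / 2) ^ n) powr (s - \<eta>)" for n
  proof -
    let ?V = "good_words s e (N * n)" and ?L = "N * n" and ?\<rho> = "(1 / 2 :: real) ^ n"
    have V: "?V \<subseteq> W ?L" by (auto simp: good_words_def)
    have \<rho>: "0 < ?\<rho>" "?\<rho> \<le> 1" by (auto intro: power_le_one)
    have ln\<rho>: "ln ?\<rho> = - (real n * ln 2)" by (simp add: ln_realpow ln_div)
    have dr: "0 < real CARD('d) * ?\<rho>" by simp
    have inner: "(\<Sum>k<?L. C * sv_min (CARD('d) * ?\<rho>) (word_mat T (take k w)) * pw (take k w)) + pw w \<le> B * ?\<rho> powr (s - \<eta>)"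
      if w: "w \<in> ?V" for w
    proof -
      have ww: "w \<in> words n0" using w V by (auto simp: words_of_length_iff)
      have ratio: "pw u / psi s u \<le> exp (info s u)" if u: "u \<in> words n0" for u
        using pw_nonneg[OF u] psi_pos[OF u, of s] s by (cases "pw u = 0") (auto simp: info_def divide_inverse mult.commute)
      have t1: "C * sv_min (CARD('d) * ?\<rho>) (word_mat T (take k w)) * pw (take k w) \<le>
          C * real CARD('d) powr s * ?\<rho> powr s * exp (e * real ?L)" if k: "k < ?L" for k
      proof -
        have u: "take k w \<in> words n0" using ww by (rule words_take)
        have "C * sv_min (CARD('d) * ?\<rho>) (word_mat T (take k w)) * pw (take k w) \<le>
            C * ((CARD('d) * ?\<rho>) powr s / psi s (take k w)) * pw (take k w)"
          using C pw_nonneg[OF u] sv_min_le_svf[OF word_mat_invertible[OF u] less_imp_le[OF s(1)] s(2) dr]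
          by (intro mult_right_mono mult_left_mono) auto
        also have "\<dots> = C * (CARD('d) * ?\<rho>) powr s * (pw (take k w) / psi s (take k w))" by simp
        also have "\<dots> \<le> C * (CARD('d) * ?\<rho>) powr s * exp (info s (take k w))"
          using C ratio[OF u] by (intro mult_left_mono) auto
        also have "\<dots> \<le> C * (CARD('d) * ?\<rho>) powr s * exp (e * real ?L)"
          using C w k by (intro mult_left_mono) (auto simp: good_words_def)
        also have "\<dots> = C * real CARD('d) powr s * ?\<rho> powr s * exp (e * real ?L)" by (simp add: powr_mult)
        finally show ?thesis .
      qed
      have "(\<Sum>k<?L. C * sv_min (CARD('d) * ?\<rho>) (word_mat T (take k w)) * pw (take k w)) \<le>
          (\<Sum>k<?L. C * real CARD('d) powr s * ?\<rho> powr s * exp (e * real ?L))" using t1 by (intro sum_mono) auto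
      also have "\<dots> = C * real CARD('d) powr s * (?\<rho> powr s * (real ?L * exp (e * real ?L)))" by simp
      also have "\<dots> \<le> C * real CARD('d) powr s * (?\<rho> powr s * (exp (e * real ?L) / e * exp (e * real ?L)))"
      proof (intro mult_left_mono mult_right_mono)
        have "e * real ?L \<le> exp (e * real ?L)" using exp_ge_add_one_self[of "e * real ?L"] by linarith
        then show "real ?L \<le> exp (e * real ?L) / e" using e by (simp add: field_simps)
      qed (use C in auto)
      also have "?\<rho> powr s * (exp (e * real ?L) / e * exp (e * real ?L)) = ?\<rho> powr (s - \<eta>) / e"
      proof -
        have "exp (e * real ?L) * exp (e * real ?L) = exp (\<eta> * (real n * ln 2))"
          using N0 by (simp add: exp_add[symmetric] e_def)
        also have "\<dots> = ?\<rho> powr (- \<eta>)" using \<rho> by (simp add: powr_def ln\<rho>)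
        finally have "?\<rho> powr s * (exp (e * real ?L) * exp (e * real ?L)) = ?\<rho> powr (s - \<eta>)"
          by (simp add: powr_add[symmetric])
        then show ?thesis by (simp add: mult.assoc)
      qed
      finally have 1: "(\<Sum>k<?L. C * sv_min (CARD('d) * ?\<rho>) (word_mat T (take k w)) * pw (take k w)) \<le>
          C * real CARD('d) powr s / e * ?\<rho> powr (s - \<eta>)" by simp
      have "pw w \<le> pw w / psi s w"
        using pw_nonneg[OF ww] psi_pos[OF ww, of s] psi_bounds(2)[OF ww, of s] s by (simp add: le_divide_eq mult_left_le)
      also have "\<dots> \<le> exp (info s w)" by (rule ratio[OF ww])
      also have "\<dots> \<le> exp (- s * (real n * ln 2))"
      proof -
        have "2 * s * ln 2 < real N * - pressure 1 s" using N Pn by (simp add: field_simps)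
        then have "real n * (2 * s * ln 2) \<le> real n * (real N * - pressure 1 s)" by (intro mult_left_mono) auto
        then have "real ?L * pressure 1 s / 2 \<le> - s * (real n * ln 2)" by (simp add: algebra_simps)
        moreover have "info s w \<le> real ?L * pressure 1 s / 2" using w by (simp add: good_words_def)
        ultimately show ?thesis by simp
      qed
      also have "\<dots> = ?\<rho> powr s" using \<rho> by (simp add: powr_def ln\<rho>)
      also have "\<dots> \<le> ?\<rho> powr (s - \<eta>)" using \<rho> \<eta> by (intro powr_mono') auto
      finally show ?thesis using 1 by (simp add: B_def distrib_right)
    qed
    have "(\<Sum>Q\<in>near_cubes ?\<rho> (rad R). omega.expectation (\<lambda>\<xi>. (\<Sum>w\<in>?V. mass \<xi> w Q) powr 2)) \<le>
      (\<Sum>w\<in>?V. pw w * ((\<Sum>k<?L. C * sv_min (CARD('d) * ?\<rho>) (word_mat T (take k w)) * pw (take k w)) + pw w))"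
      using finite_near_cubes[OF \<rho>(1) R0] by (intro E[rule_format] V \<rho>(1)) (auto simp: near_cubes_def)
    also have "\<dots> \<le> (\<Sum>w\<in>?V. pw w * (B * ?\<rho> powr (s - \<eta>)))"
      using inner V by (intro sum_mono mult_left_mono pw_nonneg) (auto simp: words_of_length_iff)
    also have "\<dots> = (\<Sum>w\<in>?V. pw w) * (B * ?\<rho> powr (s - \<eta>))" by (simp add: sum_distrib_right)
    also have "\<dots> \<le> 1 * (B * ?\<rho> powr (s - \<eta>))"
    proof (rule mult_right_mono)
      have "(\<Sum>w\<in>?V. pw w) \<le> (\<Sum>w\<in>W ?L. pw w)" using V by (intro sum_mono2 pw_nonneg) (auto simp: words_of_length_iff)
      then show "(\<Sum>w\<in>?V. pw w) \<le> 1" by (simp add: sum_pw)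
      show "0 \<le> B * ?\<rho> powr (s - \<eta>)" using C e by (simp add: B_def)
    qed
    finally show ?thesis by simp
  qed
  show ?thesis using N0 e main by blast
qed

lemma AE_lower_dim_1:
  assumes s: "0 < s" "s \<le> real CARD('d)" and Pn: "pressure 1 s < 0" and s': "s' < s"
    and J: "compact J" "J \<noteq> {}" and str: "AE \<xi> in \<Omega>. nonautonomous_structure n0 T J \<xi>"
  shows "AE \<xi> in \<Omega>. ereal s' \<le> lower_q_dim 1 (nonautonomous_measure n0 T p J \<xi>)"
proof -
  have R0: "0 \<le> rad R" using R(1) b by (simp add: rad_def)
  define s0 where "s0 = max s' 0"
  \<comment> \<open>The gap between \<open>s1\<close> and \<open>s\<close> pays both for the loss
    \<open>\<eta>\<close> in \<open>energy_decay\<close> and for the passage from expectations to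
    almost sure bounds. The truncation at 0 in \<open>s0\<close> keeps the factors nonnegative when
    \<open>s'\<close> is negative.\<close>
  define s1 where "s1 = (s0 + s) / 2"
  define \<eta> where "\<eta> = (s - s1) / 2"
  \<comment> \<open>Good words may miss mass \<open>\<delta>\<close>, which lowers the exponent from
    \<open>s1\<close> to \<open>(1 - \<delta>) * s1 = s0\<close>.\<close>
  define \<delta> where "\<delta> = 1 - s0 / s1"
  have s01: "0 \<le> s0" "s0 < s1" "s1 < s" "s' \<le> s0" using s s' by (auto simp: s0_def s1_def)
  have \<eta>: "0 < \<eta>" "s1 < s - \<eta>" using s01(3) by (simp_all add: \<eta>_def field_simps)
  have \<delta>: "0 < \<delta>" "(1 - \<delta>) * s1 = s0" using s01 by (auto simp: \<delta>_def)
  obtain N e C where N: "0 < N" and e: "0 < e"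
    and EZ: "\<And>n. (\<Sum>Q\<in>near_cubes ((1 / 2) ^ n) (rad R).
      omega.expectation (\<lambda>\<xi>. (\<Sum>w\<in>good_words s e (N * n). mass \<xi> w Q) powr 2)) \<le> C * ((1 / 2) ^ n) powr (s - \<eta>)"
    using energy_decay[OF s Pn \<eta>(1)] by blast
  obtain L0 where L0: "\<And>L. L0 \<le> L \<Longrightarrow> 1 - \<delta> \<le> (\<Sum>w\<in>good_words s e L. pw w)"
    using good_words_prob[OF less_imp_le[OF s(1)] Pn e \<delta>(1)] by blast
  let ?F = "\<lambda>n. near_cubes ((1 / 2) ^ n) (rad R) :: (real^'d) set set"
  let ?G = "\<lambda>n \<xi> Q. \<Sum>w\<in>good_words s e (N * n). mass \<xi> w Q"
  have V: "good_words s e L \<subseteq> W L" for L by (auto simp: good_words_def)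
  define Z where "Z n \<xi> = (\<Sum>Q\<in>?F n. ?G n \<xi> Q powr 2)" for n \<xi>
  have im: "integrable \<Omega> (\<lambda>\<xi>. ?G n \<xi> Q powr 2)" if "Q \<in> ?F n" for Q n
  proof (rule omega.integrable_const_bound[of _ "1"])
    have Qb: "Q \<in> sets borel" using that by (intro mesh_borel[of Q "(1 / 2) ^ n"]) (simp add: near_cubes_def)
    show "(\<lambda>\<xi>. ?G n \<xi> Q powr 2) \<in> borel_measurable \<Omega>" using Qb by measurable
    have "?G n \<xi> Q powr 2 \<le> 1" for \<xi>
    proof -
      have "?G n \<xi> Q \<le> (\<Sum>w\<in>W (N * n). pw w)"
        using V[of "N * n"] by (intro order_trans[OF sum_mono2[OF _ V]] sum_mono mass_le) (auto simp: words_of_length_iff)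
      then have "?G n \<xi> Q powr 2 \<le> 1 powr 2" by (intro powr_mono2) (auto simp: sum_pw sum_nonneg)
      then show ?thesis by simp
    qed
    then show "AE \<xi> in \<Omega>. norm (?G n \<xi> Q powr 2) \<le> 1" by (intro AE_I2) simp
  qed
  have intZ: "integrable \<Omega> (Z n)" for n
    unfolding Z_def using im by (intro Bochner_Integration.integrable_sum) auto
  have EZ': "omega.expectation (Z n) \<le> C * ((1 / 2) ^ n) powr (s - \<eta>)" for n
    unfolding Z_def using EZ[of n] im by (subst Bochner_Integration.integral_sum) auto
  have Z0: "0 \<le> Z n \<xi>" for n \<xi> by (simp add: Z_def sum_nonneg)
  have "AE \<xi> in \<Omega>. \<exists>c. \<forall>n. Z n \<xi> \<le> c * ((1 / 2) ^ n) powr s1"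
    by (rule omega.AE_bounded_of_expectation[OF intZ Z0 EZ' \<eta>(2)])
  then show ?thesis using AE_bounded str
  proof eventually_elim
    case (elim \<xi>)
    then obtain c where c: "\<And>n. Z n \<xi> \<le> c * ((1 / 2) ^ n) powr s1" by blast
    define D where "D = ((2 * real CARD('d) + 2) ^ CARD('d)) powr (2 - 1) * (4 * real CARD('d) + 2) ^ CARD('d)"
    have D: "0 < D" unfolding D_def by (intro mult_pos_pos zero_less_power) (auto simp: add_nonneg_pos)
    define h where "h = s0 * ln 2 + D * c + ln 2"
    \<comment> \<open>The restriction on \<open>r\<close> makes the dyadic index exceed
      \<open>L0\<close>, so that the good words of length \<open>N * n\<close> carry mass at least
      \<open>1 - \<delta>\<close>.\<close>
    have main: "qlog 1 (nonautonomous_measure n0 T p J \<xi>) r \<le> s' * ln r + h" if r: "0 < r" "r < (1 / 2) ^ (L0 + 1)" for r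
    proof -
      have r1: "r < 1" using r(2) power_le_one[of "1 / 2 :: real" "L0 + 1"] by simp
      obtain n where n: "r \<le> (1 / 2) ^ n" "(1 / 2) ^ n \<le> 2 * r" by (rule dyadic_scale[OF r(1) r1])
      have nL: "L0 \<le> N * n"
      proof -
        have "(1 / 2 :: real) ^ (L0 + 1) = (1 / 2) ^ L0 / 2" by simp
        then have "(1 / 2 :: real) ^ n < (1 / 2) ^ L0" using n(2) r(2) by linarith
        then have "L0 < n" using power_decreasing[of n L0 "1 / 2 :: real"] by (cases "n \<le> L0") auto
        moreover have "n \<le> N * n" using N by simp
        ultimately show ?thesis by linarith
      qed
      let ?y = "((1 / 2 :: real) ^ n) powr s1" and ?\<gamma> = "\<Sum>w\<in>good_words s e (N * n). pw w"
      have y: "0 < ?y" by simp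
      have g0: "0 \<le> ?\<gamma>" by (intro sum_nonneg pw_nonneg) (auto simp: good_words_def words_of_length_iff)
      have "(\<Sum>Q\<in>near_cubes r (rad R). ?G n \<xi> Q powr 2) \<le> D * Z n \<xi>"
        unfolding Z_def D_def by (rule mesh_moment_compare[OF elim(2) R(1) r(1) n]) simp
      also have "\<dots> \<le> D * (c * ?y)" using c D by (intro mult_left_mono) auto
      finally have "(\<Sum>Q\<in>near_cubes r (rad R). ?G n \<xi> Q powr 2) / ?y \<le> D * (c * ?y) / ?y" using y by (intro divide_right_mono) auto
      also have "\<dots> = D * c" using y by simp
      finally have 1: "(\<Sum>Q\<in>near_cubes r (rad R). ?G n \<xi> Q powr 2) / ?y \<le> D * c" .
      have "?\<gamma> * (ln ?y - 1) \<le> ?\<gamma> * ln ?y" using g0 by (intro mult_left_mono) auto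
      also have "\<dots> \<le> (1 - \<delta>) * ln ?y"
        using L0[OF nL] s01 by (intro mult_right_mono_neg) (auto simp: ln_powr ln_realpow ln_div intro!: mult_nonneg_nonpos)
      also have "\<dots> = s0 * ln ((1 / 2) ^ n)" using \<delta>(2) by (simp add: ln_powr mult.assoc[symmetric])
      also have "\<dots> \<le> s0 * ln (2 * r)" using n(2) s01 r by (intro mult_left_mono ln_mono) auto
      also have "\<dots> = s0 * ln 2 + s0 * ln r" using r by (simp add: ln_mult distrib_left)
      also have "s0 * ln r \<le> s' * ln r" using s01 r r1 by (intro mult_right_mono_neg) auto
      finally have 2: "?\<gamma> * (ln ?y - 1) \<le> s0 * ln 2 + s' * ln r" by simp
      have "qlog 1 (nonautonomous_measure n0 T p J \<xi>) r = (\<Sum>Q\<in>near_cubes r (rad R). mass \<xi> [] Q * ln (mass \<xi> [] Q))"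
        by (simp add: qlog_eq[OF J elim(3,2) R(1) r(1)])
      also have "\<dots> \<le> ?\<gamma> * (ln ?y - 1) + (\<Sum>Q\<in>near_cubes r (rad R). ?G n \<xi> Q powr 2) / ?y + ln 2"
        by (rule entropy_le[OF elim(2) R(1) r(1) V y])
      finally show ?thesis using 1 2 by (simp add: h_def)
    qed
    have "\<forall>\<^sub>F r in at_right (0::real). 0 < r \<and> r < (1 / 2) ^ (L0 + 1)"
      unfolding eventually_at_right_field by (intro exI[of _ "(1 / 2) ^ (L0 + 1)"]) auto
    then have "\<forall>\<^sub>F r in at_right 0. qlog 1 (nonautonomous_measure n0 T p J \<xi>) r \<le> s' * ln r + h"
      by eventually_elim (use main in blast)
    then show ?case by (rule lower_q_dim_ge)
  qed
qed

end

section \<open>Critical values and dimensions\<close>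

context affine_words
begin

lemma sum_q_root_tendsto:
  assumes q: "1 < q" and s: "0 \<le> s"
  shows "(\<lambda>k. sum_q q s k powr (1 / real k)) \<longlonglongrightarrow> exp (pressure q s)"
proof -
  have "(\<lambda>k. exp (log_sum q s k / real k)) \<longlonglongrightarrow> exp (pressure q s)"
    using pressure_limit(1)[of q s] q s by (intro tendsto_exp) simp
  moreover have "exp (log_sum q s k / real k) = sum_q q s k powr (1 / real k)" for k
    using sum_q_pos[OF s, of q k] q by (simp add: log_sum_def powr_def)
  ultimately show ?thesis by simp
qed

lemma integral_info_tendsto:
  assumes "0 \<le> s"
  shows "(\<lambda>k. 1 / real k * (\<integral>u. info s (restr u k) \<partial>M)) \<longlonglongrightarrow> pressure 1 s"
  using pressure_limit(1)[of 1 s] assms by (simp add: integral_restr mean_info_def log_sum_def)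

end

context random_affine_words
begin

text \<open>The null set of a lower bound depends on its exponent, so the bound is taken along the
  countable family \<open>t n\<close> tending to \<open>m\<close>. The upper bounds hold for every
  bounded admissible family of translations, for all exponents at once.\<close>

lemma AE_has_q_dim:
  assumes q: "1 \<le> q" and d: "0 \<le> d" "\<And>s. 0 \<le> s \<Longrightarrow> (pressure q s < 0 \<longleftrightarrow> s < d) \<and> (0 < pressure q s \<longleftrightarrow> d < s)"
    and J: "compact J" "J \<noteq> {}" and str: "AE \<xi> in \<Omega>. nonautonomous_structure n0 T J \<xi>"
  shows "AE \<xi> in \<Omega>. has_q_dim q (nonautonomous_measure n0 T p J \<xi>) (min (ereal d) (ereal (real CARD('d))))"
proof -
  define m where "m = min d (real CARD('d))"
  have m: "0 \<le> m" "m \<le> d" "m \<le> real CARD('d)" using d(1) by (auto simp: m_def)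
  define t where "t n = m - m / real (Suc n)" for n
  have "AE \<xi> in \<Omega>. ereal (t n) \<le> lower_q_dim q (nonautonomous_measure n0 T p J \<xi>)" for n
  proof (cases "m = 0")
    case True
    from AE_bounded str show ?thesis
      by eventually_elim (use lower_dim_nonneg[OF q J] True in \<open>simp add: t_def zero_ereal_def\<close>)
  next
    case False
    then have m0: "0 < m" using m by simp
    have "m / real (Suc n) \<le> m / 1" using m0 by (intro divide_left_mono) auto
    then have t: "0 \<le> t n" "t n < m" using m0 by (auto simp: t_def)
    define s where "s = (t n + m) / 2"
    have s: "0 < s" "s \<le> real CARD('d)" "t n < s" "s < d" using t m by (auto simp: s_def)
    have P: "pressure q s < 0" using d(2)[of s] s by simp
    show ?thesis
    proof (cases "q = 1")
      case True
      then show ?thesis using AE_lower_dim_1[OF s(1,2) _ s(3) J str] P by simp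
    next
      case False
      then show ?thesis using AE_lower_dim_gt1[OF _ s(1,2) P s(3) J str] q by simp
    qed
  qed
  then have "AE \<xi> in \<Omega>. \<forall>n. ereal (t n) \<le> lower_q_dim q (nonautonomous_measure n0 T p J \<xi>)"
    by (simp add: AE_all_countable)
  then show ?thesis using AE_bounded str
  proof eventually_elim
    case (elim \<xi>)
    let ?\<nu> = "nonautonomous_measure n0 T p J \<xi>"
    have "(\<lambda>n. m - m * inverse (real (Suc n))) \<longlonglongrightarrow> m - m * 0"
      by (intro tendsto_intros LIMSEQ_inverse_real_of_nat)
    then have "(\<lambda>n. ereal (t n)) \<longlonglongrightarrow> ereal m" by (simp add: t_def[abs_def] divide_inverse)
    then have lo: "ereal m \<le> lower_q_dim q ?\<nu>" by (rule LIMSEQ_le_const2) (use elim(1) in blast)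
    have up: "upper_q_dim q ?\<nu> \<le> ereal m"
    proof (rule dense_ge)
      fix x assume x: "ereal m < x"
      show "upper_q_dim q ?\<nu> \<le> x"
      proof (cases "ereal (real CARD('d)) \<le> x")
        case True
        then show ?thesis using upper_dim_le_card[OF J elim(3,2) R(1) q] by (rule order_trans[rotated])
      next
        case False
        then obtain s where s: "x = ereal s" using x by (cases x) auto
        then have "m < s" "s < real CARD('d)" using x False by auto
        then have "0 < s" "s \<le> real CARD('d)" "d < s" using m by (auto simp: m_def min_def split: if_splits)
        then show ?thesis unfolding s using d(2)[of s] by (intro upper_dim_le_pressure[OF J elim(3,2) R(1) q]) auto
      qed
    qed
    have "lower_q_dim q ?\<nu> \<le> upper_q_dim q ?\<nu>"
      unfolding lower_q_dim_def upper_q_dim_def by (intro Liminf_le_Limsup) (simp add: trivial_limit_at_right_real)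
    then have "has_q_dim q ?\<nu> (ereal m)" unfolding has_q_dim_def using lo up by (meson order_antisym order_trans)
    then show ?case by (simp add: m_def)
  qed
qed

end

section \<open>Uniform constants for the generators and assembly of the result\<close>

lemma uniform_contraction:
  fixes T :: "nat \<Rightarrow> real^'d^'d"
  assumes "finite I" "\<And>i. i \<in> I \<Longrightarrow> onorm (\<lambda>x. T i *v x) < 1"
  obtains b where "0 < b" "b < 1" "\<And>i x. i \<in> I \<Longrightarrow> norm (T i *v x) \<le> b * norm x"
proof -
  \<comment> \<open>The inserted \<open>1 / 2\<close> keeps the maximum positive.\<close>
  define b where "b = Max (insert (1 / 2) ((\<lambda>i. onorm (\<lambda>x. T i *v x)) ` I))"
  have "1 / 2 \<le> b" unfolding b_def using assms(1) by (intro Max_ge) auto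
  moreover have "b < 1" unfolding b_def using assms by (subst Max_less_iff) auto
  moreover have "norm (T i *v x) \<le> b * norm x" if i: "i \<in> I" for i x
  proof -
    have "norm (T i *v x) \<le> onorm (\<lambda>x. T i *v x) * norm x" by (rule onorm[OF matrix_vector_mul_bounded_linear])
    also have "\<dots> \<le> b * norm x" unfolding b_def using assms(1) i by (intro mult_right_mono Max_ge) auto
    finally show ?thesis .
  qed
  ultimately show thesis using that[of b] by simp
qed

lemma uniform_lower_bound:
  fixes T :: "nat \<Rightarrow> real^'d^'d"
  assumes "finite I" "\<And>i. i \<in> I \<Longrightarrow> invertible (T i)"
  obtains a where "0 < a" "a < 1" "\<And>i x. i \<in> I \<Longrightarrow> a * norm x \<le> norm (T i *v x)"
proof -
  have "\<exists>c>0. \<forall>x. c * norm x \<le> norm (T i *v x)" if "i \<in> I" for i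
    using linear_inj_bounded_below_pos[OF matrix_vector_mul_linear inj_matrix_vector_mult[OF assms(2)[OF that]]] by blast
  then obtain c where c: "\<And>i. i \<in> I \<Longrightarrow> 0 < c i" "\<And>i x. i \<in> I \<Longrightarrow> c i * norm x \<le> norm (T i *v x)" by metis
  define a where "a = Min (insert (1 / 2) (c ` I))"
  have "a \<le> 1 / 2" unfolding a_def using assms(1) by (intro Min_le) auto
  moreover have "0 < a" unfolding a_def using assms(1) c(1) by (subst Min_gr_iff) auto
  moreover have "a * norm x \<le> norm (T i *v x)" if i: "i \<in> I" for i x
  proof -
    have "a * norm x \<le> c i * norm x" unfolding a_def using assms(1) i by (intro mult_right_mono Min_le) auto
    then show ?thesis using c(2)[OF i, of x] by simp
  qed
  ultimately show thesis using that[of a] by simp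
qed

theorem corollary2p11:
  fixes n0 :: nat
    and T :: "nat \<Rightarrow> real^'d^'d"
    and p :: "nat \<Rightarrow> real"
    and J \<D> :: "(real^'d) set"
    and P :: "(real^'d) measure"
  assumes n0: "n0 \<ge> 2"
    and nonsingular: "\<And>i. i \<in> {1..n0} \<Longrightarrow> invertible (T i)"
    and contracting: "\<And>i. i \<in> {1..n0} \<Longrightarrow> onorm (\<lambda>x. T i *v x) < 1"
    and p_nonneg: "\<And>i. i \<in> {1..n0} \<Longrightarrow> 0 \<le> p i"
    and p_sum: "(\<Sum>i=1..n0. p i) = 1"
    and J: "compact J" "interior J \<noteq> {}"
    and P: "prob_space P" "sets P = sets borel" "absolutely_continuous lborel P"
    and D: "bounded \<D>" "AE x in P. x \<in> \<D>"
    and nested: "\<And>\<omega>. (\<And>u. u \<in> words n0 \<Longrightarrow> \<omega> u \<in> \<D>) \<Longrightarrow> nonautonomous_structure n0 T J \<omega>"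
  shows "(\<forall>q>0. crit_minus n0 T p q = crit_plus n0 T p q) \<and>
    (\<forall>q>1. \<exists>d\<^sub>q\<ge>0. crit_minus n0 T p q = ereal d\<^sub>q \<and>
       (\<forall>s\<ge>0. ((\<lambda>k. (\<Sum>u\<in>words_of_length n0 k.
            svf s (word_mat T u) powr (1 - q) * word_prob p u powr q) powr (1 / real k)) \<longlonglongrightarrow> 1)
          \<longleftrightarrow> s = d\<^sub>q)) \<and>
    (\<exists>d\<^sub>1\<ge>0. crit_minus n0 T p 1 = ereal d\<^sub>1 \<and>
       (\<forall>s\<ge>0. ((\<lambda>k. 1 / real k * (\<integral>u. ln (inverse (svf s (word_mat T (restr u k))) *
            word_prob p (restr u k)) \<partial>bernoulli_measure n0 p)) \<longlonglongrightarrow> 0)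
          \<longleftrightarrow> s = d\<^sub>1)) \<and>
    (\<forall>q\<ge>1. AE \<omega> in translation_measure n0 P.
       has_q_dim q (nonautonomous_measure n0 T p J \<omega>) (min (crit_minus n0 T p q) (ereal (real CARD('d)))))"
proof -
  obtain a where a: "0 < a" "a < 1" "\<And>i x. i \<in> {1..n0} \<Longrightarrow> a * norm x \<le> norm (T i *v x)"
    using uniform_lower_bound[of "{1..n0}" T] nonsingular by auto
  obtain b where b: "0 < b" "b < 1" "\<And>i x. i \<in> {1..n0} \<Longrightarrow> norm (T i *v x) \<le> b * norm x"
    using uniform_contraction[of "{1..n0}" T] contracting by auto
  obtain K where K: "1 \<le> K" "\<And>(A::real^'d^'d) B s. invertible A \<Longrightarrow> invertible B \<Longrightarrow> 0 \<le> s \<Longrightarrow>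
      svf s (A ** B) \<le> K powr (1 + s) * (svf s A * svf s B)"
    using svf_submult[where 'd='d] by blast
  obtain R where R: "0 < R" "\<And>x. x \<in> \<D> \<Longrightarrow> norm x \<le> R" using D(1) by (auto simp: bounded_pos)
  interpret affine_words n0 T p a b K
    using nonsingular a b K p_nonneg p_sum by unfold_locales auto
  interpret random_affine_words n0 T p a b K P R
  proof (intro random_affine_words.intro random_affine_words_axioms.intro)
    show "AE x in P. norm x \<le> R" using D(2) by eventually_elim (rule R(2))
  qed (fact affine_words_axioms P R(1))+
  have Jne: "J \<noteq> {}" using J(2) by auto
  \<comment> \<open>There are countably many words, so almost surely all translations lie in
    \<open>\<D>\<close>; the nested structure is given exactly for such families.\<close>
  have str: "AE \<xi> in \<Omega>. nonautonomous_structure n0 T J \<xi>"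
    using AE_in[OF D(2)] by eventually_elim (use nested in blast)
  \<comment> \<open>For \<open>q \<ge> 1\<close> the zero of the pressure identifies both critical
    values, the solution of the limit equation and the dimension.\<close>
  have zero: "\<exists>d\<ge>0. crit_minus n0 T p q = ereal d \<and> crit_plus n0 T p q = ereal d \<and> (\<forall>s\<ge>0. pressure q s = 0 \<longleftrightarrow> s = d) \<and>
      (AE \<xi> in \<Omega>. has_q_dim q (nonautonomous_measure n0 T p J \<xi>) (min (ereal d) (ereal (real CARD('d)))))"
    if q: "1 \<le> q" for q
  proof -
    obtain d where d: "0 \<le> d" "\<And>s. 0 \<le> s \<Longrightarrow> (pressure q s < 0 \<longleftrightarrow> s < d) \<and> (0 < pressure q s \<longleftrightarrow> d < s)"
      using pressure_zero[OF q] by blast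
    have "pressure q s = 0 \<longleftrightarrow> s = d" if "0 \<le> s" for s using d(2)[OF that] by linarith
    then show ?thesis using crit_eq_ge1[OF q d] AE_has_q_dim[OF q d J(1) Jne str] d(1) by (intro exI[of _ d]) simp
  qed
  have 1: "crit_minus n0 T p q = crit_plus n0 T p q" if "0 < q" for q
    using zero[of q] crit_eq_lt1[of q] by (cases "1 \<le> q") auto
  \<comment> \<open>The limits exist for every \<open>s\<close>, with value
    \<open>exp (pressure q s)\<close> here and \<open>pressure 1 s\<close> in the next statement, so
    uniqueness of limits reduces both equations to a zero of the pressure.\<close>
  have 2: "((\<lambda>k. (\<Sum>u\<in>W k. psi s u powr (1 - q) * pw u powr q) powr (1 / real k)) \<longlonglongrightarrow> 1) \<longleftrightarrow> pressure q s = 0"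
    if "1 < q" "0 \<le> s" for q s
  proof -
    note lim = sum_q_root_tendsto[OF that, unfolded sum_q_def term_q_def]
    show ?thesis using lim LIMSEQ_unique[OF lim, of 1] by auto
  qed
  have 3: "((\<lambda>k. 1 / real k * (\<integral>u. ln (inverse (psi s (restr u k)) * pw (restr u k)) \<partial>M)) \<longlonglongrightarrow> 0) \<longleftrightarrow> pressure 1 s = 0"
    if "0 \<le> s" for s
  proof -
    note lim = integral_info_tendsto[OF that, unfolded info_def]
    show ?thesis using lim LIMSEQ_unique[OF lim, of 0] by auto
  qed
  show ?thesis
  proof (intro conjI allI impI)
    show "crit_minus n0 T p q = crit_plus n0 T p q" if "0 < q" for q by (rule 1[OF that])
    show "\<exists>d\<^sub>q\<ge>0. crit_minus n0 T p q = ereal d\<^sub>q \<and>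
       (\<forall>s\<ge>0. ((\<lambda>k. (\<Sum>u\<in>W k. psi s u powr (1 - q) * pw u powr q) powr (1 / real k)) \<longlonglongrightarrow> 1) \<longleftrightarrow> s = d\<^sub>q)"
      if "1 < q" for q using zero[of q] 2[OF that] that by fastforce
    show "\<exists>d\<^sub>1\<ge>0. crit_minus n0 T p 1 = ereal d\<^sub>1 \<and>
       (\<forall>s\<ge>0. ((\<lambda>k. 1 / real k * (\<integral>u. ln (inverse (psi s (restr u k)) * pw (restr u k)) \<partial>M)) \<longlonglongrightarrow> 0) \<longleftrightarrow> s = d\<^sub>1)"
      using zero[of 1] 3 by fastforce
    show "AE \<omega> in translation_measure n0 P.
       has_q_dim q (nonautonomous_measure n0 T p J \<omega>) (min (crit_minus n0 T p q) (ereal (real CARD('d))))"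
      if "1 \<le> q" for q using zero[OF that] by auto
  qed
qed

end
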